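(* Let $n\ge 1$ be an integer, $\sigma\geq 1$, $\delta\in\left(0,\frac{\sigma}{2}\right)$ and $p>1$. Consider the semi-linear Cauchy problem $$u_{tt}(t,x)+(-\Delta)^{\sigma}u(t,x)+(-\Delta)^{2\delta}u(t,x)+2(-\Delta)^{\delta}u_{t}(t,x)=|u(t,x)|^{p},\qquad t\ge 0,\ x\in\mathbb{R}^n,$$ $$u(0,x)=0,\qquad u_t(0,x)=u_1(x).$$ Assume that one of the following two conditions on $p$ and $n$ holds: (i) $2\sigma<n\le 4\sigma$ and $2\le p\le \frac{n}{n-2\sigma}$; (ii) $\sigma<n\le 2\sigma$ and $2\le p<\infty$. Assume moreover that $$p>1+\frac{\sigma+2\delta}{n-\sigma}.$$ Then there exist constants $\varepsilon_0>0$ and $C>0$ such that for every initial velocity $u_1\in L^1(\mathbb{R}^n)\cap L^2(\mathbb{R}^n)$ with $\|u_1\|_{L^1\cap L^2}<\varepsilon_0$ there is a uniquely determined global (in time) solution $u$ of the Cauchy problem in the class $$u\in \mathcal{C}\left([0,\infty),H^{\sigma}(\mathbb{R}^n)\right)\cap \mathcal{C}^1\left([0,\infty),L^2(\mathbb{R}^n)\right).$$ In addition, this solution satisfies, for all $t\ge 0$, the (long time) estimates $$\|u(t,\cdot)\|_{L^2}\le C(1+t)^{-\frac{n-2\sigma}{4\delta}}\|u_1\|_{L^1\cap L^2},$$ $$\|(-\Delta)^{\sigma/2}u(t,\cdot)\|_{L^2}\le C(1+t)^{-\frac{n}{4\delta}}\|u_1\|_{L^1\cap L^2},$$ $$\|u_t(t,\cdot)\|_{L^2}\le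 C(1+t)^{-\frac{n-(2\sigma-4\delta)}{4\delta}}\|u_1\|_{L^1\cap L^2}.$$
   Context: For $a>0$, $(-\Delta)^a$ acts on functions of $x\in\mathbb{R}^n$ as the Fourier multiplier with symbol $|\xi|^{2a}$. $H^s(\mathbb{R}^n)$ is the Sobolev space of tempered distributions $f$ with $\|f\|_{H^s}=\|(1+|\cdot|^2)^{s/2}\mathcal{F}(f)\|_{L^2}<\infty$. The norm on $L^1\cap L^2$ is $\|f\|_{L^1\cap L^2}=\|f\|_{L^1}+\|f\|_{L^2}$. A solution is understood in the mild (Duhamel) sense: $u$ satisfies $$u(t,\cdot)=K(t,\cdot)\ast u_1+\int_0^t K(t-\tau,\cdot)\ast |u(\tau,\cdot)|^p\,d\tau\qquad\text{for all } t\ge 0,$$ where $\ast$ is convolution in $x$ and $K(t,\cdot)$ is the kernel whose spatial Fourier transform (i.e. whose associated Fourier multiplier) is $$\frac{e^{-|\xi|^{2\delta}t+i|\xi|^{\sigma}t}-e^{-|\xi|^{2\delta}t-i|\xi|^{\sigma}t}}{2i|\xi|^{\sigma}}.$$ *)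

theory Defs
  imports "HOL-Analysis.Analysis"
begin

section \<open>The spaces L1 and L2 of complex-valued functions\<close>

definition square_integrable :: "(real^'n \<Rightarrow> complex) \<Rightarrow> bool" where
  "square_integrable f \<longleftrightarrow>
     f \<in> borel_measurable borel \<and> integrable lborel (\<lambda>x. (cmod (f x))\<^sup>2)"

definition L1norm :: "(real^'n \<Rightarrow> complex) \<Rightarrow> real" where
  "L1norm f = (LINT x|lborel. cmod (f x))"

definition L2norm :: "(real^'n \<Rightarrow> complex) \<Rightarrow> real" where
  "L2norm f = sqrt (LINT x|lborel. (cmod (f x))\<^sup>2)"

lemma square_integrable_zero: "square_integrable (\<lambda>x. 0)"
  by (simp add: square_integrable_def)

lemma square_integrable_add:
  assumes "square_integrable f" "square_integrable g"
  shows "square_integrable (\<lambda>x. f x + g x)"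
proof -
  have [measurable]: "f \<in> borel_measurable borel" "g \<in> borel_measurable borel"
    using assms by (auto simp: square_integrable_def)
  have b: "(cmod (f x + g x))\<^sup>2 \<le> 2 * (cmod (f x))\<^sup>2 + 2 * (cmod (g x))\<^sup>2" for x
  proof -
    have "(cmod (f x + g x))\<^sup>2 \<le> (cmod (f x) + cmod (g x))\<^sup>2"
      by (intro power_mono norm_triangle_ineq) auto
    also have "\<dots> \<le> 2 * (cmod (f x))\<^sup>2 + 2 * (cmod (g x))\<^sup>2"
      using zero_le_power2[of "cmod (f x) - cmod (g x)"]
      by (simp add: power2_eq_square algebra_simps)
    finally show ?thesis .
  qed
  have "integrable lborel (\<lambda>x. 2 * (cmod (f x))\<^sup>2 + 2 * (cmod (g x))\<^sup>2)"
    using assms by (auto simp: square_integrable_def)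
  then have "integrable lborel (\<lambda>x. (cmod (f x + g x))\<^sup>2)"
    by (rule Bochner_Integration.integrable_bound) (auto intro!: AE_I2 simp: b)
  then show ?thesis by (simp add: square_integrable_def)
qed

lemma square_integrable_scaleR:
  assumes "square_integrable f"
  shows "square_integrable (\<lambda>x. r *\<^sub>R f x)"
  using assms by (auto simp: square_integrable_def power_mult_distrib)

lemma square_integrable_uminus:
  "square_integrable f \<Longrightarrow> square_integrable (\<lambda>x. - f x)"
  using square_integrable_scaleR[of f "-1"] by simp

lemma square_integrable_diff:
  "square_integrable f \<Longrightarrow> square_integrable g \<Longrightarrow> square_integrable (\<lambda>x. f x - g x)"
  using square_integrable_add[of f "\<lambda>x. - g x"] square_integrable_uminus[of g] by simp

lemma square_integrable_inner:
  assumes "square_integrable f" "square_integrable g"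
  shows "integrable lborel (\<lambda>x. f x \<bullet> g x)"
proof -
  have [measurable]: "f \<in> borel_measurable borel" "g \<in> borel_measurable borel"
    using assms by (auto simp: square_integrable_def)
  have b: "\<bar>f x \<bullet> g x\<bar> \<le> (cmod (f x))\<^sup>2 + (cmod (g x))\<^sup>2" for x
  proof -
    have "\<bar>f x \<bullet> g x\<bar> \<le> cmod (f x) * cmod (g x)"
      by (rule Cauchy_Schwarz_ineq2)
    also have "\<dots> \<le> (cmod (f x))\<^sup>2 + (cmod (g x))\<^sup>2"
    proof -
      have "2 * (cmod (f x) * cmod (g x)) \<le> (cmod (f x))\<^sup>2 + (cmod (g x))\<^sup>2"
        using zero_le_power2[of "cmod (f x) - cmod (g x)"]
        by (simp add: power2_eq_square algebra_simps)
      moreover have "0 \<le> cmod (f x) * cmod (g x)" by simp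
      ultimately show ?thesis by linarith
    qed
    finally show ?thesis .
  qed
  have "integrable lborel (\<lambda>x. (cmod (f x))\<^sup>2 + (cmod (g x))\<^sup>2)"
    using assms by (auto simp: square_integrable_def)
  then show ?thesis
    by (rule Bochner_Integration.integrable_bound) (auto intro!: AE_I2 simp: b)
qed

text \<open>\<open>'n l2\<close> is the Hilbert space of square-integrable functions modulo equality almost everywhere.
  Since \<open>quotient_type\<close> does not provide a class for a non-square-integrable function,
  \<open>abs_l2 f\<close> is meaningful only if \<open>square_integrable f\<close>.\<close>

definition l2_rel :: "(real^'n \<Rightarrow> complex) \<Rightarrow> (real^'n \<Rightarrow> complex) \<Rightarrow> bool" where
  "l2_rel f g \<longleftrightarrow>
     square_integrable f \<and> square_integrable g \<and> (AE x in lborel. f x = g x)"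

lemma l2_rel_integral_eq:
  assumes "l2_rel f f'" "l2_rel g g'"
  shows "(LINT x|lborel. f x \<bullet> g x) = (LINT x|lborel. f' x \<bullet> g' x)"
proof (rule integral_cong_AE)
  have [measurable]: "f \<in> borel_measurable borel" "g \<in> borel_measurable borel"
      "f' \<in> borel_measurable borel" "g' \<in> borel_measurable borel"
    using assms by (auto simp: l2_rel_def square_integrable_def)
  show "(\<lambda>x. f x \<bullet> g x) \<in> borel_measurable lborel" "(\<lambda>x. f' x \<bullet> g' x) \<in> borel_measurable lborel"
    by auto
  have "AE x in lborel. f x = f' x" "AE x in lborel. g x = g' x"
    using assms by (auto simp: l2_rel_def)
  then show "AE x in lborel. f x \<bullet> g x = f' x \<bullet> g' x" by eventually_elim simp
qed

quotient_type 'n l2 = "real^('n::finite) \<Rightarrow> complex" / partial: l2_rel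
proof (rule part_equivpI)
  show "\<exists>f::real^'n \<Rightarrow> complex. l2_rel f f"
    by (rule exI[of _ "\<lambda>x. 0"]) (simp add: l2_rel_def square_integrable_zero)
  show "symp (l2_rel :: (real^'n \<Rightarrow> complex) \<Rightarrow> _)"
    by (rule sympI) (auto simp: l2_rel_def elim: eventually_mono)
  show "transp (l2_rel :: (real^'n \<Rightarrow> complex) \<Rightarrow> _)"
  proof (rule transpI)
    fix f g h :: "real^'n \<Rightarrow> complex" assume a: "l2_rel f g" "l2_rel g h"
    then have "AE x in lborel. f x = g x" "AE x in lborel. g x = h x"
      by (auto simp: l2_rel_def)
    then have "AE x in lborel. f x = h x" by eventually_elim simp
    with a show "l2_rel f h" by (simp add: l2_rel_def)
  qed
qed

instantiation l2 :: (finite) real_inner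
begin

lift_definition zero_l2 :: "'a l2" is "\<lambda>x. 0"
  by (simp add: l2_rel_def square_integrable_zero)

lift_definition plus_l2 :: "'a l2 \<Rightarrow> 'a l2 \<Rightarrow> 'a l2" is "\<lambda>f g x. f x + g x"
  by (auto simp: l2_rel_def square_integrable_add)

lift_definition minus_l2 :: "'a l2 \<Rightarrow> 'a l2 \<Rightarrow> 'a l2" is "\<lambda>f g x. f x - g x"
  by (auto simp: l2_rel_def square_integrable_diff)

lift_definition uminus_l2 :: "'a l2 \<Rightarrow> 'a l2" is "\<lambda>f x. - f x"
  by (auto simp: l2_rel_def square_integrable_uminus)

lift_definition scaleR_l2 :: "real \<Rightarrow> 'a l2 \<Rightarrow> 'a l2" is "\<lambda>r f x. r *\<^sub>R f x"
  unfolding l2_rel_def by (auto intro: square_integrable_scaleR simp del: scaleR_conv_of_real)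

text \<open>On \<open>complex\<close>, \<open>z \<bullet> w\<close> is the real part of \<open>z * cnj w\<close>: this is the real inner product.\<close>

lift_definition inner_l2 :: "'a l2 \<Rightarrow> 'a l2 \<Rightarrow> real" is
  "\<lambda>f g. LINT x|lborel. f x \<bullet> g x"
  by (rule l2_rel_integral_eq)

lift_definition norm_l2 :: "'a l2 \<Rightarrow> real" is L2norm
  unfolding L2norm_def power2_norm_eq_inner using l2_rel_integral_eq by metis

definition sgn_l2 :: "'a l2 \<Rightarrow> 'a l2" where
  "sgn_l2 f = inverse (norm f) *\<^sub>R f"

definition dist_l2 :: "'a l2 \<Rightarrow> 'a l2 \<Rightarrow> real" where
  "dist_l2 f g = norm (f - g)"

definition uniformity_l2 :: "('a l2 \<times> 'a l2) filter" where
  "uniformity_l2 = (INF e\<in>{0<..}. principal {(x, y). dist x y < e})"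

definition open_l2 :: "'a l2 set \<Rightarrow> bool" where
  "open_l2 U = (\<forall>x\<in>U. eventually (\<lambda>(x', y). x' = x \<longrightarrow> y \<in> U) uniformity)"

instance
proof
  fix f g h :: "'a l2" and r s :: real and U :: "'a l2 set"
  show "f + g + h = f + (g + h)"
    by transfer (auto simp: l2_rel_def add.assoc intro!: square_integrable_add)
  show "f + g = g + f"
    by transfer (auto simp: l2_rel_def add.commute intro!: square_integrable_add)
  show "0 + f = f" by transfer (auto simp: l2_rel_def)
  show "- f + f = 0" by transfer (auto simp: l2_rel_def square_integrable_zero)
  show "f - g = f + - g"
    by transfer (auto simp: l2_rel_def square_integrable_diff)
  show "r *\<^sub>R (f + g) = r *\<^sub>R f + r *\<^sub>R g"
    by transfer (auto simp: l2_rel_def scaleR_add_right simp del: scaleR_conv_of_real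
        intro!: square_integrable_add square_integrable_scaleR)
  show "(r + s) *\<^sub>R f = r *\<^sub>R f + s *\<^sub>R f"
    by transfer (auto simp: l2_rel_def scaleR_add_left simp del: scaleR_conv_of_real
        intro!: square_integrable_add square_integrable_scaleR)
  show "r *\<^sub>R s *\<^sub>R f = (r * s) *\<^sub>R f"
    by transfer (auto simp: l2_rel_def simp del: scaleR_conv_of_real
        intro!: square_integrable_scaleR)
  show "1 *\<^sub>R f = f" by transfer (auto simp: l2_rel_def)
  show "sgn f = inverse (norm f) *\<^sub>R f" by (simp add: sgn_l2_def)
  show "dist f g = norm (f - g)" by (simp add: dist_l2_def)
  show "uniformity = (INF e\<in>{0<..}. principal {(x::'a l2, y). dist x y < e})"
    by (simp add: uniformity_l2_def)
  show "open U \<longleftrightarrow> (\<forall>x\<in>U. eventually (\<lambda>(x', y). x' = x \<longrightarrow> y \<in> U) uniformity)"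
    by (simp add: open_l2_def)
  show "f \<bullet> g = g \<bullet> f" by transfer (simp add: inner_commute)
  show "(f + g) \<bullet> h = f \<bullet> h + g \<bullet> h"
    by transfer (auto simp: l2_rel_def inner_add_left square_integrable_inner
        intro!: Bochner_Integration.integral_add)
  show "(r *\<^sub>R f) \<bullet> g = r * (f \<bullet> g)"
    by transfer (simp del: scaleR_conv_of_real)
  show "0 \<le> f \<bullet> f" by transfer simp
  show "f \<bullet> f = 0 \<longleftrightarrow> f = 0"
  proof transfer
    fix f :: "real^'a \<Rightarrow> complex" assume "l2_rel f f"
    then have sq: "square_integrable f" by (simp add: l2_rel_def)
    have "(LINT x|lborel. f x \<bullet> f x) = 0 \<longleftrightarrow> (AE x in lborel. f x \<bullet> f x = 0)"
      by (rule integral_nonneg_eq_0_iff_AE[OF square_integrable_inner[OF sq sq]]) simp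
    then show "(LINT x|lborel. f x \<bullet> f x) = 0 \<longleftrightarrow> l2_rel f (\<lambda>x. 0)"
      using sq by (simp add: l2_rel_def square_integrable_zero)
  qed
  show "norm f = sqrt (f \<bullet> f)"
    by transfer (simp add: L2norm_def power2_norm_eq_inner)
qed

end

section \<open>Schwartz functions and tempered distributions\<close>

definition partial_derivative :: "'n \<Rightarrow> (real^'n \<Rightarrow> complex) \<Rightarrow> real^'n \<Rightarrow> complex" where
  "partial_derivative i \<phi> = (\<lambda>x. frechet_derivative \<phi> (at x) (axis i 1))"

definition iterated_derivative :: "'n list \<Rightarrow> (real^'n \<Rightarrow> complex) \<Rightarrow> real^'n \<Rightarrow> complex" where
  "iterated_derivative js \<phi> = foldr partial_derivative js \<phi>"

text \<open>A function is smooth iff all its iterated partial derivatives exist and are differentiable.\<close>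

definition schwartz :: "(real^'n \<Rightarrow> complex) set" where
  "schwartz = {\<phi>. \<forall>js. (\<forall>x. iterated_derivative js \<phi> differentiable at x) \<and>
     (\<forall>k::nat. bounded (range (\<lambda>x. (1 + norm x) ^ k *\<^sub>R iterated_derivative js \<phi> x)))}"

definition schwartz_seminorm :: "nat \<Rightarrow> 'n list \<Rightarrow> (real^'n \<Rightarrow> complex) \<Rightarrow> real" where
  "schwartz_seminorm k js \<phi> = (SUP x. (1 + norm x) ^ k * cmod (iterated_derivative js \<phi> x))"

text \<open>Distributions are represented by functionals on all functions; only their values
  on \<open>schwartz\<close> matter.\<close>

type_synonym 'n distribution = "(real^'n \<Rightarrow> complex) \<Rightarrow> complex"

definition tempered :: "('n::finite) distribution \<Rightarrow> bool" where
  "tempered T \<longleftrightarrow>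
     (\<forall>\<phi>\<in>schwartz. \<forall>\<psi>\<in>schwartz. T (\<lambda>x. \<phi> x + \<psi> x) = T \<phi> + T \<psi>) \<and>
     (\<forall>\<phi>\<in>schwartz. \<forall>c. T (\<lambda>x. c * \<phi> x) = c * T \<phi>) \<and>
     (\<exists>C k N. \<forall>\<phi>\<in>schwartz.
        cmod (T \<phi>) \<le> C * (\<Sum>js | length js \<le> N. schwartz_seminorm k js \<phi>))"

definition l2_distribution :: "('n::finite) l2 \<Rightarrow> 'n distribution" where
  "l2_distribution f \<phi> = (LINT x|lborel. rep_l2 f x * \<phi> x)"

text \<open>With this normalisation, the Fourier transform of a convolution is the product of the
  Fourier transforms, so that the Fourier transform of a convolution kernel is the associated
  multiplier.\<close>

definition fourier :: "(real^'n \<Rightarrow> complex) \<Rightarrow> real^'n \<Rightarrow> complex" where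
  "fourier \<phi> \<xi> = (LINT x|lborel. exp (- \<i> * of_real (x \<bullet> \<xi>)) * \<phi> x)"

definition inverse_fourier :: "(real^'n \<Rightarrow> complex) \<Rightarrow> real^'n \<Rightarrow> complex" where
  "inverse_fourier m x =
     (LINT \<xi>|lborel. exp (\<i> * of_real (x \<bullet> \<xi>)) * m \<xi>) / of_real ((2 * pi) ^ CARD('n))"

text \<open>The distributional Fourier transform of \<open>T\<close>, which maps \<open>\<phi>\<close> to \<open>T (fourier \<phi>)\<close>, is given by
  the function \<open>g\<close>.\<close>

definition has_fourier_transform ::
    "('n::finite) distribution \<Rightarrow> (real^'n \<Rightarrow> complex) \<Rightarrow> bool" where
  "has_fourier_transform T g \<longleftrightarrow> g \<in> borel_measurable borel \<and>
     (\<forall>\<phi>\<in>schwartz. integrable lborel (\<lambda>\<xi>. g \<xi> * \<phi> \<xi>) \<and>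
        T (fourier \<phi>) = (LINT \<xi>|lborel. g \<xi> * \<phi> \<xi>))"

section \<open>Sobolev spaces and the fractional Laplacian\<close>

definition bessel_weight :: "real \<Rightarrow> (real^'n \<Rightarrow> complex) \<Rightarrow> real^'n \<Rightarrow> complex" where
  "bessel_weight s g \<xi> = of_real ((1 + (norm \<xi>)\<^sup>2) powr (s / 2)) * g \<xi>"

definition sobolev :: "real \<Rightarrow> ('n::finite) distribution set" where
  "sobolev s = {T. tempered T \<and>
     (\<exists>g. has_fourier_transform T g \<and> square_integrable (bessel_weight s g))}"

definition sobolev_norm :: "real \<Rightarrow> ('n::finite) distribution \<Rightarrow> real" where
  "sobolev_norm s T = L2norm (bessel_weight s (SOME g. has_fourier_transform T g))"

text \<open>Meaningful when the product of \<open>m\<close> and the Fourier transform of \<open>f\<close> is square-integrable.\<close>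

definition fourier_multiplier :: "(real^'n \<Rightarrow> complex) \<Rightarrow> 'n l2 \<Rightarrow> ('n::finite) l2" where
  "fourier_multiplier m f = (THE h. \<exists>g. has_fourier_transform (l2_distribution f) g \<and>
     has_fourier_transform (l2_distribution h) (\<lambda>\<xi>. m \<xi> * g \<xi>))"

definition frac_laplacian :: "real \<Rightarrow> ('n::finite) l2 \<Rightarrow> 'n l2" where
  "frac_laplacian a = fourier_multiplier (\<lambda>\<xi>. of_real (norm \<xi> powr (2 * a)))"

section \<open>Mild solutions\<close>

text \<open>The value at \<open>\<xi> = 0\<close>, where the formula divides by zero, is irrelevant.\<close>

definition kernel_symbol :: "real \<Rightarrow> real \<Rightarrow> real \<Rightarrow> real^'n \<Rightarrow> complex" where
  "kernel_symbol \<sigma> \<delta> t \<xi> =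
     (exp (- of_real (norm \<xi> powr (2 * \<delta>) * t) + \<i> * of_real (norm \<xi> powr \<sigma> * t))
      - exp (- of_real (norm \<xi> powr (2 * \<delta>) * t) - \<i> * of_real (norm \<xi> powr \<sigma> * t)))
     / (2 * \<i> * of_real (norm \<xi> powr \<sigma>))"

text \<open>For \<open>t > 0\<close> the symbol is in L1 and in L2, and for \<open>t = 0\<close> it vanishes, so for \<open>t \<ge> 0\<close>
  the kernel is a genuine function, in L2.\<close>

definition kernel :: "real \<Rightarrow> real \<Rightarrow> real \<Rightarrow> real^'n \<Rightarrow> complex" where
  "kernel \<sigma> \<delta> t = inverse_fourier (kernel_symbol \<sigma> \<delta> t)"

definition convolution ::
    "(real^'n \<Rightarrow> complex) \<Rightarrow> (real^'n \<Rightarrow> complex) \<Rightarrow> real^'n \<Rightarrow> complex" where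
  "convolution k f x = (LINT y|lborel. k (x - y) * f y)"

definition abs_power :: "real \<Rightarrow> (real^'n \<Rightarrow> complex) \<Rightarrow> real^'n \<Rightarrow> complex" where
  "abs_power p f x = of_real (cmod (f x) powr p)"

text \<open>Duhamel's formula, an identity in L2 in which the time integral is an L2-valued integral.
  The convolutions are in L2 as soon as \<open>u1\<close> and the functions \<open>abs_power p (rep_l2 (u \<tau>))\<close> are,
  because the symbol is bounded; for \<open>u \<tau>\<close> in the Sobolev space of order \<open>\<sigma>\<close> the latter holds if
  this space embeds in the Lebesgue space of exponent \<open>2 * p\<close>.\<close>

definition mild_solution ::
    "real \<Rightarrow> real \<Rightarrow> real \<Rightarrow> (real^'n \<Rightarrow> complex) \<Rightarrow> (real \<Rightarrow> ('n::finite) l2) \<Rightarrow> bool" where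
  "mild_solution \<sigma> \<delta> p u1 u \<longleftrightarrow> (\<forall>t\<ge>0.
     ((\<lambda>\<tau>. abs_l2 (convolution (kernel \<sigma> \<delta> (t - \<tau>)) (abs_power p (rep_l2 (u \<tau>)))))
        has_integral (u t - abs_l2 (convolution (kernel \<sigma> \<delta> t) u1))) {0..t})"

text \<open>Continuity of \<open>u\<close> on \<open>[0,\<infinity>)\<close> with values in the Sobolev space of order \<open>s\<close>.\<close>

definition continuous_sobolev :: "real \<Rightarrow> (real \<Rightarrow> ('n::finite) l2) \<Rightarrow> bool" where
  "continuous_sobolev s u \<longleftrightarrow> (\<forall>t\<ge>0. l2_distribution (u t) \<in> sobolev s \<and>
     ((\<lambda>r. sobolev_norm s (l2_distribution (u r - u t))) \<longlongrightarrow> 0) (at t within {0..}))"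

text \<open>At \<open>t = 0\<close> the derivative is one-sided.\<close>

definition time_derivative :: "(real \<Rightarrow> ('n::finite) l2) \<Rightarrow> real \<Rightarrow> 'n l2" where
  "time_derivative u t = vector_derivative u (at t within {0..})"

definition C1_L2 :: "(real \<Rightarrow> ('n::finite) l2) \<Rightarrow> bool" where
  "C1_L2 u \<longleftrightarrow> (\<forall>t\<ge>0. u differentiable (at t within {0..})) \<and>
     continuous_on {0..} (time_derivative u)"

end

(*
Write V(t) for the Fourier transform of u(t) times the weight (1+t)^r0 + (1+t)^r1 |xi|^sigma, where
r0 = (n - 2 sigma)/(4 delta) and r1 = n/(4 delta). The claimed decay of u says that V is bounded, and
Duhamel's formula becomes a fixed point equation for V in the bounded continuous L2-valued functions.
The low frequencies of the kernel give the decay (1+s)^(-r1) from L1 to L2, the high frequencies decay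
exponentially. By the Sobolev embedding, which subsumes the Gagliardo-Nirenberg inequality, |u|^p is
bounded in L1 by (1+t)^(-kappa) and in L2 by (1+t)^(-kappa-r1), where
kappa = (p (n - sigma) - n)/(2 delta); the condition p > 1 + (sigma + 2 delta)/(n - sigma) says
kappa > 1, which makes the Duhamel integral bounded uniformly in time. Hence for small data the map is
a contraction on a ball. For u_t the kernel itself carries the additional decay. Uniqueness without
smallness follows from Gronwall's inequality, since |u|^p is locally Lipschitz from the Sobolev space
of order sigma to L2.

The Fourier transform on L2 is the extension of the Fourier integral by continuity; the inversion
formula is checked on modulated Gaussians, which span a dense subspace.
*)

theory Submission
  imports Defs "HOL-Probability.Characteristic_Functions" "HOL-Probability.Sinc_Integral"
begin

section \<open>The space of square-integrable functions and multiplication by symbols\<close>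

text \<open>The weight pays for the kernel. The quotient sin(|xi|^sigma s)/|xi|^sigma is bounded by
  s and by |xi|^(-sigma); the first bound loses one power of time, and r0 + 1 <= r1, which is 2
  delta <= sigma, lets the weight absorb it. So the weighted symbol is at most 2 (1+t)^r1
  exp(-|xi|^(2 delta) s/2), and only this majorant enters the estimates; the L2 norm of the
  exponential scales like s^(-n/(4 delta)), the origin of r1. The time derivative of the symbol has
  such an exponential bound without any weight, so u_t even decays at the rate r1.

  The source is needed in L1 and in L2, hence the Lebesgue exponents p and 2p. Either condition on n
  and p implies that the Sobolev order n(1/2 - 1/(2p)) belonging to 2p is at most sigma.

  The time-dependent weight serves only the decay. Continuity and uniqueness use the fixed weight 1
  + |xi|^sigma, since a competing solution is not known to decay.

  A Sobolev norm that chooses some Fourier transform of a distribution is usable only once that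
  transform is unique almost everywhere; the modulated Gaussians are the explicit Schwartz functions
  that prove this too.\<close>

lemma l2_rel_refl_iff: "l2_rel f f \<longleftrightarrow> square_integrable f"
  by (simp add: l2_rel_def)

lemma square_integrable_rep_l2 [simp]: "square_integrable (rep_l2 f)"
  using Quotient3_rep_reflp[OF Quotient3_l2] by (simp add: l2_rel_refl_iff)

lemma square_integrable_measurable:
  "square_integrable f \<Longrightarrow> f \<in> borel_measurable borel"
  by (simp add: square_integrable_def)

lemma measurable_rep_l2 [measurable, simp]: "rep_l2 f \<in> borel_measurable borel"
  by (simp add: square_integrable_measurable)

lemma AE_rep_abs_l2: "square_integrable f \<Longrightarrow> AE x in lborel. rep_l2 (abs_l2 f) x = f x"
  using rep_abs_rsp_left[OF Quotient3_l2, of f f] by (simp add: l2_rel_def)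

lemma abs_rep_l2 [simp]: "abs_l2 (rep_l2 f) = f"
  by (rule Quotient3_abs_rep[OF Quotient3_l2])

lemma abs_l2_eqI:
  "square_integrable f \<Longrightarrow> square_integrable g \<Longrightarrow> (AE x in lborel. f x = g x) \<Longrightarrow> abs_l2 f = abs_l2 g"
  using Quotient3_rel_abs[OF Quotient3_l2] by (auto simp: l2_rel_def)

lemma l2_eqI: "(AE x in lborel. rep_l2 f x = rep_l2 g x) \<Longrightarrow> f = g"
  using abs_l2_eqI[of "rep_l2 f" "rep_l2 g"] by simp

lemma norm_abs_l2: "square_integrable f \<Longrightarrow> norm (abs_l2 f) = L2norm f"
  by (simp add: norm_l2.abs_eq l2_rel_refl_iff)

lemma norm_l2_eq: "norm f = L2norm (rep_l2 f)"
  using norm_abs_l2[of "rep_l2 f"] by simp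

lemma inner_abs_l2:
  "square_integrable f \<Longrightarrow> square_integrable g \<Longrightarrow> abs_l2 f \<bullet> abs_l2 g = (LINT x|lborel. f x \<bullet> g x)"
  by (simp add: inner_l2.abs_eq l2_rel_refl_iff)

lemma abs_l2_add: "square_integrable f \<Longrightarrow> square_integrable g \<Longrightarrow>
    abs_l2 f + abs_l2 g = abs_l2 (\<lambda>x. f x + g x)"
  by (simp add: plus_l2.abs_eq l2_rel_refl_iff)

lemma abs_l2_diff: "square_integrable f \<Longrightarrow> square_integrable g \<Longrightarrow>
    abs_l2 f - abs_l2 g = abs_l2 (\<lambda>x. f x - g x)"
  by (simp add: minus_l2.abs_eq l2_rel_refl_iff)

lemma abs_l2_scaleR: "square_integrable f \<Longrightarrow> r *\<^sub>R abs_l2 f = abs_l2 (\<lambda>x. r *\<^sub>R f x)"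
  using scaleR_l2.abs_eq[of f r] unfolding l2_rel_refl_iff by blast

lemma abs_l2_zero: "abs_l2 (\<lambda>x. 0) = 0"
  by (simp add: zero_l2_def)

lemma AE_rep_l2_add: "AE x in lborel. rep_l2 (f + g) x = rep_l2 f x + rep_l2 g x"
  using abs_l2_add[of "rep_l2 f" "rep_l2 g"] AE_rep_abs_l2[of "\<lambda>x. rep_l2 f x + rep_l2 g x"]
  by (simp add: square_integrable_add)

lemma AE_rep_l2_diff: "AE x in lborel. rep_l2 (f - g) x = rep_l2 f x - rep_l2 g x"
  using abs_l2_diff[of "rep_l2 f" "rep_l2 g"] AE_rep_abs_l2[of "\<lambda>x. rep_l2 f x - rep_l2 g x"]
  by (simp add: square_integrable_diff)

lemma AE_rep_l2_scaleR: "AE x in lborel. rep_l2 (r *\<^sub>R f) x = r *\<^sub>R rep_l2 f x"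
  using abs_l2_scaleR[of "rep_l2 f" r] AE_rep_abs_l2[of "\<lambda>x. r *\<^sub>R rep_l2 f x"]
  by (simp add: square_integrable_scaleR del: scaleR_conv_of_real)

lemma L2norm_nonneg [simp]: "0 \<le> L2norm f"
  by (simp add: L2norm_def)

lemma L1norm_nonneg [simp]: "0 \<le> L1norm f"
  by (simp add: L1norm_def)

lemma square_integrable_bound:
  assumes "square_integrable g" "f \<in> borel_measurable borel"
    and "AE x in lborel. cmod (f x) \<le> B * cmod (g x)"
  shows "square_integrable f"
proof -
  have [measurable]: "f \<in> borel_measurable borel" by fact
  have "integrable lborel (\<lambda>x. B\<^sup>2 * (cmod (g x))\<^sup>2)"
    using assms(1) by (simp add: square_integrable_def)
  then have "integrable lborel (\<lambda>x. (cmod (f x))\<^sup>2)"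
  proof (rule Bochner_Integration.integrable_bound)
    show "AE x in lborel. norm ((cmod (f x))\<^sup>2) \<le> norm (B\<^sup>2 * (cmod (g x))\<^sup>2)"
      using assms(3) by eventually_elim (simp add: power_mult_distrib[symmetric] power_mono)
  qed simp
  then show ?thesis using assms(2) by (simp add: square_integrable_def)
qed

lemma L2norm_mono:
  assumes g: "square_integrable g" and f: "f \<in> borel_measurable borel" and "0 \<le> B"
    and le: "AE x in lborel. cmod (f x) \<le> B * cmod (g x)"
  shows "L2norm f \<le> B * L2norm g"
proof -
  have "(LINT x|lborel. (cmod (f x))\<^sup>2) \<le> (LINT x|lborel. B\<^sup>2 * (cmod (g x))\<^sup>2)"
  proof (rule integral_mono_AE)
    show "integrable lborel (\<lambda>x. (cmod (f x))\<^sup>2)"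
      using square_integrable_bound[OF g f le] by (simp add: square_integrable_def)
    show "integrable lborel (\<lambda>x. B\<^sup>2 * (cmod (g x))\<^sup>2)"
      using g by (simp add: square_integrable_def)
    show "AE x in lborel. (cmod (f x))\<^sup>2 \<le> B\<^sup>2 * (cmod (g x))\<^sup>2"
      using le by eventually_elim (simp add: power_mult_distrib[symmetric] power_mono)
  qed
  then have "L2norm f \<le> sqrt (B\<^sup>2 * (LINT x|lborel. (cmod (g x))\<^sup>2))"
    unfolding L2norm_def by (simp only: integral_mult_right_zero real_sqrt_le_iff)
  then show ?thesis using \<open>0 \<le> B\<close> by (simp add: L2norm_def real_sqrt_mult)
qed

lemma L2norm_power2: "(L2norm f)\<^sup>2 = (LINT x|lborel. (cmod (f x))\<^sup>2)"
  by (simp add: L2norm_def)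

lemma square_integrable_nnI:
  assumes [measurable]: "f \<in> borel_measurable borel"
    and le: "(\<integral>\<^sup>+x. ennreal ((cmod (f x))\<^sup>2) \<partial>lborel) \<le> ennreal (B\<^sup>2)" and "0 \<le> B"
  shows "square_integrable f" "L2norm f \<le> B"
proof -
  have i: "integrable lborel (\<lambda>x. (cmod (f x))\<^sup>2)"
    using le by (intro integrableI_bounded) (auto simp: less_top[symmetric] top_unique)
  then show "square_integrable f" by (simp add: square_integrable_def)
  have "ennreal (LINT x|lborel. (cmod (f x))\<^sup>2) \<le> ennreal (B\<^sup>2)"
    using nn_integral_eq_integral[OF i] le by simp
  then have "(LINT x|lborel. (cmod (f x))\<^sup>2) \<le> B\<^sup>2" by simp
  then show "L2norm f \<le> B" unfolding L2norm_def using \<open>0 \<le> B\<close> by (simp add: real_le_lsqrt)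
qed

lemma nn_integral_L2norm:
  "square_integrable f \<Longrightarrow> (\<integral>\<^sup>+x. ennreal ((cmod (f x))\<^sup>2) \<partial>lborel) = ennreal ((L2norm f)\<^sup>2)"
  unfolding L2norm_power2 square_integrable_def by (intro nn_integral_eq_integral) auto

lemma square_integrable_prod_integrable:
  assumes "square_integrable f" "square_integrable g"
  shows "integrable lborel (\<lambda>x. f x * g x)"
proof -
  have [measurable]: "f \<in> borel_measurable borel" "g \<in> borel_measurable borel"
    using assms by (auto simp: square_integrable_def)
  have "integrable lborel (\<lambda>x. (cmod (f x))\<^sup>2 + (cmod (g x))\<^sup>2)"
    using assms by (auto simp: square_integrable_def)
  then show ?thesis
  proof (rule Bochner_Integration.integrable_bound)
    show "AE x in lborel. norm (f x * g x) \<le> norm ((cmod (f x))\<^sup>2 + (cmod (g x))\<^sup>2)"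
    proof (rule AE_I2)
      fix x
      have "2 * (cmod (f x) * cmod (g x)) \<le> (cmod (f x))\<^sup>2 + (cmod (g x))\<^sup>2"
        using zero_le_power2[of "cmod (f x) - cmod (g x)"]
        by (simp add: power2_eq_square algebra_simps)
      moreover have "0 \<le> cmod (f x) * cmod (g x)" by simp
      ultimately show "norm (f x * g x) \<le> norm ((cmod (f x))\<^sup>2 + (cmod (g x))\<^sup>2)"
        unfolding norm_mult real_norm_def by linarith
    qed
  qed simp
qed

lemma square_integrable_of_real_cmod:
  "square_integrable f \<Longrightarrow> square_integrable (\<lambda>x. of_real (cmod (f x)))"
  by (auto simp: square_integrable_def)

text \<open>The inner product of \<open>l2\<close> is only the real part of the Hermitian one, so
  Cauchy-Schwarz is applied to the moduli of \<open>f\<close> and \<open>g\<close>, where nothing is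
  lost.\<close>

lemma L2_Cauchy_Schwarz:
  assumes f: "square_integrable f" and g: "square_integrable g"
  shows "(LINT x|lborel. cmod (f x) * cmod (g x)) \<le> L2norm f * L2norm g"
proof -
  let ?f = "\<lambda>x. complex_of_real (cmod (f x))" and ?g = "\<lambda>x. complex_of_real (cmod (g x))"
  have s: "square_integrable ?f" "square_integrable ?g"
    using f g by (auto intro: square_integrable_of_real_cmod)
  have "(LINT x|lborel. cmod (f x) * cmod (g x)) = abs_l2 ?f \<bullet> abs_l2 ?g"
    by (simp add: inner_abs_l2[OF s] inner_complex_def)
  also have "\<dots> \<le> norm (abs_l2 ?f) * norm (abs_l2 ?g)"
    by (rule norm_cauchy_schwarz)
  also have "\<dots> = L2norm f * L2norm g"
    by (simp add: norm_abs_l2[OF s(1)] norm_abs_l2[OF s(2)] L2norm_def)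
  finally show ?thesis .
qed

lemma L2_prod_integral_bound:
  assumes f: "square_integrable f" and g: "square_integrable g"
  shows "cmod (LINT x|lborel. f x * g x) \<le> L2norm f * L2norm g"
  using integral_norm_bound[of lborel "\<lambda>x. f x * g x"] L2_Cauchy_Schwarz[OF f g]
  by (simp add: norm_mult)

section \<open>Multiplication operators with bounded symbols\<close>

definition symbol_mult :: "(real^'n \<Rightarrow> complex) \<Rightarrow> ('n::finite) l2 \<Rightarrow> 'n l2" where
  "symbol_mult m f = abs_l2 (\<lambda>\<xi>. m \<xi> * rep_l2 f \<xi>)"

text \<open>The bound is required at every point and not just almost everywhere, so that it passes
  to differences and difference quotients in families of symbols.\<close>

definition bounded_symbol :: "real \<Rightarrow> (real^'n \<Rightarrow> complex) \<Rightarrow> bool" where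
  "bounded_symbol B m \<longleftrightarrow> m \<in> borel_measurable borel \<and> (\<forall>\<xi>. cmod (m \<xi>) \<le> B)"

lemma bounded_symbolD:
  assumes "bounded_symbol B m"
  shows "m \<in> borel_measurable borel" "cmod (m \<xi>) \<le> B" "0 \<le> B"
proof -
  show "m \<in> borel_measurable borel" "cmod (m \<xi>) \<le> B"
    using assms by (auto simp: bounded_symbol_def)
  then show "0 \<le> B" using norm_ge_zero order_trans by blast
qed

lemma square_integrable_symbol:
  assumes m: "bounded_symbol B m" and f: "square_integrable f"
  shows "square_integrable (\<lambda>\<xi>. m \<xi> * f \<xi>)"
proof (rule square_integrable_bound[OF f, where B = B])
  have [measurable]: "m \<in> borel_measurable borel" "f \<in> borel_measurable borel"
    using bounded_symbolD[OF m] f square_integrable_measurable by auto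
  show "(\<lambda>\<xi>. m \<xi> * f \<xi>) \<in> borel_measurable borel" by measurable
  show "AE x in lborel. cmod (m x * f x) \<le> B * cmod (f x)"
    using bounded_symbolD(2)[OF m] by (auto simp: norm_mult intro!: mult_right_mono)
qed

lemma symbol_mult_abs_l2:
  assumes m: "bounded_symbol B m" and f: "square_integrable f"
  shows "symbol_mult m (abs_l2 f) = abs_l2 (\<lambda>\<xi>. m \<xi> * f \<xi>)"
  unfolding symbol_mult_def
proof (rule abs_l2_eqI)
  show "AE x in lborel. m x * rep_l2 (abs_l2 f) x = m x * f x"
    using AE_rep_abs_l2[OF f] by eventually_elim simp
qed (auto intro!: square_integrable_symbol[OF m] f)

lemma AE_rep_symbol_mult:
  assumes m: "bounded_symbol B m"
  shows "AE x in lborel. rep_l2 (symbol_mult m f) x = m x * rep_l2 f x"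
  unfolding symbol_mult_def by (rule AE_rep_abs_l2) (auto intro!: square_integrable_symbol[OF m])

lemma norm_symbol_mult_le:
  assumes m: "bounded_symbol B m"
  shows "norm (symbol_mult m f) \<le> B * norm f"
  unfolding symbol_mult_def norm_l2_eq[of f]
proof (subst norm_abs_l2)
  have [measurable]: "m \<in> borel_measurable borel" using bounded_symbolD[OF m] by auto
  show "L2norm (\<lambda>\<xi>. m \<xi> * rep_l2 f \<xi>) \<le> B * L2norm (rep_l2 f)"
    using bounded_symbolD[OF m] by (intro L2norm_mono) (auto simp: norm_mult intro!: mult_right_mono)
qed (auto intro!: square_integrable_symbol[OF m])

lemma symbol_mult_add:
  assumes m: "bounded_symbol B m"
  shows "symbol_mult m (f + g) = symbol_mult m f + symbol_mult m g"
proof (rule l2_eqI)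
  show "AE x in lborel. rep_l2 (symbol_mult m (f + g)) x = rep_l2 (symbol_mult m f + symbol_mult m g) x"
    using AE_rep_symbol_mult[OF m, of "f + g"] AE_rep_symbol_mult[OF m, of f] AE_rep_symbol_mult[OF m, of g]
      AE_rep_l2_add[of f g] AE_rep_l2_add[of "symbol_mult m f" "symbol_mult m g"]
    by eventually_elim (simp add: distrib_left)
qed

lemma symbol_mult_scaleR:
  assumes m: "bounded_symbol B m"
  shows "symbol_mult m (r *\<^sub>R f) = r *\<^sub>R symbol_mult m f"
proof (rule l2_eqI)
  show "AE x in lborel. rep_l2 (symbol_mult m (r *\<^sub>R f)) x = rep_l2 (r *\<^sub>R symbol_mult m f) x"
    using AE_rep_symbol_mult[OF m, of "r *\<^sub>R f"] AE_rep_symbol_mult[OF m, of f]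
      AE_rep_l2_scaleR[of r f] AE_rep_l2_scaleR[of r "symbol_mult m f"]
    by eventually_elim simp
qed

lemma bounded_linear_symbol_mult:
  assumes m: "bounded_symbol B m"
  shows "bounded_linear (symbol_mult m)"
  by (rule bounded_linear_intro[where K = B])
    (auto simp: symbol_mult_add[OF m] symbol_mult_scaleR[OF m] mult.commute norm_symbol_mult_le[OF m])

lemmas symbol_mult_diff = bounded_linear_symbol_mult[THEN bounded_linear.linear, THEN linear_diff]

lemma symbol_mult_mult:
  assumes m: "bounded_symbol B m" and m': "bounded_symbol B' m'"
    and mm: "AE x in lborel. m x * m' x = k x" and k: "bounded_symbol B'' k"
  shows "symbol_mult m (symbol_mult m' f) = symbol_mult k f"
proof (rule l2_eqI)
  show "AE x in lborel. rep_l2 (symbol_mult m (symbol_mult m' f)) x = rep_l2 (symbol_mult k f) x"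
    using AE_rep_symbol_mult[OF m, of "symbol_mult m' f"] AE_rep_symbol_mult[OF m', of f] AE_rep_symbol_mult[OF k, of f] mm
    by eventually_elim simp
qed

lemma symbol_mult_1: "symbol_mult (\<lambda>_. 1) f = f"
  by (simp add: symbol_mult_def)

lemma symbol_mult_diff_symbol:
  assumes m: "bounded_symbol B m" and m': "bounded_symbol B' m'"
  shows "symbol_mult m f - symbol_mult m' f = symbol_mult (\<lambda>\<xi>. m \<xi> - m' \<xi>) f"
  unfolding symbol_mult_def
  by (subst abs_l2_diff) (auto intro!: square_integrable_symbol[OF m] square_integrable_symbol[OF m']
      simp: left_diff_distrib)

text \<open>Pointwise convergence of uniformly bounded symbols yields strong convergence of the
  operators: for a fixed \<open>f\<close>, dominated convergence applies with the majorant
  \<open>(2*B)\<^sup>2 * (cmod (rep_l2 f x))\<^sup>2\<close>.\<close>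

lemma symbol_mult_tendsto:
  fixes m :: "nat \<Rightarrow> real^'n::finite \<Rightarrow> complex"
  assumes m: "\<And>k. bounded_symbol B (m k)" and m': "bounded_symbol B m'"
    and lim: "\<And>\<xi>. (\<lambda>k. m k \<xi>) \<longlonglongrightarrow> m' \<xi>"
  shows "(\<lambda>k. symbol_mult (m k) f) \<longlonglongrightarrow> symbol_mult m' f"
proof -
  note [measurable] = bounded_symbolD(1)[OF m] bounded_symbolD(1)[OF m']
  have b: "bounded_symbol (2*B) (\<lambda>\<xi>. m k \<xi> - m' \<xi>)" for k
    unfolding bounded_symbol_def
  proof (intro conjI allI)
    show "(\<lambda>\<xi>. m k \<xi> - m' \<xi>) \<in> borel_measurable borel" by measurable
    show "cmod (m k \<xi> - m' \<xi>) \<le> 2 * B" for \<xi>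
      using norm_triangle_ineq4[of "m k \<xi>" "m' \<xi>"] bounded_symbolD(2)[OF m, of k \<xi>]
        bounded_symbolD(2)[OF m', of \<xi>] by linarith
  qed
  have si: "square_integrable (\<lambda>\<xi>. (m k \<xi> - m' \<xi>) * rep_l2 f \<xi>)" for k
    by (intro square_integrable_symbol[OF b] square_integrable_rep_l2)
  have n: "(norm (symbol_mult (m k) f - symbol_mult m' f))\<^sup>2 = (LINT x|lborel. (cmod ((m k x - m' x) * rep_l2 f x))\<^sup>2)" for k
    by (simp add: symbol_mult_diff_symbol[OF m m'] symbol_mult_def[of "\<lambda>\<xi>. m k \<xi> - m' \<xi>"]
        norm_abs_l2[OF si] L2norm_power2)
  have "(\<lambda>k. LINT x|lborel. (cmod ((m k x - m' x) * rep_l2 f x))\<^sup>2) \<longlonglongrightarrow> (LINT x|(lborel::(real^'n) measure). 0)"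
  proof (rule integral_dominated_convergence[where w = "\<lambda>x. (2*B)\<^sup>2 * (cmod (rep_l2 f x))\<^sup>2"])
    show "integrable lborel (\<lambda>x. (2*B)\<^sup>2 * (cmod (rep_l2 f x))\<^sup>2)"
      using square_integrable_rep_l2[of f] unfolding square_integrable_def by auto
    have "(\<lambda>k. (cmod ((m k x - m' x) * rep_l2 f x))\<^sup>2) \<longlonglongrightarrow> (cmod ((m' x - m' x) * rep_l2 f x))\<^sup>2" for x
      by (intro tendsto_intros lim)
    then show "AE x in lborel. (\<lambda>k. (cmod ((m k x - m' x) * rep_l2 f x))\<^sup>2) \<longlonglongrightarrow> 0"
      by simp
    show "AE x in lborel. norm ((cmod ((m k x - m' x) * rep_l2 f x))\<^sup>2) \<le> (2*B)\<^sup>2 * (cmod (rep_l2 f x))\<^sup>2" for k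
      unfolding power_mult_distrib[symmetric] norm_mult
      using bounded_symbolD(2)[OF b]
      by (auto intro!: power_mono mult_right_mono)
  qed auto
  then have "(\<lambda>k. (norm (symbol_mult (m k) f - symbol_mult m' f))\<^sup>2) \<longlonglongrightarrow> 0" by (simp add: n)
  then have "(\<lambda>k. sqrt ((norm (symbol_mult (m k) f - symbol_mult m' f))\<^sup>2)) \<longlonglongrightarrow> sqrt 0"
    by (rule tendsto_real_sqrt)
  then show ?thesis
    unfolding tendsto_dist_iff[of _ "symbol_mult m' f"] dist_norm by simp
qed

text \<open>Strong convergence handles the fixed vector \<open>g a\<close>, and the common operator
  bound \<open>B\<close> handles the increment of \<open>g\<close>. This is the source of all
  continuity in time below.\<close>

lemma continuous_on_symbol_mult:
  fixes g :: "'a::metric_space \<Rightarrow> ('n::finite) l2"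
  assumes m: "\<And>a. a \<in> S \<Longrightarrow> bounded_symbol B (m a)"
    and cm: "\<And>\<xi>. continuous_on S (\<lambda>a. m a \<xi>)" and g: "continuous_on S g"
  shows "continuous_on S (\<lambda>a. symbol_mult (m a) (g a))"
  unfolding continuous_on_sequentially
proof (intro allI ballI impI)
  fix x a assume a: "a \<in> S" and x: "(\<forall>k. x k \<in> S) \<and> x \<longlonglongrightarrow> a"
  have "(\<lambda>k. symbol_mult (m (x k)) (g a)) \<longlonglongrightarrow> symbol_mult (m a) (g a)"
    using x a m cm by (intro symbol_mult_tendsto) (auto simp: continuous_on_sequentially o_def)
  moreover have "(\<lambda>k. symbol_mult (m (x k)) (g (x k) - g a)) \<longlonglongrightarrow> 0"
  proof (rule Lim_null_comparison)
    show "\<forall>\<^sub>F k in sequentially. norm (symbol_mult (m (x k)) (g (x k) - g a)) \<le> B * norm (g (x k) - g a)"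
      using x m norm_symbol_mult_le by (intro always_eventually allI) blast
    have "(\<lambda>k. g (x k)) \<longlonglongrightarrow> g a"
      using g x a by (auto simp: continuous_on_sequentially o_def)
    then have "(\<lambda>k. B * norm (g (x k) - g a)) \<longlonglongrightarrow> B * norm (g a - g a)"
      by (intro tendsto_intros)
    then show "(\<lambda>k. B * norm (g (x k) - g a)) \<longlonglongrightarrow> 0" by simp
  qed
  ultimately have "(\<lambda>k. symbol_mult (m (x k)) (g (x k) - g a) + symbol_mult (m (x k)) (g a)) \<longlonglongrightarrow> 0 + symbol_mult (m a) (g a)"
    by (intro tendsto_add)
  moreover have "symbol_mult (m (x k)) (g (x k) - g a) + symbol_mult (m (x k)) (g a) = symbol_mult (m (x k)) (g (x k))" for k
    using symbol_mult_diff[OF m, of "x k"] x by simp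
  ultimately show "((\<lambda>a. symbol_mult (m a) (g a)) \<circ> x) \<longlonglongrightarrow> symbol_mult (m a) (g a)"
    by (simp add: o_def)
qed

text \<open>The form with difference quotients is the one to which limit theorems for symbols apply
  directly.\<close>

lemma has_vector_derivative_iff_slope:
  fixes f :: "real \<Rightarrow> 'a::real_normed_vector"
  shows "(f has_vector_derivative D) (at s within S) \<longleftrightarrow>
    ((\<lambda>r. (1 / (r - s)) *\<^sub>R (f r - f s)) \<longlongrightarrow> D) (at s within S)"
proof -
  have eq: "norm ((1 / norm (y - s)) *\<^sub>R (f y - (f s + (y - s) *\<^sub>R D)))
      = norm ((1 / (y - s)) *\<^sub>R (f y - f s) - D)" if "y \<noteq> s" for y
  proof -
    have "(1 / (y - s)) *\<^sub>R (f y - f s) - D = (1 / (y - s)) *\<^sub>R (f y - (f s + (y - s) *\<^sub>R D))"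
      using that by (simp add: scaleR_diff_right scaleR_add_right)
    then show ?thesis by simp
  qed
  have "(f has_vector_derivative D) (at s within S) \<longleftrightarrow>
      ((\<lambda>y. norm ((1 / norm (y - s)) *\<^sub>R (f y - (f s + (y - s) *\<^sub>R D)))) \<longlongrightarrow> 0) (at s within S)"
    unfolding has_vector_derivative_def has_derivative_within tendsto_norm_zero_iff
    by (simp add: bounded_linear_scaleR_left)
  also have "\<dots> \<longleftrightarrow> ((\<lambda>y. norm ((1 / (y - s)) *\<^sub>R (f y - f s) - D)) \<longlongrightarrow> 0) (at s within S)"
    using eq by (intro tendsto_cong) (simp add: eventually_at_filter)
  also have "\<dots> \<longleftrightarrow> ((\<lambda>r. (1 / (r - s)) *\<^sub>R (f r - f s)) \<longlongrightarrow> D) (at s within S)"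
    by (simp only: tendsto_norm_zero_iff LIM_zero_iff)
  finally show ?thesis .
qed

text \<open>By the mean value inequality the bound \<open>B\<close> on \<open>m'\<close> also bounds
  all difference quotients of \<open>m\<close>, so their pointwise convergence is enough for
  \<open>symbol_mult_tendsto\<close>.\<close>

lemma has_vector_derivative_symbol_mult:
  fixes f :: "('n::finite) l2"
  assumes m: "\<And>s. bounded_symbol (M s) (m s)" and m': "bounded_symbol B (m' s)"
    and d: "\<And>\<xi> s. ((\<lambda>s. m s \<xi>) has_vector_derivative m' s \<xi>) (at s)"
    and b: "\<And>\<xi> s. cmod (m' s \<xi>) \<le> B"
  shows "((\<lambda>s. symbol_mult (m s) f) has_vector_derivative symbol_mult (m' s) f) (at s)"
  unfolding has_vector_derivative_iff_slope
proof -
  define q where "q r \<xi> = (1 / (r - s)) *\<^sub>R (m r \<xi> - m s \<xi>)" for r \<xi>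
  have lip: "cmod (m r \<xi> - m s \<xi>) \<le> B * \<bar>r - s\<bar>" for r \<xi>
  proof -
    have "norm (m r \<xi> - m s \<xi>) \<le> B * norm (r - s)"
    proof (rule differentiable_bound[of UNIV "\<lambda>r. m r \<xi>" "\<lambda>r x. x *\<^sub>R m' r \<xi>"])
      show "onorm (\<lambda>x. x *\<^sub>R m' t \<xi>) \<le> B" for t
        using b[of t \<xi>] by (intro onorm_le) (auto simp: mult.commute[of B] norm_mult intro!: mult_left_mono)
    qed (use d in \<open>auto simp: has_vector_derivative_def\<close>)
    then show ?thesis by simp
  qed
  have qb: "bounded_symbol B (q r)" for r
    unfolding bounded_symbol_def q_def
  proof (intro conjI allI)
    note [measurable] = bounded_symbolD(1)[OF m]
    show "(\<lambda>\<xi>. (1 / (r - s)) *\<^sub>R (m r \<xi> - m s \<xi>)) \<in> borel_measurable borel" by measurable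
    show "cmod ((1 / (r - s)) *\<^sub>R (m r \<xi> - m s \<xi>)) \<le> B" for \<xi>
    proof (cases "r = s")
      case False
      then show ?thesis using lip[of r \<xi>] by (simp add: divide_simps norm_mult norm_divide)
    qed (use bounded_symbolD(3)[OF m'] in simp)
  qed
  have qlim: "((\<lambda>r. q r \<xi>) \<longlongrightarrow> m' s \<xi>) (at s)" for \<xi>
    using d[of \<xi> s] unfolding q_def has_vector_derivative_iff_slope .
  have qeq: "symbol_mult (q r) f = (1 / (r - s)) *\<^sub>R (symbol_mult (m r) f - symbol_mult (m s) f)" for r
    unfolding symbol_mult_diff_symbol[OF m m] unfolding symbol_mult_def
    by (subst abs_l2_scaleR)
      (auto simp: q_def left_diff_distrib intro!: square_integrable_diff square_integrable_symbol[OF m])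
  have "((\<lambda>r. symbol_mult (q r) f) \<longlongrightarrow> symbol_mult (m' s) f) (at s)"
    unfolding tendsto_at_iff_sequentially o_def
    using qlim unfolding tendsto_at_iff_sequentially o_def
    by (auto intro!: symbol_mult_tendsto[OF qb m'])
  then show "((\<lambda>r. (1 / (r - s)) *\<^sub>R (symbol_mult (m r) f - symbol_mult (m s) f)) \<longlongrightarrow> symbol_mult (m' s) f) (at s)"
    unfolding qeq .
qed

section \<open>Completeness\<close>

text \<open>On a ball, Cauchy-Schwarz against the indicator turns summable L2 norms into a summable
  series of integrals, so the sum is finite almost everywhere there. Countably many balls cover the
  space.\<close>

lemma AE_summable_if_L2_summable:
  fixes d :: "nat \<Rightarrow> real^'n::finite \<Rightarrow> complex"
  assumes d: "\<And>k. square_integrable (d k)" and s: "summable (\<lambda>k. L2norm (d k))"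
  shows "AE x in lborel. summable (\<lambda>k. cmod (d k x))"
proof -
  have [measurable]: "d k \<in> borel_measurable borel" for k
    by (rule square_integrable_measurable[OF d])
  have "AE x in lborel. x \<in> cball 0 (real j) \<longrightarrow> summable (\<lambda>k. cmod (d k x))" for j
  proof -
    define h :: "real^'n \<Rightarrow> complex" where "h = indicator (cball 0 (real j))"
    have em: "emeasure lborel (cball (0::real^'n) (real j)) < \<infinity>"
      using emeasure_lborel_cball_finite by (simp add: less_top[symmetric])
    have h: "square_integrable h"
      unfolding square_integrable_def h_def
    proof
      have "integrable lborel (indicator (cball 0 (real j)) :: real^'n \<Rightarrow> real)"
        using em by (intro integrable_real_indicator) auto
      then show "integrable lborel (\<lambda>x::real^'n. (cmod (indicator (cball 0 (real j)) x))\<^sup>2)"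
        by (rule Bochner_Integration.integrable_cong[THEN iffD1, rotated -1]) (auto simp: indicator_def)
    qed (auto intro!: borel_measurable_indicator)
    have hd: "integrable lborel (\<lambda>x. cmod (h x) * cmod (d k x))" for k
      using integrable_norm[OF square_integrable_prod_integrable[OF h d]] by (simp add: norm_mult)
    have [measurable]: "h \<in> borel_measurable borel" unfolding h_def by (auto intro!: borel_measurable_indicator)
    have "(\<integral>\<^sup>+x. (\<Sum>k. ennreal (cmod (h x) * cmod (d k x))) \<partial>lborel)
        = (\<Sum>k. \<integral>\<^sup>+x. ennreal (cmod (h x) * cmod (d k x)) \<partial>lborel)"
      by (intro nn_integral_suminf) measurable
    also have "\<dots> = (\<Sum>k. ennreal (LINT x|lborel. cmod (h x) * cmod (d k x)))"
      by (intro arg_cong[where f = suminf] ext nn_integral_eq_integral hd) auto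
    also have "\<dots> \<le> (\<Sum>k. ennreal (L2norm h * L2norm (d k)))"
      by (intro suminf_le ennreal_leI L2_Cauchy_Schwarz h d) auto
    also have "\<dots> = ennreal (\<Sum>k. L2norm h * L2norm (d k))"
      by (intro suminf_ennreal2 summable_mult s) auto
    also have "\<dots> < \<infinity>" by simp
    finally have "AE x in lborel. (\<Sum>k. ennreal (cmod (h x) * cmod (d k x))) \<noteq> \<infinity>"
      by (intro nn_integral_noteq_infinite) auto
    then show ?thesis
    proof eventually_elim
      case (elim x)
      show ?case
      proof
        assume "x \<in> cball 0 (real j)"
        then have "(\<Sum>k. ennreal (cmod (d k x))) \<noteq> top" using elim by (simp add: h_def)
        then show "summable (\<lambda>k. cmod (d k x))" by (intro summable_suminf_not_top) auto
      qed
    qed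
  qed
  then have "AE x in lborel. \<forall>j::nat. x \<in> cball 0 (real j) \<longrightarrow> summable (\<lambda>k. cmod (d k x))"
    unfolding AE_all_countable by blast
  then show ?thesis
  proof eventually_elim
    case (elim x)
    obtain j :: nat where "norm x \<le> real j" using real_arch_simple by blast
    then show ?case using elim by (auto simp: dist_norm)
  qed
qed

text \<open>Fatou's lemma. A bound that holds eventually is enough, so it can be applied to the
  tails of a Cauchy sequence.\<close>

lemma L2norm_limit_le:
  fixes f :: "nat \<Rightarrow> real^'n::finite \<Rightarrow> complex"
  assumes f: "\<And>k. square_integrable (f k)" and [measurable]: "F \<in> borel_measurable borel"
    and lim: "AE x in lborel. (\<lambda>k. f k x) \<longlonglongrightarrow> F x"
    and b: "\<forall>\<^sub>F k in sequentially. L2norm (f k) \<le> B" and "0 \<le> B"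
  shows "square_integrable F" "L2norm F \<le> B"
proof -
  have [measurable]: "f k \<in> borel_measurable borel" for k
    by (rule square_integrable_measurable[OF f])
  have "(\<integral>\<^sup>+x. ennreal ((cmod (F x))\<^sup>2) \<partial>lborel) = (\<integral>\<^sup>+x. liminf (\<lambda>k. ennreal ((cmod (f k x))\<^sup>2)) \<partial>lborel)"
  proof (rule nn_integral_cong_AE)
    show "AE x in lborel. ennreal ((cmod (F x))\<^sup>2) = liminf (\<lambda>k. ennreal ((cmod (f k x))\<^sup>2))"
      using lim
    proof eventually_elim
      case (elim x)
      then have "(\<lambda>k. ennreal ((cmod (f k x))\<^sup>2)) \<longlonglongrightarrow> ennreal ((cmod (F x))\<^sup>2)"
        by (intro tendsto_intros)
      then show ?case by (intro lim_imp_Liminf[symmetric]) auto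
    qed
  qed
  also have "\<dots> \<le> liminf (\<lambda>k. \<integral>\<^sup>+x. ennreal ((cmod (f k x))\<^sup>2) \<partial>lborel)"
    by (rule nn_integral_liminf) measurable
  also have "\<dots> \<le> ennreal (B\<^sup>2)"
  proof (rule order_trans[OF Liminf_le_Limsup Limsup_bounded])
    show "\<forall>\<^sub>F k in sequentially. (\<integral>\<^sup>+x. ennreal ((cmod (f k x))\<^sup>2) \<partial>lborel) \<le> ennreal (B\<^sup>2)"
      using b by eventually_elim (auto simp: nn_integral_L2norm[OF f] intro!: ennreal_leI power_mono)
  qed auto
  finally have *: "(\<integral>\<^sup>+x. ennreal ((cmod (F x))\<^sup>2) \<partial>lborel) \<le> ennreal (B\<^sup>2)" .
  show "square_integrable F" "L2norm F \<le> B"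
    using square_integrable_nnI[OF _ * \<open>0 \<le> B\<close>] by auto
qed

text \<open>Riesz-Fischer: a subsequence with increments below \<open>(1/2)^k\<close> converges
  almost everywhere, Fatou's lemma bounds the distance of its members to the limit, and a Cauchy
  sequence follows its subsequence.\<close>

instance l2 :: (finite) complete_space
proof
  fix X :: "nat \<Rightarrow> 'a l2" assume X: "Cauchy X"
  have ex: "\<exists>N. \<forall>m\<ge>N. \<forall>n\<ge>N. norm (X m - X n) < (1/2)^k" for k :: nat
    using X by (simp add: Cauchy_iff)
  have "\<exists>r. \<forall>k. (\<forall>m\<ge>r k. \<forall>n\<ge>r k. norm (X m - X n) < (1/2)^k) \<and> r k < r (Suc k)"
  proof (rule dependent_nat_choice)
    show "\<exists>r. \<forall>m\<ge>r. \<forall>n\<ge>r. norm (X m - X n) < (1/2)^0" by (rule ex)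
    fix r and k :: nat
    obtain N where "\<forall>m\<ge>N. \<forall>n\<ge>N. norm (X m - X n) < (1/2)^(Suc k)" using ex by blast
    then show "\<exists>r'. (\<forall>m\<ge>r'. \<forall>n\<ge>r'. norm (X m - X n) < (1/2)^(Suc k)) \<and> r < r'"
      by (intro exI[of _ "max N (Suc r)"]) auto
  qed
  then obtain r :: "nat \<Rightarrow> nat" where r: "\<And>k m n. m \<ge> r k \<Longrightarrow> n \<ge> r k \<Longrightarrow> norm (X m - X n) < (1/2)^k"
    and rs: "\<And>k. r k < r (Suc k)" by blast
  have sm: "strict_mono r" using rs by (simp add: strict_mono_Suc_iff)
  define f where "f k = rep_l2 (X (r k))" for k
  have fs: "square_integrable (f k)" for k by (simp add: f_def)
  have fd: "L2norm (\<lambda>x. f j x - f k x) = norm (X (r j) - X (r k))" for j k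
    unfolding f_def using abs_l2_diff[of "rep_l2 (X (r j))" "rep_l2 (X (r k))"]
    by (simp add: norm_abs_l2[symmetric] square_integrable_diff)
  \<comment> \<open>\<open>lim\<close> is total, so \<open>F\<close> is measurable on the whole
    space; its value where the subsequence diverges is arbitrary but concerns only a null
    set.\<close>
  define F where "F x = lim (\<lambda>k. f k x)" for x
  have [measurable]: "f k \<in> borel_measurable borel" for k by (simp add: f_def)
  have Fm [measurable]: "F \<in> borel_measurable borel"
    unfolding F_def by (rule borel_measurable_lim_metric) simp
  have "AE x in lborel. summable (\<lambda>k. cmod (f (Suc k) x - f k x))"
  proof (rule AE_summable_if_L2_summable)
    show "summable (\<lambda>k. L2norm (\<lambda>x. f (Suc k) x - f k x))"
    proof (rule summable_comparison_test')
      show "norm (L2norm (\<lambda>x. f (Suc k) x - f k x)) \<le> (1/2)^k" for k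
        unfolding fd using r[of k "r (Suc k)" "r k"] rs[of k] by (simp add: less_imp_le)
    qed (simp add: summable_geometric)
  qed (intro square_integrable_diff fs)
  then have lim: "AE x in lborel. (\<lambda>k. f k x) \<longlonglongrightarrow> F x"
  proof eventually_elim
    case (elim x)
    then have "summable (\<lambda>k. f (Suc k) x - f k x)" by (rule summable_norm_cancel)
    then have "(\<lambda>k. (\<Sum>i<k. f (Suc i) x - f i x) + f 0 x) \<longlonglongrightarrow> suminf (\<lambda>k. f (Suc k) x - f k x) + f 0 x"
      by (intro tendsto_intros summable_LIMSEQ)
    then have "convergent (\<lambda>k. f k x)"
      unfolding sum_lessThan_telescope[of "\<lambda>i. f i x"] by (auto simp: convergent_def)
    then show ?case unfolding F_def by (rule convergent_LIMSEQ_iff[THEN iffD1])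
  qed
  have tail: "square_integrable (\<lambda>x. F x - f k x)" "L2norm (\<lambda>x. F x - f k x) \<le> (1/2)^k" for k
  proof -
    have l: "AE x in lborel. (\<lambda>j. f j x - f k x) \<longlonglongrightarrow> F x - f k x"
      using lim by eventually_elim (intro tendsto_intros)
    have e: "\<forall>\<^sub>F j in sequentially. L2norm (\<lambda>x. f j x - f k x) \<le> (1/2)^k"
      unfolding fd
      using eventually_ge_at_top[of k]
    proof eventually_elim
      case (elim j)
      then show ?case using r[of k "r j" "r k"] sm by (simp add: less_imp_le strict_mono_less_eq)
    qed
    show "square_integrable (\<lambda>x. F x - f k x)" "L2norm (\<lambda>x. F x - f k x) \<le> (1/2)^k"
      using L2norm_limit_le[OF square_integrable_diff[OF fs fs] _ l e] by auto
  qed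
  have Fs: "square_integrable F"
    using square_integrable_add[OF tail(1)[of 0] fs[of 0]] by simp
  have k: "norm (X (r k) - abs_l2 F) \<le> (1/2)^k" for k
  proof -
    have "norm (abs_l2 F - X (r k)) = L2norm (\<lambda>x. F x - f k x)"
      unfolding f_def using abs_l2_diff[OF Fs, of "rep_l2 (X (r k))"]
      by (simp add: norm_abs_l2[symmetric] square_integrable_diff Fs)
    then show ?thesis using tail(2)[of k] by (simp add: norm_minus_commute)
  qed
  have "X \<longlonglongrightarrow> abs_l2 F"
  proof (rule LIMSEQ_I)
    fix e :: real assume "e > 0"
    then obtain k :: nat where e: "(1/2)^k < e / 2"
      using real_arch_pow_inv[of "e / 2" "1/2"] by auto
    have "norm (X m - abs_l2 F) < e" if "m \<ge> r k" for m
    proof -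
      have "norm (X m - abs_l2 F) \<le> norm (X m - X (r k)) + norm (X (r k) - abs_l2 F)"
        using norm_triangle_ineq[of "X m - X (r k)" "X (r k) - abs_l2 F"] by simp
      then show ?thesis using r[of k m "r k"] that k[of k] e by linarith
    qed
    then show "\<exists>no. \<forall>m\<ge>no. norm (X m - abs_l2 F) < e" by blast
  qed
  then show "convergent X" by (auto simp: convergent_def)
qed

instance l2 :: (finite) banach ..

section \<open>The Fourier integral\<close>

lemma measurable_cis [measurable]: "cis \<in> borel_measurable borel"
  by (intro borel_measurable_continuous_onI continuous_intros)

section \<open>Affine changes of variables, product integrands and Fubini majorants\<close>

lemma nn_integral_lborel_affine:
  fixes f :: "'a::euclidean_space \<Rightarrow> ennreal"
  assumes [measurable]: "f \<in> borel_measurable borel" and c: "c \<noteq> 0"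
  shows "(\<integral>\<^sup>+x. f x \<partial>lborel) = \<bar>c\<bar> ^ DIM('a) * (\<integral>\<^sup>+x. f (t + c *\<^sub>R x) \<partial>lborel)"
  by (subst lborel_affine[OF c, of t])
    (simp add: nn_integral_density nn_integral_distr nn_integral_cmult ennreal_power)

lemma integral_lborel_affine:
  fixes f :: "'a::euclidean_space \<Rightarrow> 'b::{banach, second_countable_topology}"
  assumes [measurable]: "f \<in> borel_measurable borel" and c: "c \<noteq> 0"
  shows "(LINT x|lborel. f x) = \<bar>c\<bar> ^ DIM('a) *\<^sub>R (LINT x|lborel. f (t + c *\<^sub>R x))"
  by (subst lborel_affine[OF c, of t])
    (simp add: integral_density integral_distr)

lemma integrable_lborel_affine_iff:
  fixes f :: "'a::euclidean_space \<Rightarrow> 'b::{banach, second_countable_topology}"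
  assumes [measurable]: "f \<in> borel_measurable borel" and c: "c \<noteq> 0"
  shows "integrable lborel (\<lambda>x. f (t + c *\<^sub>R x)) \<longleftrightarrow> integrable lborel f"
proof
  let ?c = "\<bar>c\<bar> ^ DIM('a)"
  have eq: "integrable lborel f \<longleftrightarrow> integrable lborel (\<lambda>x. ?c *\<^sub>R f (t + c *\<^sub>R x))"
    by (subst lborel_affine[OF c, of t]) (simp add: integrable_density integrable_distr_eq)
  show "integrable lborel f" if "integrable lborel (\<lambda>x. f (t + c *\<^sub>R x))"
    unfolding eq using that by (rule integrable_scaleR_right)
  assume "integrable lborel f"
  then have "integrable lborel (\<lambda>x. (1 / ?c) *\<^sub>R (?c *\<^sub>R f (t + c *\<^sub>R x)))"
    unfolding eq by (rule integrable_scaleR_right)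
  then show "integrable lborel (\<lambda>x. f (t + c *\<^sub>R x))" using c by simp
qed

text \<open>Integrals in several variables are never computed otherwise: Gaussians are products over
  the coordinates, and the majorants for polynomial decay and for the singular weight are chosen as
  such products.\<close>

lemma integral_lborel_prod:
  fixes f :: "'a::euclidean_space \<Rightarrow> real \<Rightarrow> complex"
  assumes f: "\<And>b. b \<in> Basis \<Longrightarrow> integrable lborel (f b)"
  shows "integrable lborel (\<lambda>x. \<Prod>b\<in>Basis. f b (x \<bullet> b))"
    and "(LINT x|lborel. (\<Prod>b\<in>Basis. f b (x \<bullet> b))) = (\<Prod>b\<in>Basis. LINT x|lborel. f b x)"
proof -
  interpret product_sigma_finite "\<lambda>_::'a. lborel :: real measure" ..
  have [measurable]: "f b \<in> borel_measurable borel" if "b \<in> Basis" for b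
    using borel_measurable_integrable[OF f[OF that]] by simp
  have eq: "(\<Prod>b\<in>Basis. f b ((\<Sum>b'\<in>Basis. g b' *\<^sub>R b') \<bullet> b)) = (\<Prod>b\<in>Basis. f b (g b))" for g :: "'a \<Rightarrow> real"
    by (intro prod.cong) simp_all
  have m: "(\<lambda>x. \<Prod>b\<in>Basis. f b (x \<bullet> b)) \<in> borel_measurable borel"
    by (intro borel_measurable_prod) measurable
  have i: "integrable (Pi\<^sub>M Basis (\<lambda>_. lborel)) (\<lambda>g. \<Prod>b\<in>Basis. f b (g b))"
    by (rule product_integrable_prod) (auto intro: f)
  show "integrable lborel (\<lambda>x. \<Prod>b\<in>Basis. f b (x \<bullet> b))"
    by (subst lborel_eq, subst integrable_distr_eq) (use m i in \<open>auto simp: eq\<close>)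
  show "(LINT x|lborel. (\<Prod>b\<in>Basis. f b (x \<bullet> b))) = (\<Prod>b\<in>Basis. LINT x|lborel. f b x)"
    by (subst lborel_eq, subst integral_distr) (use m f in \<open>auto simp: eq product_integral_prod\<close>)
qed

text \<open>The hypothesis of Fubini's theorem in all uses below, where \<open>c\<close> is a phase
  or a Gaussian in the difference of the variables.\<close>

lemma integrable_tensor:
  fixes f :: "'a::euclidean_space \<Rightarrow> complex" and g :: "'b::euclidean_space \<Rightarrow> complex"
  assumes f: "integrable lborel f" and g: "integrable lborel g"
    and c: "c \<in> borel_measurable (borel \<Otimes>\<^sub>M borel)" and le: "\<And>z. cmod (c z) \<le> B"
  shows "integrable (lborel \<Otimes>\<^sub>M lborel) (\<lambda>(x, y). c (x, y) * (f x * g y))"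
proof -
  have [measurable]: "f \<in> borel_measurable borel" "g \<in> borel_measurable borel"
    using borel_measurable_integrable[OF f] borel_measurable_integrable[OF g] by auto
  note [measurable] = c
  have "integrable (lborel \<Otimes>\<^sub>M lborel) (\<lambda>z. f (fst z) * g (snd z))"
  proof (rule lborel_pair.Fubini_integrable)
    show "(\<lambda>z. f (fst z) * g (snd z)) \<in> borel_measurable (lborel \<Otimes>\<^sub>M lborel)" by measurable
    show "integrable lborel (\<lambda>x. LINT y|lborel. norm (f (fst (x, y)) * g (snd (x, y))))"
      using integrable_norm[OF f] by (simp add: norm_mult)
    show "AE x in lborel. integrable lborel (\<lambda>y. f (fst (x, y)) * g (snd (x, y)))"
      using g by simp
  qed
  then have "integrable (lborel \<Otimes>\<^sub>M lborel) (\<lambda>z. B * (f (fst z) * g (snd z)))"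
    by simp
  then show ?thesis
  proof (rule Bochner_Integration.integrable_bound)
    have "0 \<le> B" using le norm_ge_zero order_trans by blast
    show "AE z in lborel \<Otimes>\<^sub>M lborel. norm (case z of (x, y) \<Rightarrow> c (x, y) * (f x * g y)) \<le> norm (B * (f (fst z) * g (snd z)))"
      using le \<open>0 \<le> B\<close> by (auto simp: norm_mult intro!: mult_right_mono AE_I2)
  qed measurable
qed

text \<open>The sign \<open>s\<close>, which is 1 or -1 in all uses, treats the transform and its
  inverse together.\<close>

definition ft :: "real \<Rightarrow> (real^'n \<Rightarrow> complex) \<Rightarrow> real^'n \<Rightarrow> complex" where
  "ft s f \<xi> = (LINT x|lborel. cis (- s * (x \<bullet> \<xi>)) * f x)"

lemma fourier_eq_ft: "fourier f = ft 1 f"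
  by (rule ext) (simp add: fourier_def ft_def cis_conv_exp)

lemma inverse_fourier_eq_ft:
  "inverse_fourier m x = ft (-1) m x / of_real ((2 * pi) ^ CARD('n))" for x :: "real^'n"
  by (simp add: inverse_fourier_def ft_def cis_conv_exp inner_commute)

lemma integrable_cis_mult:
  assumes f: "integrable lborel f" and [measurable]: "g \<in> borel_measurable borel"
  shows "integrable lborel (\<lambda>x. cis (g x) * f x)"
proof (rule Bochner_Integration.integrable_bound[OF f])
  show "(\<lambda>x. cis (g x) * f x) \<in> borel_measurable lborel"
    using borel_measurable_integrable[OF f] by measurable
qed (simp add: norm_mult)

lemma cmod_ft_le: "cmod (ft s f \<xi>) \<le> L1norm f"
  unfolding ft_def L1norm_def
  using integral_norm_bound[of lborel "\<lambda>x. cis (- s * (x \<bullet> \<xi>)) * f x"] by (simp add: norm_mult)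

lemma measurable_ft [measurable]:
  fixes f :: "real^'n \<Rightarrow> complex"
  assumes [measurable]: "f \<in> borel_measurable borel"
  shows "ft s f \<in> borel_measurable borel"
proof -
  have "(\<lambda>\<xi>. LINT x|lborel. cis (- s * (x \<bullet> \<xi>)) * f x) \<in> borel_measurable borel"
    by (rule lborel.borel_measurable_lebesgue_integral) measurable
  then show ?thesis by (simp add: ft_def[abs_def])
qed

lemma ft_diff:
  assumes "integrable lborel f" "integrable lborel g"
  shows "ft s (\<lambda>x. f x - g x) \<xi> = ft s f \<xi> - ft s g \<xi>"
  unfolding ft_def right_diff_distrib
  by (intro Bochner_Integration.integral_diff integrable_cis_mult assms) measurable

lemma cnj_ft: "cnj (ft s f \<xi>) = ft (-s) (\<lambda>x. cnj (f x)) \<xi>"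
  by (simp add: ft_def cis_cnj flip: Bochner_Integration.integral_cnj)

lemma ft_swap:
  assumes f: "integrable lborel f" and g: "integrable lborel g"
  shows "(LINT \<xi>|lborel. ft s f \<xi> * g \<xi>) = (LINT x|lborel. f x * ft s g x)"
proof -
  have i: "integrable (lborel \<Otimes>\<^sub>M lborel) (\<lambda>(x, \<xi>). cis (- s * (x \<bullet> \<xi>)) * (f x * g \<xi>))"
    using integrable_tensor[OF f g, of "\<lambda>z. cis (- s * (fst z \<bullet> snd z))" 1] by (simp add: split_beta)
  have "(LINT \<xi>|lborel. ft s f \<xi> * g \<xi>)
      = (LINT \<xi>|lborel. LINT x|lborel. cis (- s * (x \<bullet> \<xi>)) * (f x * g \<xi>))"
    by (simp add: ft_def flip: integral_mult_left_zero mult.assoc)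
  also have "\<dots> = (LINT x|lborel. LINT \<xi>|lborel. cis (- s * (x \<bullet> \<xi>)) * (f x * g \<xi>))"
    by (rule lborel_pair.Fubini_integral[OF i])
  also have "\<dots> = (LINT x|lborel. f x * ft s g x)"
    by (simp add: ft_def inner_commute mult.left_commute flip: integral_mult_right_zero)
  finally show ?thesis .
qed

text \<open>The convolution theorem read backwards. With a Gaussian \<open>G\<close> it expresses
  Gaussian convolutions through the transform of \<open>k\<close>; with \<open>G\<close> the kernel
  symbol it identifies the convolution in Duhamel's formula.\<close>

lemma ft_convolution:
  assumes G: "integrable lborel G" and k: "integrable lborel k"
  shows "ft s (\<lambda>\<xi>. G \<xi> * ft (-s) k \<xi>) x = (LINT y|lborel. k y * ft s G (x - y))"
proof -
  have i: "integrable (lborel \<Otimes>\<^sub>M lborel) (\<lambda>(\<xi>, y). cis (- s * (\<xi> \<bullet> (x - y))) * (G \<xi> * k y))"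
    using integrable_tensor[OF G k, of "\<lambda>z. cis (- s * (fst z \<bullet> (x - snd z)))" 1] by (simp add: split_beta)
  have c: "cis (- s * (\<xi> \<bullet> x)) * cis (s * (y \<bullet> \<xi>)) = cis (- s * (\<xi> \<bullet> (x - y)))" for \<xi> y
    by (simp add: cis_mult inner_diff_right inner_commute algebra_simps)
  have "ft s (\<lambda>\<xi>. G \<xi> * ft (-s) k \<xi>) x
      = (LINT \<xi>|lborel. LINT y|lborel. cis (- s * (\<xi> \<bullet> (x - y))) * (G \<xi> * k y))"
    unfolding c[symmetric]
    by (simp add: ft_def ac_simps flip: integral_mult_right_zero)
  also have "\<dots> = (LINT y|lborel. LINT \<xi>|lborel. cis (- s * (\<xi> \<bullet> (x - y))) * (G \<xi> * k y))"
    by (rule lborel_pair.Fubini_integral[OF i, symmetric])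
  also have "\<dots> = (LINT y|lborel. k y * ft s G (x - y))"
    by (simp add: ft_def ac_simps flip: integral_mult_right_zero)
  finally show ?thesis .
qed

section \<open>Gaussians and their transforms\<close>

definition gaussian :: "real \<Rightarrow> real^'n \<Rightarrow> complex" where
  "gaussian c x = of_real (exp (- (c * (norm x)\<^sup>2 / 2)))"

lemma measurable_gaussian [measurable]: "gaussian c \<in> borel_measurable borel"
  unfolding gaussian_def[abs_def] by measurable

text \<open>Scaling by \<open>1 / sqrt c\<close> reduces this to the characteristic function of the
  standard normal distribution.\<close>

lemma integral_gaussian_real:
  fixes c t :: real
  assumes c: "c > 0"
  shows "integrable lborel (\<lambda>x. cis (t * x) * of_real (exp (- (c * x\<^sup>2 / 2))))"
    and "(LINT x|lborel. cis (t * x) * of_real (exp (- (c * x\<^sup>2 / 2))))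
      = of_real (sqrt (2 * pi / c) * exp (- (t\<^sup>2 / (2 * c))))"
proof -
  have si: "integrable lborel (\<lambda>x. complex_of_real (std_normal_density x))"
    by (intro integrable_of_real integrable_normal_density) simp
  have std: "(LINT x|lborel. cis (r * x) * of_real (std_normal_density x)) = of_real (exp (- r\<^sup>2 / 2))" for r
  proof -
    have "char std_normal_distribution r = (LINT x|lborel. std_normal_density x *\<^sub>R iexp (r * x))"
      unfolding char_def by (subst integral_density) auto
    then show ?thesis
      by (simp add: char_std_normal_distribution cis_conv_exp scaleR_conv_of_real mult.commute)
  qed
  define f where "f = (\<lambda>x. cis (t * x) * complex_of_real (exp (- (c * x\<^sup>2 / 2))))"
  have fm[measurable]: "f \<in> borel_measurable borel" by (simp add: f_def)
  have sc: "f (0 + (1 / sqrt c) *\<^sub>R x) = sqrt (2 * pi) *\<^sub>R (cis (t / sqrt c * x) * of_real (std_normal_density x))" for x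
    using c by (simp add: f_def std_normal_density_def power_divide scaleR_conv_of_real field_simps)
  have "integrable lborel (\<lambda>x. f (0 + (1 / sqrt c) *\<^sub>R x))"
    unfolding sc by (intro integrable_scaleR_right integrable_cis_mult si) auto
  then show "integrable lborel (\<lambda>x. cis (t * x) * of_real (exp (- (c * x\<^sup>2 / 2))))"
    using c by (subst (asm) integrable_lborel_affine_iff) (auto simp: f_def)
  have "(LINT x|lborel. f x) = \<bar>1 / sqrt c\<bar> ^ DIM(real) *\<^sub>R (LINT x|lborel. f (0 + (1 / sqrt c) *\<^sub>R x))"
    by (rule integral_lborel_affine) (use c in auto)
  also have "\<dots> = \<bar>1 / sqrt c\<bar> *\<^sub>R (sqrt (2 * pi) *\<^sub>R of_real (exp (- (t / sqrt c)\<^sup>2 / 2)))"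
    unfolding sc by (subst integral_scaleR_right) (simp only: std DIM_real power_one_right)
  also have "\<dots> = of_real (sqrt (2 * pi / c) * exp (- (t\<^sup>2 / (2 * c))))"
    using c by (simp add: scaleR_conv_of_real power_divide real_sqrt_divide)
  finally show "(LINT x|lborel. cis (t * x) * of_real (exp (- (c * x\<^sup>2 / 2))))
      = of_real (sqrt (2 * pi / c) * exp (- (t\<^sup>2 / (2 * c))))"
    by (simp add: f_def)
qed

lemma cis_sum: "finite A \<Longrightarrow> cis (\<Sum>i\<in>A. f i) = (\<Prod>i\<in>A. cis (f i))"
  by (induction A rule: finite_induct) (simp_all flip: cis_mult)

lemma ft_gaussian:
  fixes \<xi> :: "real^'n"
  assumes c: "c > 0" and s: "s\<^sup>2 = 1"
  shows "integrable lborel (gaussian c :: real^'n \<Rightarrow> complex)"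
    and "ft s (gaussian c) \<xi> = of_real (sqrt (2 * pi / c) ^ CARD('n)) * gaussian (1 / c) \<xi>"
proof -
  have prodeq: "cis (- s * (x \<bullet> \<eta>)) * gaussian c x
      = (\<Prod>b\<in>Basis. cis ((- s * (\<eta> \<bullet> b)) * (x \<bullet> b)) * of_real (exp (- (c * (x \<bullet> b)\<^sup>2 / 2))))" for x \<eta> :: "real^'n"
  proof -
    have "cis (- s * (x \<bullet> \<eta>)) = (\<Prod>b\<in>Basis. cis ((- s * (\<eta> \<bullet> b)) * (x \<bullet> b)))"
      by (subst euclidean_inner) (simp add: sum_distrib_left cis_sum[symmetric] sum_negf ac_simps)
    moreover have "gaussian c x = (\<Prod>b\<in>Basis. of_real (exp (- (c * (x \<bullet> b)\<^sup>2 / 2))))"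
      unfolding gaussian_def power2_norm_eq_inner
      by (subst euclidean_inner)
        (simp add: sum_distrib_left sum_divide_distrib power2_eq_square exp_sum flip: sum_negf)
    ultimately show ?thesis by (simp add: prod.distrib)
  qed
  note i = integral_gaussian_real[OF c]
  show "integrable lborel (gaussian c :: real^'n \<Rightarrow> complex)"
  proof -
    have "gaussian c = (\<lambda>x::real^'n. \<Prod>b\<in>Basis. cis (0 * (x \<bullet> b)) * of_real (exp (- (c * (x \<bullet> b)\<^sup>2 / 2))))"
      by (rule ext) (use prodeq[of _ 0] in simp)
    then show ?thesis
      using integral_lborel_prod(1)[where 'a = "real^'n", OF i(1), of "\<lambda>b. 0"] by simp
  qed
  have "ft s (gaussian c) \<xi> = (\<Prod>b\<in>(Basis::(real^'n) set). of_real (sqrt (2 * pi / c) * exp (- ((- s * (\<xi> \<bullet> b))\<^sup>2 / (2 * c)))))"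
    unfolding ft_def prodeq by (subst integral_lborel_prod(2)[OF i(1)]) (simp only: i(2))
  also have "\<dots> = (\<Prod>b\<in>(Basis::(real^'n) set). of_real (sqrt (2 * pi / c)) * of_real (exp (- ((\<xi> \<bullet> b)\<^sup>2 / (2 * c)))))"
    using s by (simp add: power_mult_distrib)
  also have "\<dots> = of_real (sqrt (2 * pi / c) ^ CARD('n)) * of_real (\<Prod>b\<in>(Basis::(real^'n) set). exp (- ((\<xi> \<bullet> b)\<^sup>2 / (2 * c))))"
    by (simp add: prod.distrib)
  also have "(\<Prod>b\<in>(Basis::(real^'n) set). exp (- ((\<xi> \<bullet> b)\<^sup>2 / (2 * c)))) = exp (- (1 / c * (norm \<xi>)\<^sup>2 / 2))"
  proof -
    have "(norm \<xi>)\<^sup>2 = (\<Sum>b\<in>Basis. (\<xi> \<bullet> b)\<^sup>2)"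
      unfolding power2_norm_eq_inner by (subst euclidean_inner) (simp add: power2_eq_square)
    then show ?thesis
      by (simp add: sum_divide_distrib sum_distrib_left exp_sum mult.commute flip: sum_negf)
  qed
  also have "of_real (exp (- (1 / c * (norm \<xi>)\<^sup>2 / 2))) = gaussian (1 / c) \<xi>"
    by (simp add: gaussian_def)
  finally show "ft s (gaussian c) \<xi> = of_real (sqrt (2 * pi / c) ^ CARD('n)) * gaussian (1 / c) \<xi>" .
qed

lemma cmod_gaussian: "cmod (gaussian c x) = exp (- (c * (norm x)\<^sup>2 / 2))"
  by (simp add: gaussian_def)

lemma integral_gaussian:
  assumes "c > 0"
  shows "(LINT x|lborel. gaussian c (x::real^'n)) = of_real (sqrt (2 * pi / c) ^ CARD('n))"
  using ft_gaussian(2)[OF assms, of 1 "0::real^'n"] by (simp add: ft_def gaussian_def)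

lemma gaussian_minus: "gaussian c (x - y) = gaussian c (y - x)"
  by (simp add: gaussian_def norm_minus_commute)

section \<open>Injectivity of the Fourier integral\<close>

lemma set_integral_box_0_imp_AE_0:
  fixes h :: "'a::euclidean_space \<Rightarrow> complex"
  assumes h: "integrable lborel h"
    and box: "\<And>a b. (LINT x:box a b|lborel. h x) = 0"
  shows "AE x in lborel. h x = 0"
proof -
  have [measurable]: "h \<in> borel_measurable borel" using borel_measurable_integrable[OF h] by simp
  have si: "set_integrable lborel A h" if "A \<in> sets borel" for A
    using that unfolding set_integrable_def by (intro integrable_mult_indicator h) auto
  \<comment> \<open>The integral over the whole space is the limit over growing boxes, hence 0. The
    induction below needs it for complements.\<close>
  have "(\<lambda>k. LINT x|lborel. indicator (box (- (real k *\<^sub>R One)) (real k *\<^sub>R One)) x *\<^sub>R h x) \<longlonglongrightarrow> (LINT x|lborel. h x)"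
  proof (rule integral_dominated_convergence[where w = "\<lambda>x. norm (h x)"])
    show "AE x in lborel. (\<lambda>k. indicat_real (box (- (real k *\<^sub>R One)) (real k *\<^sub>R One)) x *\<^sub>R h x) \<longlonglongrightarrow> h x"
    proof (rule AE_I2)
      fix x :: 'a
      obtain k :: nat where k: "norm x < real k" using reals_Archimedean2 by blast
      have "x \<in> box (- (real j *\<^sub>R One)) (real j *\<^sub>R One)" if "j \<ge> k" for j
      proof -
        have "- real j < x \<bullet> b \<and> x \<bullet> b < real j" if "b \<in> Basis" for b
          using Basis_le_norm[OF that, of x] k \<open>j \<ge> k\<close> by linarith
        then show ?thesis by (auto simp: box_def)
      qed
      then have "\<forall>\<^sub>F j in sequentially. indicat_real (box (- (real j *\<^sub>R One)) (real j *\<^sub>R One)) x *\<^sub>R h x = h x"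
        unfolding eventually_sequentially by (intro exI[of _ k]) auto
      then show "(\<lambda>k. indicat_real (box (- (real k *\<^sub>R One)) (real k *\<^sub>R One)) x *\<^sub>R h x) \<longlonglongrightarrow> h x"
        by (rule tendsto_eventually)
    qed
  qed (use h in \<open>auto intro!: AE_I2 simp: indicator_def\<close>)
  moreover have "(LINT x|lborel. indicator (box (- (real k *\<^sub>R One)) (real k *\<^sub>R One)) x *\<^sub>R h x) = 0" for k
    using box by (simp add: set_lebesgue_integral_def)
  ultimately have tot: "(LINT x|lborel. h x) = 0" by (simp add: LIMSEQ_const_iff)
  have *: "(LINT x:A|lborel. h x) = 0" if A: "A \<in> sets borel" for A
  proof -
    \<comment> \<open>Boxes are stable under intersection and generate the Borel sets, so the
      vanishing of the integral propagates from boxes to all Borel sets by Dynkin's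
      argument.\<close>
    have mem: "A \<in> sigma_sets UNIV (range (\<lambda>(a, b). box a b))"
      using A unfolding borel_eq_box by simp
    have stable: "Int_stable (range (\<lambda>(a, b). box a b :: 'a set))"
      by (auto simp: Int_stable_def box_Int_box)
    have sub: "range (\<lambda>(a, b). box a b :: 'a set) \<subseteq> Pow UNIV" by simp
    show ?thesis
      using stable sub mem
    proof (induction rule: sigma_sets_induct_disjoint)
      case (basic A)
      then show ?case using box by auto
    next
      case empty
      then show ?case by (simp add: set_lebesgue_integral_def)
    next
      case (compl A)
      then have A: "A \<in> sets borel" by (simp add: borel_eq_box)
      have "(LINT x:A \<union> (UNIV - A)|lborel. h x) = (LINT x:A|lborel. h x) + (LINT x:UNIV - A|lborel. h x)"
        using A by (intro set_integral_Un si) auto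
      then show ?case using compl tot by (simp add: set_lebesgue_integral_def)
    next
      case (union A)
      have A: "A i \<in> sets borel" for i
        using union(2) by (auto simp: borel_eq_box)
      have "(LINT x:(\<Union>i. A i)|lborel. h x) = (\<Sum>i. (LINT x:(A i)|lborel. h x))"
        using union(1) A by (intro lebesgue_integral_countable_add si) (auto simp: disjoint_family_on_def)
      then show ?case using union by simp
    qed
  qed
  have "AE x in lborel. Re (h x) = 0"
  proof (rule density_unique_real)
    show "(LINT x:A|lborel. Re (h x)) = (LINT x:A|lborel. 0)" if "A \<in> sets lborel" for A
      using arg_cong[OF *, of A Re] that si[of A]
      by (simp add: set_lebesgue_integral_def set_integrable_def flip: integral_Re)
  qed (use h in auto)
  moreover have "AE x in lborel. Im (h x) = 0"
  proof (rule density_unique_real)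
    show "(LINT x:A|lborel. Im (h x)) = (LINT x:A|lborel. 0)" if "A \<in> sets lborel" for A
      using arg_cong[OF *, of A Im] that si[of A]
      by (simp add: set_lebesgue_integral_def set_integrable_def flip: integral_Im)
  qed (use h in auto)
  ultimately show ?thesis by eventually_elim (simp add: complex_eq_iff)
qed

text \<open>The exceptional set is the boundary of the box. It must not depend on the sequence
  \<open>w\<close>, because \<open>w\<close> will contain a second integration variable.\<close>

lemma AE_indicator_box_tendsto:
  fixes a b :: "'a::euclidean_space"
  shows "AE y in lborel. \<forall>w. (w :: nat \<Rightarrow> 'a) \<longlonglongrightarrow> 0 \<longrightarrow>
    (\<lambda>k. indicator (box a b) (y + w k) :: real) \<longlonglongrightarrow> indicator (box a b) y"
proof -
  have "cbox a b - box a b \<in> null_sets lborel"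
    using negligible_frontier_interval[of a b]
    by (auto simp: negligible_iff_null_sets null_sets_def emeasure_completion)
  then have "AE y in lborel. y \<notin> cbox a b - box a b" by (rule AE_not_in)
  then show ?thesis
  proof eventually_elim
    case (elim y)
    show ?case
    proof (intro allI impI)
      fix w :: "nat \<Rightarrow> 'a" assume "w \<longlonglongrightarrow> 0"
      then have w: "(\<lambda>k. y + w k) \<longlonglongrightarrow> y" using tendsto_add[OF tendsto_const] by fastforce
      show "(\<lambda>k. indicator (box a b) (y + w k) :: real) \<longlonglongrightarrow> indicator (box a b) y"
      proof (cases "y \<in> box a b")
        case True
        then have "\<forall>\<^sub>F k in sequentially. y + w k \<in> box a b"
          using w open_box topological_tendstoD by blast
        then show ?thesis by (rule tendsto_eventually[OF eventually_mono]) (simp add: True)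
      next
        case False
        then have "y \<in> - cbox a b" using elim by auto
        then have "\<forall>\<^sub>F k in sequentially. y + w k \<in> - cbox a b"
          using w closed_cbox topological_tendstoD by blast
        then show ?thesis
          by (rule tendsto_eventually[OF eventually_mono]) (use False box_subset_cbox[of a b] in \<open>auto simp: indicator_def\<close>)
      qed
    qed
  qed
qed

text \<open>If \<open>ft s h = 0\<close>, then all convolutions of \<open>h\<close> with Gaussians vanish. Integrating them over a box
  and letting the width tend to zero shows that \<open>h\<close> has integral zero over every box.\<close>

lemma ft_eq_0_imp_AE_0:
  fixes h :: "real^'n::finite \<Rightarrow> complex"
  assumes h: "integrable lborel h" and s: "s\<^sup>2 = 1" and zero: "\<And>\<xi>. ft s h \<xi> = 0"
  shows "AE x in lborel. h x = 0"
proof (rule set_integral_box_0_imp_AE_0[OF h])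
  fix a b :: "real^'n"
  let ?B = "\<lambda>x. complex_of_real (indicator (box a b) x)"
  have [measurable]: "h \<in> borel_measurable borel" using borel_measurable_integrable[OF h] by simp
  note gi = ft_gaussian(1)[OF _ s]
  \<comment> \<open>\<open>gaussian c\<close> is a multiple of the transform of
    \<open>gaussian (1/c)\<close>, so \<open>ft_convolution\<close> writes this convolution as a
    transform of a product that contains the factor \<open>ft s h\<close>.\<close>
  have conv: "(LINT y|lborel. h y * gaussian c (x - y)) = 0" if c: "c > 0" for x c
  proof -
    have e: "h y * ft (-s) (gaussian (1/c)) (x - y)
        = of_real (sqrt (2 * pi * c) ^ CARD('n)) * (h y * gaussian c (x - y))" for y
      by (subst ft_gaussian(2)) (use c s in auto)
    have "(LINT y|lborel. h y * ft (-s) (gaussian (1/c)) (x - y)) = 0"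
      using ft_convolution[OF gi h, of "1/c" "-s" x] c zero by (simp add: ft_def)
    then show ?thesis
      unfolding e integral_mult_right_zero using c by simp
  qed
  have Bi: "integrable lborel ?B"
    by (intro integrable_of_real integrable_real_indicator) (auto simp: emeasure_lborel_box_eq)
  define I where "I = (LINT z|lborel. gaussian 1 (z::real^'n))"
  have I0: "I \<noteq> 0" by (simp add: I_def integral_gaussian)
  define \<Psi> where "\<Psi> k y = (LINT z|lborel. ?B (y + (1 / real (Suc k)) *\<^sub>R z) * gaussian 1 z)" for k y
  have \<Psi>m [measurable]: "\<Psi> k \<in> borel_measurable borel" for k
    unfolding \<Psi>_def[abs_def] by (rule lborel.borel_measurable_lebesgue_integral) measurable
  have h\<Psi>: "(LINT y|lborel. h y * \<Psi> k y) = 0" for k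
  proof -
    \<comment> \<open>A Gaussian of width \<open>1 / real (Suc k)\<close>: the substitution by this
      scale turns it into the fixed \<open>gaussian 1\<close> and moves the scale into the
      indicator, where the limit can be taken.\<close>
    define c where "c = (real (Suc k))\<^sup>2"
    have c: "c > 0" by (simp add: c_def)
    have le: "cmod (gaussian c z) \<le> 1" for z :: "real^'n"
      using c by (simp add: cmod_gaussian)
    have "(LINT y|lborel. LINT x|lborel. gaussian c (x - y) * (h y * ?B x))
        = (LINT x|lborel. LINT y|lborel. gaussian c (x - y) * (h y * ?B x))"
      by (rule lborel_pair.Fubini_integral[symmetric])
        (use integrable_tensor[OF h Bi, of "\<lambda>z. gaussian c (snd z - fst z)" 1] le
         in \<open>simp add: split_beta\<close>)
    also have "\<dots> = 0"
    proof -
      have "gaussian c (x - y) * (h y * ?B x) = ?B x * (h y * gaussian c (x - y))" for x y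
        by (simp only: mult.commute mult.left_commute)
      then show ?thesis by (simp only: integral_mult_right_zero conv[OF c] mult_zero_right integral_zero)
    qed
    finally have z: "(LINT y|lborel. LINT x|lborel. gaussian c (x - y) * (h y * ?B x)) = 0" .
    have e: "(LINT x|lborel. gaussian c (x - y) * (h y * ?B x)) = (1 / real (Suc k)) ^ CARD('n) *\<^sub>R (h y * \<Psi> k y)" for y
    proof -
      have "(LINT x|lborel. gaussian c (x - y) * (h y * ?B x))
         = \<bar>1 / real (Suc k)\<bar> ^ DIM(real^'n) *\<^sub>R (LINT z|lborel. gaussian c ((y + (1 / real (Suc k)) *\<^sub>R z) - y) * (h y * ?B (y + (1 / real (Suc k)) *\<^sub>R z)))"
        by (rule integral_lborel_affine) simp_all
      also have "(LINT z|lborel. gaussian c ((y + (1 / real (Suc k)) *\<^sub>R z) - y) * (h y * ?B (y + (1 / real (Suc k)) *\<^sub>R z)))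
          = h y * \<Psi> k y"
        unfolding \<Psi>_def integral_mult_right_zero[symmetric]
      proof (rule Bochner_Integration.integral_cong[OF refl])
        fix z
        have "gaussian c ((y + (1 / real (Suc k)) *\<^sub>R z) - y) = gaussian 1 z"
          by (simp add: gaussian_def c_def power_divide power_mult_distrib del: of_nat_Suc)
        then show "gaussian c ((y + (1 / real (Suc k)) *\<^sub>R z) - y) * (h y * ?B (y + (1 / real (Suc k)) *\<^sub>R z))
            = h y * (?B (y + (1 / real (Suc k)) *\<^sub>R z) * gaussian 1 z)"
          by (simp only: mult.commute mult.left_commute)
      qed
      finally show ?thesis by simp
    qed
    show ?thesis using z unfolding e integral_scaleR_right by simp
  qed
  have \<Psi>lim: "AE y in lborel. (\<lambda>k. \<Psi> k y) \<longlonglongrightarrow> ?B y * I"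
    using AE_indicator_box_tendsto[of a b]
  proof eventually_elim
    case (elim y)
    have "(\<lambda>k. \<Psi> k y) \<longlonglongrightarrow> (LINT z|lborel. ?B y * gaussian 1 (z::real^'n))"
      unfolding \<Psi>_def
    proof (rule integral_dominated_convergence[where w = "\<lambda>z::real^'n. norm (gaussian 1 z)"])
      show "AE z in lborel. (\<lambda>k. ?B (y + (1 / real (Suc k)) *\<^sub>R z) * gaussian 1 z) \<longlonglongrightarrow> ?B y * gaussian 1 z"
      proof (rule AE_I2)
        fix z :: "real^'n"
        have "(\<lambda>k. 1 / real (Suc k)) \<longlonglongrightarrow> 0"
          using LIMSEQ_inverse_real_of_nat by (simp add: inverse_eq_divide)
        from tendsto_scaleR[OF this tendsto_const, of z]
        have "(\<lambda>k. (1 / real (Suc k)) *\<^sub>R z) \<longlonglongrightarrow> 0" by simp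
        with elim have "(\<lambda>k. indicator (box a b) (y + (1 / real (Suc k)) *\<^sub>R z) :: real) \<longlonglongrightarrow> indicator (box a b) y"
          by blast
        then show "(\<lambda>k. ?B (y + (1 / real (Suc k)) *\<^sub>R z) * gaussian 1 z) \<longlonglongrightarrow> ?B y * gaussian 1 z"
          by (intro tendsto_mult tendsto_of_real tendsto_const)
      qed
    qed (use gi[of 1] in \<open>auto intro!: AE_I2 simp: indicator_def\<close>)
    then show ?case by (simp add: I_def)
  qed
  have "(\<lambda>k. LINT y|lborel. h y * \<Psi> k y) \<longlonglongrightarrow> (LINT y|lborel. h y * (?B y * I))"
  proof (rule integral_dominated_convergence[where w = "\<lambda>y. norm (h y) * L1norm (gaussian 1 :: real^'n \<Rightarrow> complex)"])
    show "AE y in lborel. (\<lambda>k. h y * \<Psi> k y) \<longlonglongrightarrow> h y * (?B y * I)"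
      using \<Psi>lim by eventually_elim (intro tendsto_intros)
    show "AE y in lborel. norm (h y * \<Psi> k y) \<le> norm (h y) * L1norm (gaussian 1 :: real^'n \<Rightarrow> complex)" for k
    proof (rule AE_I2)
      fix y
      have "norm (\<Psi> k y) \<le> (LINT z|lborel. norm (?B (y + (1 / real (Suc k)) *\<^sub>R z) * gaussian 1 z))"
        unfolding \<Psi>_def by (rule integral_norm_bound)
      also have "\<dots> \<le> L1norm (gaussian 1 :: real^'n \<Rightarrow> complex)"
        unfolding L1norm_def
      proof (rule integral_mono')
        show "integrable lborel (\<lambda>x. cmod (gaussian 1 (x::real^'n)))" using gi[of 1] by auto
      qed (auto simp: indicator_def)
      finally show "norm (h y * \<Psi> k y) \<le> norm (h y) * L1norm (gaussian 1 :: real^'n \<Rightarrow> complex)"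
        by (simp add: norm_mult mult_left_mono)
    qed
  qed (use h in auto)
  then have "(LINT y|lborel. h y * (?B y * I)) = 0"
    unfolding h\<Psi> by (simp only: LIMSEQ_const_iff)
  then have "(LINT y|lborel. h y * ?B y) * I = 0"
    unfolding mult.assoc[symmetric] integral_mult_left_zero .
  then show "(LINT x:box a b|lborel. h x) = 0"
    using I0 by (simp add: set_lebesgue_integral_def scaleR_conv_of_real mult.commute)
qed

section \<open>The L2 bound for the Fourier integral\<close>

lemma norm_integral_le_nn_integral:
  "ennreal (norm (integral\<^sup>L M f)) \<le> (\<integral>\<^sup>+x. ennreal (norm (f x)) \<partial>M)"
  \<comment> \<open>A non-integrable function has integral 0 by convention, so the bound can be used
    before integrability is known.\<close>
  by (cases "integrable M f") (auto intro: integral_norm_bound_ennreal simp: not_integrable_integral_eq)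

text \<open>The value does not depend on \<open>c\<close>: this is what keeps the L2 bound uniform
  when \<open>c\<close> tends to 0.\<close>

lemma nn_integral_gaussian_shift:
  assumes c: "c > 0"
  shows "(\<integral>\<^sup>+y. ennreal (sqrt (2 * pi / c) ^ CARD('n) * cmod (gaussian (1 / c) (x - (y::real^'n)))) \<partial>lborel)
    = ennreal ((2 * pi) ^ CARD('n))"
proof -
  let ?A = "sqrt (2 * pi / c) ^ CARD('n)"
  have i: "integrable lborel (\<lambda>y::real^'n. ?A * cmod (gaussian (1 / c) y))"
    using ft_gaussian(1)[of "1/c" 1, where 'n = 'n] c by auto
  have "complex_of_real (LINT y|lborel. ?A * cmod (gaussian (1 / c) (y::real^'n)))
      = (LINT y|lborel. of_real ?A * gaussian (1 / c) (y::real^'n))"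
    by (subst integral_complex_of_real[symmetric]) (simp add: gaussian_def)
  also have "\<dots> = of_real (?A * sqrt (2 * pi * c) ^ CARD('n))"
    using integral_gaussian[of "1/c", where 'n = 'n] c by simp
  also have "?A * sqrt (2 * pi * c) ^ CARD('n) = (2 * pi) ^ CARD('n)"
  proof -
    have "sqrt (2 * pi / c) * sqrt (2 * pi * c) = sqrt ((2 * pi)\<^sup>2)"
      unfolding real_sqrt_mult[symmetric] using c by (simp add: power2_eq_square)
    then show ?thesis unfolding power_mult_distrib[symmetric] by (simp only: real_sqrt_abs) simp
  qed
  finally have v: "(LINT y|lborel. ?A * cmod (gaussian (1 / c) (y::real^'n))) = (2 * pi) ^ CARD('n)"
    using of_real_eq_iff by blast
  have "(\<integral>\<^sup>+y. ennreal (?A * cmod (gaussian (1 / c) (x - (y::real^'n)))) \<partial>lborel)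
      = (\<integral>\<^sup>+y. ennreal (?A * cmod (gaussian (1 / c) (y::real^'n))) \<partial>lborel)"
    using nn_integral_lborel_affine[of "\<lambda>y::real^'n. ennreal (?A * cmod (gaussian (1 / c) y))" "-1" x]
    by simp
  also have "\<dots> = ennreal ((2 * pi) ^ CARD('n))"
    unfolding v[symmetric] using c by (intro nn_integral_eq_integral i) auto
  finally show ?thesis .
qed

text \<open>Integrated against a Gaussian, \<open>\<bar>ft s f\<bar>\<^sup>2\<close> becomes a quadratic form in \<open>f\<close> with a Gaussian kernel of
  fixed mass; the bound survives as the Gaussian tends to \<open>1\<close> by Fatou's lemma.\<close>

lemma ft_L2_bound:
  fixes f :: "real^'n::finite \<Rightarrow> complex"
  assumes f: "integrable lborel f" and f2: "square_integrable f" and s: "s\<^sup>2 = 1"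
  shows "square_integrable (ft s f)"
    and "L2norm (ft s f) \<le> sqrt (2 * (2 * pi) ^ CARD('n)) * L2norm f"
proof -
  have [measurable]: "f \<in> borel_measurable borel" using borel_measurable_integrable[OF f] by simp
  define J where "J = (2 * pi) ^ CARD('n)"
  have J: "J \<ge> 0" by (simp add: J_def)
  \<comment> \<open>The parameter is \<open>c / 2\<close> because
    \<open>(cmod (u c \<xi>))\<^sup>2\<close> then carries the factor
    \<open>gaussian c \<xi>\<close>.\<close>
  define u where "u c \<xi> = gaussian (c / 2) \<xi> * ft s f \<xi>" for c \<xi>
  have um [measurable]: "u c \<in> borel_measurable borel" for c
    unfolding u_def[abs_def] by measurable
  have u: "square_integrable (u c)" "L2norm (u c) \<le> sqrt (2 * J) * L2norm f" if c: "c > 0" for c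
  proof -
    let ?k = "\<lambda>x. cnj (f x)"
    let ?\<Gamma> = "\<lambda>x y. sqrt (2 * pi / c) ^ CARD('n) * cmod (gaussian (1 / c) (x - (y::real^'n)))"
    have k: "integrable lborel ?k" using f by simp
    have [measurable]: "?k \<in> borel_measurable borel" using borel_measurable_integrable[OF k] by simp
    have gi: "integrable lborel (gaussian c :: real^'n \<Rightarrow> complex)" by (rule ft_gaussian(1)[OF c s])
    have Gi: "integrable lborel (\<lambda>\<xi>. gaussian c \<xi> * ft (-s) ?k \<xi>)"
    proof (rule Bochner_Integration.integrable_bound)
      show "integrable lborel (\<lambda>\<xi>::real^'n. of_real (L1norm f) * gaussian c \<xi>)" using gi by simp
      show "AE \<xi> in lborel. norm (gaussian c \<xi> * ft (-s) ?k \<xi>) \<le> norm (of_real (L1norm f) * gaussian c \<xi>)"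
        using cmod_ft_le[of s f] by (auto simp: norm_mult mult.commute[of "L1norm f"] cnj_ft[symmetric] intro!: mult_left_mono)
    qed measurable
    have sq: "complex_of_real ((cmod (u c \<xi>))\<^sup>2) = ft s f \<xi> * (gaussian c \<xi> * ft (-s) ?k \<xi>)" for \<xi>
    proof -
      have "complex_of_real ((cmod (u c \<xi>))\<^sup>2) = (gaussian (c/2) \<xi>)\<^sup>2 * (ft s f \<xi> * cnj (ft s f \<xi>))"
        unfolding u_def complex_norm_square by (simp add: gaussian_def power2_eq_square)
      also have "(gaussian (c/2) \<xi>)\<^sup>2 = gaussian c \<xi>"
        by (simp add: gaussian_def power2_eq_square flip: of_real_mult exp_add)
      finally show ?thesis by (simp add: cnj_ft)
    qed
    have "integrable lborel (\<lambda>\<xi>. complex_of_real ((cmod (u c \<xi>))\<^sup>2))"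
      unfolding sq
    proof (rule Bochner_Integration.integrable_bound)
      show "integrable lborel (\<lambda>\<xi>. of_real (L1norm f) * (gaussian c \<xi> * ft (-s) ?k \<xi>))" using Gi by simp
      show "AE \<xi> in lborel. norm (ft s f \<xi> * (gaussian c \<xi> * ft (-s) ?k \<xi>)) \<le> norm (of_real (L1norm f) * (gaussian c \<xi> * ft (-s) ?k \<xi>))"
        using cmod_ft_le[of s f] by (auto simp: norm_mult intro!: mult_right_mono)
    qed measurable
    then have i: "integrable lborel (\<lambda>\<xi>. (cmod (u c \<xi>))\<^sup>2)"
      by (simp only: complex_of_real_integrable_eq)
    have "complex_of_real (LINT \<xi>|lborel. (cmod (u c \<xi>))\<^sup>2)
        = (LINT \<xi>|lborel. ft s f \<xi> * (gaussian c \<xi> * ft (-s) ?k \<xi>))"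
      unfolding sq[symmetric] by (rule integral_complex_of_real[symmetric])
    also have "\<dots> = (LINT x|lborel. f x * (LINT y|lborel. ?k y * ft s (gaussian c) (x - y)))"
      unfolding ft_swap[OF f Gi] ft_convolution[OF gi k] ..
    finally have "cmod (complex_of_real (LINT \<xi>|lborel. (cmod (u c \<xi>))\<^sup>2))
        = cmod (LINT x|lborel. f x * (LINT y|lborel. ?k y * ft s (gaussian c) (x - y)))" by simp
    then have "ennreal (LINT \<xi>|lborel. (cmod (u c \<xi>))\<^sup>2)
        \<le> (\<integral>\<^sup>+x. ennreal (cmod (f x * (LINT y|lborel. ?k y * ft s (gaussian c) (x - y)))) \<partial>lborel)"
      using norm_integral_le_nn_integral[of lborel "\<lambda>x. f x * (LINT y|lborel. ?k y * ft s (gaussian c) (x - y))"]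
      by simp
    also have "\<dots> \<le> (\<integral>\<^sup>+x. \<integral>\<^sup>+y. ennreal (cmod (f x) * (cmod (f y) * ?\<Gamma> x y)) \<partial>lborel \<partial>lborel)"
    proof (rule nn_integral_mono)
      fix x
      have "ennreal (cmod (LINT y|lborel. ?k y * ft s (gaussian c) (x - y)))
          \<le> (\<integral>\<^sup>+y. ennreal (cmod (?k y * ft s (gaussian c) (x - y))) \<partial>lborel)"
        by (rule norm_integral_le_nn_integral)
      also have "\<dots> = (\<integral>\<^sup>+y. ennreal (cmod (f y) * ?\<Gamma> x y) \<partial>lborel)"
        using c by (subst ft_gaussian(2)[OF c s]) (simp add: norm_mult norm_power)
      finally have "ennreal (cmod (f x)) * ennreal (cmod (LINT y|lborel. ?k y * ft s (gaussian c) (x - y)))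
          \<le> ennreal (cmod (f x)) * (\<integral>\<^sup>+y. ennreal (cmod (f y) * ?\<Gamma> x y) \<partial>lborel)"
        by (rule mult_left_mono) simp
      then show "ennreal (cmod (f x * (LINT y|lborel. ?k y * ft s (gaussian c) (x - y))))
          \<le> (\<integral>\<^sup>+y. ennreal (cmod (f x) * (cmod (f y) * ?\<Gamma> x y)) \<partial>lborel)"
        by (simp add: norm_mult ennreal_mult' nn_integral_cmult)
    qed
    \<comment> \<open>The bound of a product by the sum of the squares splits the quadratic form
      into two equal parts, each the fixed mass times the squared norm of \<open>f\<close>. The lost
      factor is recovered in \<open>Plancherel\<close>, so this constant need not be sharp.\<close>
    also have "\<dots> \<le> (\<integral>\<^sup>+x. \<integral>\<^sup>+y. (ennreal ((cmod (f x))\<^sup>2) * ennreal (?\<Gamma> x y) + ennreal ((cmod (f y))\<^sup>2) * ennreal (?\<Gamma> x y)) \<partial>lborel \<partial>lborel)"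
    proof (intro nn_integral_mono)
      fix x y
      have "2 * (cmod (f x) * cmod (f y)) \<le> (cmod (f x))\<^sup>2 + (cmod (f y))\<^sup>2"
        using zero_le_power2[of "cmod (f x) - cmod (f y)"]
        by (simp add: power2_eq_square algebra_simps)
      moreover have "0 \<le> cmod (f x) * cmod (f y)" by simp
      ultimately have "cmod (f x) * cmod (f y) \<le> (cmod (f x))\<^sup>2 + (cmod (f y))\<^sup>2" by linarith
      moreover have "0 \<le> ?\<Gamma> x y" using c by simp
      ultimately have "cmod (f x) * cmod (f y) * ?\<Gamma> x y \<le> ((cmod (f x))\<^sup>2 + (cmod (f y))\<^sup>2) * ?\<Gamma> x y"
        by (rule mult_right_mono)
      then show "ennreal (cmod (f x) * (cmod (f y) * ?\<Gamma> x y))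
          \<le> ennreal ((cmod (f x))\<^sup>2) * ennreal (?\<Gamma> x y) + ennreal ((cmod (f y))\<^sup>2) * ennreal (?\<Gamma> x y)"
        using c by (simp add: ennreal_mult[symmetric] ennreal_plus[symmetric] distrib_right mult.assoc del: ennreal_plus)
    qed
    also have "\<dots> = (\<integral>\<^sup>+x. \<integral>\<^sup>+y. ennreal ((cmod (f x))\<^sup>2) * ennreal (?\<Gamma> x y) \<partial>lborel \<partial>lborel)
        + (\<integral>\<^sup>+x. \<integral>\<^sup>+y. ennreal ((cmod (f y))\<^sup>2) * ennreal (?\<Gamma> x y) \<partial>lborel \<partial>lborel)"
      by (simp add: nn_integral_add)
    also have "(\<integral>\<^sup>+x. \<integral>\<^sup>+y. ennreal ((cmod (f y))\<^sup>2) * ennreal (?\<Gamma> x y) \<partial>lborel \<partial>lborel)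
        = (\<integral>\<^sup>+y. \<integral>\<^sup>+x. ennreal ((cmod (f y))\<^sup>2) * ennreal (?\<Gamma> x y) \<partial>lborel \<partial>lborel)"
      by (rule lborel_pair.Fubini') measurable
    also have "\<dots> = (\<integral>\<^sup>+y. ennreal ((cmod (f y))\<^sup>2) * ennreal J \<partial>lborel)"
      by (subst nn_integral_cmult)
        (simp_all add: J_def nn_integral_gaussian_shift[OF c] gaussian_minus[of _ _ "y" for y])
    also have "(\<integral>\<^sup>+x. \<integral>\<^sup>+y. ennreal ((cmod (f x))\<^sup>2) * ennreal (?\<Gamma> x y) \<partial>lborel \<partial>lborel)
        = (\<integral>\<^sup>+x. ennreal ((cmod (f x))\<^sup>2) * ennreal J \<partial>lborel)"
      by (subst nn_integral_cmult) (simp_all add: J_def nn_integral_gaussian_shift[OF c])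
    also have "(\<integral>\<^sup>+x. ennreal ((cmod (f x))\<^sup>2) * ennreal J \<partial>lborel) = ennreal ((L2norm f)\<^sup>2) * ennreal J"
      by (simp add: nn_integral_multc nn_integral_L2norm[OF f2])
    also have "ennreal ((L2norm f)\<^sup>2) * ennreal J + ennreal ((L2norm f)\<^sup>2) * ennreal J = ennreal (2 * J * (L2norm f)\<^sup>2)"
      using J by (simp add: ennreal_mult[symmetric] ennreal_plus[symmetric] del: ennreal_plus)
    finally have "(L2norm (u c))\<^sup>2 \<le> 2 * J * (L2norm f)\<^sup>2"
      using J by (simp add: L2norm_power2)
    then have "sqrt ((L2norm (u c))\<^sup>2) \<le> sqrt (2 * J * (L2norm f)\<^sup>2)" by (rule real_sqrt_le_mono)
    then show "L2norm (u c) \<le> sqrt (2 * J) * L2norm f" by (simp add: real_sqrt_mult)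
    show "square_integrable (u c)" using i by (simp add: square_integrable_def)
  qed
  have lim: "(\<lambda>k. u (1 / real (Suc k)) \<xi>) \<longlonglongrightarrow> ft s f \<xi>" for \<xi>
  proof -
    have "(\<lambda>k. 1 / real (Suc k)) \<longlonglongrightarrow> 0"
      using LIMSEQ_inverse_real_of_nat by (simp add: inverse_eq_divide)
    then have "(\<lambda>k. u (1 / real (Suc k)) \<xi>) \<longlonglongrightarrow> complex_of_real (exp (- (0 / 2 * (norm \<xi>)\<^sup>2 / 2))) * ft s f \<xi>"
      unfolding u_def gaussian_def by (intro tendsto_intros) auto
    then show ?thesis by simp
  qed
  show "square_integrable (ft s f)" "L2norm (ft s f) \<le> sqrt (2 * (2 * pi) ^ CARD('n)) * L2norm f"
    unfolding J_def[symmetric]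
    using L2norm_limit_le[of "\<lambda>k. u (1 / real (Suc k))" "ft s f" "sqrt (2 * J) * L2norm f"] u lim J
    by auto
qed

section \<open>The Fourier transform on L2\<close>

lemma square_integrable_cnj: "square_integrable f \<Longrightarrow> square_integrable (\<lambda>x. cnj (f x))"
  by (auto simp: square_integrable_def intro: borel_measurable_continuous_on[of cnj] continuous_intros)

lemma square_integrable_times_const: "square_integrable f \<Longrightarrow> square_integrable (\<lambda>x. c * f x)"
  by (rule square_integrable_symbol[where m = "\<lambda>_. c" and B = "cmod c"])
    (auto simp: bounded_symbol_def)

text \<open>Since \<open>l2\<close> is a real inner product space, complex identities are obtained
  from this one by varying a complex factor.\<close>

lemma inner_abs_l2_Re:
  assumes f: "square_integrable f" and g: "square_integrable g"
  shows "abs_l2 f \<bullet> abs_l2 g = Re (LINT x|lborel. f x * cnj (g x))"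
proof -
  have "f x \<bullet> g x = Re (f x * cnj (g x))" for x by (simp add: inner_complex_def)
  then have "abs_l2 f \<bullet> abs_l2 g = (LINT x|lborel. Re (f x * cnj (g x)))"
    by (simp only: inner_abs_l2[OF f g])
  also have "\<dots> = Re (LINT x|lborel. f x * cnj (g x))"
    by (intro integral_Re square_integrable_prod_integrable f square_integrable_cnj g)
  finally show ?thesis .
qed

section \<open>Extension to L2 by truncation in space\<close>

definition trunc :: "nat \<Rightarrow> (real^'n \<Rightarrow> complex) \<Rightarrow> real^'n \<Rightarrow> complex" where
  "trunc k f x = indicator (cball 0 (real k)) x * f x"

lemma bounded_symbol_indicator: "A \<in> sets borel \<Longrightarrow> bounded_symbol 1 (indicator A)"
  unfolding bounded_symbol_def by (auto intro!: borel_measurable_indicator simp: indicator_def)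

lemma square_integrable_indicator_bounded:
  fixes A :: "(real^'n::finite) set"
  assumes A: "A \<in> sets borel" "bounded A"
  shows "square_integrable (indicator A)"
  unfolding square_integrable_def
proof
  have "emeasure lborel A < \<infinity>" by (rule emeasure_bounded_finite[OF A(2)])
  then have "integrable lborel (indicator A :: real^'n \<Rightarrow> real)"
    using A by (intro integrable_real_indicator) auto
  then show "integrable lborel (\<lambda>x::real^'n. (cmod (indicator A x))\<^sup>2)"
    by (rule Bochner_Integration.integrable_cong[THEN iffD1, rotated -1]) (auto simp: indicator_def)
qed (use A in \<open>auto intro!: borel_measurable_indicator\<close>)

lemma square_integrable_trunc: "square_integrable f \<Longrightarrow> square_integrable (trunc k f)"
  unfolding trunc_def[abs_def] by (rule square_integrable_symbol[OF bounded_symbol_indicator]) auto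

lemma integrable_trunc: "square_integrable f \<Longrightarrow> integrable lborel (trunc k (f :: real^'n::finite \<Rightarrow> complex))"
  unfolding trunc_def[abs_def]
  by (rule square_integrable_prod_integrable[OF square_integrable_indicator_bounded]) auto

lemma trunc_tendsto: "(\<lambda>k. abs_l2 (trunc k (rep_l2 f))) \<longlonglongrightarrow> (f :: ('n::finite) l2)"
proof -
  have "(\<lambda>k. symbol_mult (indicator (cball 0 (real k))) f) \<longlonglongrightarrow> symbol_mult (\<lambda>_. 1) f"
  proof (rule symbol_mult_tendsto[where B = 1])
    fix \<xi> :: "real^'n"
    obtain k :: nat where k: "norm \<xi> \<le> real k" using real_arch_simple by blast
    then have "\<forall>\<^sub>F j in sequentially. (indicator (cball 0 (real j)) \<xi> :: complex) = 1"
      unfolding eventually_sequentially by (intro exI[of _ k]) auto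
    then show "(\<lambda>k. indicator (cball 0 (real k)) \<xi> :: complex) \<longlonglongrightarrow> 1" by (rule tendsto_eventually)
  qed (auto intro!: bounded_symbol_indicator simp: bounded_symbol_def[of _ "\<lambda>_. 1"])
  then show ?thesis by (simp add: symbol_mult_1 symbol_mult_def[of "indicator _"] trunc_def[abs_def])
qed

lemma norm_ft_diff_le:
  fixes f g :: "real^'n::finite \<Rightarrow> complex"
  assumes f: "integrable lborel f" "square_integrable f" and g: "integrable lborel g" "square_integrable g"
    and s: "s\<^sup>2 = 1"
  shows "norm (abs_l2 (ft s f) - abs_l2 (ft s g)) \<le> sqrt (2 * (2 * pi) ^ CARD('n)) * norm (abs_l2 f - abs_l2 g)"
proof -
  have d: "integrable lborel (\<lambda>x. f x - g x)" "square_integrable (\<lambda>x. f x - g x)"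
    using f g by (auto intro: square_integrable_diff)
  have e: "(\<lambda>x. ft s f x - ft s g x) = ft s (\<lambda>x. f x - g x)"
    by (rule ext) (simp add: ft_diff[OF f(1) g(1)])
  have "abs_l2 (ft s f) - abs_l2 (ft s g) = abs_l2 (ft s (\<lambda>x. f x - g x))"
    unfolding e[symmetric] by (intro abs_l2_diff ft_L2_bound f g s)
  moreover have "abs_l2 f - abs_l2 g = abs_l2 (\<lambda>x. f x - g x)"
    by (intro abs_l2_diff f g)
  ultimately show ?thesis
    using ft_L2_bound[OF d s] by (simp add: norm_abs_l2 d)
qed

text \<open>A limit along one explicit sequence, so that no choice is involved.
  \<open>ft_L2_bound\<close> makes the sequence Cauchy, and it also shows that on functions in both
  L1 and L2 the result is the Fourier integral.\<close>

definition FT :: "real \<Rightarrow> ('n::finite) l2 \<Rightarrow> 'n l2" where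
  "FT s f = lim (\<lambda>k. abs_l2 (ft s (trunc k (rep_l2 f))))"

lemma FT_tendsto:
  fixes f :: "('n::finite) l2"
  assumes s: "s\<^sup>2 = 1"
  shows "(\<lambda>k. abs_l2 (ft s (trunc k (rep_l2 f)))) \<longlonglongrightarrow> FT s f"
proof -
  let ?X = "\<lambda>k. abs_l2 (trunc k (rep_l2 f))" and ?Y = "\<lambda>k. abs_l2 (ft s (trunc k (rep_l2 f)))"
  let ?C = "sqrt (2 * (2 * pi) ^ CARD('n))"
  have C: "?C > 0" by simp
  have le: "norm (?Y m - ?Y k) \<le> ?C * norm (?X m - ?X k)" for m k
    by (intro norm_ft_diff_le s integrable_trunc square_integrable_trunc) simp_all
  have X: "Cauchy ?X" using trunc_tendsto LIMSEQ_imp_Cauchy by blast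
  have "Cauchy ?Y"
  proof (rule CauchyI)
    fix e :: real assume "e > 0"
    then have "e / ?C > 0" using C by simp
    then obtain M where M: "\<And>m k. m \<ge> M \<Longrightarrow> k \<ge> M \<Longrightarrow> norm (?X m - ?X k) < e / ?C"
      using X unfolding Cauchy_iff by meson
    have "norm (?Y m - ?Y k) < e" if "m \<ge> M" "k \<ge> M" for m k
    proof -
      have "?C * norm (?X m - ?X k) < e"
        using M[OF that] C by (simp add: pos_less_divide_eq mult.commute)
      then show ?thesis using le[of m k] by linarith
    qed
    then show "\<exists>M. \<forall>m\<ge>M. \<forall>k\<ge>M. norm (?Y m - ?Y k) < e" by blast
  qed
  then have "convergent ?Y" by (rule Cauchy_convergent)
  then show ?thesis unfolding FT_def by (simp add: convergent_LIMSEQ_iff)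
qed

lemma FT_abs_l2:
  fixes f :: "real^'n::finite \<Rightarrow> complex"
  assumes f: "integrable lborel f" "square_integrable f" and s: "s\<^sup>2 = 1"
  shows "FT s (abs_l2 f) = abs_l2 (ft s f)"
proof (rule LIMSEQ_unique[OF FT_tendsto[OF s]])
  let ?X = "\<lambda>k. abs_l2 (trunc k (rep_l2 (abs_l2 f)))" and ?Y = "\<lambda>k. abs_l2 (ft s (trunc k (rep_l2 (abs_l2 f))))"
  let ?C = "sqrt (2 * (2 * pi) ^ CARD('n))"
  have le: "norm (?Y k - abs_l2 (ft s f)) \<le> ?C * norm (?X k - abs_l2 f)" for k
    by (intro norm_ft_diff_le f s integrable_trunc square_integrable_trunc) simp_all
  have "(\<lambda>k. norm (?X k - abs_l2 f)) \<longlonglongrightarrow> 0"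
    using trunc_tendsto[of "abs_l2 f"] unfolding tendsto_dist_iff[of _ "abs_l2 f"] dist_norm .
  from tendsto_mult_right_zero[OF this, of ?C]
  have "(\<lambda>k. norm (?Y k - abs_l2 (ft s f))) \<longlonglongrightarrow> 0"
    by (rule tendsto_0_le[of _ _ _ 1]) (use le in auto)
  then show "?Y \<longlonglongrightarrow> abs_l2 (ft s f)"
    unfolding tendsto_dist_iff[of _ "abs_l2 (ft s f)"] dist_norm .
qed

text \<open>The multiplication formula \<open>ft_swap\<close> on truncations, passed to the limit;
  conjugation changes the sign. Inversion, the Plancherel identity and linearity are all drawn from
  this.\<close>

lemma FT_adjoint:
  fixes f g :: "('n::finite) l2"
  assumes s: "s\<^sup>2 = 1"
  shows "FT s f \<bullet> g = f \<bullet> FT (-s) g"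
proof -
  have *: "abs_l2 (ft s f) \<bullet> abs_l2 g = abs_l2 f \<bullet> abs_l2 (ft (-s) g)"
    if f: "integrable lborel f" "square_integrable f" and g: "integrable lborel g" "square_integrable g"
    for f g :: "real^'n \<Rightarrow> complex"
  proof -
    have "(LINT x|lborel. ft s f x * cnj (g x)) = (LINT x|lborel. f x * ft s (\<lambda>x. cnj (g x)) x)"
      using f g by (intro ft_swap) auto
    then show ?thesis
      using s by (simp add: inner_abs_l2_Re f g ft_L2_bound cnj_ft)
  qed
  have s': "(-s)\<^sup>2 = 1" using s by simp
  let ?f = "\<lambda>k. trunc k (rep_l2 f)" and ?g = "\<lambda>k. trunc k (rep_l2 g)"
  have "(\<lambda>k. abs_l2 (ft s (?f k)) \<bullet> abs_l2 (?g k)) \<longlonglongrightarrow> FT s f \<bullet> g"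
    by (intro tendsto_inner FT_tendsto s trunc_tendsto)
  moreover have "(\<lambda>k. abs_l2 (?f k) \<bullet> abs_l2 (ft (-s) (?g k))) \<longlonglongrightarrow> f \<bullet> FT (-s) g"
    by (intro tendsto_inner FT_tendsto s' trunc_tendsto)
  moreover have "abs_l2 (ft s (?f k)) \<bullet> abs_l2 (?g k) = abs_l2 (?f k) \<bullet> abs_l2 (ft (-s) (?g k))" for k
    by (intro * integrable_trunc square_integrable_trunc) simp_all
  ultimately show ?thesis using LIMSEQ_unique by simp
qed

section \<open>Modulated Gaussians, inversion and the Plancherel identity\<close>

definition modulated_gaussian :: "real^'n \<Rightarrow> real^'n \<Rightarrow> complex" where
  "modulated_gaussian b x = cis (b \<bullet> x) * gaussian 1 x"

lemma square_integrable_gaussian: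
  assumes "c > 0"
  shows "square_integrable (gaussian c :: real^'n::finite \<Rightarrow> complex)"
  unfolding square_integrable_def
proof
  have "(cmod (gaussian c x))\<^sup>2 = cmod (gaussian (2 * c) x)" for x :: "real^'n"
    by (simp add: cmod_gaussian power2_eq_square flip: exp_add)
  then show "integrable lborel (\<lambda>x::real^'n. (cmod (gaussian c x))\<^sup>2)"
    using ft_gaussian(1)[of "2*c" 1, where 'n = 'n] assms by simp
qed simp

lemma modulated_gaussian_L12:
  fixes b :: "real^'n::finite"
  shows "integrable lborel (modulated_gaussian b)" "square_integrable (modulated_gaussian b)"
proof -
  show "integrable lborel (modulated_gaussian b)"
    unfolding modulated_gaussian_def[abs_def]
    by (rule integrable_cis_mult) (auto intro: ft_gaussian(1)[of 1 1])
  show "square_integrable (modulated_gaussian b)"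
    unfolding modulated_gaussian_def[abs_def]
    by (rule square_integrable_symbol[where B = 1]) (auto simp: bounded_symbol_def intro: square_integrable_gaussian)
qed

text \<open>A modulation becomes a translation, and the next lemma transforms back, so on this
  family the inversion formula is an explicit computation.\<close>

lemma ft_modulated_gaussian:
  fixes b :: "real^'n::finite"
  assumes s: "s\<^sup>2 = 1"
  shows "ft s (modulated_gaussian b) \<xi> = of_real (sqrt (2 * pi) ^ CARD('n)) * gaussian 1 (\<xi> - s *\<^sub>R b)"
proof -
  have ss: "s * (s * r) = r" for r using s by (simp add: power2_eq_square flip: mult.assoc)
  have "cis (- s * (x \<bullet> \<xi>)) * modulated_gaussian b x = cis (- s * (x \<bullet> (\<xi> - s *\<^sub>R b))) * gaussian 1 x" for x
    unfolding modulated_gaussian_def mult.assoc[symmetric] cis_mult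
    by (simp add: inner_diff_right right_diff_distrib ss inner_commute)
  then have "ft s (modulated_gaussian b) \<xi> = ft s (gaussian 1) (\<xi> - s *\<^sub>R b)"
    by (simp only: ft_def)
  then show ?thesis using ft_gaussian(2)[of 1 s] s by simp
qed

lemma ft_translated_gaussian:
  fixes b :: "real^'n::finite"
  assumes s: "s\<^sup>2 = 1"
  shows "ft (-s) (\<lambda>\<xi>. gaussian 1 (\<xi> - s *\<^sub>R b)) x = of_real (sqrt (2 * pi) ^ CARD('n)) * modulated_gaussian b x"
proof -
  have ss: "s * (s * r) = r" for r using s by (simp add: power2_eq_square flip: mult.assoc)
  have "ft (-s) (\<lambda>\<xi>. gaussian 1 (\<xi> - s *\<^sub>R b)) x
      = (LINT \<xi>|lborel. cis (s * ((s *\<^sub>R b + 1 *\<^sub>R \<xi>) \<bullet> x)) * gaussian 1 (s *\<^sub>R b + 1 *\<^sub>R \<xi> - s *\<^sub>R b))"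
    unfolding ft_def by (subst integral_lborel_affine[of _ 1 "s *\<^sub>R b"]) simp_all
  also have "\<dots> = (LINT \<xi>|lborel. cis (b \<bullet> x) * (cis (- (- s) * (\<xi> \<bullet> x)) * gaussian 1 \<xi>))"
    by (simp add: inner_add_left distrib_left ss cis_mult[symmetric] mult.assoc)
  also have "\<dots> = cis (b \<bullet> x) * ft (-s) (gaussian 1) x"
    unfolding ft_def by (rule integral_mult_right_zero)
  also have "\<dots> = of_real (sqrt (2 * pi) ^ CARD('n)) * modulated_gaussian b x"
    using ft_gaussian(2)[of 1 "-s"] s by (simp add: modulated_gaussian_def)
  finally show ?thesis .
qed

lemma ft_times_const: "ft s (\<lambda>x. c * f x) \<xi> = c * ft s f \<xi>"
  by (simp add: ft_def mult.left_commute)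

lemma FT_inverse_modulated_gaussian:
  fixes b :: "real^'n::finite"
  assumes s: "s\<^sup>2 = 1"
  shows "FT (-s) (FT s (abs_l2 (\<lambda>x. c * modulated_gaussian b x)))
    = (2 * pi) ^ CARD('n) *\<^sub>R abs_l2 (\<lambda>x. c * modulated_gaussian b x)"
proof -
  let ?A = "complex_of_real (sqrt (2 * pi) ^ CARD('n))"
  let ?h = "\<lambda>\<xi>. c * (?A * gaussian 1 (\<xi> - s *\<^sub>R b))"
  have h1: "integrable lborel ?h"
    using integrable_lborel_affine_iff[of "gaussian 1" 1 "- (s *\<^sub>R b)"] ft_gaussian(1)[of 1 1, where 'n = 'n]
    by simp
  have L: "integrable lborel (\<lambda>x. c * modulated_gaussian b x)" "square_integrable (\<lambda>x. c * modulated_gaussian b x)"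
    using modulated_gaussian_L12[of b] by (auto intro: square_integrable_times_const)
  have fe: "ft s (\<lambda>x. c * modulated_gaussian b x) = ?h"
    by (rule ext) (simp add: ft_times_const ft_modulated_gaussian[OF s])
  have h2: "square_integrable ?h"
    using ft_L2_bound(1)[OF L s] by (simp add: fe)
  have AA: "?A * ?A = of_real ((2 * pi) ^ CARD('n))"
    unfolding of_real_mult[symmetric] power_mult_distrib[symmetric] by simp
  have fh: "ft (-s) ?h x = (2 * pi) ^ CARD('n) *\<^sub>R (c * modulated_gaussian b x)" for x
  proof -
    have "ft (-s) ?h x = c * (?A * (?A * modulated_gaussian b x))"
      by (simp only: ft_times_const ft_translated_gaussian[OF s])
    also have "\<dots> = (?A * ?A) * (c * modulated_gaussian b x)" by (simp add: ac_simps)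
    finally show ?thesis by (simp only: AA scaleR_conv_of_real)
  qed
  have "FT (-s) (FT s (abs_l2 (\<lambda>x. c * modulated_gaussian b x))) = abs_l2 (ft (-s) ?h)"
  proof -
    have s': "(-s)\<^sup>2 = 1" using s by simp
    show ?thesis by (simp only: FT_abs_l2[OF L s] fe FT_abs_l2[OF h1 h2 s'])
  qed
  also have "\<dots> = (2 * pi) ^ CARD('n) *\<^sub>R abs_l2 (\<lambda>x. c * modulated_gaussian b x)"
    unfolding abs_l2_scaleR[OF L(2)] fh[abs_def] ..
  finally show ?thesis .
qed

text \<open>Pairing \<open>d\<close> with \<open>modulated_gaussian b\<close> evaluates the
  transform of \<open>gaussian 1\<close> times \<open>d\<close> at \<open>b\<close>, so injectivity
  of \<open>ft\<close> applies. The inner product sees only real parts; the factors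
  \<open>c = 1\<close> and \<open>c = \<i>\<close> give both parts.\<close>

lemma l2_eq_0_if_orthogonal_modulated_gaussian:
  fixes d :: "('n::finite) l2"
  assumes d: "\<And>b c. d \<bullet> abs_l2 (\<lambda>x. c * modulated_gaussian b x) = 0"
  shows "d = 0"
proof -
  let ?h = "\<lambda>x. gaussian 1 x * rep_l2 d x"
  have hi: "integrable lborel ?h"
    by (intro square_integrable_prod_integrable square_integrable_gaussian) auto
  have ft: "ft 1 ?h b = (LINT x|lborel. rep_l2 d x * cnj (modulated_gaussian b x))" for b
    unfolding ft_def
    by (intro Bochner_Integration.integral_cong)
      (simp_all add: modulated_gaussian_def cis_cnj inner_commute gaussian_def ac_simps)
  have "ft 1 ?h b = 0" for b
  proof -
    have si: "square_integrable (\<lambda>x. c * modulated_gaussian b x)" for c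
      by (intro square_integrable_times_const modulated_gaussian_L12)
    have r: "Re (cnj c * ft 1 ?h b) = 0" for c
    proof -
      have "d \<bullet> abs_l2 (\<lambda>x. c * modulated_gaussian b x) = Re (LINT x|lborel. rep_l2 d x * cnj (c * modulated_gaussian b x))"
        using inner_abs_l2_Re[OF square_integrable_rep_l2 si, of d c] by simp
      also have "(LINT x|lborel. rep_l2 d x * cnj (c * modulated_gaussian b x)) = cnj c * ft 1 ?h b"
        unfolding ft integral_mult_right_zero[symmetric]
        by (simp add: ac_simps)
      finally show ?thesis using d by simp
    qed
    show ?thesis using r[of 1] r[of \<i>] by (simp add: complex_eq_iff)
  qed
  then have "AE x in lborel. ?h x = 0"
    by (intro ft_eq_0_imp_AE_0[OF hi, of 1]) auto
  then have "AE x in lborel. rep_l2 d x = rep_l2 0 x"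
    using AE_rep_abs_l2[OF square_integrable_zero] unfolding abs_l2_zero
    by eventually_elim (simp add: gaussian_def)
  then show ?thesis by (rule l2_eqI)
qed

text \<open>The composition of \<open>FT s\<close> and \<open>FT (-s)\<close> is its own adjoint. It
  can therefore be moved onto the modulated Gaussians, where the formula is known and which detect
  every vector.\<close>

theorem FT_inversion:
  fixes f :: "('n::finite) l2"
  assumes s: "s\<^sup>2 = 1"
  shows "FT (-s) (FT s f) = (2 * pi) ^ CARD('n) *\<^sub>R f"
proof -
  have s': "(-s)\<^sup>2 = 1" using s by simp
  have "FT (-s) (FT s f) - (2 * pi) ^ CARD('n) *\<^sub>R f = 0"
  proof (rule l2_eq_0_if_orthogonal_modulated_gaussian)
    fix b c
    let ?g = "abs_l2 (\<lambda>x. c * modulated_gaussian b x) :: 'n l2"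
    have "FT (-s) (FT s f) \<bullet> ?g = f \<bullet> FT (-s) (FT s ?g)"
      using FT_adjoint[OF s', of "FT s f" ?g] FT_adjoint[OF s, of f "FT s ?g"] by simp
    then show "(FT (-s) (FT s f) - (2 * pi) ^ CARD('n) *\<^sub>R f) \<bullet> ?g = 0"
      by (simp add: FT_inverse_modulated_gaussian[OF s] inner_diff_left)
  qed
  then show ?thesis by simp
qed

theorem Plancherel:
  fixes f :: "('n::finite) l2"
  assumes s: "s\<^sup>2 = 1"
  shows "norm (FT s f) = sqrt ((2 * pi) ^ CARD('n)) * norm f"
proof -
  have "(norm (FT s f))\<^sup>2 = (2 * pi) ^ CARD('n) * (norm f)\<^sup>2"
    unfolding power2_norm_eq_inner FT_adjoint[OF s] FT_inversion[OF s] by simp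
  then have "sqrt ((norm (FT s f))\<^sup>2) = sqrt ((2 * pi) ^ CARD('n) * (norm f)\<^sup>2)" by simp
  then show ?thesis by (simp add: real_sqrt_mult)
qed

text \<open>A map with an adjoint is linear: the defect of linearity is orthogonal to every vector,
  in particular to itself.\<close>

lemma bounded_linear_FT:
  assumes s: "s\<^sup>2 = 1"
  shows "bounded_linear (FT s :: ('n::finite) l2 \<Rightarrow> 'n l2)"
proof (rule bounded_linear_intro)
  fix f g :: "'n l2" and r :: real
  have "(FT s (f + g) - (FT s f + FT s g)) \<bullet> h = 0" for h
    by (simp add: inner_diff_left inner_add_left FT_adjoint[OF s])
  from this[of "FT s (f + g) - (FT s f + FT s g)"] show "FT s (f + g) = FT s f + FT s g" by simp
  have "(FT s (r *\<^sub>R f) - r *\<^sub>R FT s f) \<bullet> h = 0" for h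
    by (simp add: inner_diff_left FT_adjoint[OF s])
  from this[of "FT s (r *\<^sub>R f) - r *\<^sub>R FT s f"] show "FT s (r *\<^sub>R f) = r *\<^sub>R FT s f" by simp
  show "norm (FT s f) \<le> norm f * sqrt ((2 * pi) ^ CARD('n))"
    by (simp add: Plancherel[OF s])
qed

text \<open>The adjoint identity gives only real parts, after multiplication by any complex
  \<open>c\<close>; \<open>c = 1\<close> and \<open>c = -\<i>\<close> recover the complex
  identity.\<close>

lemma FT_multiplication_formula:
  fixes f :: "('n::finite) l2"
  assumes \<phi>: "integrable lborel \<phi>" "square_integrable \<phi>" and s: "s\<^sup>2 = 1"
  shows "(LINT x|lborel. rep_l2 (FT s f) x * \<phi> x) = (LINT x|lborel. rep_l2 f x * ft s \<phi> x)"
    (is "?L = ?R")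
proof -
  have r: "Re (c * ?L) = Re (c * ?R)" for c
  proof -
    let ?g = "\<lambda>x. cnj c * cnj (\<phi> x)"
    have g: "integrable lborel ?g" "square_integrable ?g"
      using \<phi> by (auto intro: square_integrable_times_const square_integrable_cnj)
    have s': "(-s)\<^sup>2 = 1" using s by simp
    have "FT s f \<bullet> abs_l2 ?g = f \<bullet> abs_l2 (ft (-s) ?g)"
      by (simp add: FT_adjoint[OF s] FT_abs_l2[OF g s'])
    then have "Re (LINT x|lborel. rep_l2 (FT s f) x * cnj (?g x)) = Re (LINT x|lborel. rep_l2 f x * cnj (ft (-s) ?g x))"
      using inner_abs_l2_Re[OF square_integrable_rep_l2 g(2), of "FT s f"]
        inner_abs_l2_Re[OF square_integrable_rep_l2 ft_L2_bound(1)[OF g s'], of f] by simp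
    moreover have "cnj (ft (-s) ?g x) = c * ft s \<phi> x" for x
      unfolding cnj_ft by (simp add: ft_times_const)
    ultimately show ?thesis
      by (simp add: mult.left_commute[of _ c])
  qed
  show ?thesis using r[of 1] r[of "-\<i>"] by (simp add: complex_eq_iff)
qed

section \<open>Fourier transforms of tempered distributions\<close>

text \<open>The \<open>m\<close>-th power of \<open>y / m <= exp (y / m)\<close>. For
  \<open>m = 0\<close> the factor \<open>0 ^ 0 = 1\<close> makes the statement
  \<open>1 <= exp y\<close>.\<close>

lemma power_le_exp_bound:
  fixes y :: real
  assumes "y \<ge> 0"
  shows "y ^ m \<le> real m ^ m * exp y"
proof (cases "m = 0")
  case False
  have "y / real m \<le> exp (y / real m)"
    using exp_ge_add_one_self[of "y / real m"] by linarith
  then have "(y / real m) ^ m \<le> exp (y / real m) ^ m"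
    using assms by (intro power_mono) auto
  also have "\<dots> = exp y" using False by (simp flip: exp_of_nat_mult)
  finally show ?thesis using False by (simp add: power_divide divide_simps mult.commute)
qed (use assms in simp)

section \<open>Integrability from polynomial decay\<close>

lemma integrable_inverse_1_plus_square_lborel: "integrable lborel (\<lambda>x::real. 1 / (1 + x\<^sup>2))"
  using integrable_inverse_1_plus_square
  by (simp add: set_integrable_def inverse_eq_divide)

text \<open>The exponent is \<open>2 * CARD('n)\<close> because \<open>(1 + norm x)\<^sup>2\<close>
  dominates \<open>1 + (x \<bullet> b)\<^sup>2\<close> for each coordinate, which gives a majorant
  that is a product of integrable functions of one variable.\<close>

lemma integrable_decay: "integrable lborel (\<lambda>x::real^'n::finite. 1 / (1 + norm x) ^ (2 * CARD('n)))"
proof (rule Bochner_Integration.integrable_bound)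
  show "integrable lborel (\<lambda>x::real^'n. \<Prod>b\<in>Basis. complex_of_real (1 / (1 + (x \<bullet> b)\<^sup>2)))"
    by (rule integral_lborel_prod(1)) (intro integrable_of_real integrable_inverse_1_plus_square_lborel)
  show "AE x::real^'n in lborel. norm (1 / (1 + norm x) ^ (2 * CARD('n))) \<le> norm (\<Prod>b\<in>Basis. complex_of_real (1 / (1 + (x \<bullet> b)\<^sup>2)))"
  proof (rule AE_I2)
    fix x :: "real^'n"
    have "(\<Prod>b\<in>(Basis::(real^'n) set). 1 + (x \<bullet> b)\<^sup>2) \<le> (\<Prod>b\<in>(Basis::(real^'n) set). (1 + norm x)\<^sup>2)"
    proof (rule prod_mono, safe)
      fix b :: "real^'n" assume b: "b \<in> Basis"
      have "(x \<bullet> b)\<^sup>2 \<le> (norm x)\<^sup>2"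
        using Basis_le_norm[OF b, of x] by (metis abs_norm_cancel power2_le_iff_abs_le norm_ge_zero)
      moreover have "(1 + norm x)\<^sup>2 = 1 + 2 * norm x + (norm x)\<^sup>2" by (simp add: power2_sum)
      ultimately show "1 + (x \<bullet> b)\<^sup>2 \<le> (1 + norm x)\<^sup>2" using norm_ge_zero[of x] by linarith
    qed (simp add: add_nonneg_nonneg)
    also have "\<dots> = (1 + norm x) ^ (2 * CARD('n))"
      by (simp add: power_mult)
    finally have le: "(\<Prod>b\<in>(Basis::(real^'n) set). 1 + (x \<bullet> b)\<^sup>2) \<le> (1 + norm x) ^ (2 * CARD('n))" .
    have pos: "0 < (\<Prod>b\<in>(Basis::(real^'n) set). 1 + (x \<bullet> b)\<^sup>2)"
      by (intro prod_pos) (simp add: add_pos_nonneg)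
    have "norm (\<Prod>b\<in>(Basis::(real^'n) set). complex_of_real (1 / (1 + (x \<bullet> b)\<^sup>2))) = 1 / (\<Prod>b\<in>(Basis::(real^'n) set). 1 + (x \<bullet> b)\<^sup>2)"
      unfolding prod_norm[symmetric] norm_of_real by (simp add: prod_dividef abs_of_pos add_pos_nonneg)
    moreover have "1 / (1 + norm x) ^ (2 * CARD('n)) \<le> 1 / (\<Prod>b\<in>(Basis::(real^'n) set). 1 + (x \<bullet> b)\<^sup>2)"
      using le pos by (intro divide_left_mono) auto
    ultimately show "norm (1 / (1 + norm x) ^ (2 * CARD('n))) \<le> norm (\<Prod>b\<in>Basis. complex_of_real (1 / (1 + (x \<bullet> b)\<^sup>2)))"
      by simp
  qed
qed measurable

text \<open>One weighted sup bound controls both norms. It serves Schwartz functions, where the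
  explicit L2 bound becomes a seminorm estimate, and the heat symbol.\<close>

lemma decay_L1_L2:
  fixes \<phi> :: "real^'n::finite \<Rightarrow> complex"
  assumes [measurable]: "\<phi> \<in> borel_measurable borel" and "0 \<le> S"
    and le: "\<And>x. (1 + norm x) ^ (2 * CARD('n)) * cmod (\<phi> x) \<le> S"
  shows "integrable lborel \<phi>" "square_integrable \<phi>"
    and "L2norm \<phi> \<le> S * sqrt (LINT x|lborel. 1 / (1 + norm (x::real^'n)) ^ (2 * CARD('n)))"
proof -
  let ?w = "\<lambda>x::real^'n. 1 / (1 + norm x) ^ (2 * CARD('n))"
  have pos: "0 < (1 + norm x) ^ k" for x :: "real^'n" and k :: nat
    by (intro zero_less_power add_pos_nonneg) auto
  have b: "cmod (\<phi> x) \<le> S * ?w x" for x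
    using le[of x] pos[of x "2 * CARD('n)"] by (simp add: pos_le_divide_eq mult.commute)
  have Si: "integrable lborel (\<lambda>x. r * ?w x)" for r
    by (intro integrable_mult_right integrable_decay)
  show "integrable lborel \<phi>"
    by (rule Bochner_Integration.integrable_bound[OF Si[of S]])
      (use b \<open>0 \<le> S\<close> in \<open>auto simp: abs_of_nonneg\<close>)
  have w1: "?w x \<le> 1" for x
    using pos[of x] one_le_power[of "1 + norm x" "2 * CARD('n)"] by (simp add: divide_le_eq_1)
  have b2: "(cmod (\<phi> x))\<^sup>2 \<le> S\<^sup>2 * ?w x" for x
  proof -
    have "(cmod (\<phi> x))\<^sup>2 \<le> (S * ?w x)\<^sup>2" using b by (intro power_mono) auto
    also have "\<dots> = S\<^sup>2 * (?w x * ?w x)" by (simp add: power2_eq_square)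
    also have "\<dots> \<le> S\<^sup>2 * (?w x * 1)" using w1[of x] by (intro mult_left_mono) auto
    finally show ?thesis by simp
  qed
  have i: "integrable lborel (\<lambda>x. (cmod (\<phi> x))\<^sup>2)"
    by (rule Bochner_Integration.integrable_bound[OF Si[of "S\<^sup>2"]])
      (use b2 in \<open>auto simp: abs_of_nonneg\<close>)
  then show "square_integrable \<phi>" by (simp add: square_integrable_def)
  have "(LINT x|lborel. (cmod (\<phi> x))\<^sup>2) \<le> (LINT x|lborel. S\<^sup>2 * ?w x)"
    using b2 by (intro integral_mono i integrable_mult_right integrable_decay)
  then have "L2norm \<phi> \<le> sqrt (S\<^sup>2 * (LINT x|lborel. ?w x))"
    unfolding L2norm_def by (simp only: integral_mult_right_zero real_sqrt_le_iff)
  then show "L2norm \<phi> \<le> S * sqrt (LINT x|lborel. ?w x)"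
    using \<open>0 \<le> S\<close> by (simp add: real_sqrt_mult)
qed

section \<open>Schwartz functions and the distributions given by L2 functions\<close>

lemma iterated_derivative_Nil [simp]: "iterated_derivative [] \<phi> = \<phi>"
  by (simp add: iterated_derivative_def)

lemma schwartz_measurable:
  assumes "\<phi> \<in> schwartz"
  shows "\<phi> \<in> borel_measurable borel"
proof -
  have "\<phi> differentiable at x" for x
    using assms unfolding schwartz_def by (metis (mono_tags, lifting) iterated_derivative_Nil mem_Collect_eq)
  then show ?thesis
    by (intro borel_measurable_continuous_onI continuous_at_imp_continuous_on)
      (simp add: differentiable_imp_continuous_within)
qed

lemma schwartz_seminorm_upper:
  assumes "\<phi> \<in> schwartz"
  shows "(1 + norm x) ^ k * cmod (\<phi> x) \<le> schwartz_seminorm k [] \<phi>" "0 \<le> schwartz_seminorm k [] \<phi>"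
proof -
  have "bounded (range (\<lambda>x. (1 + norm x) ^ k *\<^sub>R iterated_derivative [] \<phi> x))"
    using assms unfolding schwartz_def by blast
  then obtain B where B: "\<And>x. norm ((1 + norm x) ^ k *\<^sub>R \<phi> x) \<le> B"
    unfolding bounded_iff by auto
  have "bdd_above (range (\<lambda>x. (1 + norm x) ^ k * cmod (\<phi> x)))"
    by (rule bdd_aboveI[where M = B]) (use B in auto)
  then show *: "(1 + norm x) ^ k * cmod (\<phi> x) \<le> schwartz_seminorm k [] \<phi>" for x
    unfolding schwartz_seminorm_def iterated_derivative_Nil by (rule cSUP_upper[OF UNIV_I])
  have "0 \<le> (1 + norm (0::real^'a)) ^ k * cmod (\<phi> 0)" by simp
  also have "\<dots> \<le> schwartz_seminorm k [] \<phi>" by (rule *)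
  finally show "0 \<le> schwartz_seminorm k [] \<phi>" .
qed

lemma schwartz_L1_L2:
  fixes \<phi> :: "real^'n::finite \<Rightarrow> complex"
  assumes "\<phi> \<in> schwartz"
  shows "integrable lborel \<phi>" "square_integrable \<phi>"
    and "L2norm \<phi> \<le> schwartz_seminorm (2 * CARD('n)) [] \<phi> * sqrt (LINT x|lborel. 1 / (1 + norm (x::real^'n)) ^ (2 * CARD('n)))"
  using decay_L1_L2[OF schwartz_measurable[OF assms]] schwartz_seminorm_upper[OF assms, where k = "2 * CARD('n)"]
  by auto

lemma tempered_l2_distribution: "tempered (l2_distribution (f :: ('n::finite) l2))"
  unfolding tempered_def
proof (intro conjI ballI allI)
  fix \<phi> \<psi> :: "real^'n \<Rightarrow> complex" assume "\<phi> \<in> schwartz" "\<psi> \<in> schwartz"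
  then show "l2_distribution f (\<lambda>x. \<phi> x + \<psi> x) = l2_distribution f \<phi> + l2_distribution f \<psi>"
    unfolding l2_distribution_def distrib_left
    by (intro Bochner_Integration.integral_add square_integrable_prod_integrable square_integrable_rep_l2 schwartz_L1_L2(2))
next
  fix \<phi> :: "real^'n \<Rightarrow> complex" and c
  show "l2_distribution f (\<lambda>x. c * \<phi> x) = c * l2_distribution f \<phi>"
    by (simp add: l2_distribution_def mult.left_commute[of _ c])
next
  let ?W = "sqrt (LINT x|lborel. 1 / (1 + norm (x::real^'n)) ^ (2 * CARD('n)))"
  show "\<exists>C k N. \<forall>\<phi>\<in>schwartz. cmod (l2_distribution f \<phi>) \<le> C * (\<Sum>js | length js \<le> N. schwartz_seminorm k js \<phi>)"
  proof (intro exI ballI)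
    fix \<phi> :: "real^'n \<Rightarrow> complex" assume \<phi>: "\<phi> \<in> schwartz"
    have "cmod (l2_distribution f \<phi>) \<le> norm f * L2norm \<phi>"
      unfolding l2_distribution_def norm_l2_eq
      by (intro L2_prod_integral_bound square_integrable_rep_l2 schwartz_L1_L2(2) \<phi>)
    also have "\<dots> \<le> norm f * (schwartz_seminorm (2 * CARD('n)) [] \<phi> * ?W)"
      by (intro mult_left_mono schwartz_L1_L2(3) \<phi> norm_ge_zero)
    \<comment> \<open>With \<open>N = 0\<close> the sum has only the empty list, so a single
      seminorm without derivatives bounds the distribution.\<close>
    also have "\<dots> = (norm f * ?W) * (\<Sum>js | length js \<le> 0. schwartz_seminorm (2 * CARD('n)) js \<phi>)"
      by simp
    finally show "cmod (l2_distribution f \<phi>) \<le> (norm f * ?W) * (\<Sum>js | length js \<le> 0. schwartz_seminorm (2 * CARD('n)) js \<phi>)" .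
  qed
qed

lemma has_fourier_transform_l2:
  fixes f :: "('n::finite) l2"
  assumes g: "square_integrable g" and eq: "abs_l2 g = FT 1 f"
  shows "has_fourier_transform (l2_distribution f) g"
  unfolding has_fourier_transform_def
proof (intro conjI ballI)
  show [measurable]: "g \<in> borel_measurable borel" using g by (rule square_integrable_measurable)
  fix \<phi> :: "real^'n \<Rightarrow> complex" assume "\<phi> \<in> schwartz"
  note \<phi> = schwartz_L1_L2[OF this]
  have [measurable]: "\<phi> \<in> borel_measurable borel" using \<phi>(2) by (rule square_integrable_measurable)
  show "integrable lborel (\<lambda>\<xi>. g \<xi> * \<phi> \<xi>)" by (intro square_integrable_prod_integrable g \<phi>)
  have "AE \<xi> in lborel. rep_l2 (FT 1 f) \<xi> = g \<xi>" using AE_rep_abs_l2[OF g] eq by simp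
  then have "(LINT \<xi>|lborel. rep_l2 (FT 1 f) \<xi> * \<phi> \<xi>) = (LINT \<xi>|lborel. g \<xi> * \<phi> \<xi>)"
    by (intro integral_cong_AE) auto
  then show "l2_distribution f (fourier \<phi>) = (LINT \<xi>|lborel. g \<xi> * \<phi> \<xi>)"
    using FT_multiplication_formula[OF \<phi>(1,2), of 1 f]
    by (simp add: l2_distribution_def fourier_eq_ft[abs_def])
qed

section \<open>Modulated Gaussians as test functions\<close>

lemma partial_derivative_eq:
  "(f has_derivative f') (at x) \<Longrightarrow> partial_derivative i f x = f' (axis i 1)"
  unfolding partial_derivative_def using frechet_derivative_at[of f f' x] by simp

text \<open>The factors that differentiation puts in front of a modulated Gaussian. Only closure
  under partial derivatives and polynomial growth matter, and both follow by rule induction.\<close>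

inductive cpolynomial :: "(real^'n::finite \<Rightarrow> complex) \<Rightarrow> bool" where
  const: "cpolynomial (\<lambda>x. c)"
| coord: "cpolynomial (\<lambda>x. of_real (x $ i))"
| add: "cpolynomial P \<Longrightarrow> cpolynomial Q \<Longrightarrow> cpolynomial (\<lambda>x. P x + Q x)"
| mult: "cpolynomial P \<Longrightarrow> cpolynomial Q \<Longrightarrow> cpolynomial (\<lambda>x. P x * Q x)"

lemma cpolynomial_partial_derivative:
  fixes P :: "real^'n::finite \<Rightarrow> complex"
  assumes "cpolynomial P"
  shows "(\<forall>x. P differentiable at x) \<and> cpolynomial (partial_derivative j P)"
  using assms
proof induction
  case (const c)
  have "partial_derivative j (\<lambda>x. c) = (\<lambda>x. 0)"
    by (rule ext) (simp add: partial_derivative_eq[OF has_derivative_const])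
  then show ?case by (simp add: cpolynomial.const)
next
  case (coord i)
  have d: "((\<lambda>x. complex_of_real (x $ i)) has_derivative (\<lambda>h. of_real (h $ i))) (at x)" for x :: "real^'n"
    by (intro has_derivative_of_real bounded_linear.has_derivative[OF bounded_linear_vec_nth] has_derivative_ident)
  have "partial_derivative j (\<lambda>x. complex_of_real (x $ i)) = (\<lambda>x. of_real (axis j 1 $ i))"
    by (rule ext) (rule partial_derivative_eq[OF d])
  then show ?case using d by (auto simp: cpolynomial.const differentiable_def)
next
  case (add P Q)
  have dP: "(P has_derivative frechet_derivative P (at x)) (at x)" and dQ: "(Q has_derivative frechet_derivative Q (at x)) (at x)" for x
    using add by (auto simp: frechet_derivative_works[symmetric])
  have "partial_derivative j (\<lambda>x. P x + Q x) x = partial_derivative j P x + partial_derivative j Q x" for x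
    unfolding partial_derivative_eq[OF has_derivative_add[OF dP[of x] dQ[of x]]] by (simp add: partial_derivative_def)
  then have "partial_derivative j (\<lambda>x. P x + Q x) = (\<lambda>x. partial_derivative j P x + partial_derivative j Q x)" ..
  then show ?case using add by (auto intro: cpolynomial.add)
next
  case (mult P Q)
  have dP: "(P has_derivative frechet_derivative P (at x)) (at x)" and dQ: "(Q has_derivative frechet_derivative Q (at x)) (at x)" for x
    using mult by (auto simp: frechet_derivative_works[symmetric])
  have "partial_derivative j (\<lambda>x. P x * Q x) x = P x * partial_derivative j Q x + partial_derivative j P x * Q x" for x
    unfolding partial_derivative_eq[OF has_derivative_mult[OF dP[of x] dQ[of x]]] by (simp add: partial_derivative_def)
  then have "partial_derivative j (\<lambda>x. P x * Q x) = (\<lambda>x. P x * partial_derivative j Q x + partial_derivative j P x * Q x)" ..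
  then show ?case using mult by (auto intro: cpolynomial.add cpolynomial.mult)
qed

lemma cpolynomial_growth:
  fixes P :: "real^'n::finite \<Rightarrow> complex"
  assumes "cpolynomial P"
  shows "\<exists>C k. C \<ge> 0 \<and> (\<forall>x. cmod (P x) \<le> C * (1 + norm x) ^ k)"
  using assms
proof induction
  case (const c)
  show ?case by (intro exI[of _ "cmod c"] exI[of _ 0]) auto
next
  case (coord i)
  have "\<bar>x $ i\<bar> \<le> 1 + norm x" for x :: "real^'n"
    using component_le_norm_cart[of x i] by linarith
  then show ?case by (intro exI[of _ 1] exI[of _ 1]) auto
next
  case (add P Q)
  then obtain C k C' k' where C: "C \<ge> 0" "\<And>x. cmod (P x) \<le> C * (1 + norm x) ^ k"
    and C': "C' \<ge> 0" "\<And>x. cmod (Q x) \<le> C' * (1 + norm x) ^ k'" by blast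
  have "cmod (P x + Q x) \<le> (C + C') * (1 + norm x) ^ (k + k')" for x
  proof -
    have "C * (1 + norm x) ^ k \<le> C * (1 + norm x) ^ (k + k')" "C' * (1 + norm x) ^ k' \<le> C' * (1 + norm x) ^ (k + k')"
      using C C' by (auto intro!: mult_left_mono power_increasing)
    then show ?thesis
      using norm_triangle_ineq[of "P x" "Q x"] C(2)[of x] C'(2)[of x] by (simp add: distrib_right)
  qed
  then show ?case using C C' by (intro exI[of _ "C + C'"] exI[of _ "k + k'"]) auto
next
  case (mult P Q)
  then obtain C k C' k' where C: "C \<ge> 0" "\<And>x. cmod (P x) \<le> C * (1 + norm x) ^ k"
    and C': "C' \<ge> 0" "\<And>x. cmod (Q x) \<le> C' * (1 + norm x) ^ k'" by blast
  have "cmod (P x * Q x) \<le> (C * C') * (1 + norm x) ^ (k + k')" for x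
    using mult_mono[OF C(2)[of x] C'(2)[of x]] C C' by (simp add: norm_mult power_add ac_simps)
  then show ?case using C C' by (intro exI[of _ "C * C'"] exI[of _ "k + k'"]) auto
qed

lemma has_derivative_modulated_gaussian:
  "(modulated_gaussian b has_derivative
     (\<lambda>h. (\<i> * of_real (b \<bullet> h) - of_real (x \<bullet> h)) * modulated_gaussian b x)) (at x)"
proof -
  have e: "modulated_gaussian b = (\<lambda>x. exp (\<i> * of_real (b \<bullet> x) + of_real (x \<bullet> x) * (-1/2)))"
    by (rule ext) (simp add: modulated_gaussian_def gaussian_def cis_conv_exp power2_norm_eq_inner
        mult_exp_exp flip: exp_of_real)
  have "((\<lambda>x. \<i> * of_real (b \<bullet> x) + of_real (x \<bullet> x) * (-1/2)) has_derivative
      (\<lambda>h. \<i> * of_real (b \<bullet> h) + of_real (x \<bullet> h + h \<bullet> x) * (-1/2))) (at x)"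
    by (intro has_derivative_add has_derivative_mult_right has_derivative_mult_left has_derivative_of_real
        has_derivative_inner has_derivative_inner_right has_derivative_ident)
  then have "((\<lambda>x. \<i> * of_real (b \<bullet> x) + of_real (x \<bullet> x) * (-1/2)) has_derivative
      (\<lambda>h. \<i> * of_real (b \<bullet> h) - of_real (x \<bullet> h))) (at x)"
    by (simp add: inner_commute)
  from has_derivative_compose[OF this DERIV_exp[unfolded has_field_derivative_def]] show ?thesis
    unfolding e by (simp add: mult.commute)
qed

lemma cpolynomial_times_gaussian_iterated:
  assumes "cpolynomial P"
  shows "\<exists>Q. cpolynomial Q \<and> iterated_derivative js (\<lambda>x. P x * modulated_gaussian b x) = (\<lambda>x. Q x * modulated_gaussian b x)"
proof (induction js)
  case Nil
  then show ?case using assms by auto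
next
  case (Cons j js)
  then obtain Q where Q: "cpolynomial Q"
    "iterated_derivative js (\<lambda>x. P x * modulated_gaussian b x) = (\<lambda>x. Q x * modulated_gaussian b x)" by blast
  \<comment> \<open>\<open>\<i> * of_real (b $ j) - of_real (x $ j)\<close> is the logarithmic
    derivative of the modulated Gaussian in direction \<open>j\<close>.\<close>
  let ?R = "\<lambda>x. Q x * (\<i> * of_real (b $ j) + (-1) * of_real (x $ j)) + partial_derivative j Q x"
  have d: "(Q has_derivative frechet_derivative Q (at x)) (at x)" for x
    using cpolynomial_partial_derivative[OF Q(1)] by (intro frechet_derivative_works[THEN iffD1]) simp
  have "partial_derivative j (\<lambda>x. Q x * modulated_gaussian b x) x = ?R x * modulated_gaussian b x" for x
    unfolding partial_derivative_eq[OF has_derivative_mult[OF d[of x] has_derivative_modulated_gaussian[of b x]]]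
    by (simp add: partial_derivative_def inner_axis algebra_simps)
  moreover have "cpolynomial ?R"
    using cpolynomial_partial_derivative[OF Q(1)] Q(1)
    by (intro cpolynomial.add cpolynomial.mult cpolynomial.const cpolynomial.coord) auto
  moreover have "iterated_derivative (j # js) (\<lambda>x. P x * modulated_gaussian b x)
      = partial_derivative j (\<lambda>x. Q x * modulated_gaussian b x)"
    using Q(2) by (simp add: iterated_derivative_def)
  ultimately show ?case by (intro exI[of _ ?R]) (auto intro!: ext)
qed

text \<open>This admits the modulated Gaussians as test functions in
  \<open>has_fourier_transform\<close>.\<close>

lemma modulated_gaussian_schwartz: "modulated_gaussian b \<in> schwartz"
  unfolding schwartz_def
proof (safe intro!: CollectI)
  fix js
  obtain Q where Q: "cpolynomial Q" "iterated_derivative js (modulated_gaussian b) = (\<lambda>x. Q x * modulated_gaussian b x)"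
    using cpolynomial_times_gaussian_iterated[OF cpolynomial.const[of 1], of js b] by auto
  show "iterated_derivative js (modulated_gaussian b) differentiable at x" for x
    unfolding Q(2) using cpolynomial_partial_derivative[OF Q(1)] has_derivative_modulated_gaussian[of b x]
    by (intro differentiable_mult) (auto simp: differentiable_def)
  fix k :: nat
  obtain C m where C: "C \<ge> 0" "\<And>x. cmod (Q x) \<le> C * (1 + norm x) ^ m"
    using cpolynomial_growth[OF Q(1)] by blast
  have "norm ((1 + norm x) ^ k *\<^sub>R (Q x * modulated_gaussian b x)) \<le> C * (real (k + m) ^ (k + m) * exp (3/2))" for x
  proof -
    \<comment> \<open>The square of \<open>norm x - 1\<close> trades the Gaussian for
      \<open>exp (- (1 + norm x))\<close>, against which \<open>power_le_exp_bound\<close> controls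
      every power of \<open>1 + norm x\<close>.\<close>
    have e: "exp (- ((norm x)\<^sup>2 / 2)) \<le> exp (3/2) * exp (- (1 + norm x))"
    proof -
      have "0 \<le> (norm x - 1)\<^sup>2" by simp
      then have "- ((norm x)\<^sup>2 / 2) \<le> 3/2 + - (1 + norm x)"
        by (simp add: power2_eq_square algebra_simps)
      then show ?thesis unfolding exp_add[symmetric] by simp
    qed
    have "norm ((1 + norm x) ^ k *\<^sub>R (Q x * modulated_gaussian b x))
        = (1 + norm x) ^ k * cmod (Q x) * exp (- ((norm x)\<^sup>2 / 2))"
      by (simp add: norm_mult modulated_gaussian_def cmod_gaussian abs_of_nonneg)
    also have "\<dots> \<le> (1 + norm x) ^ k * (C * (1 + norm x) ^ m) * (exp (3/2) * exp (- (1 + norm x)))"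
      using C e by (intro mult_mono) auto
    also have "\<dots> = C * exp (3/2) * ((1 + norm x) ^ (k + m) * exp (- (1 + norm x)))"
      by (simp add: power_add)
    also have "\<dots> \<le> C * exp (3/2) * (real (k + m) ^ (k + m))"
    proof (intro mult_left_mono)
      have "(1 + norm x) ^ (k + m) \<le> real (k + m) ^ (k + m) * exp (1 + norm x)"
        by (intro power_le_exp_bound) simp
      then have "(1 + norm x) ^ (k + m) / exp (1 + norm x) \<le> real (k + m) ^ (k + m)"
        by (subst pos_divide_le_eq) auto
      then show "(1 + norm x) ^ (k + m) * exp (- (1 + norm x)) \<le> real (k + m) ^ (k + m)"
        unfolding exp_minus divide_inverse .
    qed (use C in auto)
    finally show ?thesis by (simp add: ac_simps)
  qed
  then show "bounded (range (\<lambda>x. (1 + norm x) ^ k *\<^sub>R iterated_derivative js (modulated_gaussian b) x))"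
    unfolding Q(2) bounded_iff by blast
qed

text \<open>Tested with all modulated Gaussians, the difference of two transforms times
  \<open>gaussian 1\<close> has vanishing Fourier integral. Hence the choice in
  \<open>sobolev_norm\<close> and the description in \<open>fourier_multiplier\<close> are
  harmless.\<close>

theorem has_fourier_transform_unique:
  fixes g g' :: "real^'n::finite \<Rightarrow> complex"
  assumes g: "has_fourier_transform T g" and g': "has_fourier_transform T g'"
  shows "AE x in lborel. g x = g' x"
proof -
  note [measurable] = g[unfolded has_fourier_transform_def, THEN conjunct1] g'[unfolded has_fourier_transform_def, THEN conjunct1]
  have i: "integrable lborel (\<lambda>\<xi>. g \<xi> * modulated_gaussian b \<xi>)" "integrable lborel (\<lambda>\<xi>. g' \<xi> * modulated_gaussian b \<xi>)"
    and e: "(LINT \<xi>|lborel. g \<xi> * modulated_gaussian b \<xi>) = (LINT \<xi>|lborel. g' \<xi> * modulated_gaussian b \<xi>)" for b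
    using bspec[OF g[unfolded has_fourier_transform_def, THEN conjunct2] modulated_gaussian_schwartz[of b]]
      bspec[OF g'[unfolded has_fourier_transform_def, THEN conjunct2] modulated_gaussian_schwartz[of b]] by auto
  let ?h = "\<lambda>x. (g x - g' x) * gaussian 1 x"
  have m0: "modulated_gaussian 0 = (gaussian 1 :: real^'n \<Rightarrow> complex)"
    by (rule ext) (simp add: modulated_gaussian_def)
  have h: "integrable lborel ?h"
    using Bochner_Integration.integrable_diff[OF i[of 0]] by (simp add: m0 left_diff_distrib)
  have "ft (-1) ?h b = 0" for b
  proof -
    have "ft (-1) ?h b = (LINT \<xi>|lborel. g \<xi> * modulated_gaussian b \<xi> - g' \<xi> * modulated_gaussian b \<xi>)"
      unfolding ft_def
      by (intro Bochner_Integration.integral_cong) (simp_all add: modulated_gaussian_def inner_commute algebra_simps)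
    then show ?thesis using e[of b] Bochner_Integration.integral_diff[OF i[of b]] by simp
  qed
  then have "AE x in lborel. ?h x = 0"
    by (intro ft_eq_0_imp_AE_0[OF h, of "-1"]) auto
  then show ?thesis by eventually_elim (simp add: gaussian_def)
qed

section \<open>Sobolev norms and Fourier multipliers of L2 functions\<close>

lemma measurable_bessel_weight: "g \<in> borel_measurable borel \<Longrightarrow> bessel_weight s g \<in> borel_measurable borel"
  unfolding bessel_weight_def[abs_def] by measurable

lemma bessel_weight_AE_cong:
  assumes "AE x in lborel. g x = h x"
  shows "AE x in lborel. bessel_weight s g x = bessel_weight s h x"
  using assms by eventually_elim (simp add: bessel_weight_def)

lemma has_fourier_transform_measurable: "has_fourier_transform T g \<Longrightarrow> g \<in> borel_measurable borel"
  by (simp add: has_fourier_transform_def)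

lemma has_fourier_transform_rep_FT:
  "has_fourier_transform (l2_distribution f) (rep_l2 (FT 1 (f :: ('n::finite) l2)))"
  by (rule has_fourier_transform_l2) auto

lemma square_integrable_cong_AE:
  assumes "square_integrable f" "g \<in> borel_measurable borel" "AE x in lborel. f x = g x"
  shows "square_integrable g"
proof (rule square_integrable_bound[OF assms(1,2), where B = 1])
  show "AE x in lborel. cmod (g x) \<le> 1 * cmod (f x)" using assms(3) by eventually_elim simp
qed

lemma L2norm_cong_AE:
  assumes "f \<in> borel_measurable borel" "g \<in> borel_measurable borel" "AE x in lborel. f x = g x"
  shows "L2norm f = L2norm g"
proof -
  note [measurable] = assms(1,2)
  have "(LINT x|lborel. (cmod (f x))\<^sup>2) = (LINT x|lborel. (cmod (g x))\<^sup>2)"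
  proof (rule integral_cong_AE)
    show "AE x in lborel. (cmod (f x))\<^sup>2 = (cmod (g x))\<^sup>2" using assms(3) by eventually_elim simp
  qed measurable
  then show ?thesis by (simp add: L2norm_def)
qed

text \<open>By uniqueness the arbitrary transform in the definition may be replaced by the
  representative of \<open>FT 1 f\<close>; the next lemma does the same for the norm.\<close>

lemma sobolev_l2_iff:
  fixes f :: "('n::finite) l2"
  shows "l2_distribution f \<in> sobolev s \<longleftrightarrow> square_integrable (bessel_weight s (rep_l2 (FT 1 f)))"
proof
  assume "l2_distribution f \<in> sobolev s"
  then obtain g where g: "has_fourier_transform (l2_distribution f) g" "square_integrable (bessel_weight s g)"
    by (auto simp: sobolev_def)
  show "square_integrable (bessel_weight s (rep_l2 (FT 1 f)))"
    by (rule square_integrable_cong_AE[OF g(2) measurable_bessel_weight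
          bessel_weight_AE_cong[OF has_fourier_transform_unique[OF g(1) has_fourier_transform_rep_FT]]]) simp
next
  assume "square_integrable (bessel_weight s (rep_l2 (FT 1 f)))"
  then show "l2_distribution f \<in> sobolev s"
    using has_fourier_transform_rep_FT[of f] tempered_l2_distribution[of f] by (auto simp: sobolev_def)
qed

lemma sobolev_norm_l2:
  fixes f :: "('n::finite) l2"
  shows "sobolev_norm s (l2_distribution f) = L2norm (bessel_weight s (rep_l2 (FT 1 f)))"
proof -
  let ?g = "SOME g. has_fourier_transform (l2_distribution f) g"
  have g: "has_fourier_transform (l2_distribution f) ?g"
    using has_fourier_transform_rep_FT[of f] by (rule someI[of "has_fourier_transform (l2_distribution f)"])
  have "AE x in lborel. ?g x = rep_l2 (FT 1 f) x"
    by (rule has_fourier_transform_unique[OF g has_fourier_transform_rep_FT])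
  moreover have "?g \<in> borel_measurable borel" using g by (rule has_fourier_transform_measurable)
  ultimately show ?thesis
    unfolding sobolev_norm_def
    by (intro L2norm_cong_AE measurable_bessel_weight bessel_weight_AE_cong) simp_all
qed

lemma FT_surj: "FT 1 ((1 / (2 * pi) ^ CARD('n)) *\<^sub>R FT (-1) F) = (F :: ('n::finite) l2)"
proof -
  have "FT 1 (FT (-1) F) = (2 * pi) ^ CARD('n) *\<^sub>R F"
    using FT_inversion[of "-1" F] by simp
  then show ?thesis
    by (simp add: linear_scale[OF bounded_linear.linear[OF bounded_linear_FT]])
qed

lemma FT_inj:
  fixes f g :: "('n::finite) l2"
  assumes "FT 1 f = FT 1 g" shows "f = g"
proof -
  have "(2 * pi) ^ CARD('n) *\<^sub>R f = (2 * pi) ^ CARD('n) *\<^sub>R g"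
    unfolding FT_inversion[of 1, OF one_power2, symmetric] assms ..
  then show ?thesis by simp
qed

text \<open>Resolves the definite description: the inverse transform of the product is a candidate,
  and any other one has the same Fourier transform almost everywhere.\<close>

lemma FT_fourier_multiplier:
  fixes f :: "('n::finite) l2"
  assumes m: "square_integrable (\<lambda>\<xi>. m \<xi> * rep_l2 (FT 1 f) \<xi>)" and [measurable]: "m \<in> borel_measurable borel"
  shows "FT 1 (fourier_multiplier m f) = abs_l2 (\<lambda>\<xi>. m \<xi> * rep_l2 (FT 1 f) \<xi>)"
proof -
  let ?F = "abs_l2 (\<lambda>\<xi>. m \<xi> * rep_l2 (FT 1 f) \<xi>)"
  let ?h = "(1 / (2 * pi) ^ CARD('n)) *\<^sub>R FT (-1) ?F"
  have h: "has_fourier_transform (l2_distribution ?h) (\<lambda>\<xi>. m \<xi> * rep_l2 (FT 1 f) \<xi>)"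
    by (rule has_fourier_transform_l2[OF m]) (simp only: FT_surj)
  have "fourier_multiplier m f = ?h"
    unfolding fourier_multiplier_def
  proof (rule the_equality)
    show "\<exists>g. has_fourier_transform (l2_distribution f) g \<and> has_fourier_transform (l2_distribution ?h) (\<lambda>\<xi>. m \<xi> * g \<xi>)"
      using h has_fourier_transform_rep_FT by blast
    fix h' assume "\<exists>g. has_fourier_transform (l2_distribution f) g \<and> has_fourier_transform (l2_distribution h') (\<lambda>\<xi>. m \<xi> * g \<xi>)"
    then obtain g where g: "has_fourier_transform (l2_distribution f) g"
      "has_fourier_transform (l2_distribution h') (\<lambda>\<xi>. m \<xi> * g \<xi>)" by blast
    have "AE x in lborel. rep_l2 (FT 1 h') x = rep_l2 (FT 1 ?h) x"
      using has_fourier_transform_unique[OF g(1) has_fourier_transform_rep_FT]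
        has_fourier_transform_unique[OF g(2) has_fourier_transform_rep_FT] AE_rep_abs_l2[OF m]
      unfolding FT_surj by eventually_elim simp
    then show "h' = ?h" by (rule FT_inj[OF l2_eqI])
  qed
  then show ?thesis by (simp only: FT_surj)
qed

lemma norm_frac_laplacian:
  fixes f :: "('n::finite) l2"
  assumes "square_integrable (\<lambda>\<xi>. of_real (norm \<xi> powr (2 * a)) * rep_l2 (FT 1 f) \<xi>)"
  shows "norm (frac_laplacian a f)
    = L2norm (\<lambda>\<xi>. of_real (norm \<xi> powr (2 * a)) * rep_l2 (FT 1 f) \<xi>) / sqrt ((2 * pi) ^ CARD('n))"
proof -
  have "sqrt ((2 * pi) ^ CARD('n)) * norm (frac_laplacian a f) = norm (FT 1 (frac_laplacian a f))"
    by (simp add: Plancherel)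
  also have "\<dots> = L2norm (\<lambda>\<xi>. of_real (norm \<xi> powr (2 * a)) * rep_l2 (FT 1 f) \<xi>)"
    unfolding frac_laplacian_def
    by (subst FT_fourier_multiplier) (use assms in \<open>auto simp: norm_abs_l2\<close>)
  finally show ?thesis by (simp add: field_simps)
qed

text \<open>Integrability of \<open>m\<close> makes its inverse transform an actual integral, and
  \<open>ft_convolution\<close> rewrites the convolution as the inverse transform of the product of
  \<open>m\<close> and \<open>ft 1 f\<close>, which lies in L1 and L2 and so falls under
  \<open>FT_surj\<close>.\<close>

lemma FT_convolution_kernel:
  fixes m :: "real^'n::finite \<Rightarrow> complex"
  assumes mi: "integrable lborel m" and m: "bounded_symbol B m"
    and f: "integrable lborel f" "square_integrable f"
  shows "FT 1 (abs_l2 (Defs.convolution (inverse_fourier m) f)) = symbol_mult m (FT 1 (abs_l2 f))"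
proof -
  let ?N = "complex_of_real ((2 * pi) ^ CARD('n))"
  let ?F = "\<lambda>\<xi>. m \<xi> * ft 1 f \<xi>"
  note [measurable] = bounded_symbolD(1)[OF m]
  have [measurable]: "f \<in> borel_measurable borel" using f(2) by (rule square_integrable_measurable)
  have F1: "integrable lborel ?F"
  proof (rule Bochner_Integration.integrable_bound)
    show "integrable lborel (\<lambda>\<xi>. m \<xi> * of_real (L1norm f))" using mi by simp
    show "AE x in lborel. norm (m x * ft 1 f x) \<le> norm (m x * complex_of_real (L1norm f))"
      using cmod_ft_le[of 1 f] by (auto simp: norm_mult intro!: mult_left_mono AE_I2)
  qed measurable
  have F2: "square_integrable ?F"
    by (intro square_integrable_symbol[OF m] ft_L2_bound(1) f) simp
  have conv: "Defs.convolution (inverse_fourier m) f = (\<lambda>x. (1 / (2 * pi) ^ CARD('n)) *\<^sub>R ft (-1) ?F x)"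
  proof
    fix x
    have "Defs.convolution (inverse_fourier m) f x = (LINT y|lborel. (f y * ft (-1) m (x - y)) / ?N)"
      unfolding Defs.convolution_def inverse_fourier_eq_ft by (simp add: mult.commute)
    also have "\<dots> = (LINT y|lborel. f y * ft (-1) m (x - y)) / ?N" by (rule integral_divide_zero)
    also have "\<dots> = ft (-1) ?F x / ?N" using ft_convolution[OF mi f(1), of "-1" x] by simp
    finally show "Defs.convolution (inverse_fourier m) f x = (1 / (2 * pi) ^ CARD('n)) *\<^sub>R ft (-1) ?F x"
      by (simp add: scaleR_conv_of_real)
  qed
  have "abs_l2 (Defs.convolution (inverse_fourier m) f) = (1 / (2 * pi) ^ CARD('n)) *\<^sub>R FT (-1) (abs_l2 ?F)"
    unfolding conv FT_abs_l2[OF F1 F2, of "-1", simplified]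
    by (rule abs_l2_scaleR[symmetric]) (intro ft_L2_bound F1 F2, simp)
  then have "FT 1 (abs_l2 (Defs.convolution (inverse_fourier m) f)) = abs_l2 ?F"
    by (simp only: FT_surj)
  also have "\<dots> = symbol_mult m (FT 1 (abs_l2 f))"
    by (simp add: FT_abs_l2[OF f] symbol_mult_abs_l2[OF m] ft_L2_bound f)
  finally show ?thesis .
qed

section \<open>Sobolev embedding\<close>

lemma nn_integral_powr_Icc:
  fixes a c :: real
  assumes "a > -1" "c \<ge> 0"
  shows "(\<integral>\<^sup>+x. ennreal (indicator {0..c} x * x powr a) \<partial>lborel) = ennreal (c powr (a + 1) / (a + 1))"
  using nn_integral_has_integral_lebesgue[OF _ has_integral_powr_from_0[OF assms]] by simp

lemma integrable_abs_powr_Icc: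
  fixes a :: real
  assumes "a > -1"
  shows "integrable lborel (\<lambda>t. indicator {-1..1} t * \<bar>t\<bar> powr a)"
proof -
  define f where "f t = indicator {0..1} t * t powr a" for t :: real
  have [measurable]: "f \<in> borel_measurable borel" by (simp add: f_def[abs_def])
  have f: "integrable lborel f"
    by (rule integrableI_nonneg) (auto simp: f_def nn_integral_powr_Icc[OF assms, of 1] intro!: AE_I2)
  have "integrable lborel (\<lambda>t. f (0 + (-1) * t))"
    by (rule lborel_integrable_real_affine[OF f]) simp
  then have "integrable lborel (\<lambda>t. f t + f (- t))" using f by simp
  then show ?thesis
    by (rule Bochner_Integration.integrable_bound) (auto simp: f_def indicator_def intro!: AE_I2)
qed

lemma AE_inner_Basis_neq_0: "AE x in lborel. \<forall>b\<in>Basis. (x :: 'a::euclidean_space) \<bullet> b \<noteq> 0"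
proof (rule AE_finite_allI[OF finite_Basis])
  fix b :: 'a assume b: "b \<in> Basis"
  have "{x. x \<bullet> b = 0} \<in> null_sets lebesgue"
    using negligible_standard_hyperplane[OF b, of 0] by (simp add: negligible_iff_null_sets)
  then have "{x. x \<bullet> b = 0} \<in> null_sets lborel"
    by (subst (asm) null_sets_completion_iff) auto
  then show "AE x in lborel. x \<bullet> b \<noteq> 0"
    using AE_not_in by fastforce
qed

section \<open>The singular weight and the low frequencies\<close>

definition singular_weight :: "real \<Rightarrow> real \<Rightarrow> real^'n \<Rightarrow> complex" where
  "singular_weight s A \<xi> = of_real (indicator (cball 0 A) \<xi> * norm \<xi> powr (-s))"

lemma measurable_singular_weight [measurable]:
  "(singular_weight s A :: real^'n \<Rightarrow> complex) \<in> borel_measurable borel"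
proof -
  have [measurable]: "(indicator (cball 0 A) :: real^'n \<Rightarrow> real) \<in> borel_measurable borel"
    by (intro borel_measurable_indicator) simp
  show ?thesis unfolding singular_weight_def[abs_def] by measurable
qed

text \<open>The square, \<open>norm x powr (-2 * s)\<close>, is a product of \<open>CARD('n)\<close>
  equal factors with exponent \<open>-a\<close>. Replacing \<open>norm x\<close> by a different
  coordinate in each factor gives a majorant that is a product of functions of one variable,
  integrable because \<open>a < 1\<close>.\<close>

lemma square_integrable_singular_weight_1:
  assumes s: "0 \<le> s" "2 * s < real CARD('n)"
  shows "square_integrable (singular_weight s 1 :: real^'n::finite \<Rightarrow> complex)"
  unfolding square_integrable_def
proof
  let ?n = "real CARD('n)"
  define a where "a = 2 * s / ?n"
  have n: "?n > 0" by simp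
  have a: "0 \<le> a" "a < 1" using s n by (auto simp: a_def)
  define h :: "real \<Rightarrow> complex" where "h t = of_real (indicator {-1..1} t * \<bar>t\<bar> powr (-a))" for t
  have "integrable lborel h"
    unfolding h_def[abs_def] by (intro integrable_of_real integrable_abs_powr_Icc) (use a in simp)
  then have "integrable lborel (\<lambda>x::real^'n. \<Prod>b\<in>Basis. h (x \<bullet> b))"
    by (intro integral_lborel_prod(1))
  then show "integrable lborel (\<lambda>x::real^'n. (cmod (singular_weight s 1 x))\<^sup>2)"
  proof (rule Bochner_Integration.integrable_bound)
    show "AE x::real^'n in lborel. norm ((cmod (singular_weight s 1 x))\<^sup>2) \<le> norm (\<Prod>b\<in>Basis. h (x \<bullet> b))"
      \<comment> \<open>On a coordinate hyperplane \<open>0 powr (-a) = 0\<close> makes the product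
        vanish, so the majorant is available only off this null set.\<close>
      using AE_inner_Basis_neq_0
    proof eventually_elim
      case (elim x)
      show ?case
      proof (cases "norm x \<le> 1")
        case True
        have le: "\<bar>x \<bullet> b\<bar> \<le> norm x" if "b \<in> Basis" for b using Basis_le_norm[OF that] .
        have "(norm x powr (-s))\<^sup>2 = (norm x powr (-a)) ^ CARD('n)"
        proof (cases "x = 0")
          case False
          then show ?thesis using n
            by (simp add: powr_realpow[symmetric] powr_powr a_def mult.commute)
        qed simp
        also have "\<dots> = (\<Prod>b\<in>(Basis::(real^'n) set). norm x powr (-a))" by simp
        also have "\<dots> \<le> (\<Prod>b\<in>(Basis::(real^'n) set). \<bar>x \<bullet> b\<bar> powr (-a))"
          using elim le a by (intro prod_mono conjI powr_mono2') auto
        also have "\<dots> = (\<Prod>b\<in>(Basis::(real^'n) set). norm (h (x \<bullet> b)))"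
        proof (rule prod.cong[OF refl])
          fix b :: "real^'n" assume "b \<in> Basis"
          then show "\<bar>x \<bullet> b\<bar> powr (-a) = norm (h (x \<bullet> b))"
            using le[of b] True by (simp add: h_def indicator_def abs_le_iff)
        qed
        finally show ?thesis using True by (simp add: singular_weight_def prod_norm)
      qed (simp add: singular_weight_def)
    qed
  qed measurable
qed simp

lemma singular_weight_scale:
  assumes A: "A > 0"
  shows "singular_weight s A (A *\<^sub>R \<xi>) = of_real (A powr (-s)) * singular_weight s 1 \<xi>"
  using A by (auto simp: singular_weight_def indicator_def powr_mult)

text \<open>Both parts come from the substitution that scales the ball of radius \<open>A\<close> to
  the unit ball.\<close>

lemma singular_weight_L2:
  assumes s: "0 \<le> s" "2 * s < real CARD('n)" and A: "A > 0"
  shows "square_integrable (singular_weight s A :: real^'n::finite \<Rightarrow> complex)"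
    and "L2norm (singular_weight s A :: real^'n \<Rightarrow> complex)
      = A powr (real CARD('n) / 2 - s) * L2norm (singular_weight s 1 :: real^'n \<Rightarrow> complex)"
proof -
  let ?f = "\<lambda>\<xi>::real^'n. (cmod (singular_weight s A \<xi>))\<^sup>2"
  have f: "?f (0 + A *\<^sub>R \<xi>) = (A powr (-s))\<^sup>2 * (cmod (singular_weight s 1 \<xi>))\<^sup>2" for \<xi> :: "real^'n"
    by (simp add: singular_weight_scale[OF A] norm_mult power_mult_distrib)
  have [measurable]: "?f \<in> borel_measurable borel" by measurable
  have "integrable lborel (\<lambda>\<xi>. ?f (0 + A *\<^sub>R \<xi>))"
    unfolding f using square_integrable_singular_weight_1[OF s] by (simp add: square_integrable_def)
  then have "integrable lborel ?f"
    by (subst (asm) integrable_lborel_affine_iff) (use A in auto)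
  then show "square_integrable (singular_weight s A :: real^'n \<Rightarrow> complex)" by (simp add: square_integrable_def)
  have "(LINT \<xi>|lborel. ?f \<xi>) = \<bar>A\<bar> ^ DIM(real^'n) *\<^sub>R (LINT \<xi>|lborel. ?f (0 + A *\<^sub>R \<xi>))"
    by (rule integral_lborel_affine) (use A in auto)
  also have "\<dots> = (A ^ CARD('n) * (A powr (-s))\<^sup>2) * (LINT \<xi>|lborel. (cmod (singular_weight s 1 (\<xi>::real^'n)))\<^sup>2)"
    unfolding f using A by simp
  also have "A ^ CARD('n) * (A powr (-s))\<^sup>2 = (A powr (real CARD('n) / 2 - s))\<^sup>2"
    using A by (simp add: powr_realpow[symmetric] powr_powr powr_add[symmetric] algebra_simps)
  finally show "L2norm (singular_weight s A :: real^'n \<Rightarrow> complex)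
      = A powr (real CARD('n) / 2 - s) * L2norm (singular_weight s 1 :: real^'n \<Rightarrow> complex)"
    unfolding L2norm_def by (simp add: real_sqrt_mult)
qed

text \<open>Cauchy-Schwarz after inserting \<open>norm \<xi> powr (-s) * norm \<xi> powr s\<close>,
  which is 1 except at the origin, where \<open>powr\<close> vanishes.\<close>

lemma low_frequency_L1:
  fixes g :: "real^'n::finite \<Rightarrow> complex"
  assumes g: "square_integrable g" and W: "square_integrable (\<lambda>\<xi>. of_real (norm \<xi> powr s) * g \<xi>)"
    and s: "0 \<le> s" "2 * s < real CARD('n)" and A: "A > 0"
  shows "L1norm (\<lambda>\<xi>. indicator (cball 0 A) \<xi> * g \<xi>)
    \<le> A powr (real CARD('n) / 2 - s) * L2norm (singular_weight s 1 :: real^'n \<Rightarrow> complex)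
        * L2norm (\<lambda>\<xi>. of_real (norm \<xi> powr s) * g \<xi>)"
proof -
  note sw = singular_weight_L2[OF s A]
  have [measurable]: "g \<in> borel_measurable borel" using g by (rule square_integrable_measurable)
  have "L1norm (\<lambda>\<xi>. indicator (cball 0 A) \<xi> * g \<xi>)
      = (LINT \<xi>|lborel. cmod (singular_weight s A \<xi>) * cmod (of_real (norm \<xi> powr s) * g \<xi>))"
    unfolding L1norm_def
  proof (rule integral_cong_AE)
    show "AE \<xi> in lborel. cmod (indicator (cball 0 A) \<xi> * g \<xi>)
        = cmod (singular_weight s A \<xi>) * cmod (of_real (norm \<xi> powr s) * g \<xi>)"
      using AE_lborel_singleton[of 0]
    proof eventually_elim
      case (elim \<xi>)
      have "norm \<xi> powr (-s) * norm \<xi> powr s = 1" using elim by (simp flip: powr_add)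
      then show ?case
        by (auto simp: singular_weight_def indicator_def norm_mult simp flip: mult.assoc)
    qed
  next
    have "(indicator (cball 0 A) :: real^'n \<Rightarrow> complex) \<in> borel_measurable borel"
      by (intro borel_measurable_indicator) simp
    then show "(\<lambda>\<xi>. cmod (indicator (cball 0 A) \<xi> * g \<xi>)) \<in> borel_measurable lborel" by measurable
  qed auto
  also have "\<dots> \<le> L2norm (singular_weight s A :: real^'n \<Rightarrow> complex) * L2norm (\<lambda>\<xi>. of_real (norm \<xi> powr s) * g \<xi>)"
    by (rule L2_Cauchy_Schwarz[OF sw(1) W])
  finally show ?thesis by (simp add: sw(2))
qed

section \<open>Level sets and the homogeneous embedding\<close>

lemma layer_cake_powr:
  fixes f :: "'a::euclidean_space \<Rightarrow> real"
  assumes [measurable]: "f \<in> borel_measurable borel" and f: "\<And>x. 0 \<le> f x" and q: "q > 0"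
  shows "(\<integral>\<^sup>+x. ennreal (f x powr q) \<partial>lborel)
    = (\<integral>\<^sup>+l. ennreal (indicator {0<..} l * (q * l powr (q - 1))) * emeasure lborel {x. l \<le> f x} \<partial>lborel)"
proof -
  have "ennreal (f x powr q) = (\<integral>\<^sup>+l. ennreal (indicator {0..f x} l * (q * l powr (q - 1))) \<partial>lborel)" for x
  proof -
    have "(\<integral>\<^sup>+l. ennreal (indicator {0..f x} l * (q * l powr (q - 1))) \<partial>lborel)
        = (\<integral>\<^sup>+l. ennreal q * ennreal (indicator {0..f x} l * l powr (q - 1)) \<partial>lborel)"
      using q by (intro nn_integral_cong) (simp add: ennreal_mult'[symmetric] mult.left_commute)
    also have "\<dots> = ennreal q * ennreal (f x powr q / q)"
      using nn_integral_powr_Icc[of "q - 1" "f x"] q f by (subst nn_integral_cmult) auto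
    also have "\<dots> = ennreal (f x powr q)" using q by (simp flip: ennreal_mult')
    finally show ?thesis ..
  qed
  then have "(\<integral>\<^sup>+x. ennreal (f x powr q) \<partial>lborel)
      = (\<integral>\<^sup>+x. \<integral>\<^sup>+l. ennreal (indicator {0<..} l * (q * l powr (q - 1))) * indicator {x. l \<le> f x} x \<partial>lborel \<partial>lborel)"
    \<comment> \<open>The level \<open>l = 0\<close> contributes nothing on either side because
      \<open>0 powr (q - 1) = 0\<close>.\<close>
    by (simp only:) (intro nn_integral_cong, auto simp: indicator_def)
  also have "\<dots> = (\<integral>\<^sup>+l. \<integral>\<^sup>+x. ennreal (indicator {0<..} l * (q * l powr (q - 1))) * indicator {x. l \<le> f x} x \<partial>lborel \<partial>lborel)"
    by (rule lborel_pair.Fubini') measurable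
  also have "\<dots> = (\<integral>\<^sup>+l. ennreal (indicator {0<..} l * (q * l powr (q - 1))) * emeasure lborel {x. l \<le> f x} \<partial>lborel)"
    by (intro nn_integral_cong, subst nn_integral_cmult_indicator) auto
  finally show ?thesis .
qed

text \<open>If the frequency \<open>A\<close> is such that the low-frequency part of \<open>u\<close> is bounded by \<open>l / 2\<close>, then the level
  set of \<open>u\<close> at \<open>l\<close> is contained in that of the high-frequency part at \<open>l / 2\<close>. Choosing \<open>A\<close> in terms of
  \<open>l\<close> and integrating over \<open>l\<close> gives the embedding (Chemin and Xu).\<close>

lemma distribution_function_bound:
  fixes u :: "('n::finite) l2"
  defines "g \<equiv> rep_l2 (FT 1 u)" and "n \<equiv> real CARD('n)"
  assumes W: "square_integrable (\<lambda>\<xi>. of_real (norm \<xi> powr s) * g \<xi>)"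
    and s: "0 \<le> s" "2 * s < n" and A: "A > 0" and l: "l > 0"
    and le: "A powr (n / 2 - s) * L2norm (singular_weight s 1 :: real^'n \<Rightarrow> complex)
        * L2norm (\<lambda>\<xi>. of_real (norm \<xi> powr s) * g \<xi>) \<le> (2 * pi) ^ CARD('n) * (l / 2)"
  shows "emeasure lborel {x. l \<le> cmod (rep_l2 u x)}
    \<le> ennreal (4 / l\<^sup>2 / (2 * pi) ^ CARD('n)) * (\<integral>\<^sup>+\<xi>. ennreal (indicator (- cball 0 A) \<xi> * (cmod (g \<xi>))\<^sup>2) \<partial>lborel)"
proof -
  let ?N = "(2 * pi) ^ CARD('n)"
  let ?lo = "\<lambda>\<xi>. indicator (cball 0 A) \<xi> * g \<xi>" and ?hi = "\<lambda>\<xi>. indicator (- cball 0 A) \<xi> * g \<xi>"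
  have N: "?N > 0" by simp
  have g: "square_integrable g" by (simp add: g_def)
  have [measurable]: "g \<in> borel_measurable borel" by (simp add: g_def)
  have lo: "integrable lborel ?lo" "square_integrable ?lo"
    by (rule square_integrable_prod_integrable[OF square_integrable_indicator_bounded g], simp, simp)
      (rule square_integrable_symbol[OF bounded_symbol_indicator g], simp)
  have hi: "square_integrable ?hi"
    by (rule square_integrable_symbol[OF bounded_symbol_indicator g]) simp
  \<comment> \<open>The low-frequency part of \<open>u\<close>, taken as a Fourier integral and not
    as a class, so that \<open>wb\<close> bounds it at every point; \<open>v\<close> below is the
    high-frequency part.\<close>
  define w where "w x = (1 / ?N) *\<^sub>R ft (-1) ?lo x" for x
  have w2: "square_integrable w"
    unfolding w_def[abs_def] using ft_L2_bound(1)[OF lo, of "-1"] by (intro square_integrable_scaleR) simp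
  have wabs: "abs_l2 w = (1 / ?N) *\<^sub>R FT (-1) (abs_l2 ?lo)"
    using ft_L2_bound(1)[OF lo, of "-1"] FT_abs_l2[OF lo, of "-1"]
    by (simp add: w_def[abs_def] abs_l2_scaleR del: scaleR_conv_of_real)
  have "FT 1 (abs_l2 w) = abs_l2 ?lo" unfolding wabs by (rule FT_surj)
  moreover have "abs_l2 ?lo + abs_l2 ?hi = abs_l2 g"
    unfolding abs_l2_add[OF lo(2) hi]
    by (rule arg_cong[where f = abs_l2]) (auto simp: indicator_def)
  moreover have "abs_l2 g = FT 1 u" by (simp add: g_def)
  ultimately have FTv: "FT 1 (u - abs_l2 w) = abs_l2 ?hi"
    by (simp add: linear_diff[OF bounded_linear.linear[OF bounded_linear_FT]] algebra_simps)
  define v where "v = rep_l2 (u - abs_l2 w)"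
  have [measurable]: "v \<in> borel_measurable borel" by (simp add: v_def)
  have "sqrt ?N * L2norm v = L2norm ?hi"
    using Plancherel[of 1 "u - abs_l2 w"] by (simp add: FTv norm_abs_l2[OF hi] v_def norm_l2_eq[of "u - abs_l2 w"])
  then have "(sqrt ?N * L2norm v)\<^sup>2 = (L2norm ?hi)\<^sup>2" by simp
  then have vn: "?N * (L2norm v)\<^sup>2 = (L2norm ?hi)\<^sup>2" using N by (simp add: power_mult_distrib)
  have wb: "cmod (w x) \<le> l / 2" for x
  proof -
    have "cmod (ft (-1) ?lo x) \<le> ?N * (l / 2)"
      using cmod_ft_le[of "-1" ?lo x] low_frequency_L1[OF g W s(1) s(2)[unfolded n_def] A] le
      unfolding n_def by linarith
    then show ?thesis using N by (simp add: w_def pos_divide_le_eq mult.commute del: scaleR_conv_of_real)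
  qed
  have "AE x in lborel. v x = rep_l2 u x - w x"
    unfolding v_def using AE_rep_l2_diff[of u "abs_l2 w"] AE_rep_abs_l2[OF w2] by eventually_elim simp
  then have "AE x in lborel. l \<le> cmod (rep_l2 u x) \<longrightarrow> l / 2 \<le> cmod (v x)"
  proof eventually_elim
    case (elim x)
    then show ?case using wb[of x] norm_triangle_ineq2[of "rep_l2 u x" "w x"] by auto
  qed
  then have "emeasure lborel {x. l \<le> cmod (rep_l2 u x)} \<le> emeasure lborel {x. l / 2 \<le> cmod (v x)}"
    by (intro emeasure_mono_AE) auto
  also have "\<dots> = (\<integral>\<^sup>+x. indicator {x. l / 2 \<le> cmod (v x)} x \<partial>lborel)"
    by (subst nn_integral_indicator) auto
  \<comment> \<open>Chebyshev's inequality at level \<open>l / 2\<close>.\<close>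
  also have "\<dots> \<le> (\<integral>\<^sup>+x. ennreal (4 / l\<^sup>2) * ennreal ((cmod (v x))\<^sup>2) \<partial>lborel)"
  proof (rule nn_integral_mono)
    fix x
    show "indicator {x. l / 2 \<le> cmod (v x)} x \<le> ennreal (4 / l\<^sup>2) * ennreal ((cmod (v x))\<^sup>2)"
    proof (cases "l / 2 \<le> cmod (v x)")
      case True
      then have "(l / 2)\<^sup>2 \<le> (cmod (v x))\<^sup>2" using l by (intro power_mono) auto
      then have "1 \<le> 4 / l\<^sup>2 * (cmod (v x))\<^sup>2" using l by (simp add: power_divide field_simps)
      then show ?thesis using True by (simp flip: ennreal_mult' ennreal_1 add: ennreal_leI)
    qed simp
  qed
  also have "\<dots> = ennreal (4 / l\<^sup>2) * ennreal ((L2norm v)\<^sup>2)"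
    by (subst nn_integral_cmult) (auto simp: nn_integral_L2norm v_def)
  also have "(L2norm v)\<^sup>2 = (L2norm ?hi)\<^sup>2 / ?N" using vn N by (simp add: field_simps)
  also have "ennreal (4 / l\<^sup>2) * ennreal ((L2norm ?hi)\<^sup>2 / ?N) = ennreal (4 / l\<^sup>2 / ?N) * ennreal ((L2norm ?hi)\<^sup>2)"
    using N by (simp flip: ennreal_mult')
  also have "ennreal ((L2norm ?hi)\<^sup>2) = (\<integral>\<^sup>+\<xi>. ennreal (indicator (- cball 0 A) \<xi> * (cmod (g \<xi>))\<^sup>2) \<partial>lborel)"
    unfolding nn_integral_L2norm[OF hi, symmetric]
    by (intro nn_integral_cong) (auto simp: indicator_def norm_mult)
  finally show ?thesis .
qed

text \<open>Since \<open>n / 2 - s = n / q\<close>, the condition on the low frequencies suggests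
  the radius with \<open>A powr (n / q) = l / L\<close>. After the exchange of integrals each
  \<open>\<xi>\<close> sees the levels up to \<open>L * norm \<xi> powr (n / q)\<close>, and
  \<open>(n / q) * (q - 2) = 2 * s\<close> produces the homogeneous Sobolev norm.\<close>

lemma Lq_integral_bound:
  fixes u :: "('n::finite) l2"
  defines "g \<equiv> rep_l2 (FT 1 u)" and "n \<equiv> real CARD('n)"
  assumes q: "q > 2" and s: "s = n * (1/2 - 1/q)"
    and W: "square_integrable (\<lambda>\<xi>. of_real (norm \<xi> powr s) * g \<xi>)"
    and L: "L > 0"
    and HL: "2 * L2norm (singular_weight s 1 :: real^'n \<Rightarrow> complex)
        * L2norm (\<lambda>\<xi>. of_real (norm \<xi> powr s) * g \<xi>) \<le> (2 * pi) ^ CARD('n) * L"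
  shows "(\<integral>\<^sup>+x. ennreal (cmod (rep_l2 u x) powr q) \<partial>lborel)
    \<le> ennreal (4 * q / (2 * pi) ^ CARD('n) * (L powr (q - 2) / (q - 2))
        * (L2norm (\<lambda>\<xi>. of_real (norm \<xi> powr s) * g \<xi>))\<^sup>2)"
proof -
  let ?N = "(2 * pi) ^ CARD('n)"
  let ?K = "L2norm (singular_weight s 1 :: real^'n \<Rightarrow> complex)"
  let ?H = "L2norm (\<lambda>\<xi>. of_real (norm \<xi> powr s) * g \<xi>)"
  have N: "?N > 0" by simp
  have n: "n > 0" by (simp add: n_def)
  have s0: "0 \<le> s" "2 * s < n" using q n by (auto simp: s field_simps)
  have ns: "n / 2 - s = n / q" using q by (simp add: s field_simps)
  have [measurable]: "g \<in> borel_measurable borel" by (simp add: g_def)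
  \<comment> \<open>The exponent \<open>q - 3\<close> is \<open>q - 1\<close> from the layer cake
    minus 2 from Chebyshev's inequality; it exceeds -1 because \<open>q > 2\<close>.\<close>
  define F where "F l \<xi> = ennreal (4 * q / ?N * (cmod (g \<xi>))\<^sup>2)
      * ennreal (indicator {0..L * norm \<xi> powr (n / q)} l * l powr (q - 3))" for l and \<xi> :: "real^'n"
  have Fm [measurable]: "case_prod F \<in> borel_measurable (borel \<Otimes>\<^sub>M borel)"
  proof -
    have "{z \<in> space (borel \<Otimes>\<^sub>M borel :: (real \<times> (real^'n)) measure). 0 \<le> fst z \<and> fst z \<le> L * norm (snd z) powr (n / q)}
        \<in> sets (borel \<Otimes>\<^sub>M borel)"
      by measurable
    then have "{z::real \<times> (real^'n). 0 \<le> fst z \<and> fst z \<le> L * norm (snd z) powr (n / q)} \<in> sets (borel \<Otimes>\<^sub>M borel)"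
      by (simp add: space_pair_measure)
    then have "(indicator {z::real \<times> (real^'n). 0 \<le> fst z \<and> fst z \<le> L * norm (snd z) powr (n / q)} :: _ \<Rightarrow> real)
        \<in> borel_measurable (borel \<Otimes>\<^sub>M borel)" by (rule borel_measurable_indicator)
    then have "(\<lambda>z. ennreal (4 * q / ?N * (cmod (g (snd z)))\<^sup>2)
      * ennreal (indicator {z. 0 \<le> fst z \<and> fst z \<le> L * norm (snd z) powr (n / q)} z * fst z powr (q - 3)))
        \<in> borel_measurable (borel \<Otimes>\<^sub>M borel)" by measurable
    moreover have "case_prod F = (\<lambda>z. ennreal (4 * q / ?N * (cmod (g (snd z)))\<^sup>2)
      * ennreal (indicator {z. 0 \<le> fst z \<and> fst z \<le> L * norm (snd z) powr (n / q)} z * fst z powr (q - 3)))"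
      by (auto simp: F_def indicator_def fun_eq_iff)
    ultimately show ?thesis by simp
  qed
  have Fl [measurable]: "F l \<in> borel_measurable borel" for l
    using measurable_compose[OF measurable_Pair1' Fm, of l] by simp
  have "(\<integral>\<^sup>+x. ennreal (cmod (rep_l2 u x) powr q) \<partial>lborel)
      = (\<integral>\<^sup>+l. ennreal (indicator {0<..} l * (q * l powr (q - 1))) * emeasure lborel {x. l \<le> cmod (rep_l2 u x)} \<partial>lborel)"
    by (rule layer_cake_powr) (use q in auto)
  also have "\<dots> \<le> (\<integral>\<^sup>+l. \<integral>\<^sup>+\<xi>. F l \<xi> \<partial>lborel \<partial>lborel)"
  proof (rule nn_integral_mono)
    fix l :: real
    show "ennreal (indicator {0<..} l * (q * l powr (q - 1))) * emeasure lborel {x. l \<le> cmod (rep_l2 u x)}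
        \<le> (\<integral>\<^sup>+\<xi>. F l \<xi> \<partial>lborel)"
    proof (cases "l > 0")
      case l: True
      define A where "A = (l / L) powr (q / n)"
      have A: "A > 0" using l L by (simp add: A_def)
      have Anq: "A powr (n / q) = l / L" using l L q n by (simp add: A_def powr_powr)
      have le: "A powr (n / 2 - s) * ?K * ?H \<le> ?N * (l / 2)"
      proof -
        have "(l / L) * (2 * ?K * ?H) \<le> (l / L) * (?N * L)"
          using HL l L by (intro mult_left_mono) auto
        then show ?thesis unfolding ns Anq using L by (simp add: field_simps)
      qed
      have "ennreal (q * l powr (q - 1)) * emeasure lborel {x. l \<le> cmod (rep_l2 u x)}
          \<le> ennreal (q * l powr (q - 1)) * (ennreal (4 / l\<^sup>2 / ?N) * (\<integral>\<^sup>+\<xi>. ennreal (indicator (- cball 0 A) \<xi> * (cmod (g \<xi>))\<^sup>2) \<partial>lborel))"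
        unfolding g_def
        by (intro mult_left_mono distribution_function_bound A l)
          (use W s0 le in \<open>auto simp: g_def n_def\<close>)
      also have "\<dots> = (\<integral>\<^sup>+\<xi>. ennreal (q * l powr (q - 1) * (4 / l\<^sup>2 / ?N)) * ennreal (indicator (- cball 0 A) \<xi> * (cmod (g \<xi>))\<^sup>2) \<partial>lborel)"
      proof -
        have "(indicator (- cball 0 A) :: real^'n \<Rightarrow> real) \<in> borel_measurable borel"
          by (intro borel_measurable_indicator) simp
        then have [measurable]: "(\<lambda>\<xi>. ennreal (indicator (- cball 0 A) \<xi> * (cmod (g \<xi>))\<^sup>2)) \<in> borel_measurable borel"
          by measurable
        show ?thesis
        proof -
          have "ennreal (q * l powr (q - 1)) * ennreal (4 / l\<^sup>2 / ?N) = ennreal (q * l powr (q - 1) * (4 / l\<^sup>2 / ?N))"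
            using q l by (intro ennreal_mult[symmetric]) auto
          then show ?thesis unfolding mult.assoc[symmetric] by (subst nn_integral_cmult) simp_all
        qed
      qed
      also have "\<dots> \<le> (\<integral>\<^sup>+\<xi>. F l \<xi> \<partial>lborel)"
      proof (rule nn_integral_mono)
        fix \<xi> :: "real^'n"
        show "ennreal (q * l powr (q - 1) * (4 / l\<^sup>2 / ?N)) * ennreal (indicator (- cball 0 A) \<xi> * (cmod (g \<xi>))\<^sup>2) \<le> F l \<xi>"
        proof (cases "norm \<xi> > A")
          case True
          have "A powr (n / q) \<le> norm \<xi> powr (n / q)"
            using True A n q by (intro powr_mono2) auto
          then have "l \<le> L * norm \<xi> powr (n / q)" unfolding Anq using L by (simp add: field_simps)
          then have F: "F l \<xi> = ennreal (4 * q / ?N * (cmod (g \<xi>))\<^sup>2) * ennreal (l powr (q - 3))"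
            using l by (simp add: F_def)
          have "l powr (q - 1) = l powr (q - 3) * l powr 2" by (simp flip: powr_add)
          then have "q * l powr (q - 1) * (4 / l\<^sup>2 / ?N) = 4 * q / ?N * l powr (q - 3)"
            using l by (simp add: powr_numeral)
          then have "ennreal (q * l powr (q - 1) * (4 / l\<^sup>2 / ?N)) * ennreal (indicator (- cball 0 A) \<xi> * (cmod (g \<xi>))\<^sup>2)
              = ennreal (4 * q / ?N * l powr (q - 3)) * ennreal ((cmod (g \<xi>))\<^sup>2)"
            using True by simp
          also have "\<dots> = ennreal (4 * q / ?N * l powr (q - 3) * (cmod (g \<xi>))\<^sup>2)"
            using q by (intro ennreal_mult[symmetric]) auto
          also have "4 * q / ?N * l powr (q - 3) * (cmod (g \<xi>))\<^sup>2 = 4 * q / ?N * (cmod (g \<xi>))\<^sup>2 * l powr (q - 3)"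
            by simp
          also have "ennreal \<dots> = F l \<xi>"
            unfolding F using q by (intro ennreal_mult) auto
          finally show ?thesis by simp
        qed (simp add: F_def)
      qed
      finally show ?thesis using l by simp
    qed simp
  qed
  also have "\<dots> = (\<integral>\<^sup>+\<xi>. \<integral>\<^sup>+l. F l \<xi> \<partial>lborel \<partial>lborel)"
    by (rule lborel_pair.Fubini') (use Fm in simp)
  also have "\<dots> = (\<integral>\<^sup>+\<xi>. ennreal (4 * q / ?N * (L powr (q - 2) / (q - 2))) * ennreal ((cmod (of_real (norm \<xi> powr s) * g \<xi>))\<^sup>2) \<partial>lborel)"
  proof (rule nn_integral_cong)
    fix \<xi> :: "real^'n"
    have "(\<integral>\<^sup>+l. F l \<xi> \<partial>lborel) = ennreal (4 * q / ?N * (cmod (g \<xi>))\<^sup>2) * ennreal ((L * norm \<xi> powr (n / q)) powr (q - 3 + 1) / (q - 3 + 1))"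
      unfolding F_def using q L by (subst nn_integral_cmult) (auto simp: nn_integral_powr_Icc)
    also have "(L * norm \<xi> powr (n / q)) powr (q - 3 + 1) = L powr (q - 2) * (norm \<xi> powr s)\<^sup>2"
    proof -
      have "n / q * (q - 2) = s * 2" using q by (simp add: s field_simps)
      then have "(norm \<xi> powr (n / q)) powr (q - 2) = (norm \<xi> powr s)\<^sup>2"
        by (simp add: powr_powr power2_eq_square mult_2_right flip: powr_add)
      then show ?thesis using L by (simp add: powr_mult)
    qed
    also have "ennreal (4 * q / ?N * (cmod (g \<xi>))\<^sup>2) * ennreal (L powr (q - 2) * (norm \<xi> powr s)\<^sup>2 / (q - 3 + 1))
        = ennreal (4 * q / ?N * (cmod (g \<xi>))\<^sup>2 * (L powr (q - 2) * (norm \<xi> powr s)\<^sup>2 / (q - 3 + 1)))"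
      using q by (intro ennreal_mult[symmetric]) auto
    also have "4 * q / ?N * (cmod (g \<xi>))\<^sup>2 * (L powr (q - 2) * (norm \<xi> powr s)\<^sup>2 / (q - 3 + 1))
        = 4 * q / ?N * (L powr (q - 2) / (q - 2)) * (cmod (of_real (norm \<xi> powr s) * g \<xi>))\<^sup>2"
      by (simp add: norm_mult power_mult_distrib)
    also have "ennreal \<dots> = ennreal (4 * q / ?N * (L powr (q - 2) / (q - 2))) * ennreal ((cmod (of_real (norm \<xi> powr s) * g \<xi>))\<^sup>2)"
      using q by (intro ennreal_mult) auto
    finally show "(\<integral>\<^sup>+l. F l \<xi> \<partial>lborel) = ennreal (4 * q / ?N * (L powr (q - 2) / (q - 2))) * ennreal ((cmod (of_real (norm \<xi> powr s) * g \<xi>))\<^sup>2)" .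
  qed
  also have "\<dots> = ennreal (4 * q / ?N * (L powr (q - 2) / (q - 2))) * ennreal (?H\<^sup>2)"
    using square_integrable_measurable[OF W] by (subst nn_integral_cmult) (auto simp: nn_integral_L2norm[OF W])
  also have "\<dots> = ennreal (4 * q / ?N * (L powr (q - 2) / (q - 2)) * ?H\<^sup>2)"
    using q N by (subst ennreal_mult) auto
  finally show ?thesis .
qed

lemma powr_minus_two_mult_square:
  fixes h :: real
  assumes "h > 0"
  shows "h powr (q - 2) * h\<^sup>2 = h powr q"
proof -
  have "h powr (q - 2) * h powr 2 = h powr q" by (simp flip: powr_add)
  then show ?thesis using assms by (simp add: powr_numeral)
qed

text \<open>The case \<open>H = 0\<close> needs \<open>L\<close> to be chosen independently of \<open>H\<close>.\<close>

theorem homogeneous_Sobolev_embedding: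
  fixes q s :: real
  assumes q: "q > 2" and s: "s = real CARD('n::finite) * (1/2 - 1/q)"
  shows "\<exists>C\<ge>0. \<forall>u :: 'n l2. square_integrable (\<lambda>\<xi>. of_real (norm \<xi> powr s) * rep_l2 (FT 1 u) \<xi>) \<longrightarrow>
    (\<integral>\<^sup>+x. ennreal (cmod (rep_l2 u x) powr q) \<partial>lborel)
      \<le> ennreal ((C * L2norm (\<lambda>\<xi>. of_real (norm \<xi> powr s) * rep_l2 (FT 1 u) \<xi>)) powr q)"
proof -
  let ?N = "(2 * pi) ^ CARD('n)"
  \<comment> \<open>The summand 1 makes \<open>K\<close>, and with it \<open>L\<close>, positive
    when \<open>?H\<close> is.\<close>
  define K where "K = L2norm (singular_weight s 1 :: real^'n \<Rightarrow> complex) + 1"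
  have K: "K > 0" by (simp add: K_def add_nonneg_pos)
  define c where "c = 4 * q / ?N * ((2 * K / ?N) powr (q - 2) / (q - 2))"
  have c: "c \<ge> 0" using q by (simp add: c_def)
  show ?thesis
  proof (intro exI[of _ "c powr (1 / q)"] conjI allI impI)
    fix u :: "'n l2"
    let ?H = "L2norm (\<lambda>\<xi>. of_real (norm \<xi> powr s) * rep_l2 (FT 1 u) \<xi>)"
    assume W: "square_integrable (\<lambda>\<xi>. of_real (norm \<xi> powr s) * rep_l2 (FT 1 u) \<xi>)"
    define L where "L = (if ?H = 0 then 1 else 2 * K / ?N * ?H)"
    have "?H \<ge> 0" by simp
    have L: "L > 0"
    proof (cases "?H = 0")
      case False
      with \<open>?H \<ge> 0\<close> have "?H > 0" by linarith
      then have "2 * K / ?N * ?H > 0" using K by (intro mult_pos_pos divide_pos_pos) auto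
      then show ?thesis using False by (simp add: L_def)
    qed (simp add: L_def)
    have HL: "2 * L2norm (singular_weight s 1 :: real^'n \<Rightarrow> complex) * ?H \<le> ?N * L"
      using \<open>?H \<ge> 0\<close> by (auto simp: L_def K_def intro!: mult_right_mono)
    have "(\<integral>\<^sup>+x. ennreal (cmod (rep_l2 u x) powr q) \<partial>lborel)
        \<le> ennreal (4 * q / ?N * (L powr (q - 2) / (q - 2)) * ?H\<^sup>2)"
      by (rule Lq_integral_bound[OF q s W L HL])
    also have "4 * q / ?N * (L powr (q - 2) / (q - 2)) * ?H\<^sup>2 = (c powr (1 / q) * ?H) powr q"
    proof (cases "?H = 0")
      case False
      then have H: "?H > 0" using \<open>?H \<ge> 0\<close> by linarith
      have "L powr (q - 2) * ?H\<^sup>2 = (2 * K / ?N) powr (q - 2) * ?H powr q"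
      proof -
        have "L powr (q - 2) = (2 * K / ?N) powr (q - 2) * ?H powr (q - 2)"
          unfolding L_def using H K by (simp only: if_False False powr_mult)
        moreover have "?H powr (q - 2) * ?H\<^sup>2 = ?H powr q"
          by (rule powr_minus_two_mult_square[OF H])
        ultimately show ?thesis by simp
      qed
      then have "4 * q / ?N * (L powr (q - 2) / (q - 2)) * ?H\<^sup>2 = c * ?H powr q"
        by (simp add: c_def)
      also have "\<dots> = (c powr (1 / q) * ?H) powr q"
        using c q H by (simp add: powr_mult powr_powr)
      finally show ?thesis .
    qed simp
    finally show "(\<integral>\<^sup>+x. ennreal (cmod (rep_l2 u x) powr q) \<partial>lborel) \<le> ennreal ((c powr (1 / q) * ?H) powr q)" .
  qed simp
qed

section \<open>The nonlinearity\<close>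

text \<open>Writing \<open>FT 1 u\<close> as \<open>inv_weight\<close> times some \<open>V\<close>
  in L2 says that the weighted transform of \<open>u\<close> is square-integrable, and it uses only
  a bounded operator; the unbounded weight itself never acts on \<open>l2\<close>.\<close>

definition inv_weight :: "real \<Rightarrow> real \<Rightarrow> real \<Rightarrow> real^'n \<Rightarrow> complex" where
  "inv_weight \<sigma> \<alpha> \<beta> \<xi> = of_real (1 / (\<alpha> + \<beta> * norm \<xi> powr \<sigma>))"

lemma weight_pos: "\<alpha> > 0 \<Longrightarrow> \<beta> > 0 \<Longrightarrow> 0 < \<alpha> + \<beta> * norm \<xi> powr \<sigma>" for \<alpha> \<beta> \<sigma> :: real
  by (intro add_pos_nonneg) auto

lemma bounded_symbol_inv_weight:
  assumes "\<alpha> > 0" "\<beta> > 0"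
  shows "bounded_symbol (1 / \<alpha>) (inv_weight \<sigma> \<alpha> \<beta> :: real^'n \<Rightarrow> complex)"
  unfolding bounded_symbol_def
proof (intro conjI allI)
  show "(inv_weight \<sigma> \<alpha> \<beta> :: real^'n \<Rightarrow> complex) \<in> borel_measurable borel"
    unfolding inv_weight_def[abs_def] by measurable
  fix \<xi> :: "real^'n"
  have "1 / (\<alpha> + \<beta> * norm \<xi> powr \<sigma>) \<le> 1 / \<alpha>"
    using assms weight_pos[OF assms, of \<xi> \<sigma>] by (intro divide_left_mono) auto
  then show "cmod (inv_weight \<sigma> \<alpha> \<beta> \<xi>) \<le> 1 / \<alpha>"
    unfolding inv_weight_def norm_of_real using weight_pos[OF assms, of \<xi> \<sigma>] by (simp add: abs_of_pos)
qed

text \<open>Both \<open>\<alpha>\<close> and \<open>\<beta> * r\<close> are at most their sum, hence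
  so is their geometric mean with exponents \<open>1 - \<theta>\<close> and
  \<open>\<theta>\<close>.\<close>

lemma interpolation_le_weight:
  fixes \<alpha> \<beta> \<theta> r :: real
  assumes "\<alpha> > 0" "\<beta> > 0" "0 \<le> \<theta>" "\<theta> \<le> 1" "r \<ge> 0"
  shows "r powr \<theta> \<le> \<alpha> powr (-(1 - \<theta>)) * \<beta> powr (-\<theta>) * (\<alpha> + \<beta> * r)"
proof -
  let ?M = "\<alpha> + \<beta> * r"
  have M: "?M > 0" using assms by (intro add_pos_nonneg) auto
  have "(\<beta> * r) powr \<theta> * \<alpha> powr (1 - \<theta>) \<le> ?M powr \<theta> * ?M powr (1 - \<theta>)"
    using assms by (intro mult_mono powr_mono2) auto
  also have "\<dots> = ?M" using M by (simp flip: powr_add)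
  finally have "\<beta> powr \<theta> * r powr \<theta> * \<alpha> powr (1 - \<theta>) \<le> ?M" using assms by (simp add: powr_mult)
  then have "(\<alpha> powr (-(1 - \<theta>)) * \<beta> powr (-\<theta>)) * (\<beta> powr \<theta> * r powr \<theta> * \<alpha> powr (1 - \<theta>))
      \<le> (\<alpha> powr (-(1 - \<theta>)) * \<beta> powr (-\<theta>)) * ?M"
    by (intro mult_left_mono) auto
  moreover have "(\<alpha> powr (-(1 - \<theta>)) * \<beta> powr (-\<theta>)) * (\<beta> powr \<theta> * r powr \<theta> * \<alpha> powr (1 - \<theta>))
      = (\<alpha> powr (-(1 - \<theta>)) * \<alpha> powr (1 - \<theta>)) * (\<beta> powr (-\<theta>) * \<beta> powr \<theta>) * r powr \<theta>"
    by (simp only: ac_simps)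
  moreover have "\<alpha> powr (-(1 - \<theta>)) * \<alpha> powr (1 - \<theta>) = 1" "\<beta> powr (-\<theta>) * \<beta> powr \<theta> = 1"
    unfolding powr_add[symmetric] using assms by auto
  ultimately show ?thesis by (simp only: mult_1)
qed

lemma nn_integral_L2_powr:
  "square_integrable f \<Longrightarrow> (\<integral>\<^sup>+x. ennreal (cmod (f x) powr 2) \<partial>lborel) = ennreal ((L2norm f)\<^sup>2)"
  by (simp add: nn_integral_L2norm[symmetric] powr_numeral)

text \<open>Interpolation with exponent \<open>s / \<sigma>\<close> bounds
  \<open>norm \<xi> powr s\<close> by the weight, and the homogeneous embedding of order
  \<open>s\<close> does the rest. For \<open>q = 2\<close> the order is 0 and the Plancherel
  identity takes its place. \<open>C\<close> is uniform in \<open>\<alpha>\<close> and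
  \<open>\<beta>\<close>, which will be powers of time.\<close>

theorem weighted_Lq_bound:
  fixes q \<sigma> s :: real
  assumes q: "q \<ge> 2" and s: "s = real CARD('n::finite) * (1/2 - 1/q)" and \<sigma>: "\<sigma> > 0" "s \<le> \<sigma>"
  shows "\<exists>C\<ge>0. \<forall>(u :: 'n l2) V \<alpha> \<beta>. \<alpha> > 0 \<longrightarrow> \<beta> > 0 \<longrightarrow> FT 1 u = symbol_mult (inv_weight \<sigma> \<alpha> \<beta>) V \<longrightarrow>
    (\<integral>\<^sup>+x. ennreal (cmod (rep_l2 u x) powr q) \<partial>lborel)
      \<le> ennreal ((C * (\<alpha> powr (-(1 - s/\<sigma>)) * \<beta> powr (-(s/\<sigma>))) * norm V) powr q)"
proof -
  have s0: "0 \<le> s" using q by (simp add: s field_simps)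
  have \<theta>: "0 \<le> s / \<sigma>" "s / \<sigma> \<le> 1" using s0 \<sigma> by auto
  have W: "square_integrable (\<lambda>\<xi>. of_real (norm \<xi> powr s) * rep_l2 (FT 1 u) \<xi>)"
    "L2norm (\<lambda>\<xi>. of_real (norm \<xi> powr s) * rep_l2 (FT 1 u) \<xi>) \<le> (\<alpha> powr (-(1 - s/\<sigma>)) * \<beta> powr (-(s/\<sigma>))) * norm V"
    if a: "\<alpha> > 0" "\<beta> > 0" and eq: "FT 1 u = symbol_mult (inv_weight \<sigma> \<alpha> \<beta>) V" for u V :: "'n l2" and \<alpha> \<beta>
  proof -
    let ?B = "\<alpha> powr (-(1 - s/\<sigma>)) * \<beta> powr (-(s/\<sigma>))"
    note bs = bounded_symbol_inv_weight[OF a, of \<sigma>]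
    have le: "AE \<xi> in lborel. cmod (of_real (norm \<xi> powr s) * rep_l2 (FT 1 u) \<xi>) \<le> ?B * cmod (rep_l2 V \<xi>)"
      unfolding eq using AE_rep_symbol_mult[OF bs, of V]
    proof eventually_elim
      case (elim \<xi>)
      let ?w = "\<alpha> + \<beta> * norm \<xi> powr \<sigma>"
      have w: "?w > 0" by (rule weight_pos[OF a])
      have "norm \<xi> powr s = (norm \<xi> powr \<sigma>) powr (s / \<sigma>)" using \<sigma> by (simp add: powr_powr)
      also have "\<dots> \<le> ?B * ?w" by (intro interpolation_le_weight a \<theta>) auto
      finally have "norm \<xi> powr s * (1 / ?w) \<le> ?B" using w by (simp add: field_simps)
      then have "norm \<xi> powr s * (1 / ?w) * cmod (rep_l2 V \<xi>) \<le> ?B * cmod (rep_l2 V \<xi>)"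
        by (rule mult_right_mono) simp
      moreover have "cmod (inv_weight \<sigma> \<alpha> \<beta> \<xi>) = 1 / ?w"
        unfolding inv_weight_def norm_of_real using w by simp
      ultimately show ?case unfolding elim by (simp add: norm_mult)
    qed
    show "square_integrable (\<lambda>\<xi>. of_real (norm \<xi> powr s) * rep_l2 (FT 1 u) \<xi>)"
      by (rule square_integrable_bound[OF square_integrable_rep_l2 _ le]) measurable
    show "L2norm (\<lambda>\<xi>. of_real (norm \<xi> powr s) * rep_l2 (FT 1 u) \<xi>) \<le> ?B * norm V"
      unfolding norm_l2_eq[of V] by (rule L2norm_mono[OF square_integrable_rep_l2 _ _ le]) auto
  qed
  show ?thesis
  proof (cases "q = 2")
    case True
    then have s2: "s = 0" by (simp add: s)
    let ?N = "sqrt ((2 * pi) ^ CARD('n))"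
    have N: "?N > 0" by simp
    show ?thesis
    proof (intro exI[of _ "1 / ?N"] conjI allI impI)
      fix u V :: "'n l2" and \<alpha> \<beta> :: real
      assume a: "\<alpha> > 0" "\<beta> > 0" and eq: "FT 1 u = symbol_mult (inv_weight \<sigma> \<alpha> \<beta>) V"
      let ?B = "\<alpha> powr (-(1 - s/\<sigma>)) * \<beta> powr (-(s/\<sigma>))"
      have B: "?B = 1 / \<alpha>" using a by (simp add: s2 powr_minus_divide)
      have "?N * norm u = norm (FT 1 u)" by (simp add: Plancherel)
      also have "\<dots> \<le> ?B * norm V"
        unfolding eq B by (rule norm_symbol_mult_le[OF bounded_symbol_inv_weight[OF a]])
      finally have "norm u \<le> 1 / ?N * ?B * norm V" using N by (simp add: field_simps)
      then have "(norm u) powr 2 \<le> (1 / ?N * ?B * norm V) powr 2" by (intro powr_mono2) auto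
      moreover have "(norm u) powr 2 = (norm u)\<^sup>2" by (simp add: powr_numeral)
      ultimately show "(\<integral>\<^sup>+x. ennreal (cmod (rep_l2 u x) powr q) \<partial>lborel) \<le> ennreal ((1 / ?N * ?B * norm V) powr q)"
        unfolding True nn_integral_L2_powr[OF square_integrable_rep_l2] norm_l2_eq[of u, symmetric]
        by (simp add: ennreal_leI)
    qed simp
  next
    case False
    then have q2: "q > 2" using q by simp
    obtain C where C: "C \<ge> 0" "\<And>u :: 'n l2. square_integrable (\<lambda>\<xi>. of_real (norm \<xi> powr s) * rep_l2 (FT 1 u) \<xi>) \<Longrightarrow>
        (\<integral>\<^sup>+x. ennreal (cmod (rep_l2 u x) powr q) \<partial>lborel)
        \<le> ennreal ((C * L2norm (\<lambda>\<xi>. of_real (norm \<xi> powr s) * rep_l2 (FT 1 u) \<xi>)) powr q)"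
      using homogeneous_Sobolev_embedding[OF q2 s] by blast
    show ?thesis
    proof (intro exI[of _ C] conjI allI impI)
      fix u V :: "'n l2" and \<alpha> \<beta> :: real
      assume a: "\<alpha> > 0" "\<beta> > 0" and eq: "FT 1 u = symbol_mult (inv_weight \<sigma> \<alpha> \<beta>) V"
      note w = W[OF a eq]
      have "(C * L2norm (\<lambda>\<xi>. of_real (norm \<xi> powr s) * rep_l2 (FT 1 u) \<xi>)) powr q
          \<le> (C * (\<alpha> powr (-(1 - s/\<sigma>)) * \<beta> powr (-(s/\<sigma>))) * norm V) powr q"
        using C(1) w(2) q unfolding mult.assoc[of C] by (intro powr_mono2 mult_left_mono) auto
      then show "(\<integral>\<^sup>+x. ennreal (cmod (rep_l2 u x) powr q) \<partial>lborel)
          \<le> ennreal ((C * (\<alpha> powr (-(1 - s/\<sigma>)) * \<beta> powr (-(s/\<sigma>))) * norm V) powr q)"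
        using C(2)[OF w(1)] ennreal_leI order_trans by blast
    qed (rule C(1))
  qed
qed

section \<open>Differences of powers\<close>

lemma powr_diff_le:
  fixes a b p :: real
  assumes "a \<ge> 0" "b \<ge> 0" "p > 1"
  shows "\<bar>a powr p - b powr p\<bar> \<le> p * \<bar>a - b\<bar> * max a b powr (p - 1)"
proof -
  have *: "y powr p - x powr p \<le> p * (y - x) * y powr (p - 1) \<and> 0 \<le> y powr p - x powr p" if "0 \<le> x" "x < y" for x y
  proof (cases "x = 0")
    \<comment> \<open>The mean value theorem is applied on positive arguments only; for
      \<open>x = 0\<close> the difference is \<open>y powr p\<close> itself.\<close>
    case True
    have "y powr p = y * y powr (p - 1)" using that by (simp add: powr_mult_base)
    moreover have "1 * (y * y powr (p - 1)) \<le> p * (y * y powr (p - 1))"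
      using assms that by (intro mult_right_mono) auto
    ultimately show ?thesis using True that by simp
  next
    case False
    then have x: "x > 0" using that by simp
    have "\<exists>z. x < z \<and> z < y \<and> y powr p - x powr p = (y - x) * (p * z powr (p - 1))"
      using x that by (intro MVT2) (auto intro!: derivative_eq_intros)
    then obtain z where z: "x < z" "z < y" "y powr p - x powr p = (y - x) * (p * z powr (p - 1))" by blast
    have "(y - x) * (p * z powr (p - 1)) \<le> (y - x) * (p * y powr (p - 1))"
      using z x assms that by (intro mult_left_mono powr_mono2) auto
    moreover have "0 \<le> (y - x) * (p * z powr (p - 1))" using that assms by simp
    ultimately show ?thesis using z(3) by (simp add: ac_simps)
  qed
  consider "a = b" | "a < b" | "b < a" by linarith
  then show ?thesis
  proof cases
    case 2 then show ?thesis using *[of a b] assms by (simp add: max_def)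
  next
    case 3 then show ?thesis using *[of b a] assms by (simp add: max_def)
  qed simp
qed

lemma measurable_abs_power [measurable]:
  "f \<in> borel_measurable borel \<Longrightarrow> abs_power p f \<in> borel_measurable borel"
  unfolding abs_power_def[abs_def] by measurable

lemma cmod_abs_power: "cmod (abs_power p f x) = cmod (f x) powr p"
  by (simp add: abs_power_def)

lemma abs_power_diff_le:
  assumes "p > 1"
  shows "cmod (abs_power p f x - abs_power p g x)
    \<le> p * cmod (f x - g x) * max (cmod (f x)) (cmod (g x)) powr (p - 1)"
proof -
  have "cmod (abs_power p f x - abs_power p g x) = \<bar>cmod (f x) powr p - cmod (g x) powr p\<bar>"
    unfolding abs_power_def of_real_diff[symmetric] norm_of_real ..
  also have "\<dots> \<le> p * \<bar>cmod (f x) - cmod (g x)\<bar> * max (cmod (f x)) (cmod (g x)) powr (p - 1)"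
    by (rule powr_diff_le) (use assms in auto)
  also have "\<dots> \<le> p * cmod (f x - g x) * max (cmod (f x)) (cmod (g x)) powr (p - 1)"
    using assms norm_triangle_ineq3[of "f x" "g x"] by (intro mult_right_mono mult_left_mono) auto
  finally show ?thesis .
qed

text \<open>Normalising \<open>f - g\<close> by \<open>D\<close> and \<open>f\<close>, \<open>g\<close> by \<open>A\<close> and bounding by the largest of the three
  quotients replaces Hoelder's inequality.\<close>

lemma abs_power_diff_Lr:
  fixes f g :: "real^'n::finite \<Rightarrow> complex"
  assumes [measurable]: "f \<in> borel_measurable borel" "g \<in> borel_measurable borel"
    and p: "p > 1" and r: "r > 0" and A: "A \<ge> 0" and D: "D \<ge> 0"
    and f: "(\<integral>\<^sup>+x. ennreal (cmod (f x) powr (r * p)) \<partial>lborel) \<le> ennreal (A powr (r * p))"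
    and g: "(\<integral>\<^sup>+x. ennreal (cmod (g x) powr (r * p)) \<partial>lborel) \<le> ennreal (A powr (r * p))"
    and d: "(\<integral>\<^sup>+x. ennreal (cmod (f x - g x) powr (r * p)) \<partial>lborel) \<le> ennreal (D powr (r * p))"
  shows "(\<integral>\<^sup>+x. ennreal (cmod (abs_power p f x - abs_power p g x) powr r) \<partial>lborel)
    \<le> ennreal (3 * (p * D * A powr (p - 1)) powr r)"
proof (cases "D = 0 \<or> A = 0")
  case True
  have zero: "AE x in lborel. h x = 0" if [measurable]: "h \<in> borel_measurable borel"
    and "(\<integral>\<^sup>+x. ennreal (cmod (h x) powr (r * p)) \<partial>lborel) \<le> ennreal (0 powr (r * p))" for h :: "real^'n \<Rightarrow> complex"
  proof -
    have "(\<integral>\<^sup>+x. ennreal (cmod (h x) powr (r * p)) \<partial>lborel) = 0" using that(2) by simp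
    then have "AE x in lborel. ennreal (cmod (h x) powr (r * p)) = 0"
      by (subst (asm) nn_integral_0_iff_AE) auto
    then show ?thesis by eventually_elim (simp add: ennreal_eq_0_iff)
  qed
  \<comment> \<open>The quotients by \<open>D\<close> and \<open>A\<close> are meaningless here, but
    then \<open>f = g\<close> almost everywhere and the left side vanishes.\<close>
  have "AE x in lborel. f x = g x"
  proof (cases "D = 0")
    case True
    have "AE x in lborel. f x - g x = 0" by (rule zero) (use d True in auto)
    then show ?thesis by eventually_elim simp
  next
    case False
    with \<open>D = 0 \<or> A = 0\<close> have "A = 0" by simp
    then have "AE x in lborel. f x = 0" "AE x in lborel. g x = 0" using zero f g by auto
    then show ?thesis by eventually_elim simp
  qed
  then have "AE x in lborel. ennreal (cmod (abs_power p f x - abs_power p g x) powr r) = 0"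
    by eventually_elim (simp add: abs_power_def)
  then have "(\<integral>\<^sup>+x. ennreal (cmod (abs_power p f x - abs_power p g x) powr r) \<partial>lborel) = 0"
    by (subst nn_integral_0_iff_AE) auto
  then show ?thesis by simp
next
  case False
  then have A0: "A > 0" and D0: "D > 0" using A D by auto
  let ?q = "r * p"
  have q: "?q > 0" using p r by simp
  define M where "M = (p * D * A powr (p - 1)) powr r"
  have "(\<integral>\<^sup>+x. ennreal (cmod (abs_power p f x - abs_power p g x) powr r) \<partial>lborel)
      \<le> (\<integral>\<^sup>+x. ennreal (M / D powr ?q) * ennreal (cmod (f x - g x) powr ?q)
        + (ennreal (M / A powr ?q) * ennreal (cmod (f x) powr ?q)
        + ennreal (M / A powr ?q) * ennreal (cmod (g x) powr ?q)) \<partial>lborel)"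
  proof (rule nn_integral_mono)
    fix x
    define m where "m = max (cmod (f x - g x) / D) (max (cmod (f x) / A) (cmod (g x) / A))"
    have m: "m \<ge> 0" "cmod (f x - g x) \<le> D * m" "max (cmod (f x)) (cmod (g x)) \<le> A * m"
    proof -
      have "cmod (f x - g x) / D \<le> m" "cmod (f x) / A \<le> m" "cmod (g x) / A \<le> m" by (auto simp: m_def)
      then show "m \<ge> 0" "cmod (f x - g x) \<le> D * m" "max (cmod (f x)) (cmod (g x)) \<le> A * m"
        using A0 D0 order_trans[of 0 "cmod (f x) / A" m] by (auto simp: field_simps)
    qed
    have "cmod (abs_power p f x - abs_power p g x) \<le> p * cmod (f x - g x) * max (cmod (f x)) (cmod (g x)) powr (p - 1)"
      by (rule abs_power_diff_le[OF p])
    also have "\<dots> \<le> p * (D * m) * (A * m) powr (p - 1)"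
      using m p D0 by (intro mult_mono powr_mono2) (auto simp: le_max_iff_disj)
    also have "\<dots> = p * D * A powr (p - 1) * m powr p"
      using m A0 p powr_mult_base[of m "p - 1"] by (simp add: powr_mult)
    finally have "cmod (abs_power p f x - abs_power p g x) powr r \<le> (p * D * A powr (p - 1) * m powr p) powr r"
      using r by (intro powr_mono2) auto
    also have "\<dots> = M * m powr ?q"
      using m p D0 by (simp add: M_def powr_mult powr_powr mult.commute)
    also have "m powr ?q \<le> (cmod (f x - g x) / D) powr ?q + ((cmod (f x) / A) powr ?q + (cmod (g x) / A) powr ?q)"
      unfolding m_def by (auto simp: max_def)
    finally have "cmod (abs_power p f x - abs_power p g x) powr r
        \<le> M * ((cmod (f x - g x) / D) powr ?q + ((cmod (f x) / A) powr ?q + (cmod (g x) / A) powr ?q))"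
      by (simp add: M_def mult_left_mono)
    also have "\<dots> = M / D powr ?q * cmod (f x - g x) powr ?q
        + (M / A powr ?q * cmod (f x) powr ?q + M / A powr ?q * cmod (g x) powr ?q)"
      using A0 D0 by (simp add: powr_divide distrib_left)
    finally have "ennreal (cmod (abs_power p f x - abs_power p g x) powr r)
        \<le> ennreal (M / D powr ?q * cmod (f x - g x) powr ?q
        + (M / A powr ?q * cmod (f x) powr ?q + M / A powr ?q * cmod (g x) powr ?q))"
      by (rule ennreal_leI)
    also have "\<dots> = ennreal (M / D powr ?q) * ennreal (cmod (f x - g x) powr ?q)
        + (ennreal (M / A powr ?q) * ennreal (cmod (f x) powr ?q)
        + ennreal (M / A powr ?q) * ennreal (cmod (g x) powr ?q))"
      by (simp add: ennreal_mult[symmetric] M_def)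
    finally show "ennreal (cmod (abs_power p f x - abs_power p g x) powr r)
        \<le> ennreal (M / D powr ?q) * ennreal (cmod (f x - g x) powr ?q)
        + (ennreal (M / A powr ?q) * ennreal (cmod (f x) powr ?q)
        + ennreal (M / A powr ?q) * ennreal (cmod (g x) powr ?q))" .
  qed
  also have "\<dots> = ennreal (M / D powr ?q) * (\<integral>\<^sup>+x. ennreal (cmod (f x - g x) powr ?q) \<partial>lborel)
        + (ennreal (M / A powr ?q) * (\<integral>\<^sup>+x. ennreal (cmod (f x) powr ?q) \<partial>lborel)
        + ennreal (M / A powr ?q) * (\<integral>\<^sup>+x. ennreal (cmod (g x) powr ?q) \<partial>lborel))"
    by (subst nn_integral_add, simp, simp, subst nn_integral_add, simp, simp, subst (1 2 3) nn_integral_cmult) simp_all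
  also have "\<dots> \<le> ennreal (M / D powr ?q) * ennreal (D powr ?q)
        + (ennreal (M / A powr ?q) * ennreal (A powr ?q) + ennreal (M / A powr ?q) * ennreal (A powr ?q))"
    by (intro add_mono mult_left_mono f g d) auto
  also have "\<dots> = ennreal (3 * M)"
    using A0 D0 by (simp add: ennreal_mult[symmetric] M_def flip: ennreal_plus)
  finally show ?thesis by (simp add: M_def)
qed

text \<open>The \<open>p\<close>-th power of the constant in \<open>interpolation_le_weight\<close>.
  With the time-dependent weights it becomes the decay of the source.\<close>

definition interpolation_factor :: "real \<Rightarrow> real \<Rightarrow> real \<Rightarrow> real \<Rightarrow> real" where
  "interpolation_factor \<theta> p \<alpha> \<beta> = (\<alpha> powr (-(1 - \<theta>)) * \<beta> powr (-\<theta>)) powr p"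

lemma symbol_mult_inv_weight_diff:
  fixes u v :: "('n::finite) l2"
  assumes a: "\<alpha> > 0" "\<beta> > 0"
    and u: "FT 1 u = symbol_mult (inv_weight \<sigma> \<alpha> \<beta>) U" and v: "FT 1 v = symbol_mult (inv_weight \<sigma> \<alpha> \<beta>) V"
  shows "FT 1 (u - v) = symbol_mult (inv_weight \<sigma> \<alpha> \<beta>) (U - V)"
  by (simp add: linear_diff[OF bounded_linear.linear[OF bounded_linear_FT]] u v
      symbol_mult_diff[OF bounded_symbol_inv_weight[OF a]])

lemma Lq_diff_cong:
  fixes u v :: "('n::finite) l2"
  shows "(\<integral>\<^sup>+x. ennreal (cmod (rep_l2 u x - rep_l2 v x) powr q) \<partial>lborel)
    = (\<integral>\<^sup>+x. ennreal (cmod (rep_l2 (u - v) x) powr q) \<partial>lborel)"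
proof (rule nn_integral_cong_AE)
  show "AE x in lborel. ennreal (cmod (rep_l2 u x - rep_l2 v x) powr q) = ennreal (cmod (rep_l2 (u - v) x) powr q)"
    using AE_rep_l2_diff[of u v] by eventually_elim simp
qed

lemma powr_square: "(x powr y)\<^sup>2 = x powr (2 * y)" for x y :: real
  unfolding power2_eq_square mult_2 powr_add ..

text \<open>\<open>abs_power_diff_Lr\<close> with \<open>r = 1\<close> and \<open>r = 2\<close>
  needs \<open>u\<close>, \<open>v\<close> and \<open>u - v\<close> in the Lebesgue spaces of
  exponents \<open>p\<close> and \<open>2 * p\<close>; \<open>s1\<close> and \<open>s2\<close> are
  the corresponding Sobolev orders. The difference has weighted transform \<open>U - V\<close>
  because the weight acts linearly.\<close>

theorem nonlinearity_bounds:
  fixes p \<sigma> s1 s2 :: real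
  assumes p: "p \<ge> 2" and \<sigma>: "\<sigma> > 0"
    and s1: "s1 = real CARD('n::finite) * (1/2 - 1/p)" "s1 \<le> \<sigma>"
    and s2: "s2 = real CARD('n) * (1/2 - 1/(2*p))" "s2 \<le> \<sigma>"
  shows "\<exists>C\<ge>0. \<forall>(u::'n l2) v U V \<alpha> \<beta> M. \<alpha> > 0 \<longrightarrow> \<beta> > 0 \<longrightarrow>
    FT 1 u = symbol_mult (inv_weight \<sigma> \<alpha> \<beta>) U \<longrightarrow> FT 1 v = symbol_mult (inv_weight \<sigma> \<alpha> \<beta>) V \<longrightarrow>
    norm U \<le> M \<longrightarrow> norm V \<le> M \<longrightarrow>
    integrable lborel (abs_power p (rep_l2 u)) \<and> square_integrable (abs_power p (rep_l2 u)) \<and>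
    L1norm (\<lambda>x. abs_power p (rep_l2 u) x - abs_power p (rep_l2 v) x)
      \<le> C * interpolation_factor (s1/\<sigma>) p \<alpha> \<beta> * (norm (U - V) * M powr (p - 1)) \<and>
    L2norm (\<lambda>x. abs_power p (rep_l2 u) x - abs_power p (rep_l2 v) x)
      \<le> C * interpolation_factor (s2/\<sigma>) p \<alpha> \<beta> * (norm (U - V) * M powr (p - 1))"
proof -
  obtain C1 where C1: "C1 \<ge> 0" and Lp: "\<And>(u::'n l2) V \<alpha> \<beta>. \<alpha> > 0 \<Longrightarrow> \<beta> > 0 \<Longrightarrow>
      FT 1 u = symbol_mult (inv_weight \<sigma> \<alpha> \<beta>) V \<Longrightarrow>
      (\<integral>\<^sup>+x. ennreal (cmod (rep_l2 u x) powr p) \<partial>lborel)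
      \<le> ennreal ((C1 * (\<alpha> powr (-(1 - s1/\<sigma>)) * \<beta> powr (-(s1/\<sigma>))) * norm V) powr p)"
    using weighted_Lq_bound[OF p s1(1) \<sigma> s1(2)] by blast
  obtain C2 where C2: "C2 \<ge> 0" and L2p: "\<And>(u::'n l2) V \<alpha> \<beta>. \<alpha> > 0 \<Longrightarrow> \<beta> > 0 \<Longrightarrow>
      FT 1 u = symbol_mult (inv_weight \<sigma> \<alpha> \<beta>) V \<Longrightarrow>
      (\<integral>\<^sup>+x. ennreal (cmod (rep_l2 u x) powr (2 * p)) \<partial>lborel)
      \<le> ennreal ((C2 * (\<alpha> powr (-(1 - s2/\<sigma>)) * \<beta> powr (-(s2/\<sigma>))) * norm V) powr (2 * p))"
    using weighted_Lq_bound[of "2 * p", OF _ s2(1) \<sigma> s2(2)] p by auto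
  let ?C = "3 * p * C1 powr p + 2 * p * C2 powr p"
  have C: "3 * p * C1 powr p \<le> ?C" "2 * p * C2 powr p \<le> ?C" "0 \<le> ?C" using p by auto
  have p1: "p > 1" using p by simp
  \<comment> \<open>The embedding constant occurs once with the difference and \<open>p - 1\<close>
    times with the size \<open>M\<close>, together a full \<open>p\<close>-th power.\<close>
  have DA: "c * B * d * (c * B * M) powr (p - 1) = c powr p * B powr p * (d * M powr (p - 1))"
    if "c \<ge> 0" "B \<ge> 0" "M \<ge> 0" for c B d M :: real
  proof -
    have "c * B * d * (c * B * M) powr (p - 1) = ((c * B) * (c * B) powr (p - 1)) * (d * M powr (p - 1))"
      using that by (simp add: powr_mult)
    also have "(c * B) * (c * B) powr (p - 1) = (c * B) powr p"
      using powr_mult_base[of "c * B" "p - 1"] that by simp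
    finally show ?thesis using that by (simp add: powr_mult)
  qed
  show ?thesis
  proof (intro exI[of _ ?C] conjI allI impI C(3))
    fix u v U V :: "'n l2" and \<alpha> \<beta> M :: real
    assume a: "\<alpha> > 0" "\<beta> > 0" and u: "FT 1 u = symbol_mult (inv_weight \<sigma> \<alpha> \<beta>) U"
      and v: "FT 1 v = symbol_mult (inv_weight \<sigma> \<alpha> \<beta>) V" and U: "norm U \<le> M" and V: "norm V \<le> M"
    have M: "M \<ge> 0" using U norm_ge_zero order_trans by blast
    let ?f = "abs_power p (rep_l2 u)" and ?g = "abs_power p (rep_l2 v)"
    let ?h = "\<lambda>x. ?f x - ?g x"
    show "integrable lborel ?f"
    proof (rule integrableI_bounded)
      have "(\<integral>\<^sup>+x. ennreal (cmod (rep_l2 u x) powr p) \<partial>lborel) < \<infinity>"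
        by (rule order_le_less_trans[OF Lp[OF a u]]) simp
      then show "(\<integral>\<^sup>+x. ennreal (norm (?f x)) \<partial>lborel) < \<infinity>" by (simp add: cmod_abs_power)
    qed simp
    show "square_integrable ?f"
    proof (rule square_integrable_nnI(1))
      let ?Z = "(C2 * (\<alpha> powr (-(1 - s2/\<sigma>)) * \<beta> powr (-(s2/\<sigma>))) * norm U) powr p"
      have "(cmod (?f x))\<^sup>2 = cmod (rep_l2 u x) powr (2 * p)" for x
        by (simp only: cmod_abs_power powr_square)
      moreover have "?Z\<^sup>2 = (C2 * (\<alpha> powr (-(1 - s2/\<sigma>)) * \<beta> powr (-(s2/\<sigma>))) * norm U) powr (2 * p)"
        by (rule powr_square)
      ultimately show "(\<integral>\<^sup>+x. ennreal ((cmod (?f x))\<^sup>2) \<partial>lborel) \<le> ennreal (?Z\<^sup>2)"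
        using L2p[OF a u] by simp
    qed auto
    note uv = symbol_mult_inv_weight_diff[OF a u v]
    let ?B1 = "\<alpha> powr (-(1 - s1/\<sigma>)) * \<beta> powr (-(s1/\<sigma>))"
    let ?B2 = "\<alpha> powr (-(1 - s2/\<sigma>)) * \<beta> powr (-(s2/\<sigma>))"
    have mono: "ennreal ((c * B * x) powr q) \<le> ennreal ((c * B * M) powr q)"
      if "c \<ge> 0" "B \<ge> 0" "0 \<le> x" "x \<le> M" "q > 0" for c B x q :: real
      using that by (intro ennreal_leI powr_mono2 mult_left_mono) auto
    have "(\<integral>\<^sup>+x. ennreal (cmod (?h x) powr 1) \<partial>lborel) \<le> ennreal (3 * (p * (C1 * ?B1 * norm (U - V)) * (C1 * ?B1 * M) powr (p - 1)) powr 1)"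
    proof (rule abs_power_diff_Lr)
      show "(\<integral>\<^sup>+x. ennreal (cmod (rep_l2 u x) powr (1 * p)) \<partial>lborel) \<le> ennreal ((C1 * ?B1 * M) powr (1 * p))"
        using order_trans[OF Lp[OF a u] mono[of C1 ?B1 "norm U" p]] C1 U p by simp
      show "(\<integral>\<^sup>+x. ennreal (cmod (rep_l2 v x) powr (1 * p)) \<partial>lborel) \<le> ennreal ((C1 * ?B1 * M) powr (1 * p))"
        using order_trans[OF Lp[OF a v] mono[of C1 ?B1 "norm V" p]] C1 V p by simp
      show "(\<integral>\<^sup>+x. ennreal (cmod (rep_l2 u x - rep_l2 v x) powr (1 * p)) \<partial>lborel) \<le> ennreal ((C1 * ?B1 * norm (U - V)) powr (1 * p))"
        unfolding Lq_diff_cong using Lp[OF a uv] by simp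
    qed (use C1 M p1 in auto)
    then have "(\<integral>\<^sup>+x. ennreal (cmod (?h x)) \<partial>lborel) \<le> ennreal (3 * (p * (C1 * ?B1 * norm (U - V)) * (C1 * ?B1 * M) powr (p - 1)))"
      using C1 p by simp
    then have "L1norm ?h \<le> 3 * (p * (C1 * ?B1 * norm (U - V)) * (C1 * ?B1 * M) powr (p - 1))"
      unfolding L1norm_def using C1 p by (intro integral_real_bounded) auto
    also have "\<dots> = 3 * p * C1 powr p * (interpolation_factor (s1/\<sigma>) p \<alpha> \<beta> * (norm (U - V) * M powr (p - 1)))"
      using DA[of C1 ?B1 M "norm (U - V)"] C1 M by (simp add: interpolation_factor_def)
    also have "\<dots> \<le> ?C * (interpolation_factor (s1/\<sigma>) p \<alpha> \<beta> * (norm (U - V) * M powr (p - 1)))"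
      using C(1) by (rule mult_right_mono) (simp add: interpolation_factor_def)
    finally show "L1norm ?h \<le> ?C * interpolation_factor (s1/\<sigma>) p \<alpha> \<beta> * (norm (U - V) * M powr (p - 1))"
      by (simp only: mult.assoc)
    let ?Y = "p * (C2 * ?B2 * norm (U - V)) * (C2 * ?B2 * M) powr (p - 1)"
    have Y: "?Y \<ge> 0" using p C2 by simp
    have "(\<integral>\<^sup>+x. ennreal (cmod (?h x) powr 2) \<partial>lborel) \<le> ennreal (3 * ?Y powr 2)"
    proof (rule abs_power_diff_Lr)
      show "(\<integral>\<^sup>+x. ennreal (cmod (rep_l2 u x) powr (2 * p)) \<partial>lborel) \<le> ennreal ((C2 * ?B2 * M) powr (2 * p))"
        using order_trans[OF L2p[OF a u] mono[of C2 ?B2 "norm U" "2 * p"]] C2 U p by simp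
      show "(\<integral>\<^sup>+x. ennreal (cmod (rep_l2 v x) powr (2 * p)) \<partial>lborel) \<le> ennreal ((C2 * ?B2 * M) powr (2 * p))"
        using order_trans[OF L2p[OF a v] mono[of C2 ?B2 "norm V" "2 * p"]] C2 V p by simp
      show "(\<integral>\<^sup>+x. ennreal (cmod (rep_l2 u x - rep_l2 v x) powr (2 * p)) \<partial>lborel) \<le> ennreal ((C2 * ?B2 * norm (U - V)) powr (2 * p))"
        unfolding Lq_diff_cong using L2p[OF a uv] by simp
    qed (use C2 M p1 in auto)
    \<comment> \<open>Rounding 3 up to 4 makes the bound a square, as
      \<open>square_integrable_nnI\<close> requires.\<close>
    moreover have "3 * y powr 2 \<le> (2 * y)\<^sup>2" if "y \<ge> 0" for y :: real
      using that by (simp add: powr_numeral power_mult_distrib)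
    note this[OF Y]
    ultimately have "(\<integral>\<^sup>+x. ennreal (cmod (?h x) powr 2) \<partial>lborel) \<le> ennreal ((2 * ?Y)\<^sup>2)"
      by (rule order_trans[OF _ ennreal_leI])
    then have "(\<integral>\<^sup>+x. ennreal ((cmod (?h x))\<^sup>2) \<partial>lborel) \<le> ennreal ((2 * ?Y)\<^sup>2)"
      by (simp only: powr_numeral norm_ge_zero)
    then have "L2norm ?h \<le> 2 * ?Y"
      by (rule square_integrable_nnI(2)[rotated]) (use Y in auto)
    also have "\<dots> = 2 * p * C2 powr p * (interpolation_factor (s2/\<sigma>) p \<alpha> \<beta> * (norm (U - V) * M powr (p - 1)))"
      using DA[of C2 ?B2 M "norm (U - V)"] C2 M by (simp add: interpolation_factor_def)
    also have "\<dots> \<le> ?C * (interpolation_factor (s2/\<sigma>) p \<alpha> \<beta> * (norm (U - V) * M powr (p - 1)))"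
      using C(2) by (rule mult_right_mono) (simp add: interpolation_factor_def)
    finally show "L2norm ?h \<le> ?C * interpolation_factor (s2/\<sigma>) p \<alpha> \<beta> * (norm (U - V) * M powr (p - 1))"
      by (simp only: mult.assoc)
  qed
qed

section \<open>The wave symbol and its decay\<close>

lemma exp_powr_decay:
  fixes c e :: real and m :: nat
  assumes c: "c > 0" and e: "e > 0"
  shows "\<exists>S\<ge>0. \<forall>r\<ge>0. (1 + r) ^ m * exp (- (c * r powr e)) \<le> S"
proof -
  \<comment> \<open>For \<open>r >= 1\<close> this \<open>k\<close> gives
    \<open>r ^ m <= (r powr e) ^ k\<close>, and \<open>power_le_exp_bound\<close> with exponent
    \<open>k\<close> applies to \<open>c * r powr e\<close>.\<close>
  define k where "k = nat \<lceil>real m / e\<rceil>"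
  have k: "real m \<le> e * real k"
  proof -
    have "real m / e \<le> real k" unfolding k_def by (rule real_nat_ceiling_ge)
    then show ?thesis using e by (simp add: pos_divide_le_eq mult.commute)
  qed
  let ?S = "2 ^ m + 2 ^ m * (real k ^ k / c ^ k)"
  show ?thesis
  proof (intro exI[of _ ?S] conjI allI impI)
    show "0 \<le> ?S" using c by simp
    fix r :: real assume r: "r \<ge> 0"
    show "(1 + r) ^ m * exp (- (c * r powr e)) \<le> ?S"
    proof (cases "r \<le> 1")
      case True
      have "(1 + r) ^ m * exp (- (c * r powr e)) \<le> 2 ^ m * 1"
        using True r c by (intro mult_mono power_mono) auto
      also have "\<dots> \<le> ?S" using c by simp
      finally show ?thesis .
    next
      case False
      have "(1 + r) ^ m \<le> (2 * r) ^ m" using False by (intro power_mono) auto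
      also have "\<dots> = 2 ^ m * r powr real m" using False by (simp add: power_mult_distrib powr_realpow)
      also have "\<dots> \<le> 2 ^ m * r powr (e * real k)"
        using False k by (intro mult_left_mono powr_mono) auto
      also have "r powr (e * real k) = (r powr e) ^ k" using False by (simp add: powr_realpow[symmetric] powr_powr)
      also have "(r powr e) ^ k = (c * r powr e) ^ k / c ^ k" using c by (simp add: power_mult_distrib)
      also have "\<dots> \<le> real k ^ k * exp (c * r powr e) / c ^ k"
        using c by (intro divide_right_mono power_le_exp_bound) auto
      finally have "(1 + r) ^ m \<le> 2 ^ m * (real k ^ k / c ^ k) * exp (c * r powr e)" by simp
      then have "(1 + r) ^ m / exp (c * r powr e) \<le> 2 ^ m * (real k ^ k / c ^ k)"
        by (subst pos_divide_le_eq) auto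
      then have "(1 + r) ^ m * exp (- (c * r powr e)) \<le> 2 ^ m * (real k ^ k / c ^ k)"
        by (simp add: exp_minus divide_inverse)
      then show ?thesis using zero_le_power[of "2::real" m] by linarith
    qed
  qed
qed

text \<open>The symbol at time \<open>c\<close> of the semigroup generated by minus the fractional
  Laplacian of order \<open>\<delta>\<close>: the dissipative factor of the kernel, and the majorant
  in all decay estimates.\<close>

definition heat_symbol :: "real \<Rightarrow> real \<Rightarrow> real^'n \<Rightarrow> complex" where
  "heat_symbol \<delta> c \<xi> = of_real (exp (- (c * norm \<xi> powr (2 * \<delta>))))"

lemma measurable_heat_symbol [measurable]: "heat_symbol \<delta> c \<in> borel_measurable borel"
  unfolding heat_symbol_def[abs_def] by measurable

lemma cmod_heat_symbol: "cmod (heat_symbol \<delta> c \<xi>) = exp (- (c * norm \<xi> powr (2 * \<delta>)))"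
  by (simp add: heat_symbol_def)

lemma heat_symbol_L1_L2:
  assumes "\<delta> > 0" "c > 0"
  shows "integrable lborel (heat_symbol \<delta> c :: real^'n::finite \<Rightarrow> complex)"
    and "square_integrable (heat_symbol \<delta> c :: real^'n \<Rightarrow> complex)"
proof -
  obtain S where S: "S \<ge> 0" "\<And>r. r \<ge> 0 \<Longrightarrow> (1 + r) ^ (2 * CARD('n)) * exp (- (c * r powr (2 * \<delta>))) \<le> S"
    using exp_powr_decay[of c "2 * \<delta>"] assms by auto
  show "integrable lborel (heat_symbol \<delta> c :: real^'n \<Rightarrow> complex)"
    "square_integrable (heat_symbol \<delta> c :: real^'n \<Rightarrow> complex)"
    using decay_L1_L2[of "heat_symbol \<delta> c :: real^'n \<Rightarrow> complex" S] S by (auto simp: cmod_heat_symbol)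
qed

text \<open>The substitution by \<open>a\<close>, for which
  \<open>c * a powr (2 * \<delta>) = 1\<close>, removes \<open>c\<close>; its Jacobian is the origin
  of the rate \<open>n / (4 * \<delta>)\<close>.\<close>

lemma L2norm_heat_symbol:
  assumes \<delta>: "\<delta> > 0" and c: "c > 0"
  shows "L2norm (heat_symbol \<delta> c :: real^'n::finite \<Rightarrow> complex)
    = c powr (- (real CARD('n) / (4 * \<delta>))) * L2norm (heat_symbol \<delta> 1 :: real^'n \<Rightarrow> complex)"
proof -
  define a where "a = c powr (- (1 / (2 * \<delta>)))"
  have a: "a > 0" using c by (simp add: a_def)
  have ca: "c * a powr (2 * \<delta>) = 1"
  proof -
    have "a powr (2 * \<delta>) = c powr (-1)" unfolding a_def powr_powr using \<delta> by simp
    then show ?thesis using c by (simp add: powr_minus_divide)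
  qed
  have f: "heat_symbol \<delta> c (0 + a *\<^sub>R \<xi>) = heat_symbol \<delta> 1 \<xi>" for \<xi> :: "real^'n"
  proof -
    have "c * norm (a *\<^sub>R \<xi>) powr (2 * \<delta>) = (c * a powr (2 * \<delta>)) * norm \<xi> powr (2 * \<delta>)"
      using a by (simp add: powr_mult)
    then show ?thesis by (simp add: heat_symbol_def ca)
  qed
  have "(LINT \<xi>|lborel. (cmod (heat_symbol \<delta> c (\<xi>::real^'n)))\<^sup>2)
      = \<bar>a\<bar> ^ DIM(real^'n) *\<^sub>R (LINT \<xi>|lborel. (cmod (heat_symbol \<delta> c (0 + a *\<^sub>R (\<xi>::real^'n))))\<^sup>2)"
    by (rule integral_lborel_affine) (use a in auto)
  also have "\<dots> = (c powr (- (real CARD('n) / (4 * \<delta>))))\<^sup>2 * (LINT \<xi>|lborel. (cmod (heat_symbol \<delta> 1 (\<xi>::real^'n)))\<^sup>2)"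
  proof -
    have "\<bar>a\<bar> ^ CARD('n) = c powr (- (real CARD('n) / (2 * \<delta>)))"
    proof -
      have "\<bar>a\<bar> ^ CARD('n) = a powr real CARD('n)" using a by (simp add: powr_realpow)
      also have "\<dots> = c powr (- (real CARD('n) / (2 * \<delta>)))" unfolding a_def powr_powr by simp
      finally show ?thesis .
    qed
    also have "\<dots> = (c powr (- (real CARD('n) / (4 * \<delta>))))\<^sup>2"
      by (simp add: power2_eq_square field_simps flip: powr_add)
    finally show ?thesis unfolding f by simp
  qed
  finally show ?thesis unfolding L2norm_def by (simp add: real_sqrt_mult)
qed

text \<open>The kernel symbol, extended to negative times so that it is continuously differentiable in
  time. At \<open>\<xi> = 0\<close> it is \<open>0\<close>, by the convention \<open>x / 0 = 0\<close>; so is \<open>wave_symbol'\<close>.\<close>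

definition wave_symbol :: "real \<Rightarrow> real \<Rightarrow> real \<Rightarrow> real^'n \<Rightarrow> complex" where
  "wave_symbol \<sigma> \<delta> s \<xi> = of_real (exp (- (norm \<xi> powr (2 * \<delta>) * \<bar>s\<bar>)) * sin (norm \<xi> powr \<sigma> * s) / norm \<xi> powr \<sigma>)"

definition wave_symbol' :: "real \<Rightarrow> real \<Rightarrow> real \<Rightarrow> real^'n \<Rightarrow> complex" where
  "wave_symbol' \<sigma> \<delta> s \<xi> = of_real (exp (- (norm \<xi> powr (2 * \<delta>) * \<bar>s\<bar>))
     * (norm \<xi> powr \<sigma> * cos (norm \<xi> powr \<sigma> * s) - norm \<xi> powr (2 * \<delta>) * sin (norm \<xi> powr \<sigma> * \<bar>s\<bar>))
     / norm \<xi> powr \<sigma>)"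

section \<open>The wave symbol: bounds and time derivative\<close>

lemma kernel_symbol_eq: "t \<ge> 0 \<Longrightarrow> kernel_symbol \<sigma> \<delta> t \<xi> = wave_symbol \<sigma> \<delta> t \<xi>"
proof -
  assume t: "t \<ge> 0"
  let ?a = "norm \<xi> powr (2 * \<delta>)" and ?b = "norm \<xi> powr \<sigma>"
  have e: "exp (- of_real (?a * t) + \<i> * of_real (?b * t)) = of_real (exp (- (?a * t))) * cis (?b * t)"
    "exp (- of_real (?a * t) - \<i> * of_real (?b * t)) = of_real (exp (- (?a * t))) * cis (- (?b * t))"
    by (simp_all add: cis_conv_exp exp_add exp_diff exp_minus exp_of_real[symmetric] divide_inverse)
  have "cis r - cis (- r) = 2 * \<i> * of_real (sin r)" for r
    by (simp add: complex_eq_iff)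
  then have "of_real (exp (- (?a * t))) * cis (?b * t) - of_real (exp (- (?a * t))) * cis (- (?b * t))
      = of_real (exp (- (?a * t))) * (2 * \<i> * of_real (sin (?b * t)))"
    by (simp only: right_diff_distrib[symmetric])
  then show ?thesis
    unfolding kernel_symbol_def e wave_symbol_def using t by simp
qed

lemma measurable_wave_symbol [measurable]: "wave_symbol \<sigma> \<delta> s \<in> borel_measurable borel"
  unfolding wave_symbol_def[abs_def] by measurable

lemma measurable_wave_symbol' [measurable]: "wave_symbol' \<sigma> \<delta> s \<in> borel_measurable borel"
  unfolding wave_symbol'_def[abs_def] by measurable

lemma wave_symbol_0 [simp]: "wave_symbol \<sigma> \<delta> 0 = (\<lambda>_. 0)"
  by (simp add: wave_symbol_def[abs_def])

lemma continuous_wave_symbol: "continuous_on S (\<lambda>s. wave_symbol \<sigma> \<delta> s \<xi>)"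
  unfolding wave_symbol_def by (cases "\<xi> = 0") (auto intro!: continuous_intros)

lemma continuous_wave_symbol': "continuous_on S (\<lambda>s. wave_symbol' \<sigma> \<delta> s \<xi>)"
  unfolding wave_symbol'_def by (cases "\<xi> = 0") (auto intro!: continuous_intros)

text \<open>Bounding the sine by its argument cancels the singularity at \<open>\<xi> = 0\<close> at
  the price of growth in time. The next lemma bounds it by 1 and keeps the factor
  \<open>norm \<xi> powr \<sigma>\<close>. The two weights need one bound each.\<close>

lemma cmod_wave_symbol_le: "cmod (wave_symbol \<sigma> \<delta> s \<xi>) \<le> \<bar>s\<bar> * exp (- (norm \<xi> powr (2 * \<delta>) * \<bar>s\<bar>))"
proof (cases "\<xi> = 0")
  case False
  let ?b = "norm \<xi> powr \<sigma>"
  have b: "?b > 0" using False by simp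
  have "\<bar>sin (?b * s)\<bar> \<le> \<bar>?b * s\<bar>" by (rule abs_sin_x_le_abs_x)
  then have "\<bar>sin (?b * s)\<bar> / ?b \<le> \<bar>s\<bar>" using b by (simp add: abs_mult field_simps)
  then have "exp (- (norm \<xi> powr (2 * \<delta>) * \<bar>s\<bar>)) * (\<bar>sin (?b * s)\<bar> / ?b) \<le> exp (- (norm \<xi> powr (2 * \<delta>) * \<bar>s\<bar>)) * \<bar>s\<bar>"
    by (intro mult_left_mono) auto
  then show ?thesis
    unfolding wave_symbol_def norm_of_real by (simp add: abs_mult mult.commute)
qed (simp add: wave_symbol_def)

lemma cmod_wave_symbol_times_le:
  "norm \<xi> powr \<sigma> * cmod (wave_symbol \<sigma> \<delta> s \<xi>) \<le> exp (- (norm \<xi> powr (2 * \<delta>) * \<bar>s\<bar>))"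
proof (cases "\<xi> = 0")
  case False
  let ?b = "norm \<xi> powr \<sigma>"
  have b: "?b > 0" using False by simp
  have "?b * cmod (wave_symbol \<sigma> \<delta> s \<xi>) = exp (- (norm \<xi> powr (2 * \<delta>) * \<bar>s\<bar>)) * \<bar>sin (?b * s)\<bar>"
    unfolding wave_symbol_def norm_of_real using b by (simp add: abs_mult)
  also have "\<dots> \<le> exp (- (norm \<xi> powr (2 * \<delta>) * \<bar>s\<bar>)) * 1"
    by (intro mult_left_mono) auto
  finally show ?thesis by simp
qed (simp add: wave_symbol_def)

text \<open>Differentiating the exponential produces
  \<open>norm \<xi> powr (2 * \<delta>) * \<bar>s\<bar>\<close>, which is absorbed by half of the
  exponent through \<open>1 + x <= 2 * exp (x / 2)\<close>. This is why \<open>s / 2\<close> appears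
  in all later majorants.\<close>

lemma cmod_wave_symbol'_le:
  "cmod (wave_symbol' \<sigma> \<delta> s \<xi>) \<le> 2 * exp (- (norm \<xi> powr (2 * \<delta>) * (\<bar>s\<bar> / 2)))"
proof (cases "\<xi> = 0")
  case False
  let ?b = "norm \<xi> powr \<sigma>" and ?a = "norm \<xi> powr (2 * \<delta>)"
  have b: "?b > 0" and a: "?a \<ge> 0" using False by auto
  have "\<bar>?b * cos (?b * s) - ?a * sin (?b * \<bar>s\<bar>)\<bar> \<le> ?b * \<bar>cos (?b * s)\<bar> + ?a * \<bar>sin (?b * \<bar>s\<bar>)\<bar>"
    using abs_triangle_ineq4[of "?b * cos (?b * s)" "?a * sin (?b * \<bar>s\<bar>)"] a b by (simp add: abs_mult)
  also have "\<dots> \<le> ?b * 1 + ?a * (?b * \<bar>s\<bar>)"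
    using a b abs_sin_x_le_abs_x[of "?b * \<bar>s\<bar>"] by (intro add_mono mult_left_mono) (auto simp: abs_mult)
  also have "\<dots> = ?b * (1 + ?a * \<bar>s\<bar>)" by (simp add: algebra_simps)
  finally have "\<bar>?b * cos (?b * s) - ?a * sin (?b * \<bar>s\<bar>)\<bar> / ?b \<le> 1 + ?a * \<bar>s\<bar>"
    using b by (simp add: pos_divide_le_eq mult.commute)
  also have "\<dots> \<le> 2 * exp (?a * (\<bar>s\<bar> / 2))"
    using exp_ge_add_one_self[of "?a * (\<bar>s\<bar> / 2)"] by linarith
  finally have "exp (- (?a * \<bar>s\<bar>)) * (\<bar>?b * cos (?b * s) - ?a * sin (?b * \<bar>s\<bar>)\<bar> / ?b)
      \<le> exp (- (?a * \<bar>s\<bar>)) * (2 * exp (?a * (\<bar>s\<bar> / 2)))" by (intro mult_left_mono) auto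
  also have "\<dots> = 2 * exp (- (?a * (\<bar>s\<bar> / 2)))" by (simp flip: exp_add)
  finally show ?thesis
    unfolding wave_symbol'_def norm_of_real by (simp add: abs_mult)
qed (simp add: wave_symbol'_def)

text \<open>The kink of \<open>\<bar>s\<bar>\<close> at 0 is harmless because the sine vanishes
  there: the smooth branches \<open>f 1\<close> and \<open>f (-1)\<close> have the same derivative
  at 0 and are glued.\<close>

lemma has_vector_derivative_wave_symbol:
  "((\<lambda>s. wave_symbol \<sigma> \<delta> s \<xi>) has_vector_derivative wave_symbol' \<sigma> \<delta> s \<xi>) (at s)"
proof (cases "\<xi> = 0")
  case True
  then show ?thesis by (simp add: wave_symbol_def wave_symbol'_def)
next
  case False
  define b where "b = norm \<xi> powr \<sigma>"
  define a where "a = norm \<xi> powr (2 * \<delta>)"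
  have b: "b > 0" using False by (simp add: b_def)
  define f where "f c s = exp (- (a * (c * s))) * sin (b * s) / b" for c s
  define f' where "f' c s = exp (- (a * (c * s))) * (b * cos (b * s) - a * (c * sin (b * s))) / b" for c s
  have f: "(f c has_vector_derivative f' c s) (at s within S)" for c s S
    unfolding f_def f'_def using b
    by (auto intro!: derivative_eq_intros simp: has_real_derivative_iff_has_vector_derivative[symmetric] field_simps)
  define k where "k s = exp (- (a * \<bar>s\<bar>)) * sin (b * s) / b" for s
  define k' where "k' s = exp (- (a * \<bar>s\<bar>)) * (b * cos (b * s) - a * sin (b * \<bar>s\<bar>)) / b" for s
  have 1: "(k has_vector_derivative k' s) (at s within {0..})" if "s \<ge> 0"
  proof (rule has_vector_derivative_transform[where f = "f 1"])
    show "(f 1 has_vector_derivative k' s) (at s within {0..})"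
      using f[of 1 s "{0..}"] that by (simp add: f'_def k'_def)
  qed (use that in \<open>auto simp: f_def k_def\<close>)
  have 2: "(k has_vector_derivative k' s) (at s within {..0})" if "s \<le> 0"
  proof (rule has_vector_derivative_transform[where f = "f (-1)"])
    show "(f (-1) has_vector_derivative k' s) (at s within {..0})"
      using f[of "-1" s "{..0}"] that by (simp add: f'_def k'_def)
  qed (use that in \<open>auto simp: f_def k_def\<close>)
  have k: "(k has_vector_derivative k' s) (at s)"
  proof -
    consider "s > 0" | "s < 0" | "s = 0" by linarith
    then show ?thesis
    proof cases
      case 1
      then have "at s within {0..} = at s" by (intro at_within_interior) (simp add: interior_Ici[of "0 - 1"])
      then show ?thesis using \<open>s \<ge> 0 \<Longrightarrow> _\<close> 1 by simp
    next
      case 2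
      then have "at s within {..0} = at s" by (intro at_within_interior) (simp add: interior_Iic[of _ "0 + 1"])
      then show ?thesis using \<open>s \<le> 0 \<Longrightarrow> _\<close> 2 by simp
    next
      case 3
      have "{0..} \<union> {..0::real} = UNIV" by auto
      then have "at s = sup (at s within {0..}) (at s within {..0})"
        using at_within_union[of s "{0..}" "{..0}"] by simp
      then show ?thesis
        using 1 2 3 unfolding has_vector_derivative_iff_slope by (simp add: filterlim_sup)
    qed
  qed
  have "((\<lambda>s. complex_of_real (k s)) has_vector_derivative of_real (k' s)) (at s)"
    by (rule has_vector_derivative_of_real) (use k in \<open>simp add: has_real_derivative_iff_has_vector_derivative\<close>)
  then show ?thesis
    unfolding wave_symbol_def wave_symbol'_def k_def k'_def a_def b_def .
qed

lemma bounded_symbol_wave_symbol: "bounded_symbol \<bar>s\<bar> (wave_symbol \<sigma> \<delta> s :: real^'n \<Rightarrow> complex)"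
  unfolding bounded_symbol_def
proof (intro conjI allI)
  fix \<xi> :: "real^'n"
  have "\<bar>s\<bar> * exp (- (norm \<xi> powr (2 * \<delta>) * \<bar>s\<bar>)) \<le> \<bar>s\<bar> * 1" by (intro mult_left_mono) auto
  then show "cmod (wave_symbol \<sigma> \<delta> s \<xi>) \<le> \<bar>s\<bar>" using cmod_wave_symbol_le[of \<sigma> \<delta> s \<xi>] by linarith
qed simp

lemma bounded_symbol_wave_symbol': "bounded_symbol 2 (wave_symbol' \<sigma> \<delta> s :: real^'n \<Rightarrow> complex)"
  unfolding bounded_symbol_def
proof (intro conjI allI)
  fix \<xi> :: "real^'n"
  have "2 * exp (- (norm \<xi> powr (2 * \<delta>) * (\<bar>s\<bar> / 2))) \<le> 2 * 1" by (intro mult_left_mono) auto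
  then show "cmod (wave_symbol' \<sigma> \<delta> s \<xi>) \<le> 2" using cmod_wave_symbol'_le[of \<sigma> \<delta> s \<xi>] by linarith
qed simp

lemma FT_kernel_convolution:
  fixes f :: "real^'n::finite \<Rightarrow> complex"
  assumes \<delta>: "\<delta> > 0" and t: "t \<ge> 0" and f: "integrable lborel f" "square_integrable f"
  shows "FT 1 (abs_l2 (Defs.convolution (kernel \<sigma> \<delta> t) f)) = symbol_mult (wave_symbol \<sigma> \<delta> t) (FT 1 (abs_l2 f))"
proof -
  have k: "kernel \<sigma> \<delta> t = inverse_fourier (wave_symbol \<sigma> \<delta> t)"
    unfolding kernel_def by (rule arg_cong[where f = inverse_fourier], rule ext) (rule kernel_symbol_eq[OF t])
  have i: "integrable lborel (wave_symbol \<sigma> \<delta> t :: real^'n \<Rightarrow> complex)"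
  proof (cases "t = 0")
    case False
    with t have "t > 0" by simp
    have "integrable lborel (\<lambda>\<xi>::real^'n. of_real t * heat_symbol \<delta> t \<xi>)"
      using heat_symbol_L1_L2(1)[OF \<delta> \<open>t > 0\<close>, where 'n = 'n] by simp
    then show ?thesis
    proof (rule Bochner_Integration.integrable_bound)
      show "AE \<xi>::real^'n in lborel. norm (wave_symbol \<sigma> \<delta> t \<xi>) \<le> norm (of_real t * heat_symbol \<delta> t \<xi>)"
        using cmod_wave_symbol_le[of \<sigma> \<delta> t] t by (auto simp: norm_mult cmod_heat_symbol mult.commute[of t])
    qed simp
  qed simp
  show ?thesis
    unfolding k by (rule FT_convolution_kernel[OF i bounded_symbol_wave_symbol f])
qed

text \<open>No frequencies are split, only times. The first bound is the Plancherel identity. For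
  \<open>s > 1\<close>, \<open>ft 1 f\<close> is bounded by \<open>L1norm f\<close> and the L2 norm
  falls on the heat symbol; for \<open>s <= 1\<close> the decaying factor is bounded below and the
  first bound suffices.\<close>

lemma low_time_decay:
  fixes \<delta> :: real
  assumes \<delta>: "\<delta> > 0"
  shows "\<exists>C>0. \<forall>m f s B. integrable lborel f \<longrightarrow> square_integrable (f :: real^'n::finite \<Rightarrow> complex) \<longrightarrow>
    m \<in> borel_measurable borel \<longrightarrow> s \<ge> 0 \<longrightarrow> B \<ge> 0 \<longrightarrow> (\<forall>\<xi>. cmod (m \<xi>) \<le> B * exp (- (norm \<xi> powr (2 * \<delta>) * (s / 2)))) \<longrightarrow>
    norm (symbol_mult m (FT 1 (abs_l2 f))) \<le> C * B * L2norm f \<and>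
    norm (symbol_mult m (FT 1 (abs_l2 f))) \<le> C * B * (1 + s) powr (- (real CARD('n) / (4 * \<delta>))) * (L1norm f + L2norm f)"
proof -
  let ?N = "sqrt ((2 * pi) ^ CARD('n))"
  let ?E = "L2norm (heat_symbol \<delta> 1 :: real^'n \<Rightarrow> complex)"
  define r where "r = real CARD('n) / (4 * \<delta>)"
  have r: "r > 0" using \<delta> by (simp add: r_def)
  \<comment> \<open>One summand for each case: the Plancherel identity, large \<open>s\<close> and
    small \<open>s\<close>.\<close>
  define C where "C = ?N + 4 powr r * ?E + 2 powr r * ?N"
  have N: "?N > 0" by simp
  have C0: "C > 0" unfolding C_def by (intro add_pos_nonneg) auto
  have C1: "?N \<le> C" "4 powr r * ?E \<le> C" "2 powr r * ?N \<le> C" by (auto simp: C_def)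
  show ?thesis
  proof (intro exI[of _ C] conjI C0 allI impI)
    fix m f :: "real^'n \<Rightarrow> complex" and s B :: real
    assume f: "integrable lborel f" "square_integrable f"
      and [measurable]: "m \<in> borel_measurable borel" and s: "s \<ge> 0" and B: "B \<ge> 0"
      and m: "\<forall>\<xi>. cmod (m \<xi>) \<le> B * exp (- (norm \<xi> powr (2 * \<delta>) * (s / 2)))"
    have [measurable]: "f \<in> borel_measurable borel" using f(2) by (rule square_integrable_measurable)
    have bm: "bounded_symbol B m"
      unfolding bounded_symbol_def
    proof (intro conjI allI)
      fix \<xi> :: "real^'n"
      have "B * exp (- (norm \<xi> powr (2 * \<delta>) * (s / 2))) \<le> B * 1" using s B by (intro mult_left_mono) auto
      then show "cmod (m \<xi>) \<le> B" using m[rule_format, of \<xi>] by linarith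
    qed simp
    let ?F = "symbol_mult m (FT 1 (abs_l2 f))"
    have "norm ?F \<le> B * norm (FT 1 (abs_l2 f))" by (rule norm_symbol_mult_le[OF bm])
    also have "\<dots> = ?N * B * L2norm f" by (simp add: Plancherel norm_abs_l2[OF f(2)])
    finally have 2: "norm ?F \<le> ?N * B * L2norm f" .
    also have "\<dots> \<le> C * B * L2norm f" using C1(1) B by (intro mult_right_mono) auto
    finally show "norm ?F \<le> C * B * L2norm f" .
    show "norm ?F \<le> C * B * (1 + s) powr (- (real CARD('n) / (4 * \<delta>))) * (L1norm f + L2norm f)"
      unfolding r_def[symmetric]
    proof (cases "s \<le> 1")
      case True
      have "2 powr (-r) \<le> (1 + s) powr (-r)" using True s r by (intro powr_mono2') auto
      then have "2 powr r * 2 powr (-r) \<le> 2 powr r * (1 + s) powr (-r)" by (intro mult_left_mono) auto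
      then have le: "1 \<le> 2 powr r * (1 + s) powr (-r)" by (simp flip: powr_add)
      have "?N * B * L2norm f \<le> ?N * B * L2norm f * (2 powr r * (1 + s) powr (-r))"
        using mult_left_mono[OF le, of "?N * B * L2norm f"] B by simp
      also have "\<dots> = (2 powr r * ?N) * (B * (1 + s) powr (-r) * L2norm f)" by (simp only: ac_simps)
      also have "\<dots> \<le> C * (B * (1 + s) powr (-r) * (L1norm f + L2norm f))"
        using C1(3) B C0 by (intro mult_mono mult_left_mono) auto
      finally show "norm ?F \<le> C * B * (1 + s) powr (-r) * (L1norm f + L2norm f)"
        using 2 by (simp only: mult.assoc)
    next
      case False
      have s2: "s / 2 > 0" using False by simp
      have F: "?F = abs_l2 (\<lambda>\<xi>. m \<xi> * ft 1 f \<xi>)"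
        by (simp add: FT_abs_l2[OF f] symbol_mult_abs_l2[OF bm] ft_L2_bound f)
      have "norm ?F = L2norm (\<lambda>\<xi>. m \<xi> * ft 1 f \<xi>)"
        unfolding F by (intro norm_abs_l2 square_integrable_symbol[OF bm] ft_L2_bound f) simp
      also have "\<dots> \<le> (B * L1norm f) * L2norm (heat_symbol \<delta> (s / 2) :: real^'n \<Rightarrow> complex)"
      proof (rule L2norm_mono[OF heat_symbol_L1_L2(2)[OF \<delta> s2]])
        show "AE \<xi> in lborel. cmod (m \<xi> * ft 1 f \<xi>) \<le> B * L1norm f * cmod (heat_symbol \<delta> (s / 2) \<xi>)"
        proof (rule AE_I2)
          fix \<xi>
          have "cmod (m \<xi>) * cmod (ft 1 f \<xi>) \<le> (B * exp (- (norm \<xi> powr (2 * \<delta>) * (s / 2)))) * L1norm f"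
            using m B by (intro mult_mono cmod_ft_le) auto
          then show "cmod (m \<xi> * ft 1 f \<xi>) \<le> B * L1norm f * cmod (heat_symbol \<delta> (s / 2) \<xi>)"
            by (simp add: norm_mult cmod_heat_symbol ac_simps)
        qed
      qed (use B in auto)
      also have "\<dots> = B * L1norm f * ((s / 2) powr (-r) * ?E)"
        unfolding L2norm_heat_symbol[OF \<delta> s2] r_def ..
      also have "\<dots> \<le> B * L1norm f * ((4 powr r * (1 + s) powr (-r)) * ?E)"
      proof (intro mult_left_mono mult_right_mono)
        \<comment> \<open>\<open>s > 1\<close> gives \<open>(1 + s) / 4 <= s / 2\<close>, which
          replaces the singular power of \<open>s\<close> by one of \<open>1 + s\<close>.\<close>
        have "(s / 2) powr (-r) \<le> ((1 + s) / 4) powr (-r)" using False r by (intro powr_mono2') auto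
        also have "\<dots> = 4 powr r * (1 + s) powr (-r)" using s by (simp add: powr_divide powr_minus field_simps)
        finally show "(s / 2) powr (-r) \<le> 4 powr r * (1 + s) powr (-r)" .
      qed (use B in auto)
      also have "\<dots> = (4 powr r * ?E) * (B * (1 + s) powr (-r) * L1norm f)" by (simp only: ac_simps)
      also have "\<dots> \<le> C * (B * (1 + s) powr (-r) * (L1norm f + L2norm f))"
        using C1(2) B C0 by (intro mult_mono mult_left_mono) auto
      finally show "norm ?F \<le> C * B * (1 + s) powr (-r) * (L1norm f + L2norm f)"
        by (simp only: mult.assoc)
    qed
  qed
qed

section \<open>Volterra integrals\<close>

text \<open>Symbol bounds are in general uniform only on bounded time intervals, so continuity is
  proved there first.\<close>

lemma continuous_on_atLeast_if_atLeastAtMost: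
  fixes f :: "real \<Rightarrow> 'a::topological_space"
  assumes "\<And>T. T \<ge> 0 \<Longrightarrow> continuous_on {0..T} f"
  shows "continuous_on {0..} f"
  unfolding continuous_on_eq_continuous_within
proof
  fix t :: real assume t: "t \<in> {0..}"
  have "continuous (at t within {0..t+1}) f"
    using assms[of "t + 1"] t by (auto simp: continuous_on_eq_continuous_within)
  moreover have "at t within {0..t+1} = at t within {0..}"
    by (rule at_within_nhd[of t "{t-1<..<t+1}"]) auto
  ultimately show "continuous (at t within {0..}) f" by simp
qed

text \<open>Extended constantly in the second variable beyond the diagonal, the integrand lives on a
  fixed square, where the continuity of parameter integrals applies. The surplus
  \<open>(T - t) *\<^sub>R J t t\<close> is explicit.\<close>

lemma continuous_on_Volterra_integral:
  fixes J :: "real \<Rightarrow> real \<Rightarrow> 'a::banach"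
  assumes J: "continuous_on {z. 0 \<le> snd z \<and> snd z \<le> fst z \<and> fst z \<le> T} (\<lambda>z. J (fst z) (snd z))"
  shows "continuous_on {0..T} (\<lambda>t. integral {0..t} (J t))"
proof (cases "T \<ge> 0")
  case T: True
  have c: "continuous_on ({0..T} \<times> {0..T}) (\<lambda>z. J (fst z) (min (snd z) (fst z)))"
    by (rule continuous_on_compose2[OF J, of _ "\<lambda>z. (fst z, min (snd z) (fst z))", simplified])
      (auto intro!: continuous_intros)
  then have "continuous_on ({0..T} \<times> cbox 0 T) (\<lambda>(t, \<tau>). J t (min \<tau> t))"
    by (simp add: split_beta)
  then have c1: "continuous_on {0..T} (\<lambda>t. integral (cbox 0 T) (\<lambda>\<tau>. J t (min \<tau> t)))"
    by (rule integral_continuous_on_param)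
  have c2: "continuous_on {0..T} (\<lambda>t. J t t)"
    by (rule continuous_on_compose2[OF J, of _ "\<lambda>t. (t, t)", simplified]) (auto intro!: continuous_intros)
  have eq: "integral (cbox 0 T) (\<lambda>\<tau>. J t (min \<tau> t)) - (T - t) *\<^sub>R J t t = integral {0..t} (J t)"
    if t: "t \<in> {0..T}" for t
  proof -
    have "continuous_on {0..T} (\<lambda>\<tau>. J t (min \<tau> t))"
      by (rule continuous_on_compose2[OF c, of _ "\<lambda>\<tau>. (t, \<tau>)", simplified])
        (use t in \<open>auto intro!: continuous_intros\<close>)
    then have "integral {0..t} (\<lambda>\<tau>. J t (min \<tau> t)) + integral {t..T} (\<lambda>\<tau>. J t (min \<tau> t))
        = integral {0..T} (\<lambda>\<tau>. J t (min \<tau> t))"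
      using t by (intro Henstock_Kurzweil_Integration.integral_combine integrable_continuous_interval) auto
    moreover have "integral {0..t} (\<lambda>\<tau>. J t (min \<tau> t)) = integral {0..t} (J t)"
      by (rule Henstock_Kurzweil_Integration.integral_cong) (simp add: min_def)
    moreover have "integral {t..T} (\<lambda>\<tau>. J t (min \<tau> t)) = integral {t..T} (\<lambda>\<tau>. J t t)"
      by (rule Henstock_Kurzweil_Integration.integral_cong) (auto simp: min_def)
    moreover have "integral {t..T} (\<lambda>\<tau>. J t t) = (T - t) *\<^sub>R J t t"
      using t by simp
    ultimately show ?thesis by (metis add_diff_cancel_right' interval_cbox)
  qed
  have "continuous_on {0..T} (\<lambda>t. integral (cbox 0 T) (\<lambda>\<tau>. J t (min \<tau> t)) - (T - t) *\<^sub>R J t t)"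
    by (intro continuous_intros c1 c2)
  then show ?thesis by (rule continuous_on_eq) (use eq in auto)
qed simp

text \<open>At a maximum point of \<open>exp (- (l * t)) * d t\<close> the integral inequality
  bounds the maximum by \<open>L / l\<close> times itself, and \<open>l = 2 * (L + 1)\<close> makes
  this factor at most one half.\<close>

lemma Gronwall_zero:
  fixes d :: "real \<Rightarrow> real"
  assumes T: "T \<ge> 0" and c: "continuous_on {0..T} d" and nn: "\<And>t. t \<in> {0..T} \<Longrightarrow> 0 \<le> d t" and L: "L \<ge> 0"
    and le: "\<And>t. t \<in> {0..T} \<Longrightarrow> d t \<le> L * integral {0..t} d"
  shows "\<forall>t\<in>{0..T}. d t = 0"
proof -
  define l where "l = 2 * (L + 1)"
  have l: "l > 0" using L by (simp add: l_def)
  have "continuous_on {0..T} (\<lambda>t. exp (- (l * t)) * d t)" by (intro continuous_intros c)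
  then obtain s where s: "s \<in> {0..T}" "\<And>t. t \<in> {0..T} \<Longrightarrow> exp (- (l * t)) * d t \<le> exp (- (l * s)) * d s"
    using continuous_attains_sup[of "{0..T}" "\<lambda>t. exp (- (l * t)) * d t"] T by auto
  define S where "S = exp (- (l * s)) * d s"
  have S: "0 \<le> S" using nn[OF s(1)] by (simp add: S_def)
  have dS: "d t \<le> S * exp (l * t)" if "t \<in> {0..T}" for t
  proof -
    have "exp (l * t) * (exp (- (l * t)) * d t) \<le> exp (l * t) * S"
      using s(2)[OF that] by (intro mult_left_mono) (auto simp: S_def)
    moreover have "exp (l * t) * exp (- (l * t)) = 1" by (simp flip: exp_add)
    then have "exp (l * t) * (exp (- (l * t)) * d t) = d t" by (simp only: mult.assoc[symmetric] mult_1)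
    ultimately show ?thesis by (simp only: mult.commute)
  qed
  have "((\<lambda>t. S * exp (l * t)) has_integral (S * exp (l * s) / l - S * exp (l * 0) / l)) {0..s}"
    using s l by (intro fundamental_theorem_of_calculus)
      (auto intro!: derivative_eq_intros simp: has_real_derivative_iff_has_vector_derivative[symmetric])
  then have I: "(\<lambda>t. S * exp (l * t)) integrable_on {0..s}" "integral {0..s} (\<lambda>t. S * exp (l * t)) \<le> S * exp (l * s) / l"
    using S l by (auto simp: has_integral_iff)
  have "integral {0..s} d \<le> integral {0..s} (\<lambda>t. S * exp (l * t))"
  proof (rule integral_le)
    show "d integrable_on {0..s}"
      using s(1) by (intro integrable_continuous_interval continuous_on_subset[OF c]) auto
  qed (use I dS s(1) in auto)
  also note I(2)
  finally have "L * integral {0..s} d \<le> L * (S * exp (l * s) / l)" using L by (rule mult_left_mono)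
  with le[OF s(1)] have "d s \<le> L * (S * exp (l * s) / l)" by linarith
  then have "exp (- (l * s)) * d s \<le> exp (- (l * s)) * (L * (S * exp (l * s) / l))" by (intro mult_left_mono) auto
  also have "\<dots> = L / l * S * (exp (- (l * s)) * exp (l * s))" by simp
  also have "\<dots> = L / l * S" by (simp flip: exp_add)
  finally have "S \<le> L / l * S" by (simp add: S_def)
  moreover have "L / l \<le> 1 / 2" using L by (simp add: l_def field_simps)
  then have "L / l * S \<le> 1 / 2 * S" using S by (rule mult_right_mono)
  ultimately have "S \<le> 1 / 2 * S" by linarith
  then have "S = 0" using S by simp
  then show ?thesis using dS nn by (auto intro: antisym)
qed

lemma continuous_on_wave_integrand:
  fixes N :: "real \<Rightarrow> ('n::finite) l2"
  assumes N: "continuous_on {0..} N"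
    and m: "\<And>t \<tau>. 0 \<le> \<tau> \<Longrightarrow> \<tau> \<le> t \<Longrightarrow> t \<le> T \<Longrightarrow> bounded_symbol B (m t \<tau>)"
    and c: "\<And>\<xi>. continuous_on {z. 0 \<le> snd z \<and> snd z \<le> fst z \<and> fst z \<le> T} (\<lambda>z. m (fst z) (snd z) \<xi>)"
  shows "continuous_on {z. 0 \<le> snd z \<and> snd z \<le> fst z \<and> fst z \<le> T} (\<lambda>z. symbol_mult (m (fst z) (snd z)) (N (snd z)))"
proof (rule continuous_on_symbol_mult[where B = B])
  show "continuous_on {z. 0 \<le> snd z \<and> snd z \<le> fst z \<and> fst z \<le> T} (\<lambda>z::real \<times> real. N (snd z))"
    by (rule continuous_on_compose2[OF N]) (auto intro!: continuous_intros)
qed (use m c in auto)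

lemma add_eq_imp_diff_eq: "a + b = c \<Longrightarrow> c - a = b" for a b c :: "'a::ab_group_add"
  by auto

lemma add_eq_imp_diff_eq': "a + b = c \<Longrightarrow> a - c = - b" for a b c :: "'a::ab_group_add"
  by auto

text \<open>Since \<open>wave_symbol \<sigma> \<delta> 0 = 0\<close>, moving the upper limit only contributes an error of second order.\<close>

lemma has_vector_derivative_Duhamel:
  fixes N :: "real \<Rightarrow> ('n::finite) l2"
  assumes N: "continuous_on {0..} N" and t0: "t0 \<ge> 0"
  shows "((\<lambda>t. integral {0..t} (\<lambda>\<tau>. symbol_mult (wave_symbol \<sigma> \<delta> (t - \<tau>)) (N \<tau>))) has_vector_derivative
    integral {0..t0} (\<lambda>\<tau>. symbol_mult (wave_symbol' \<sigma> \<delta> (t0 - \<tau>)) (N \<tau>))) (at t0 within {0..})"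
proof -
  let ?J = "\<lambda>t \<tau>. symbol_mult (wave_symbol \<sigma> \<delta> (t - \<tau>)) (N \<tau>)"
  \<comment> \<open>\<open>?G\<close> keeps the upper limit fixed, so the Leibniz rule applies. For
    \<open>t < t0\<close> it evaluates the symbol at negative times, which is why the symbol was
    extended.\<close>
  let ?w = "\<lambda>t. integral {0..t} (?J t)" and ?G = "\<lambda>t. integral {0..t0} (?J t)"
  have cJ: "continuous_on {a..b} (?J t)" if "0 \<le> a" for a b t
  proof (rule continuous_on_symbol_mult[where B = "max \<bar>t - a\<bar> \<bar>t - b\<bar>"])
    show "bounded_symbol (max \<bar>t - a\<bar> \<bar>t - b\<bar>) (wave_symbol \<sigma> \<delta> (t - \<tau>))" if "\<tau> \<in> {a..b}" for \<tau>
    proof -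
      have "\<bar>t - \<tau>\<bar> \<le> max \<bar>t - a\<bar> \<bar>t - b\<bar>" using that by auto
      then show ?thesis
        using bounded_symbol_wave_symbol[of "t - \<tau>" \<sigma> \<delta>] order_trans unfolding bounded_symbol_def by blast
    qed
    show "continuous_on {a..b} (\<lambda>\<tau>. wave_symbol \<sigma> \<delta> (t - \<tau>) \<xi>)" for \<xi>
      by (rule continuous_on_compose2[OF continuous_wave_symbol[of UNIV]]) (auto intro!: continuous_intros)
    show "continuous_on {a..b} N" using that by (intro continuous_on_subset[OF N]) auto
  qed
  have G: "(?G has_vector_derivative integral {0..t0} (\<lambda>\<tau>. symbol_mult (wave_symbol' \<sigma> \<delta> (t0 - \<tau>)) (N \<tau>))) (at t0 within UNIV)"
    unfolding interval_cbox
  proof (rule leibniz_rule_vector_derivative)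
    fix x \<tau> :: real
    have "((\<lambda>s. symbol_mult (wave_symbol \<sigma> \<delta> s) (N \<tau>)) has_vector_derivative symbol_mult (wave_symbol' \<sigma> \<delta> (x - \<tau>)) (N \<tau>)) (at (x - \<tau>))"
      using bounded_symbol_wave_symbol'
      by (intro has_vector_derivative_symbol_mult[OF bounded_symbol_wave_symbol bounded_symbol_wave_symbol' has_vector_derivative_wave_symbol])
        (auto simp: bounded_symbol_def)
    from vector_diff_chain_at[OF has_vector_derivative_diff_const[THEN iffD2, OF has_vector_derivative_id] this]
    show "((\<lambda>x. symbol_mult (wave_symbol \<sigma> \<delta> (x - \<tau>)) (N \<tau>)) has_vector_derivative symbol_mult (wave_symbol' \<sigma> \<delta> (x - \<tau>)) (N \<tau>)) (at x within UNIV)"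
      by (simp add: o_def)
  next
    show "?J x integrable_on cbox 0 t0" for x
      using cJ[of 0 t0 x] integrable_continuous[of 0 t0 "?J x"] by simp
    show "continuous_on (UNIV \<times> cbox 0 t0) (\<lambda>(x, \<tau>). symbol_mult (wave_symbol' \<sigma> \<delta> (x - \<tau>)) (N \<tau>))"
      unfolding split_beta
    proof (rule continuous_on_symbol_mult[OF bounded_symbol_wave_symbol'])
      show "continuous_on (UNIV \<times> cbox 0 t0) (\<lambda>z. wave_symbol' \<sigma> \<delta> (fst z - snd z) \<xi>)" for \<xi>
        by (rule continuous_on_compose2[OF continuous_wave_symbol'[of UNIV]]) (auto intro!: continuous_intros)
      show "continuous_on (UNIV \<times> cbox 0 t0) (\<lambda>z. N (snd z))"
        by (rule continuous_on_compose2[OF N]) (auto intro!: continuous_intros)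
    qed
  qed auto
  \<comment> \<open>The part between \<open>t0\<close> and \<open>t\<close>. There the symbol is at
    most the length of the interval, which gives the quadratic bound \<open>HB\<close> and a zero
    derivative.\<close>
  define H where "H t = ?w t - ?G t" for t
  have "compact (N ` {0..t0+1})"
    by (intro compact_continuous_image continuous_on_subset[OF N]) auto
  then obtain B where B: "\<And>\<tau>. \<tau> \<in> {0..t0+1} \<Longrightarrow> norm (N \<tau>) \<le> B"
    using compact_imp_bounded[of "N ` {0..t0+1}"] unfolding bounded_iff by blast
  have B0: "B \<ge> 0" using order_trans[OF norm_ge_zero B[of 0]] t0 by simp
  have JB: "norm (integral {a..b} (?J t)) \<le> B * \<bar>b - a\<bar> * \<bar>b - a\<bar>"
    if "0 \<le> a" "a \<le> b" "b \<le> t0 + 1" "t = a \<or> t = b" for a b t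
  proof -
    have "norm (integral (cbox a b) (?J t)) \<le> (B * \<bar>b - a\<bar>) * measure lborel (cbox a b)"
    proof (rule integrable_bound)
      show "?J t integrable_on cbox a b" using cJ[of a b t] that integrable_continuous[of a b "?J t"] by simp
      fix \<tau> assume \<tau>: "\<tau> \<in> cbox a b"
      have "norm (?J t \<tau>) \<le> \<bar>t - \<tau>\<bar> * norm (N \<tau>)"
        by (rule norm_symbol_mult_le[OF bounded_symbol_wave_symbol])
      also have "\<dots> \<le> \<bar>b - a\<bar> * B" using \<tau> that B by (intro mult_mono) auto
      finally show "norm (?J t \<tau>) \<le> B * \<bar>b - a\<bar>" by (simp add: mult.commute)
    qed (use B0 in auto)
    then show ?thesis using that by simp
  qed
  have HB: "norm (H t) \<le> B * \<bar>t - t0\<bar> * \<bar>t - t0\<bar>" if "t \<in> {0..t0+1}" for t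
  proof (cases "t \<ge> t0")
    case True
    have "integral {0..t0} (?J t) + integral {t0..t} (?J t) = integral {0..t} (?J t)"
      using True t0 cJ by (intro Henstock_Kurzweil_Integration.integral_combine integrable_continuous_interval) auto
    then have "H t = integral {t0..t} (?J t)" unfolding H_def by (rule add_eq_imp_diff_eq)
    then show ?thesis using JB[of t0 t t] True t0 that by simp
  next
    case False
    have "integral {0..t} (?J t) + integral {t..t0} (?J t) = integral {0..t0} (?J t)"
      using False that cJ by (intro Henstock_Kurzweil_Integration.integral_combine integrable_continuous_interval) auto
    then have "H t = - integral {t..t0} (?J t)" unfolding H_def by (rule add_eq_imp_diff_eq')
    then show ?thesis using JB[of t t0 t] False that by (simp add: abs_minus_commute)
  qed
  have H: "(H has_vector_derivative 0) (at t0 within {0..})"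
    unfolding has_vector_derivative_iff_slope
  proof (rule Lim_null_comparison)
    have "norm ((1 / (t - t0)) *\<^sub>R (H t - H t0)) \<le> B * \<bar>t - t0\<bar>" if "t \<in> {..<t0+1}" "t \<noteq> t0" "t \<in> {0..}" for t
    proof -
      have "H t0 = 0" by (simp add: H_def)
      moreover have "norm (H t) \<le> B * \<bar>t - t0\<bar> * \<bar>t - t0\<bar>" using that by (intro HB) auto
      ultimately show "norm ((1 / (t - t0)) *\<^sub>R (H t - H t0)) \<le> B * \<bar>t - t0\<bar>"
        using that by (simp add: pos_divide_le_eq)
    qed
    then show "\<forall>\<^sub>F t in at t0 within {0..}. norm ((1 / (t - t0)) *\<^sub>R (H t - H t0)) \<le> B * \<bar>t - t0\<bar>"
      unfolding eventually_at_topological by (intro exI[of _ "{..<t0+1}"]) auto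
    have "((\<lambda>t. B * \<bar>t - t0\<bar>) \<longlongrightarrow> B * \<bar>t0 - t0\<bar>) (at t0 within {0..})" by (intro tendsto_intros)
    then show "((\<lambda>t. B * \<bar>t - t0\<bar>) \<longlongrightarrow> 0) (at t0 within {0..})" by simp
  qed
  have "((\<lambda>t. ?G t + H t) has_vector_derivative integral {0..t0} (\<lambda>\<tau>. symbol_mult (wave_symbol' \<sigma> \<delta> (t0 - \<tau>)) (N \<tau>)) + 0) (at t0 within {0..})"
    by (rule has_vector_derivative_add[OF has_vector_derivative_at_within[OF G] H])
  then show ?thesis by (simp add: H_def)
qed

section \<open>Continuity in Sobolev spaces\<close>

definition inv_FT :: "('n::finite) l2 \<Rightarrow> 'n l2" where
  "inv_FT F = (1 / (2 * pi) ^ CARD('n)) *\<^sub>R FT (-1) F"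

lemma FT_inv_FT [simp]: "FT 1 (inv_FT F) = F"
  unfolding inv_FT_def by (rule FT_surj)

lemma inv_FT_FT [simp]: "inv_FT (FT 1 f) = f"
  by (rule FT_inj) simp

lemma bounded_linear_inv_FT: "bounded_linear (inv_FT :: ('n::finite) l2 \<Rightarrow> 'n l2)"
  unfolding inv_FT_def[abs_def]
  by (rule bounded_linear_const_scaleR[OF bounded_linear_FT]) simp

lemma norm_inv_FT: "norm (inv_FT F) = norm F / sqrt ((2 * pi) ^ CARD('n))" for F :: "('n::finite) l2"
  using Plancherel[of 1 "inv_FT F"] by simp

lemma norm_inv_FT_le: "norm (inv_FT F) \<le> norm F" for F :: "('n::finite) l2"
proof -
  have "1 \<le> (2 * pi) ^ CARD('n)" using pi_gt3 by (intro one_le_power) simp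
  then have "1 \<le> sqrt ((2 * pi) ^ CARD('n))" by simp
  then show ?thesis
    unfolding norm_inv_FT using divide_left_mono[of 1 "sqrt ((2 * pi) ^ CARD('n))" "norm F"] by simp
qed

lemma symbol_mult_inv_weight_inj:
  fixes U V :: "('n::finite) l2"
  assumes a: "\<alpha> > 0" "\<beta> > 0" and eq: "symbol_mult (inv_weight \<sigma> \<alpha> \<beta>) U = symbol_mult (inv_weight \<sigma> \<alpha> \<beta>) V"
  shows "U = V"
proof (rule l2_eqI)
  note b = bounded_symbol_inv_weight[OF a, of \<sigma>]
  show "AE x in lborel. rep_l2 U x = rep_l2 V x"
    using AE_rep_symbol_mult[OF b, of U] AE_rep_symbol_mult[OF b, of V] unfolding eq
  proof eventually_elim
    case (elim x)
    have "inv_weight \<sigma> \<alpha> \<beta> x \<noteq> 0" using weight_pos[OF a, of x \<sigma>] unfolding inv_weight_def of_real_eq_0_iff by simp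
    then show ?case using elim by simp
  qed
qed

text \<open>The weight \<open>1 + norm \<xi> powr \<sigma>\<close> is equivalent to the Bessel
  weight, so it describes the same Sobolev space while fitting the form
  \<open>\<alpha> + \<beta> * norm \<xi> powr \<sigma>\<close>.\<close>

lemma bessel_weight_comparison:
  fixes \<xi> :: "real^'n"
  assumes "\<sigma> \<ge> 0"
  shows "1 + norm \<xi> powr \<sigma> \<le> 2 * (1 + (norm \<xi>)\<^sup>2) powr (\<sigma> / 2)"
    and "(1 + (norm \<xi>)\<^sup>2) powr (\<sigma> / 2) \<le> 2 powr (\<sigma> / 2) * (1 + norm \<xi> powr \<sigma>)"
proof -
  have e: "norm \<xi> powr \<sigma> = ((norm \<xi>)\<^sup>2) powr (\<sigma> / 2)"
  proof -
    have "(norm \<xi>)\<^sup>2 = norm \<xi> powr 2" by (simp add: powr_numeral)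
    then show ?thesis by (simp only: powr_powr) simp
  qed
  have "1 powr (\<sigma> / 2) \<le> (1 + (norm \<xi>)\<^sup>2) powr (\<sigma> / 2)" using assms by (intro powr_mono2) auto
  moreover have "((norm \<xi>)\<^sup>2) powr (\<sigma> / 2) \<le> (1 + (norm \<xi>)\<^sup>2) powr (\<sigma> / 2)" using assms by (intro powr_mono2) auto
  ultimately show "1 + norm \<xi> powr \<sigma> \<le> 2 * (1 + (norm \<xi>)\<^sup>2) powr (\<sigma> / 2)" unfolding e by simp
  have "(1 + (norm \<xi>)\<^sup>2) powr (\<sigma> / 2) \<le> (2 * max 1 ((norm \<xi>)\<^sup>2)) powr (\<sigma> / 2)"
    using assms by (intro powr_mono2) auto
  also have "\<dots> = 2 powr (\<sigma> / 2) * max 1 ((norm \<xi>)\<^sup>2) powr (\<sigma> / 2)" by (simp add: powr_mult)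
  also have "max 1 ((norm \<xi>)\<^sup>2) powr (\<sigma> / 2) \<le> 1 + norm \<xi> powr \<sigma>" unfolding e by (auto simp: max_def)
  finally show "(1 + (norm \<xi>)\<^sup>2) powr (\<sigma> / 2) \<le> 2 powr (\<sigma> / 2) * (1 + norm \<xi> powr \<sigma>)" by simp
qed

text \<open>Continuity with values in the Sobolev space, in terms of the weighted Fourier transform \<open>Z\<close>.\<close>

lemma continuous_sobolev_iff:
  fixes u :: "real \<Rightarrow> ('n::finite) l2"
  assumes \<sigma>: "\<sigma> \<ge> 0"
  shows "continuous_sobolev \<sigma> u \<longleftrightarrow>
    (\<exists>Z. continuous_on {0..} Z \<and> (\<forall>t\<ge>0. FT 1 (u t) = symbol_mult (inv_weight \<sigma> 1 1) (Z t)))"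
proof
  assume u: "continuous_sobolev \<sigma> u"
  define w where "w \<xi> = complex_of_real (1 + norm \<xi> powr \<sigma>)" for \<xi> :: "real^'n"
  have [measurable]: "w \<in> borel_measurable borel" unfolding w_def[abs_def] by measurable
  have le: "AE \<xi> in lborel. cmod (w \<xi> * g \<xi>) \<le> 2 * cmod (bessel_weight \<sigma> g \<xi>)" for g
  proof (rule AE_I2)
    fix \<xi> :: "real^'n"
    show "cmod (w \<xi> * g \<xi>) \<le> 2 * cmod (bessel_weight \<sigma> g \<xi>)"
      using mult_right_mono[OF bessel_weight_comparison(1)[OF \<sigma>, of \<xi>], of "cmod (g \<xi>)"]
      unfolding w_def bessel_weight_def norm_mult norm_of_real by (simp add: abs_of_nonneg)
  qed
  have S: "square_integrable (bessel_weight \<sigma> (rep_l2 (FT 1 (u t))))" if "t \<ge> 0" for t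
    using u that unfolding continuous_sobolev_def sobolev_l2_iff by blast
  define Z where "Z t = abs_l2 (\<lambda>\<xi>. w \<xi> * rep_l2 (FT 1 (u t)) \<xi>)" for t
  have ZS: "square_integrable (\<lambda>\<xi>. w \<xi> * rep_l2 (FT 1 (u t)) \<xi>)" if "t \<ge> 0" for t
    by (rule square_integrable_bound[OF S[OF that] _ le]) measurable
  have FZ: "FT 1 (u t) = symbol_mult (inv_weight \<sigma> 1 1) (Z t)" if "t \<ge> 0" for t
  proof -
    have "symbol_mult (inv_weight \<sigma> 1 1) (Z t) = abs_l2 (\<lambda>\<xi>. inv_weight \<sigma> 1 1 \<xi> * (w \<xi> * rep_l2 (FT 1 (u t)) \<xi>))"
      unfolding Z_def by (rule symbol_mult_abs_l2[OF bounded_symbol_inv_weight ZS[OF that]]) auto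
    also have "(\<lambda>\<xi>. inv_weight \<sigma> 1 1 \<xi> * (w \<xi> * rep_l2 (FT 1 (u t)) \<xi>)) = rep_l2 (FT 1 (u t))"
    proof
      fix \<xi> :: "real^'n"
      have "1 + norm \<xi> powr \<sigma> \<noteq> 0" using weight_pos[of 1 1 \<xi> \<sigma>] by simp
      then have "inv_weight \<sigma> 1 1 \<xi> * w \<xi> = 1"
        unfolding inv_weight_def w_def of_real_mult[symmetric] by simp
      then show "inv_weight \<sigma> 1 1 \<xi> * (w \<xi> * rep_l2 (FT 1 (u t)) \<xi>) = rep_l2 (FT 1 (u t)) \<xi>"
        by (simp flip: mult.assoc)
    qed
    finally show ?thesis by simp
  qed
  have Zd: "norm (Z r - Z t) \<le> 2 * sobolev_norm \<sigma> (l2_distribution (u r - u t))" if "t \<ge> 0" "r \<ge> 0" for r t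
  proof -
    have ae: "AE \<xi> in lborel. rep_l2 (FT 1 (u r - u t)) \<xi> = rep_l2 (FT 1 (u r)) \<xi> - rep_l2 (FT 1 (u t)) \<xi>"
      unfolding linear_diff[OF bounded_linear.linear[OF bounded_linear_FT[of 1, OF one_power2]]]
      by (rule AE_rep_l2_diff)
    \<comment> \<open>Finiteness has to be shown separately: \<open>L2norm\<close> of a function
      that is not square-integrable is 0 by convention.\<close>
    have sb: "square_integrable (bessel_weight \<sigma> (rep_l2 (FT 1 (u r - u t))))"
    proof (rule square_integrable_cong_AE)
      show "square_integrable (\<lambda>\<xi>. bessel_weight \<sigma> (rep_l2 (FT 1 (u r))) \<xi> - bessel_weight \<sigma> (rep_l2 (FT 1 (u t))) \<xi>)"
        by (intro square_integrable_diff S that)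
      show "AE \<xi> in lborel. bessel_weight \<sigma> (rep_l2 (FT 1 (u r))) \<xi> - bessel_weight \<sigma> (rep_l2 (FT 1 (u t))) \<xi>
          = bessel_weight \<sigma> (rep_l2 (FT 1 (u r - u t))) \<xi>"
        using ae by eventually_elim (simp add: bessel_weight_def right_diff_distrib)
    qed (intro measurable_bessel_weight measurable_rep_l2)
    have "norm (Z r - Z t) = L2norm (\<lambda>\<xi>. w \<xi> * rep_l2 (FT 1 (u r)) \<xi> - w \<xi> * rep_l2 (FT 1 (u t)) \<xi>)"
      unfolding Z_def abs_l2_diff[OF ZS[OF that(2)] ZS[OF that(1)]]
      by (intro norm_abs_l2 square_integrable_diff ZS that)
    also have "\<dots> \<le> 2 * L2norm (bessel_weight \<sigma> (rep_l2 (FT 1 (u r - u t))))"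
    proof (rule L2norm_mono[OF sb])
      show "AE \<xi> in lborel. cmod (w \<xi> * rep_l2 (FT 1 (u r)) \<xi> - w \<xi> * rep_l2 (FT 1 (u t)) \<xi>)
          \<le> 2 * cmod (bessel_weight \<sigma> (rep_l2 (FT 1 (u r - u t))) \<xi>)"
        using ae le[of "rep_l2 (FT 1 (u r - u t))"] by eventually_elim (simp add: right_diff_distrib)
    qed auto
    finally show ?thesis by (simp add: sobolev_norm_l2)
  qed
  have "continuous_on {0..} Z"
    unfolding continuous_on_def
  proof
    fix t :: real assume t: "t \<in> {0..}"
    have "((\<lambda>r. sobolev_norm \<sigma> (l2_distribution (u r - u t))) \<longlongrightarrow> 0) (at t within {0..})"
      using u t by (simp add: continuous_sobolev_def)
    from tendsto_mult_right_zero[OF this, of 2]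
    have "((\<lambda>r. dist (Z r) (Z t)) \<longlongrightarrow> 0) (at t within {0..})"
    proof (rule Lim_null_comparison[rotated])
      show "\<forall>\<^sub>F r in at t within {0..}. norm (dist (Z r) (Z t)) \<le> 2 * sobolev_norm \<sigma> (l2_distribution (u r - u t))"
        unfolding eventually_at_filter using Zd t by (intro always_eventually) (simp add: dist_norm)
    qed
    then show "(Z \<longlongrightarrow> Z t) (at t within {0..})" by (subst tendsto_dist_iff)
  qed
  with FZ show "\<exists>Z. continuous_on {0..} Z \<and> (\<forall>t\<ge>0. FT 1 (u t) = symbol_mult (inv_weight \<sigma> 1 1) (Z t))" by blast
next
  assume "\<exists>Z. continuous_on {0..} Z \<and> (\<forall>t\<ge>0. FT 1 (u t) = symbol_mult (inv_weight \<sigma> 1 1) (Z t))"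
  then obtain Z where Z: "continuous_on {0..} Z" "\<And>t. t \<ge> 0 \<Longrightarrow> FT 1 (u t) = symbol_mult (inv_weight \<sigma> 1 1) (Z t)"
    by blast
  note b = bounded_symbol_inv_weight[of 1 1 \<sigma>, simplified]
  have le: "AE \<xi> in lborel. cmod (bessel_weight \<sigma> (rep_l2 (symbol_mult (inv_weight \<sigma> 1 1) V)) \<xi>) \<le> 2 powr (\<sigma> / 2) * cmod (rep_l2 V \<xi>)"
    for V :: "'n l2"
    using AE_rep_symbol_mult[OF b, of V]
  proof eventually_elim
    case (elim \<xi>)
    have w: "1 + norm \<xi> powr \<sigma> > 0" using weight_pos[of 1 1 \<xi> \<sigma>] by simp
    have "(1 + (norm \<xi>)\<^sup>2) powr (\<sigma> / 2) / (1 + norm \<xi> powr \<sigma>) \<le> 2 powr (\<sigma> / 2)"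
      using bessel_weight_comparison(2)[OF \<sigma>, of \<xi>] w by (simp add: pos_divide_le_eq)
    then have "(1 + (norm \<xi>)\<^sup>2) powr (\<sigma> / 2) / (1 + norm \<xi> powr \<sigma>) * cmod (rep_l2 V \<xi>) \<le> 2 powr (\<sigma> / 2) * cmod (rep_l2 V \<xi>)"
      by (rule mult_right_mono) simp
    then show ?case
      unfolding elim bessel_weight_def inv_weight_def norm_mult norm_of_real using w by simp
  qed
  show "continuous_sobolev \<sigma> u"
    unfolding continuous_sobolev_def
  proof (intro allI impI conjI)
    fix t :: real assume t: "0 \<le> t"
    show "l2_distribution (u t) \<in> sobolev \<sigma>"
      unfolding sobolev_l2_iff Z(2)[OF t]
      by (rule square_integrable_bound[OF square_integrable_rep_l2 _ le]) (intro measurable_bessel_weight measurable_rep_l2)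
    have nle: "sobolev_norm \<sigma> (l2_distribution (u r - u t)) \<le> 2 powr (\<sigma> / 2) * norm (Z r - Z t)" if "r \<ge> 0" for r
    proof -
      have "FT 1 (u r - u t) = symbol_mult (inv_weight \<sigma> 1 1) (Z r - Z t)"
        by (rule symbol_mult_inv_weight_diff) (use Z(2) t that in auto)
      then show ?thesis
        unfolding sobolev_norm_l2 norm_l2_eq[of "Z r - Z t"]
        by (simp only:) (rule L2norm_mono[OF square_integrable_rep_l2 _ _ le],
            auto intro!: measurable_bessel_weight)
    qed
    have "((\<lambda>r. 2 powr (\<sigma> / 2) * norm (Z r - Z t)) \<longlongrightarrow> 2 powr (\<sigma> / 2) * norm (Z t - Z t)) (at t within {0..})"
      using Z(1) t by (intro tendsto_intros) (auto simp: continuous_on_def)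
    then have "((\<lambda>r. 2 powr (\<sigma> / 2) * norm (Z r - Z t)) \<longlongrightarrow> 0) (at t within {0..})" by simp
    then show "((\<lambda>r. sobolev_norm \<sigma> (l2_distribution (u r - u t))) \<longlongrightarrow> 0) (at t within {0..})"
    proof (rule Lim_null_comparison[rotated])
      show "\<forall>\<^sub>F r in at t within {0..}. norm (sobolev_norm \<sigma> (l2_distribution (u r - u t))) \<le> 2 powr (\<sigma> / 2) * norm (Z r - Z t)"
        unfolding eventually_at_filter using nle by (intro always_eventually) (simp add: sobolev_norm_l2)
    qed
  qed
qed

section \<open>The semilinear equation\<close>

text \<open>The symbol of the Duhamel operator acting on the weighted transform \<open>V\<close>. It
  is bounded although the weight is not, since the kernel gains
  \<open>norm \<xi> powr (-\<sigma>)\<close>.\<close>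

definition weighted_wave_symbol :: "real \<Rightarrow> real \<Rightarrow> real \<Rightarrow> real \<Rightarrow> real \<Rightarrow> real^'n \<Rightarrow> complex" where
  "weighted_wave_symbol \<sigma> \<delta> \<alpha> \<beta> s \<xi> = of_real (\<alpha> + \<beta> * norm \<xi> powr \<sigma>) * wave_symbol \<sigma> \<delta> s \<xi>"

lemma measurable_weighted_wave_symbol [measurable]:
  "weighted_wave_symbol \<sigma> \<delta> \<alpha> \<beta> s \<in> borel_measurable borel"
  unfolding weighted_wave_symbol_def[abs_def] by measurable

text \<open>\<open>\<alpha>\<close> times the bound that grows in time plus \<open>\<beta>\<close>
  times the bound that does not.\<close>

lemma cmod_weighted_wave_symbol_le:
  assumes "\<alpha> > 0" "\<beta> > 0"
  shows "cmod (weighted_wave_symbol \<sigma> \<delta> \<alpha> \<beta> s \<xi>) \<le> (\<alpha> * \<bar>s\<bar> + \<beta>) * exp (- (norm \<xi> powr (2 * \<delta>) * \<bar>s\<bar>))"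
proof -
  let ?e = "exp (- (norm \<xi> powr (2 * \<delta>) * \<bar>s\<bar>))"
  have "cmod (weighted_wave_symbol \<sigma> \<delta> \<alpha> \<beta> s \<xi>) = \<alpha> * cmod (wave_symbol \<sigma> \<delta> s \<xi>) + \<beta> * (norm \<xi> powr \<sigma> * cmod (wave_symbol \<sigma> \<delta> s \<xi>))"
    unfolding weighted_wave_symbol_def norm_mult norm_of_real
    using weight_pos[OF assms, of \<xi> \<sigma>] by (simp add: distrib_right)
  also have "\<dots> \<le> \<alpha> * (\<bar>s\<bar> * ?e) + \<beta> * ?e"
    using assms by (intro add_mono mult_left_mono cmod_wave_symbol_le cmod_wave_symbol_times_le) auto
  also have "\<dots> = (\<alpha> * \<bar>s\<bar> + \<beta>) * ?e" by (simp add: distrib_right)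
  finally show ?thesis .
qed

lemma bounded_symbol_weighted_wave_symbol:
  assumes a: "\<alpha> > 0" "\<beta> > 0"
  shows "bounded_symbol (\<alpha> * \<bar>s\<bar> + \<beta>) (weighted_wave_symbol \<sigma> \<delta> \<alpha> \<beta> s :: real^'n \<Rightarrow> complex)"
  unfolding bounded_symbol_def
proof (intro conjI allI)
  fix \<xi> :: "real^'n"
  have "(\<alpha> * \<bar>s\<bar> + \<beta>) * exp (- (norm \<xi> powr (2 * \<delta>) * \<bar>s\<bar>)) \<le> (\<alpha> * \<bar>s\<bar> + \<beta>) * 1"
    using a by (intro mult_left_mono) auto
  from order_trans[OF cmod_weighted_wave_symbol_le[OF a] this]
  show "cmod (weighted_wave_symbol \<sigma> \<delta> \<alpha> \<beta> s \<xi>) \<le> \<alpha> * \<bar>s\<bar> + \<beta>" by simp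
qed simp

lemma inv_weight_weighted_wave_symbol:
  fixes F :: "('n::finite) l2"
  assumes a: "\<alpha> > 0" "\<beta> > 0"
  shows "symbol_mult (inv_weight \<sigma> \<alpha> \<beta>) (symbol_mult (weighted_wave_symbol \<sigma> \<delta> \<alpha> \<beta> s) F) = symbol_mult (wave_symbol \<sigma> \<delta> s) F"
proof -
  have "inv_weight \<sigma> \<alpha> \<beta> \<xi> * weighted_wave_symbol \<sigma> \<delta> \<alpha> \<beta> s \<xi> = wave_symbol \<sigma> \<delta> s \<xi>" for \<xi> :: "real^'n"
  proof -
    have "\<alpha> + \<beta> * norm \<xi> powr \<sigma> \<noteq> 0" using weight_pos[OF a, of \<xi> \<sigma>] by simp
    then have "inv_weight \<sigma> \<alpha> \<beta> \<xi> * of_real (\<alpha> + \<beta> * norm \<xi> powr \<sigma>) = 1"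
      unfolding inv_weight_def of_real_mult[symmetric] by simp
    then show ?thesis unfolding weighted_wave_symbol_def mult.assoc[symmetric] by simp
  qed
  from symbol_mult_mult[OF bounded_symbol_inv_weight[OF a] bounded_symbol_weighted_wave_symbol[OF a] AE_I2[OF this] bounded_symbol_wave_symbol]
  show ?thesis .
qed

lemma continuous_on_wave_symbol_diff:
  "continuous_on {0..t} (\<lambda>\<tau>. wave_symbol \<sigma> \<delta> (t - \<tau>) \<xi>)" "continuous_on {0..t} (\<lambda>\<tau>. wave_symbol' \<sigma> \<delta> (t - \<tau>) \<xi>)"
  by (rule continuous_on_compose2[OF continuous_wave_symbol[of UNIV]], auto intro!: continuous_intros)
    (rule continuous_on_compose2[OF continuous_wave_symbol'[of UNIV]], auto intro!: continuous_intros)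

lemma continuous_on_Duhamel_integrand:
  fixes N :: "real \<Rightarrow> ('n::finite) l2"
  assumes N: "continuous_on {0..} N"
  shows "continuous_on {0..t} (\<lambda>\<tau>. symbol_mult (wave_symbol \<sigma> \<delta> (t - \<tau>)) (N \<tau>))"
    and "continuous_on {0..t} (\<lambda>\<tau>. symbol_mult (wave_symbol' \<sigma> \<delta> (t - \<tau>)) (N \<tau>))"
    and "\<alpha> > 0 \<Longrightarrow> \<beta> > 0 \<Longrightarrow> continuous_on {0..t} (\<lambda>\<tau>. symbol_mult (weighted_wave_symbol \<sigma> \<delta> \<alpha> \<beta> (t - \<tau>)) (N \<tau>))"
proof -
  have N': "continuous_on {0..t} N" by (rule continuous_on_subset[OF N]) auto
  have mono: "bounded_symbol B m \<Longrightarrow> B \<le> B' \<Longrightarrow> bounded_symbol B' m" for B B' and m :: "real^'n \<Rightarrow> complex"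
    unfolding bounded_symbol_def using order_trans by blast
  show "continuous_on {0..t} (\<lambda>\<tau>. symbol_mult (wave_symbol \<sigma> \<delta> (t - \<tau>)) (N \<tau>))"
    by (rule continuous_on_symbol_mult[OF mono[OF bounded_symbol_wave_symbol, of _ t] continuous_on_wave_symbol_diff(1) N']) auto
  show "continuous_on {0..t} (\<lambda>\<tau>. symbol_mult (wave_symbol' \<sigma> \<delta> (t - \<tau>)) (N \<tau>))"
    by (rule continuous_on_symbol_mult[OF bounded_symbol_wave_symbol' continuous_on_wave_symbol_diff(2) N'])
  assume a: "\<alpha> > 0" "\<beta> > 0"
  show "continuous_on {0..t} (\<lambda>\<tau>. symbol_mult (weighted_wave_symbol \<sigma> \<delta> \<alpha> \<beta> (t - \<tau>)) (N \<tau>))"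
  proof (rule continuous_on_symbol_mult[OF mono[OF bounded_symbol_weighted_wave_symbol[OF a], of _ "\<alpha> * t + \<beta>"] _ N'])
    show "\<alpha> * \<bar>t - \<tau>\<bar> + \<beta> \<le> \<alpha> * t + \<beta>" if "\<tau> \<in> {0..t}" for \<tau> using that a by simp
    show "continuous_on {0..t} (\<lambda>\<tau>. weighted_wave_symbol \<sigma> \<delta> \<alpha> \<beta> (t - \<tau>) \<xi>)" for \<xi>
      unfolding weighted_wave_symbol_def by (intro continuous_intros continuous_on_wave_symbol_diff)
  qed
qed

text \<open>Translates the equation for \<open>V\<close> into Duhamel's formula for the transform of
  \<open>u\<close>. Only the bounded operator \<open>inv_weight\<close> has to be moved through the
  integral.\<close>

lemma inv_weight_Duhamel:
  fixes N :: "real \<Rightarrow> ('n::finite) l2"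
  assumes a: "\<alpha> > 0" "\<beta> > 0" and N: "continuous_on {0..} N"
  shows "symbol_mult (inv_weight \<sigma> \<alpha> \<beta>) (symbol_mult (weighted_wave_symbol \<sigma> \<delta> \<alpha> \<beta> t) F
      + integral {0..t} (\<lambda>\<tau>. symbol_mult (weighted_wave_symbol \<sigma> \<delta> \<alpha> \<beta> (t - \<tau>)) (N \<tau>)))
    = symbol_mult (wave_symbol \<sigma> \<delta> t) F + integral {0..t} (\<lambda>\<tau>. symbol_mult (wave_symbol \<sigma> \<delta> (t - \<tau>)) (N \<tau>))"
proof -
  note b = bounded_symbol_inv_weight[OF a, of \<sigma>]
  have "symbol_mult (inv_weight \<sigma> \<alpha> \<beta>) (integral {0..t} (\<lambda>\<tau>. symbol_mult (weighted_wave_symbol \<sigma> \<delta> \<alpha> \<beta> (t - \<tau>)) (N \<tau>)))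
      = integral {0..t} (\<lambda>\<tau>. symbol_mult (inv_weight \<sigma> \<alpha> \<beta>) (symbol_mult (weighted_wave_symbol \<sigma> \<delta> \<alpha> \<beta> (t - \<tau>)) (N \<tau>)))"
    using integral_linear[OF integrable_continuous_interval[OF continuous_on_Duhamel_integrand(3)[OF N a]] bounded_linear_symbol_mult[OF b]]
    by (simp add: o_def)
  then show ?thesis by (simp add: symbol_mult_add[OF b] inv_weight_weighted_wave_symbol[OF a])
qed

text \<open>Banach's theorem in a closed ball of bounded continuous functions. These are defined on
  the whole line; evaluation of \<open>\<Phi> V\<close> at \<open>max t 0\<close> extends a function
  from the half-line without changing its bound or its continuity.\<close>

lemma contraction_fixed_point:
  fixes \<Phi> :: "(real \<Rightarrow> 'a::banach) \<Rightarrow> real \<Rightarrow> 'a"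
  assumes R: "R \<ge> 0"
    and cont: "\<And>V. continuous_on {0..} V \<Longrightarrow> continuous_on {0..} (\<Phi> V)"
    and bound: "\<And>V t. continuous_on {0..} V \<Longrightarrow> (\<And>t. t \<ge> 0 \<Longrightarrow> norm (V t) \<le> R) \<Longrightarrow> t \<ge> 0 \<Longrightarrow> norm (\<Phi> V t) \<le> R"
    and contr: "\<And>V V' d t. continuous_on {0..} V \<Longrightarrow> (\<And>t. t \<ge> 0 \<Longrightarrow> norm (V t) \<le> R) \<Longrightarrow>
      continuous_on {0..} V' \<Longrightarrow> (\<And>t. t \<ge> 0 \<Longrightarrow> norm (V' t) \<le> R) \<Longrightarrow>
      (\<And>t. t \<ge> 0 \<Longrightarrow> norm (V t - V' t) \<le> d) \<Longrightarrow> t \<ge> 0 \<Longrightarrow> norm (\<Phi> V t - \<Phi> V' t) \<le> d / 2"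
  obtains V where "continuous_on {0..} V" "\<And>t. t \<ge> 0 \<Longrightarrow> norm (V t) \<le> R" "\<And>t. t \<ge> 0 \<Longrightarrow> V t = \<Phi> V t"
proof -
  define S where "S = (PiC UNIV (\<lambda>_. cball 0 R) :: (real \<Rightarrow>\<^sub>C 'a) set)"
  define f where "f v = Bcontfun (\<lambda>t. \<Phi> (apply_bcontfun v) (max t 0))" for v :: "real \<Rightarrow>\<^sub>C 'a"
  have S: "norm (apply_bcontfun v t) \<le> R" if "v \<in> S" for v t
    using that by (auto simp: S_def mem_PiC_iff Pi_iff)
  have c: "continuous_on A (apply_bcontfun v)" for v :: "real \<Rightarrow>\<^sub>C 'a" and A
    by (rule continuous_on_subset[OF continuous_on_apply_bcontfun[of UNIV]]) auto
  have f: "apply_bcontfun (f v) = (\<lambda>t. \<Phi> (apply_bcontfun v) (max t 0))" if "v \<in> S" for v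
    unfolding f_def
  proof (rule Bcontfun_inverse, rule bcontfun_normI)
    show "continuous_on UNIV (\<lambda>t. \<Phi> (apply_bcontfun v) (max t 0))"
      by (rule continuous_on_compose2[OF cont[OF c]]) (auto intro!: continuous_intros)
    show "norm (\<Phi> (apply_bcontfun v) (max t 0)) \<le> R" for t
      by (rule bound[OF c S[OF that]]) simp
  qed
  have "closed S" unfolding S_def by (rule closed_PiC) simp
  have "\<exists>!v. v \<in> S \<and> f v = v"
  proof (rule Banach_fix[OF complete_eq_closed[THEN iffD2, OF \<open>closed S\<close>]])
    have "0 \<in> S" using R by (simp add: S_def mem_PiC_iff Pi_iff)
    then show "S \<noteq> {}" by blast
    show "f ` S \<subseteq> S"
    proof
      fix w assume "w \<in> f ` S"
      then obtain v where v: "v \<in> S" "w = f v" by blast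
      have "norm (\<Phi> (apply_bcontfun v) (max t 0)) \<le> R" for t
        by (rule bound[OF c S[OF v(1)]]) simp
      then show "w \<in> S" by (simp add: S_def mem_PiC_iff Pi_iff v f[OF v(1), unfolded S_def])
    qed
    show "dist (f x) (f y) \<le> 1/2 * dist x y" if "x \<in> S" "y \<in> S" for x y
    proof (rule dist_bound)
      fix t
      have "norm (\<Phi> (apply_bcontfun x) (max t 0) - \<Phi> (apply_bcontfun y) (max t 0)) \<le> dist x y / 2"
        by (rule contr[OF c S[OF that(1)] c S[OF that(2)]]) (auto simp: dist_norm[symmetric] intro: dist_bounded)
      then show "dist (apply_bcontfun (f x) t) (apply_bcontfun (f y) t) \<le> 1/2 * dist x y"
        by (simp add: f that dist_norm)
    qed
  qed auto
  then obtain v where v: "v \<in> S" "f v = v" by blast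
  show thesis
  proof (rule that[OF c S[OF v(1)]])
    fix t :: real assume "t \<ge> 0"
    then show "apply_bcontfun v t = \<Phi> (apply_bcontfun v) t"
      using f[OF v(1)] unfolding v(2) by (metis max_absorb1)
  qed
qed

lemma continuous_on_weighted_wave_symbol:
  "continuous_on S f \<Longrightarrow> continuous_on S a \<Longrightarrow> continuous_on S b \<Longrightarrow>
    continuous_on S (\<lambda>z. weighted_wave_symbol \<sigma> \<delta> (a z) (b z) (f z) \<xi>)"
  unfolding weighted_wave_symbol_def
  by (intro continuous_intros continuous_on_compose2[OF continuous_wave_symbol[of UNIV]]) auto

text \<open>\<open>subcritical\<close> is the common consequence of the two alternatives for
  \<open>p\<close> and \<open>n\<close>: the Sobolev order for the exponent \<open>2 * p\<close> is
  at most \<open>\<sigma>\<close>. The parameter \<open>ty\<close> ties the locale to the index type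
  of the space.\<close>

locale damped_wave =
  fixes \<sigma> \<delta> p n :: real and ty :: "'n::finite itself"
  assumes n: "n = real CARD('n)" and \<sigma>: "\<sigma> \<ge> 1" and \<delta>: "\<delta> > 0" "2 * \<delta> < \<sigma>"
    and p: "p \<ge> 2" and n\<sigma>: "\<sigma> < n" and subcritical: "n * (1/2 - 1/(2*p)) \<le> \<sigma>"
    and supercritical: "p > 1 + (\<sigma> + 2 * \<delta>) / (n - \<sigma>)"
begin

section \<open>Decay rates and the time-dependent weight\<close>

definition "r0 = (n - 2 * \<sigma>) / (4 * \<delta>)"
definition "r1 = n / (4 * \<delta>)"
definition "\<kappa> = (p * (n - \<sigma>) - n) / (2 * \<delta>)"

lemma \<kappa>_gt_1: "\<kappa> > 1"
proof -
  have "(\<sigma> + 2 * \<delta>) / (n - \<sigma>) < p - 1" using supercritical by simp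
  then have "\<sigma> + 2 * \<delta> < (p - 1) * (n - \<sigma>)" using n\<sigma> by (simp add: pos_divide_less_eq)
  then have "2 * \<delta> < p * (n - \<sigma>) - n" by (simp add: algebra_simps)
  then show ?thesis using \<delta> by (simp add: \<kappa>_def)
qed

text \<open>\<open>r1 - r0\<close> is \<open>\<sigma> / (2 * \<delta>)\<close>, so the gap of 1
  comes from \<open>2 * \<delta> < \<sigma>\<close>. It absorbs the linear growth of the wave symbol
  in time.\<close>

lemma rates: "r0 + 1 \<le> r1" "r1 > 0"
  using \<delta> n\<sigma> \<sigma> by (auto simp: r0_def r1_def field_simps)

text \<open>The exponent is \<open>- p * (r0 + \<sigma> * \<theta> / (2 * \<delta>))\<close>, and
  \<open>\<sigma> * \<theta> * p\<close> equals \<open>n * p / 2 - n\<close> for L1 and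
  \<open>n * p / 2 - n / 2\<close> for L2. The difference \<open>n / 2\<close>, divided by
  \<open>2 * \<delta>\<close>, is the additional \<open>r1\<close>.\<close>

lemma interpolation_factor_rates:
  assumes t: "t \<ge> 0"
  shows "interpolation_factor (n * (1/2 - 1/p) / \<sigma>) p ((1 + t) powr r0) ((1 + t) powr r1) = (1 + t) powr (- \<kappa>)"
    and "interpolation_factor (n * (1/2 - 1/(2*p)) / \<sigma>) p ((1 + t) powr r0) ((1 + t) powr r1) = (1 + t) powr (- \<kappa> - r1)"
proof -
  have *: "interpolation_factor \<theta> p ((1 + t) powr r0) ((1 + t) powr r1) = (1 + t) powr ((r0 * (-(1 - \<theta>)) + r1 * (-\<theta>)) * p)" for \<theta>
    unfolding interpolation_factor_def powr_powr powr_add[symmetric] ..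
  have r: "r1 = r0 + \<sigma> / (2 * \<delta>)" using \<delta> by (simp add: r0_def r1_def field_simps)
  have e: "(r0 * (-(1 - \<theta>)) + r1 * (-\<theta>)) * p = - (r0 * p) - \<sigma> * \<theta> * p / (2 * \<delta>)" for \<theta>
    by (simp add: r algebra_simps)
  have "\<sigma> * (n * (1/2 - 1/p) / \<sigma>) * p = n * p / 2 - n" "\<sigma> * (n * (1/2 - 1/(2*p)) / \<sigma>) * p = n * p / 2 - n / 2"
    using \<sigma> p by (auto simp: field_simps)
  then have "(r0 * (-(1 - (n * (1/2 - 1/p) / \<sigma>))) + r1 * (-(n * (1/2 - 1/p) / \<sigma>))) * p = - (r0 * p) - (n * p / 2 - n) / (2 * \<delta>)"
    "(r0 * (-(1 - (n * (1/2 - 1/(2*p)) / \<sigma>))) + r1 * (-(n * (1/2 - 1/(2*p)) / \<sigma>))) * p = - (r0 * p) - (n * p / 2 - n / 2) / (2 * \<delta>)"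
    unfolding e by simp_all
  moreover have "- (r0 * p) - (n * p / 2 - n) / (2 * \<delta>) = - \<kappa>" "- (r0 * p) - (n * p / 2 - n / 2) / (2 * \<delta>) = - \<kappa> - r1"
    using \<delta> by (auto simp: r0_def r1_def \<kappa>_def divide_simps) (auto simp: algebra_simps)
  ultimately show "interpolation_factor (n * (1/2 - 1/p) / \<sigma>) p ((1 + t) powr r0) ((1 + t) powr r1) = (1 + t) powr (- \<kappa>)"
    "interpolation_factor (n * (1/2 - 1/(2*p)) / \<sigma>) p ((1 + t) powr r0) ((1 + t) powr r1) = (1 + t) powr (- \<kappa> - r1)"
    unfolding * by simp_all
qed

lemma decay_integral:
  assumes "t \<ge> 0"
  shows "(\<lambda>\<tau>. (1 + \<tau>) powr (- \<kappa>)) integrable_on {0..t}" "integral {0..t} (\<lambda>\<tau>. (1 + \<tau>) powr (- \<kappa>)) \<le> 1 / (\<kappa> - 1)"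
proof -
  let ?F = "\<lambda>\<tau>. - ((1 + \<tau>) powr (1 - \<kappa>) / (\<kappa> - 1))"
  have "((\<lambda>\<tau>. (1 + \<tau>) powr (- \<kappa>)) has_integral (?F t - ?F 0)) {0..t}"
  proof (rule fundamental_theorem_of_calculus[OF assms])
    fix x assume x: "x \<in> {0..t}"
    have "((\<lambda>\<tau>. (1 + \<tau>) powr (1 - \<kappa>)) has_real_derivative (1 - \<kappa>) * (1 + x) powr (1 - \<kappa> - 1) * 1) (at x within {0..t})"
      using x by (auto intro!: derivative_eq_intros)
    then have "(?F has_real_derivative - ((1 - \<kappa>) * (1 + x) powr (1 - \<kappa> - 1) * 1 / (\<kappa> - 1))) (at x within {0..t})"
      by (intro DERIV_minus DERIV_cdivide)
    moreover have "- ((1 - \<kappa>) * (1 + x) powr (1 - \<kappa> - 1) * 1 / (\<kappa> - 1)) = (1 + x) powr (- \<kappa>)"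
      using \<kappa>_gt_1 by (simp add: divide_simps algebra_simps)
    ultimately show "(?F has_vector_derivative (1 + x) powr (- \<kappa>)) (at x within {0..t})"
      by (simp add: has_real_derivative_iff_has_vector_derivative)
  qed
  then show "(\<lambda>\<tau>. (1 + \<tau>) powr (- \<kappa>)) integrable_on {0..t}" "integral {0..t} (\<lambda>\<tau>. (1 + \<tau>) powr (- \<kappa>)) \<le> 1 / (\<kappa> - 1)"
    using \<kappa>_gt_1 by (auto simp: has_integral_iff)
qed

text \<open>\<open>V\<close> is the Fourier transform of \<open>state t V\<close> multiplied by the weight
  \<open>(1 + t) powr r0 + (1 + t) powr r1 * norm \<xi> powr \<sigma>\<close>, so that the decay of \<open>u\<close> and of its
  fractional derivative amounts to boundedness of \<open>V\<close> in time.\<close>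

definition state :: "real \<Rightarrow> 'n l2 \<Rightarrow> 'n l2" where
  "state t V = inv_FT (symbol_mult (inv_weight \<sigma> ((1 + t) powr r0) ((1 + t) powr r1)) V)"

definition source :: "'n l2 \<Rightarrow> 'n l2" where
  "source u = FT 1 (abs_l2 (abs_power p (rep_l2 u)))"

lemma FT_state: "FT 1 (state t V) = symbol_mult (inv_weight \<sigma> ((1 + t) powr r0) ((1 + t) powr r1)) V"
  by (simp add: state_def)

text \<open>A predicate for the admissible constants, so that a lemma can fix one without repeating
  the whole estimate; the other predicates of this kind below have the same purpose.\<close>

definition nonlinearity_constant :: "real \<Rightarrow> bool" where
  "nonlinearity_constant C \<longleftrightarrow> C \<ge> 0 \<and> (\<forall>(u::'n l2) v U V \<alpha> \<beta> M. \<alpha> > 0 \<longrightarrow> \<beta> > 0 \<longrightarrow>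
    FT 1 u = symbol_mult (inv_weight \<sigma> \<alpha> \<beta>) U \<longrightarrow> FT 1 v = symbol_mult (inv_weight \<sigma> \<alpha> \<beta>) V \<longrightarrow>
    norm U \<le> M \<longrightarrow> norm V \<le> M \<longrightarrow>
    integrable lborel (abs_power p (rep_l2 u)) \<and> square_integrable (abs_power p (rep_l2 u)) \<and>
    L1norm (\<lambda>x. abs_power p (rep_l2 u) x - abs_power p (rep_l2 v) x)
      \<le> C * interpolation_factor (n * (1/2 - 1/p) / \<sigma>) p \<alpha> \<beta> * (norm (U - V) * M powr (p - 1)) \<and>
    L2norm (\<lambda>x. abs_power p (rep_l2 u) x - abs_power p (rep_l2 v) x)
      \<le> C * interpolation_factor (n * (1/2 - 1/(2*p)) / \<sigma>) p \<alpha> \<beta> * (norm (U - V) * M powr (p - 1)))"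

lemma nonlinearity: "\<exists>C. nonlinearity_constant C"
proof -
  have "1 / (2 * p) \<le> 1 / p" using p by (simp add: field_simps)
  then have "n * (1/2 - 1/p) \<le> n * (1/2 - 1/(2*p))" using n\<sigma> \<sigma> by (intro mult_left_mono) auto
  then have le: "n * (1/2 - 1/p) \<le> \<sigma>" using subcritical by linarith
  have pos: "\<sigma> > 0" using \<sigma> by simp
  have e: "n * (1/2 - 1/p) = real CARD('n) * (1/2 - 1/p)" "n * (1/2 - 1/(2*p)) = real CARD('n) * (1/2 - 1/(2*p))"
    using n by auto
  show ?thesis
    unfolding nonlinearity_constant_def by (rule nonlinearity_bounds[OF p pos e(1) le e(2) subcritical])
qed

lemma nonlinearity_constantD:
  fixes u v U V :: "'n l2"
  assumes C: "nonlinearity_constant C" and a: "\<alpha> > 0" "\<beta> > 0"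
    and u: "FT 1 u = symbol_mult (inv_weight \<sigma> \<alpha> \<beta>) U" and v: "FT 1 v = symbol_mult (inv_weight \<sigma> \<alpha> \<beta>) V"
    and M: "norm U \<le> M" "norm V \<le> M"
  shows "integrable lborel (abs_power p (rep_l2 u)) \<and> square_integrable (abs_power p (rep_l2 u))"
    and "L1norm (\<lambda>x. abs_power p (rep_l2 u) x - abs_power p (rep_l2 v) x)
      \<le> C * interpolation_factor (n * (1/2 - 1/p) / \<sigma>) p \<alpha> \<beta> * (norm (U - V) * M powr (p - 1))"
    and "L2norm (\<lambda>x. abs_power p (rep_l2 u) x - abs_power p (rep_l2 v) x)
      \<le> C * interpolation_factor (n * (1/2 - 1/(2*p)) / \<sigma>) p \<alpha> \<beta> * (norm (U - V) * M powr (p - 1))"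
  using C[unfolded nonlinearity_constant_def, THEN conjunct2, rule_format, OF a u v M] by simp_all

section \<open>Local Lipschitz continuity of the source\<close>

lemma abs_power_L1_L2:
  fixes u U :: "'n l2"
  assumes a: "\<alpha> > 0" "\<beta> > 0" and u: "FT 1 u = symbol_mult (inv_weight \<sigma> \<alpha> \<beta>) U"
  shows "integrable lborel (abs_power p (rep_l2 u))" "square_integrable (abs_power p (rep_l2 u))"
proof -
  obtain C where "nonlinearity_constant C" using nonlinearity ..
  from nonlinearity_constantD(1)[OF this a u u order_refl order_refl]
  show "integrable lborel (abs_power p (rep_l2 u))" "square_integrable (abs_power p (rep_l2 u))" by simp_all
qed

lemma source_diff:
  fixes u v U V :: "'n l2"
  assumes a: "\<alpha> > 0" "\<beta> > 0" and u: "FT 1 u = symbol_mult (inv_weight \<sigma> \<alpha> \<beta>) U"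
    and v: "FT 1 v = symbol_mult (inv_weight \<sigma> \<alpha> \<beta>) V"
  shows "source u - source v = FT 1 (abs_l2 (\<lambda>x. abs_power p (rep_l2 u) x - abs_power p (rep_l2 v) x))"
  unfolding source_def
  by (simp add: abs_l2_diff[symmetric] abs_power_L1_L2[OF a u] abs_power_L1_L2[OF a v]
      linear_diff[OF bounded_linear.linear[OF bounded_linear_FT]])

text \<open>The weight is the fixed one, so this is local Lipschitz continuity from the Sobolev
  space to L2 without any decay in time, as continuity and uniqueness require.\<close>

definition Lipschitz_constant :: "real \<Rightarrow> bool" where
  "Lipschitz_constant L \<longleftrightarrow> L \<ge> 0 \<and> (\<forall>(u::'n l2) v U V M. FT 1 u = symbol_mult (inv_weight \<sigma> 1 1) U \<longrightarrow>
    FT 1 v = symbol_mult (inv_weight \<sigma> 1 1) V \<longrightarrow> norm U \<le> M \<longrightarrow> norm V \<le> M \<longrightarrow>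
    norm (source u - source v) \<le> L * M powr (p - 1) * norm (U - V))"

lemma source_Lipschitz: "\<exists>L. Lipschitz_constant L"
proof -
  obtain C where C: "nonlinearity_constant C" using nonlinearity ..
  then have C0: "C \<ge> 0" by (simp add: nonlinearity_constant_def)
  let ?N = "sqrt ((2 * pi) ^ CARD('n))"
  have "norm (source u - source v) \<le> ?N * C * M powr (p - 1) * norm (U - V)"
    if u: "FT 1 u = symbol_mult (inv_weight \<sigma> 1 1) U" and v: "FT 1 v = symbol_mult (inv_weight \<sigma> 1 1) V"
      and M: "norm U \<le> M" "norm V \<le> M" for u v U V :: "'n l2" and M
  proof -
    let ?h = "\<lambda>x. abs_power p (rep_l2 u) x - abs_power p (rep_l2 v) x"
    have h: "square_integrable ?h"
      by (intro square_integrable_diff abs_power_L1_L2(2)[OF _ _ u] abs_power_L1_L2(2)[OF _ _ v]) auto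
    have "norm (source u - source v) = ?N * L2norm ?h"
      by (subst source_diff[OF _ _ u v]) (simp_all add: Plancherel norm_abs_l2[OF h])
    also have "\<dots> \<le> ?N * (C * 1 * (norm (U - V) * M powr (p - 1)))"
      using nonlinearity_constantD(3)[OF C _ _ u v M] by (intro mult_left_mono) (auto simp: interpolation_factor_def)
    finally show ?thesis by (simp only: ac_simps mult_1)
  qed
  then have "Lipschitz_constant (?N * C)" unfolding Lipschitz_constant_def using C0 by simp
  then show ?thesis ..
qed

lemma Lipschitz_constantD:
  fixes u v U V :: "'n l2"
  assumes L: "Lipschitz_constant L" and u: "FT 1 u = symbol_mult (inv_weight \<sigma> 1 1) U"
    and v: "FT 1 v = symbol_mult (inv_weight \<sigma> 1 1) V" and M: "norm U \<le> M" "norm V \<le> M"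
  shows "norm (source u - source v) \<le> L * M powr (p - 1) * norm (U - V)"
  using L[unfolded Lipschitz_constant_def, THEN conjunct2, rule_format, OF u v M] .

text \<open>On a compact time interval \<open>Z\<close> stays in a ball, and on that ball the source
  is Lipschitz.\<close>

lemma continuous_on_source:
  fixes u Z :: "real \<Rightarrow> 'n l2"
  assumes Z: "continuous_on {0..} Z" and u: "\<And>t. t \<ge> 0 \<Longrightarrow> FT 1 (u t) = symbol_mult (inv_weight \<sigma> 1 1) (Z t)"
  shows "continuous_on {0..} (\<lambda>t. source (u t))"
proof (rule continuous_on_atLeast_if_atLeastAtMost)
  fix T :: real
  obtain L where L: "Lipschitz_constant L" using source_Lipschitz ..
  have ZT: "continuous_on {0..T} Z" by (rule continuous_on_subset[OF Z]) auto
  then have "compact (Z ` {0..T})" by (intro compact_continuous_image) auto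
  then obtain M where M: "\<And>t. t \<in> {0..T} \<Longrightarrow> norm (Z t) \<le> M"
    using compact_imp_bounded[of "Z ` {0..T}"] unfolding bounded_iff by blast
  show "continuous_on {0..T} (\<lambda>t. source (u t))"
    unfolding continuous_on_def
  proof
    fix t assume t: "t \<in> {0..T}"
    have "((\<lambda>r. L * M powr (p - 1) * norm (Z r - Z t)) \<longlongrightarrow> L * M powr (p - 1) * norm (Z t - Z t)) (at t within {0..T})"
      using ZT t by (intro tendsto_intros) (auto simp: continuous_on_def)
    then have "((\<lambda>r. L * M powr (p - 1) * norm (Z r - Z t)) \<longlongrightarrow> 0) (at t within {0..T})" by simp
    then have "((\<lambda>r. dist (source (u r)) (source (u t))) \<longlongrightarrow> 0) (at t within {0..T})"
    proof (rule Lim_null_comparison[rotated])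
      show "\<forall>\<^sub>F r in at t within {0..T}. norm (dist (source (u r)) (source (u t))) \<le> L * M powr (p - 1) * norm (Z r - Z t)"
        unfolding eventually_at_filter using Lipschitz_constantD[OF L u u M M] t by (intro always_eventually) (auto simp: dist_norm)
    qed
    then show "((\<lambda>r. source (u r)) \<longlongrightarrow> source (u t)) (at t within {0..T})" by (subst tendsto_dist_iff)
  qed
qed

text \<open>Passes from the time-dependent weight to the fixed one: their quotient \<open>q\<close>
  is continuous in time and, on a bounded interval, a bounded symbol. The bound contains
  \<open>\<bar>r0\<bar>\<close> because \<open>r0\<close> is negative when
  \<open>n < 2 * \<sigma>\<close>.\<close>

lemma state_continuous:
  fixes V :: "real \<Rightarrow> 'n l2"
  assumes V: "continuous_on {0..} V"
  obtains Z where "continuous_on {0..} Z" "\<And>t. t \<ge> 0 \<Longrightarrow> FT 1 (state t (V t)) = symbol_mult (inv_weight \<sigma> 1 1) (Z t)"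
proof -
  define q where "q t \<xi> = complex_of_real ((1 + norm \<xi> powr \<sigma>) / ((1 + t) powr r0 + (1 + t) powr r1 * norm \<xi> powr \<sigma>))"
    for t and \<xi> :: "real^'n"
  have [measurable]: "q t \<in> borel_measurable borel" for t unfolding q_def[abs_def] by measurable
  have qb: "bounded_symbol ((1 + T) powr \<bar>r0\<bar> + 1) (q t)" if t: "t \<in> {0..T}" for t T
    unfolding bounded_symbol_def
  proof (intro conjI allI)
    fix \<xi> :: "real^'n"
    let ?r = "norm \<xi> powr \<sigma>" and ?a = "(1 + t) powr r0" and ?b = "(1 + t) powr r1"
    have pos: "?a > 0" "?b > 0" using t by auto
    note w = weight_pos[OF pos, of \<xi> \<sigma>]
    have "1 / (?a + ?b * ?r) \<le> 1 / ?a" using pos w by (intro divide_left_mono) auto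
    also have "1 / ?a = (1 + t) powr (- r0)" by (simp add: powr_minus_divide)
    also have "\<dots> \<le> (1 + t) powr \<bar>r0\<bar>" using t by (intro powr_mono) auto
    also have "\<dots> \<le> (1 + T) powr \<bar>r0\<bar>" using t by (intro powr_mono2) auto
    finally have 1: "1 / (?a + ?b * ?r) \<le> (1 + T) powr \<bar>r0\<bar>" .
    have "1 \<le> ?b" using t rates by (intro ge_one_powr_ge_zero) auto
    then have "?r \<le> ?b * ?r" using mult_right_mono[of 1 ?b ?r] by simp
    then have "?r \<le> ?a + ?b * ?r" by (rule add_increasing[OF less_imp_le[OF pos(1)]])
    then have "?r \<le> 1 * (?a + ?b * ?r)" by simp
    then have "?r / (?a + ?b * ?r) \<le> 1" using w by (simp only: pos_divide_le_eq)
    with 1 have "(1 + ?r) / (?a + ?b * ?r) \<le> (1 + T) powr \<bar>r0\<bar> + 1" by (simp add: add_divide_distrib)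
    moreover have "cmod (q t \<xi>) = (1 + ?r) / (?a + ?b * ?r)"
      unfolding q_def norm_of_real using w by (simp add: abs_of_nonneg)
    ultimately show "cmod (q t \<xi>) \<le> (1 + T) powr \<bar>r0\<bar> + 1" by simp
  qed simp
  show thesis
  proof (rule that[of "\<lambda>t. symbol_mult (q t) (V t)"])
    show "continuous_on {0..} (\<lambda>t. symbol_mult (q t) (V t))"
    proof (rule continuous_on_atLeast_if_atLeastAtMost)
      fix T :: real
      show "continuous_on {0..T} (\<lambda>t. symbol_mult (q t) (V t))"
      proof (rule continuous_on_symbol_mult[OF qb])
        fix \<xi> :: "real^'n"
        show "continuous_on {0..T} (\<lambda>t. q t \<xi>)"
          unfolding q_def
          by (intro continuous_intros ballI weight_pos[THEN less_imp_neq, THEN not_sym]) auto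
        show "continuous_on {0..T} V" by (rule continuous_on_subset[OF V]) auto
      qed
    qed
    fix t :: real assume t: "t \<ge> 0"
    have pos: "(1 + t) powr r0 > 0" "(1 + t) powr r1 > 0" using t by auto
    show "FT 1 (state t (V t)) = symbol_mult (inv_weight \<sigma> 1 1) (symbol_mult (q t) (V t))"
      unfolding FT_state
    proof (rule symbol_mult_mult[OF bounded_symbol_inv_weight qb _ bounded_symbol_inv_weight[OF pos], symmetric])
      show "AE \<xi> in lborel. inv_weight \<sigma> 1 1 \<xi> * q t \<xi> = inv_weight \<sigma> ((1 + t) powr r0) ((1 + t) powr r1) \<xi>"
      proof (rule AE_I2)
        fix \<xi> :: "real^'n"
        have "1 + norm \<xi> powr \<sigma> \<noteq> 0" using weight_pos[of 1 1 \<xi> \<sigma>] by simp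
        then show "inv_weight \<sigma> 1 1 \<xi> * q t \<xi> = inv_weight \<sigma> ((1 + t) powr r0) ((1 + t) powr r1) \<xi>"
          unfolding inv_weight_def q_def of_real_mult[symmetric] by simp
      qed
    qed (use t in auto)
  qed
qed

lemma continuous_on_source_state:
  fixes V :: "real \<Rightarrow> 'n l2"
  assumes V: "continuous_on {0..} V"
  shows "continuous_on {0..} (\<lambda>t. source (state t (V t)))"
proof (rule state_continuous[OF V])
  fix Z assume "continuous_on {0..} Z" "\<And>t. t \<ge> 0 \<Longrightarrow> FT 1 (state t (V t)) = symbol_mult (inv_weight \<sigma> 1 1) (Z t)"
  then show ?thesis by (rule continuous_on_source)
qed

text \<open>\<open>B\<close> and \<open>A\<close> abstract from symbol and source: \<open>m\<close>
  may be the weighted symbol or the time derivative, and \<open>f\<close> the initial value, with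
  \<open>\<tau> = 0\<close>, or a difference of nonlinear terms.\<close>

definition evolution_constant :: "real \<Rightarrow> bool" where
  "evolution_constant C \<longleftrightarrow> C > 0 \<and> (\<forall>t \<tau> (f :: real^'n \<Rightarrow> complex) m B A. 0 \<le> \<tau> \<longrightarrow> \<tau> \<le> t \<longrightarrow>
    integrable lborel f \<longrightarrow> square_integrable f \<longrightarrow> m \<in> borel_measurable borel \<longrightarrow> B \<ge> 0 \<longrightarrow>
    (\<forall>\<xi>. cmod (m \<xi>) \<le> B * (1 + t) powr r1 * exp (- (norm \<xi> powr (2 * \<delta>) * ((t - \<tau>) / 2)))) \<longrightarrow>
    L1norm f \<le> A * (1 + \<tau>) powr (- \<kappa>) \<longrightarrow> L2norm f \<le> A * (1 + \<tau>) powr (- \<kappa> - r1) \<longrightarrow>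
    norm (symbol_mult m (FT 1 (abs_l2 f))) \<le> C * B * A * (1 + \<tau>) powr (- \<kappa>))"

text \<open>For \<open>\<tau> \<le> t / 2\<close> the decay comes from the kernel, for \<open>\<tau> \<ge> t / 2\<close> from the better decay of the
  \<open>L2\<close> norm of the source.\<close>

lemma evolution_estimate: "\<exists>C. evolution_constant C"
proof -
  obtain C where C: "C > 0" and est0: "\<forall>m f s B. integrable lborel f \<longrightarrow> square_integrable (f :: real^'n \<Rightarrow> complex) \<longrightarrow>
    m \<in> borel_measurable borel \<longrightarrow> s \<ge> 0 \<longrightarrow> B \<ge> 0 \<longrightarrow> (\<forall>\<xi>. cmod (m \<xi>) \<le> B * exp (- (norm \<xi> powr (2 * \<delta>) * (s / 2)))) \<longrightarrow>
    norm (symbol_mult m (FT 1 (abs_l2 f))) \<le> C * B * L2norm f \<and>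
    norm (symbol_mult m (FT 1 (abs_l2 f))) \<le> C * B * (1 + s) powr (- (real CARD('n) / (4 * \<delta>))) * (L1norm f + L2norm f)"
    using low_time_decay[OF \<delta>(1), where 'n = 'n] by (elim exE conjE)
  have "norm (symbol_mult m (FT 1 (abs_l2 f))) \<le> C * (2 * 2 powr r1) * B * A * (1 + \<tau>) powr (- \<kappa>)"
    if \<tau>: "0 \<le> \<tau>" "\<tau> \<le> t" and f: "integrable lborel f" "square_integrable f" and m: "m \<in> borel_measurable borel"
      and B: "B \<ge> 0" and mb: "\<And>\<xi>. cmod (m \<xi>) \<le> B * (1 + t) powr r1 * exp (- (norm \<xi> powr (2 * \<delta>) * ((t - \<tau>) / 2)))"
      and L1: "L1norm f \<le> A * (1 + \<tau>) powr (- \<kappa>)" and L2: "L2norm f \<le> A * (1 + \<tau>) powr (- \<kappa> - r1)"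
    for t \<tau> B A and m f :: "real^'n \<Rightarrow> complex"
  proof -
    have "0 \<le> A * (1 + \<tau>) powr (- \<kappa>)" by (rule order_trans[OF L1norm_nonneg L1])
    then have A: "A \<ge> 0" using \<tau> by (simp add: zero_le_mult_iff)
    have e: "norm (symbol_mult m (FT 1 (abs_l2 f))) \<le> C * (B * (1 + t) powr r1) * L2norm f"
      "norm (symbol_mult m (FT 1 (abs_l2 f))) \<le> C * (B * (1 + t) powr r1) * (1 + (t - \<tau>)) powr (- r1) * (L1norm f + L2norm f)"
      using est0[rule_format, OF f m, of "t - \<tau>" "B * (1 + t) powr r1", OF _ _ mb] \<tau> B
      unfolding r1_def n[symmetric] by simp_all
    \<comment> \<open>Applied to \<open>1 + (t - \<tau>)\<close> in the first case and to
      \<open>1 + \<tau>\<close> in the second; the larger of the two is at least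
      \<open>(1 + t) / 2\<close>.\<close>
    have half: "(1 + t) powr r1 * x powr (- r1) \<le> 2 powr r1" if "(1 + t) / 2 \<le> x" for x
    proof -
      have "x powr (- r1) \<le> ((1 + t) / 2) powr (- r1)" using that \<tau> rates by (intro powr_mono2') auto
      then have "(1 + t) powr r1 * x powr (- r1) \<le> (1 + t) powr r1 * ((1 + t) / 2) powr (- r1)"
        by (intro mult_left_mono) auto
      also have "\<dots> = 2 powr r1" using \<tau> by (simp add: powr_divide powr_minus field_simps)
      finally show ?thesis .
    qed
    show ?thesis
    proof (cases "\<tau> \<le> t / 2")
      case True
      have "(1 + \<tau>) powr (- \<kappa> - r1) \<le> (1 + \<tau>) powr (- \<kappa>)" using \<tau> rates by (intro powr_mono) auto
      then have "A * (1 + \<tau>) powr (- \<kappa> - r1) \<le> A * (1 + \<tau>) powr (- \<kappa>)" using A by (rule mult_left_mono)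
      then have L: "L1norm f + L2norm f \<le> 2 * (A * (1 + \<tau>) powr (- \<kappa>))" using L1 L2 by linarith
      have "C * (B * (1 + t) powr r1) * (1 + (t - \<tau>)) powr (- r1) * (L1norm f + L2norm f)
          = C * B * ((1 + t) powr r1 * (1 + (t - \<tau>)) powr (- r1)) * (L1norm f + L2norm f)" by (simp only: ac_simps)
      also have "\<dots> \<le> C * B * 2 powr r1 * (2 * (A * (1 + \<tau>) powr (- \<kappa>)))"
        using C B L True by (intro mult_mono mult_left_mono half) auto
      finally show ?thesis using e(2) by (simp add: ac_simps)
    next
      case False
      have "C * (B * (1 + t) powr r1) * L2norm f \<le> C * (B * (1 + t) powr r1) * (A * (1 + \<tau>) powr (- \<kappa> - r1))"
        using C B L2 by (intro mult_left_mono) auto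
      also have "(1 + \<tau>) powr (- \<kappa> - r1) = (1 + \<tau>) powr (- r1) * (1 + \<tau>) powr (- \<kappa>)"
        unfolding powr_add[symmetric] by (intro arg_cong2[where f = "(powr)"]) simp_all
      also have "C * (B * (1 + t) powr r1) * (A * ((1 + \<tau>) powr (- r1) * (1 + \<tau>) powr (- \<kappa>)))
          = C * B * A * (1 + \<tau>) powr (- \<kappa>) * ((1 + t) powr r1 * (1 + \<tau>) powr (- r1))" by (simp only: ac_simps)
      also have "\<dots> \<le> C * B * A * (1 + \<tau>) powr (- \<kappa>) * (2 powr r1)"
        using C B A False by (intro mult_left_mono half) auto
      also have "\<dots> \<le> C * B * A * (1 + \<tau>) powr (- \<kappa>) * (2 * 2 powr r1)"
        using C B A by (intro mult_left_mono) auto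
      finally show ?thesis using e(1) by (simp add: ac_simps)
    qed
  qed
  then have "evolution_constant (C * (2 * 2 powr r1))" unfolding evolution_constant_def using C by simp
  then show ?thesis ..
qed

lemma evolution_constantD:
  fixes f m :: "real^'n \<Rightarrow> complex"
  assumes C: "evolution_constant C" and \<tau>: "0 \<le> \<tau>" "\<tau> \<le> t" and f: "integrable lborel f" "square_integrable f"
    and m: "m \<in> borel_measurable borel" and B: "B \<ge> 0"
    and mb: "\<And>\<xi>. cmod (m \<xi>) \<le> B * (1 + t) powr r1 * exp (- (norm \<xi> powr (2 * \<delta>) * ((t - \<tau>) / 2)))"
    and L: "L1norm f \<le> A * (1 + \<tau>) powr (- \<kappa>)" "L2norm f \<le> A * (1 + \<tau>) powr (- \<kappa> - r1)"
  shows "norm (symbol_mult m (FT 1 (abs_l2 f))) \<le> C * B * A * (1 + \<tau>) powr (- \<kappa>)"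
  using C[unfolded evolution_constant_def, THEN conjunct2, rule_format, OF \<tau> f m B mb L] .

section \<open>Estimates of the Duhamel integral\<close>

definition Duhamel_constant :: "real \<Rightarrow> bool" where
  "Duhamel_constant C \<longleftrightarrow> C > 0 \<and> (\<forall>t \<tau> m B V V' M. 0 \<le> \<tau> \<longrightarrow> \<tau> \<le> t \<longrightarrow>
    m \<in> borel_measurable borel \<longrightarrow> B \<ge> 0 \<longrightarrow>
    (\<forall>\<xi>. cmod (m \<xi>) \<le> B * (1 + t) powr r1 * exp (- (norm \<xi> powr (2 * \<delta>) * ((t - \<tau>) / 2)))) \<longrightarrow>
    norm V \<le> M \<longrightarrow> norm V' \<le> M \<longrightarrow>
    norm (symbol_mult m (source (state \<tau> V) - source (state \<tau> V'))) \<le> C * B * (norm (V - V') * M powr (p - 1)) * (1 + \<tau>) powr (- \<kappa>))"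

lemma Duhamel_estimate: "\<exists>C. Duhamel_constant C"
proof -
  obtain C where C: "evolution_constant C" using evolution_estimate ..
  obtain Cn where Cn: "nonlinearity_constant Cn" using nonlinearity ..
  have C0: "C > 0" "Cn \<ge> 0" using C Cn by (simp_all add: evolution_constant_def nonlinearity_constant_def)
  have "norm (symbol_mult m (source (state \<tau> V) - source (state \<tau> V')))
        \<le> C * (Cn + 1) * B * (norm (V - V') * M powr (p - 1)) * (1 + \<tau>) powr (- \<kappa>)"
    if \<tau>: "0 \<le> \<tau>" "\<tau> \<le> t" and m: "m \<in> borel_measurable borel" and B: "B \<ge> 0"
      and mb: "\<And>\<xi>. cmod (m \<xi>) \<le> B * (1 + t) powr r1 * exp (- (norm \<xi> powr (2 * \<delta>) * ((t - \<tau>) / 2)))"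
      and M: "norm V \<le> M" "norm V' \<le> M"
    for t \<tau> B M and m :: "real^'n \<Rightarrow> complex" and V V' :: "'n l2"
  proof -
    let ?h = "\<lambda>x. abs_power p (rep_l2 (state \<tau> V)) x - abs_power p (rep_l2 (state \<tau> V')) x"
    \<comment> \<open>\<open>Cn\<close> may be 0, whereas \<open>Duhamel_constant\<close> asks for a
      positive constant; hence \<open>Cn + 1\<close>.\<close>
    let ?A = "(Cn + 1) * (norm (V - V') * M powr (p - 1))"
    have pos: "(1 + \<tau>) powr r0 > 0" "(1 + \<tau>) powr r1 > 0" using \<tau> by auto
    note ap = abs_power_L1_L2[OF pos FT_state]
    have h: "integrable lborel ?h" "square_integrable ?h"
      by (intro Bochner_Integration.integrable_diff square_integrable_diff ap)+
    have le: "Cn * x * y \<le> (Cn + 1) * y * x" if "x \<ge> 0" "y \<ge> 0" for x y :: real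
      using that by (simp add: algebra_simps)
    have "norm (symbol_mult m (FT 1 (abs_l2 ?h))) \<le> C * B * ?A * (1 + \<tau>) powr (- \<kappa>)"
    proof (rule evolution_constantD[OF C \<tau> h m B mb])
      have "L1norm ?h \<le> Cn * (1 + \<tau>) powr (- \<kappa>) * (norm (V - V') * M powr (p - 1))"
        "L2norm ?h \<le> Cn * (1 + \<tau>) powr (- \<kappa> - r1) * (norm (V - V') * M powr (p - 1))"
        using nonlinearity_constantD(2,3)[OF Cn pos FT_state FT_state M] unfolding interpolation_factor_rates[OF \<tau>(1)] by auto
      then show "L1norm ?h \<le> ?A * (1 + \<tau>) powr (- \<kappa>)" "L2norm ?h \<le> ?A * (1 + \<tau>) powr (- \<kappa> - r1)"
        using le[of "(1 + \<tau>) powr (- \<kappa>)" "norm (V - V') * M powr (p - 1)"]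
          le[of "(1 + \<tau>) powr (- \<kappa> - r1)" "norm (V - V') * M powr (p - 1)"] C0 by simp_all
    qed
    then show ?thesis
      unfolding source_diff[OF pos FT_state FT_state] by (simp only: ac_simps)
  qed
  then have "Duhamel_constant (C * (Cn + 1))" unfolding Duhamel_constant_def using C0 by simp
  then show ?thesis ..
qed

lemma Duhamel_constantD:
  fixes m :: "real^'n \<Rightarrow> complex" and V V' :: "'n l2"
  assumes C: "Duhamel_constant C" and \<tau>: "0 \<le> \<tau>" "\<tau> \<le> t" and m: "m \<in> borel_measurable borel" and B: "B \<ge> 0"
    and mb: "\<And>\<xi>. cmod (m \<xi>) \<le> B * (1 + t) powr r1 * exp (- (norm \<xi> powr (2 * \<delta>) * ((t - \<tau>) / 2)))"
    and M: "norm V \<le> M" "norm V' \<le> M"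
  shows "norm (symbol_mult m (source (state \<tau> V) - source (state \<tau> V'))) \<le> C * B * (norm (V - V') * M powr (p - 1)) * (1 + \<tau>) powr (- \<kappa>)"
  using C[unfolded Duhamel_constant_def, THEN conjunct2, rule_format, OF \<tau> m B mb M] .

text \<open>Makes the bound for one function the case \<open>V' = 0\<close> of the bound for
  differences.\<close>

lemma source_state_0:
  assumes t: "t \<ge> 0"
  shows "source (state t 0) = 0"
proof -
  have sq0: "square_integrable (\<lambda>x::real^'n. 0::complex)" by (rule square_integrable_zero)
  have "(1 + t) powr r0 > 0" "(1 + t) powr r1 > 0" using t by auto
  from linear_0[OF bounded_linear.linear[OF bounded_linear_symbol_mult[OF bounded_symbol_inv_weight[OF this]]]]
  have "state t 0 = 0"
    unfolding state_def using linear_0[OF bounded_linear.linear[OF bounded_linear_inv_FT]] by metis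
  moreover have "abs_l2 (abs_power p (rep_l2 (0::'n l2))) = abs_l2 (\<lambda>x. 0)"
  proof (rule abs_l2_eqI)
    have "AE x in lborel. rep_l2 (0::'n l2) x = 0"
      using AE_rep_abs_l2[OF sq0] by (simp add: abs_l2_zero)
    then show ae: "AE x in lborel. abs_power p (rep_l2 (0::'n l2)) x = 0"
      by eventually_elim (use p in \<open>simp add: abs_power_def\<close>)
    have "AE x in lborel. 0 = abs_power p (rep_l2 (0::'n l2)) x" using ae by eventually_elim simp
    then show "square_integrable (abs_power p (rep_l2 (0::'n l2)))"
      by (rule square_integrable_cong_AE[OF sq0, rotated]) (auto simp: measurable_abs_power)
  qed (rule sq0)
  ultimately show ?thesis
    unfolding source_def using linear_0[OF bounded_linear.linear[OF bounded_linear_FT[of 1]]] by (simp add: abs_l2_zero)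
qed

lemma pos_rates: "t \<ge> 0 \<Longrightarrow> (1 + t) powr r0 > 0" "t \<ge> 0 \<Longrightarrow> (1 + t) powr r1 > 0"
  by auto

text \<open>The weight is taken at the time \<open>t\<close> of evaluation, the kernel at the
  elapsed time \<open>s\<close>.\<close>

definition rate_symbol :: "real \<Rightarrow> real \<Rightarrow> real^'n \<Rightarrow> complex" where
  "rate_symbol t = weighted_wave_symbol \<sigma> \<delta> ((1 + t) powr r0) ((1 + t) powr r1)"

lemma measurable_rate_symbol [measurable]: "rate_symbol t s \<in> borel_measurable borel"
  by (simp add: rate_symbol_def)

text \<open>The factor \<open>s\<close> from the wave symbol is at most \<open>1 + t\<close>, and
  \<open>r0 + 1 <= r1\<close> hides it in the second weight. Half of the exponent is given away to
  match the majorant of the time derivative.\<close>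

lemma cmod_rate_symbol_le:
  assumes s: "0 \<le> s" "s \<le> t"
  shows "cmod (rate_symbol t s \<xi>) \<le> 2 * (1 + t) powr r1 * exp (- (norm \<xi> powr (2 * \<delta>) * (s / 2)))"
proof -
  have t: "t \<ge> 0" using s by simp
  have "(1 + t) powr r0 * \<bar>s\<bar> \<le> (1 + t) powr r0 * (1 + t) powr 1"
    using s by (intro mult_left_mono) auto
  also have "\<dots> = (1 + t) powr (r0 + 1)" by (rule powr_add[symmetric])
  also have "\<dots> \<le> (1 + t) powr r1" using rates t by (intro powr_mono) auto
  finally have 1: "(1 + t) powr r0 * \<bar>s\<bar> + (1 + t) powr r1 \<le> 2 * (1 + t) powr r1" by simp
  have "norm \<xi> powr (2 * \<delta>) * (s / 2) \<le> norm \<xi> powr (2 * \<delta>) * \<bar>s\<bar>" using s by (intro mult_left_mono) auto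
  then have 2: "exp (- (norm \<xi> powr (2 * \<delta>) * \<bar>s\<bar>)) \<le> exp (- (norm \<xi> powr (2 * \<delta>) * (s / 2)))" by simp
  have "cmod (rate_symbol t s \<xi>) \<le> ((1 + t) powr r0 * \<bar>s\<bar> + (1 + t) powr r1) * exp (- (norm \<xi> powr (2 * \<delta>) * \<bar>s\<bar>))"
    unfolding rate_symbol_def by (rule cmod_weighted_wave_symbol_le[OF pos_rates[OF t]])
  also have "\<dots> \<le> 2 * (1 + t) powr r1 * exp (- (norm \<xi> powr (2 * \<delta>) * (s / 2)))"
    using 1 2 by (intro mult_mono) auto
  finally show ?thesis .
qed

lemma bounded_symbol_rate_symbol:
  assumes s: "0 \<le> s" "s \<le> t"
  shows "bounded_symbol (2 * (1 + t) powr r1) (rate_symbol t s)"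
  unfolding bounded_symbol_def
proof (intro conjI allI)
  fix \<xi> :: "real^'n"
  have "2 * (1 + t) powr r1 * exp (- (norm \<xi> powr (2 * \<delta>) * (s / 2))) \<le> 2 * (1 + t) powr r1 * 1"
    using s by (intro mult_left_mono) auto
  from order_trans[OF cmod_rate_symbol_le[OF s] this] show "cmod (rate_symbol t s \<xi>) \<le> 2 * (1 + t) powr r1" by simp
qed simp

text \<open>An artificial factor \<open>(1 + t) powr r1\<close> brings the bound into the form of
  the general estimates with \<open>B = 2 * (1 + t) powr (- r1)\<close>; the decay of the velocity
  then comes out as the factor \<open>B\<close>.\<close>

lemma cmod_wave_symbol'_decay:
  assumes s: "0 \<le> s" "s \<le> t"
  shows "cmod (wave_symbol' \<sigma> \<delta> s \<xi>) \<le> 2 * (1 + t) powr (- r1) * (1 + t) powr r1 * exp (- (norm \<xi> powr (2 * \<delta>) * (s / 2)))"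
proof -
  have "(1 + t) powr (- r1) * (1 + t) powr r1 = 1" using s by (simp flip: powr_add)
  then show ?thesis using cmod_wave_symbol'_le[of \<sigma> \<delta> s \<xi>] s by (simp add: mult.assoc)
qed

text \<open>The initial value is treated as a source acting at \<open>\<tau> = 0\<close>, where both
  decay factors are 1.\<close>

lemma linear_estimate:
  assumes C: "evolution_constant C" and t: "t \<ge> 0" and f: "integrable lborel f" "square_integrable f"
    and m: "m \<in> borel_measurable borel" and B: "B \<ge> 0"
    and mb: "\<And>\<xi>. cmod (m \<xi>) \<le> B * (1 + t) powr r1 * exp (- (norm \<xi> powr (2 * \<delta>) * (t / 2)))"
  shows "norm (symbol_mult m (FT 1 (abs_l2 f))) \<le> C * B * (L1norm f + L2norm (f :: real^'n \<Rightarrow> complex))"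
proof -
  have nn: "0 \<le> L1norm f" "0 \<le> L2norm f" by (simp_all add: L1norm_nonneg L2norm_nonneg)
  have "norm (symbol_mult m (FT 1 (abs_l2 f))) \<le> C * B * (L1norm f + L2norm f) * (1 + 0) powr (- \<kappa>)"
    by (rule evolution_constantD[OF C order_refl t f m B]) (use mb nn in auto)
  then show ?thesis by simp
qed

text \<open>The pointwise bound decays like \<open>(1 + \<tau>) powr (- \<kappa>)\<close>, and its
  integral is at most \<open>1 / (\<kappa> - 1)\<close> for every \<open>t\<close>.\<close>

lemma Duhamel_difference:
  assumes C: "Duhamel_constant C" and t: "t \<ge> 0" and B: "B \<ge> 0"
    and m: "\<And>\<tau>. 0 \<le> \<tau> \<Longrightarrow> \<tau> \<le> t \<Longrightarrow> bounded_symbol (M \<tau>) (m \<tau>)"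
    and mb: "\<And>\<tau> \<xi>. 0 \<le> \<tau> \<Longrightarrow> \<tau> \<le> t \<Longrightarrow> cmod (m \<tau> \<xi>) \<le> B * (1 + t) powr r1 * exp (- (norm \<xi> powr (2 * \<delta>) * ((t - \<tau>) / 2)))"
    and V: "continuous_on {0..t} (\<lambda>\<tau>. symbol_mult (m \<tau>) (source (state \<tau> (V \<tau>))))" "\<And>t. t \<ge> 0 \<Longrightarrow> norm (V t) \<le> R"
    and V': "continuous_on {0..t} (\<lambda>\<tau>. symbol_mult (m \<tau>) (source (state \<tau> (V' \<tau>))))" "\<And>t. t \<ge> 0 \<Longrightarrow> norm (V' t) \<le> R"
    and d: "\<And>t. t \<ge> 0 \<Longrightarrow> norm (V t - V' t) \<le> d"
  shows "norm (integral {0..t} (\<lambda>\<tau>. symbol_mult (m \<tau>) (source (state \<tau> (V \<tau>))))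
      - integral {0..t} (\<lambda>\<tau>. symbol_mult (m \<tau>) (source (state \<tau> (V' \<tau>))))) \<le> C * B / (\<kappa> - 1) * R powr (p - 1) * d"
proof -
  have C0: "C \<ge> 0" using C by (simp add: Duhamel_constant_def)
  have d0: "d \<ge> 0" using d[of 0] norm_ge_zero[of "V 0 - V' 0"] by linarith
  note i = integrable_continuous_interval[OF V(1)] integrable_continuous_interval[OF V'(1)]
  let ?K = "C * B * (d * R powr (p - 1))"
  have "norm (integral {0..t} (\<lambda>\<tau>. symbol_mult (m \<tau>) (source (state \<tau> (V \<tau>))) - symbol_mult (m \<tau>) (source (state \<tau> (V' \<tau>)))))
      \<le> integral {0..t} (\<lambda>\<tau>. ?K * (1 + \<tau>) powr (- \<kappa>))"
  proof (rule integral_norm_bound_integral)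
    show "(\<lambda>\<tau>. symbol_mult (m \<tau>) (source (state \<tau> (V \<tau>))) - symbol_mult (m \<tau>) (source (state \<tau> (V' \<tau>)))) integrable_on {0..t}"
      by (rule integrable_diff[OF i])
    show "(\<lambda>\<tau>. ?K * (1 + \<tau>) powr (- \<kappa>)) integrable_on {0..t}"
      using integrable_cmul[OF decay_integral(1)[OF t], of ?K] by simp
    fix \<tau> assume "\<tau> \<in> {0..t}"
    then have \<tau>: "0 \<le> \<tau>" "\<tau> \<le> t" by auto
    have "norm (symbol_mult (m \<tau>) (source (state \<tau> (V \<tau>)) - source (state \<tau> (V' \<tau>))))
        \<le> C * B * (norm (V \<tau> - V' \<tau>) * R powr (p - 1)) * (1 + \<tau>) powr (- \<kappa>)"
      by (rule Duhamel_constantD[OF C \<tau> bounded_symbolD(1)[OF m[OF \<tau>]] B mb[OF \<tau>] V(2)[OF \<tau>(1)] V'(2)[OF \<tau>(1)]])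
    also have "\<dots> \<le> ?K * (1 + \<tau>) powr (- \<kappa>)"
      using d[OF \<tau>(1)] C0 B by (intro mult_right_mono mult_left_mono) auto
    finally show "norm (symbol_mult (m \<tau>) (source (state \<tau> (V \<tau>))) - symbol_mult (m \<tau>) (source (state \<tau> (V' \<tau>)))) \<le> ?K * (1 + \<tau>) powr (- \<kappa>)"
      by (simp only: symbol_mult_diff[OF m[OF \<tau>]])
  qed
  also have "\<dots> = ?K * integral {0..t} (\<lambda>\<tau>. (1 + \<tau>) powr (- \<kappa>))" by simp
  also have "\<dots> \<le> ?K * (1 / (\<kappa> - 1))"
    using decay_integral(2)[OF t] C0 B d0 by (intro mult_left_mono) auto
  finally show ?thesis unfolding Henstock_Kurzweil_Integration.integral_diff[OF i] by (simp add: field_simps)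
qed

text \<open>\<open>Duhamel_difference\<close> with the zero function as second argument and
  \<open>d = R\<close>.\<close>

lemma Duhamel_bound:
  assumes C: "Duhamel_constant C" and t: "t \<ge> 0" and B: "B \<ge> 0"
    and m: "\<And>\<tau>. 0 \<le> \<tau> \<Longrightarrow> \<tau> \<le> t \<Longrightarrow> bounded_symbol (M \<tau>) (m \<tau>)"
    and mb: "\<And>\<tau> \<xi>. 0 \<le> \<tau> \<Longrightarrow> \<tau> \<le> t \<Longrightarrow> cmod (m \<tau> \<xi>) \<le> B * (1 + t) powr r1 * exp (- (norm \<xi> powr (2 * \<delta>) * ((t - \<tau>) / 2)))"
    and V: "continuous_on {0..t} (\<lambda>\<tau>. symbol_mult (m \<tau>) (source (state \<tau> (V \<tau>))))" "\<And>t. t \<ge> 0 \<Longrightarrow> norm (V t) \<le> R"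
  shows "norm (integral {0..t} (\<lambda>\<tau>. symbol_mult (m \<tau>) (source (state \<tau> (V \<tau>))))) \<le> C * B / (\<kappa> - 1) * R powr (p - 1) * R"
proof -
  have R: "R \<ge> 0" using V(2)[of 0] norm_ge_zero[of "V 0"] by linarith
  have z: "symbol_mult (m \<tau>) (source (state \<tau> 0)) = 0" if "\<tau> \<in> {0..t}" for \<tau>
  proof -
    have "bounded_linear (symbol_mult (m \<tau>))" using that by (intro bounded_linear_symbol_mult[OF m]) auto
    then show ?thesis using that source_state_0[of \<tau>] by (simp add: linear_0[OF bounded_linear.linear])
  qed
  have "continuous_on {0..t} (\<lambda>\<tau>. symbol_mult (m \<tau>) (source (state \<tau> 0))) \<longleftrightarrow> continuous_on {0..t} (\<lambda>\<tau>. 0 :: 'n l2)"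
    by (rule continuous_on_cong[OF refl z])
  then have c: "continuous_on {0..t} (\<lambda>\<tau>. symbol_mult (m \<tau>) (source (state \<tau> 0)))" by simp
  have "integral {0..t} (\<lambda>\<tau>. symbol_mult (m \<tau>) (source (state \<tau> 0))) = integral {0..t} (\<lambda>\<tau>. 0 :: 'n l2)"
    by (rule Henstock_Kurzweil_Integration.integral_cong[OF z])
  moreover have "norm (integral {0..t} (\<lambda>\<tau>. symbol_mult (m \<tau>) (source (state \<tau> (V \<tau>))))
      - integral {0..t} (\<lambda>\<tau>. symbol_mult (m \<tau>) (source (state \<tau> 0)))) \<le> C * B / (\<kappa> - 1) * R powr (p - 1) * R"
    by (rule Duhamel_difference[OF C t B m mb V c]) (use R V(2) in auto)
  ultimately show ?thesis by simp
qed

section \<open>The fixed point for small data\<close>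

definition fixed_point_map :: "'n l2 \<Rightarrow> (real \<Rightarrow> 'n l2) \<Rightarrow> real \<Rightarrow> 'n l2" where
  "fixed_point_map F V t = symbol_mult (rate_symbol t t) F + integral {0..t} (\<lambda>\<tau>. symbol_mult (rate_symbol t (t - \<tau>)) (source (state \<tau> (V \<tau>))))"

lemma continuous_on_fixed_point_map:
  assumes V: "continuous_on {0..} V"
  shows "continuous_on {0..} (fixed_point_map F V)"
proof -
  have T: "continuous_on {0..T} (fixed_point_map F V)" if "T \<ge> 0" for T
    unfolding fixed_point_map_def[abs_def]
  proof (intro continuous_on_add)
    have bounded: "bounded_symbol (2 * (1 + T) powr r1) (rate_symbol t s)" if "0 \<le> s" "s \<le> t" "t \<le> T" for s t
    proof -
      have "2 * (1 + t) powr r1 \<le> 2 * (1 + T) powr r1" using that rates by (intro mult_left_mono powr_mono2) auto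
      then show ?thesis using bounded_symbol_rate_symbol[OF that(1,2)] unfolding bounded_symbol_def by (meson order_trans)
    qed
    show "continuous_on {0..T} (\<lambda>t. symbol_mult (rate_symbol t t) F)"
    proof (rule continuous_on_symbol_mult)
      show "bounded_symbol (2 * (1 + T) powr r1) (rate_symbol t t)" if "t \<in> {0..T}" for t using that by (intro bounded) auto
      show "continuous_on {0..T} (\<lambda>t. rate_symbol t t \<xi>)" for \<xi>
        unfolding rate_symbol_def by (intro continuous_on_weighted_wave_symbol continuous_intros) auto
    qed simp
    show "continuous_on {0..T} (\<lambda>t. integral {0..t} (\<lambda>\<tau>. symbol_mult (rate_symbol t (t - \<tau>)) (source (state \<tau> (V \<tau>)))))"
    proof (rule continuous_on_Volterra_integral)
      show "continuous_on {z. 0 \<le> snd z \<and> snd z \<le> fst z \<and> fst z \<le> T}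
         (\<lambda>z. symbol_mult (rate_symbol (fst z) (fst z - snd z)) (source (state (snd z) (V (snd z)))))"
        by (rule continuous_on_wave_integrand[OF continuous_on_source_state[OF V], where m = "\<lambda>t \<tau>. rate_symbol t (t - \<tau>)" and B = "2 * (1 + T) powr r1"])
          (auto intro!: bounded, auto intro!: continuous_on_weighted_wave_symbol continuous_intros simp: rate_symbol_def)
    qed
  qed
  then show ?thesis by (rule continuous_on_atLeast_if_atLeastAtMost)
qed

lemma continuous_on_rate_symbol_source:
  assumes V: "continuous_on {0..} V" and t: "t \<ge> 0"
  shows "continuous_on {0..t} (\<lambda>\<tau>. symbol_mult (rate_symbol t (t - \<tau>)) (source (state \<tau> (V \<tau>))))"
  unfolding rate_symbol_def by (rule continuous_on_Duhamel_integrand(3)[OF continuous_on_source_state[OF V] pos_rates[OF t]])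

text \<open>The time derivative of Duhamel's formula on the Fourier side. There is no boundary term
  because \<open>wave_symbol\<close> vanishes at time 0.\<close>

definition velocity :: "'n l2 \<Rightarrow> (real \<Rightarrow> 'n l2) \<Rightarrow> real \<Rightarrow> 'n l2" where
  "velocity F u t = symbol_mult (wave_symbol' \<sigma> \<delta> t) F + integral {0..t} (\<lambda>\<tau>. symbol_mult (wave_symbol' \<sigma> \<delta> (t - \<tau>)) (source (u \<tau>)))"

definition Fourier_mild :: "'n l2 \<Rightarrow> (real \<Rightarrow> 'n l2) \<Rightarrow> bool" where
  "Fourier_mild F u \<longleftrightarrow> (\<forall>t\<ge>0. FT 1 (u t)
    = symbol_mult (wave_symbol \<sigma> \<delta> t) F + integral {0..t} (\<lambda>\<tau>. symbol_mult (wave_symbol \<sigma> \<delta> (t - \<tau>)) (source (u \<tau>))))"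

lemma small_data_fixed_point:
  "\<exists>\<epsilon>0>0. \<exists>K>0. \<forall>u1 :: real^'n \<Rightarrow> complex. integrable lborel u1 \<and> square_integrable u1 \<and> L1norm u1 + L2norm u1 < \<epsilon>0 \<longrightarrow>
    (\<exists>V. continuous_on {0..} V \<and> (\<forall>t\<ge>0. V t = fixed_point_map (FT 1 (abs_l2 u1)) V t \<and> norm (V t) \<le> K * (L1norm u1 + L2norm u1) \<and>
      norm (velocity (FT 1 (abs_l2 u1)) (\<lambda>\<tau>. state \<tau> (V \<tau>)) t) \<le> (1 + t) powr (- r1) * (K * (L1norm u1 + L2norm u1))))"
proof -
  obtain Cl where Cl: "evolution_constant Cl" using evolution_estimate ..
  obtain Cd where Cd: "Duhamel_constant Cd" using Duhamel_estimate ..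
  have C0: "Cl > 0" "Cd > 0" using Cl Cd by (simp_all add: evolution_constant_def Duhamel_constant_def)
  \<comment> \<open>The linear part is at most \<open>2 * Cl\<close> times the data; with
    \<open>4 * Cl\<close> it fills half of the ball.\<close>
  define K where "K = 4 * Cl"
  define K1 where "K1 = Cd * 2 / (\<kappa> - 1)"
  \<comment> \<open>Chosen so that \<open>K1 * \<rho> powr (p - 1) = 1 / 2\<close>: the nonlinear
    part then fills at most the other half of the ball, and the map contracts with factor one
    half.\<close>
  define \<rho> where "\<rho> = (1 / (2 * K1)) powr (1 / (p - 1))"
  have K: "K > 0" and K1: "K1 > 0" using C0 \<kappa>_gt_1 by (auto simp: K_def K1_def)
  have \<rho>: "\<rho> > 0" using K1 by (simp add: \<rho>_def)
  show ?thesis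
  proof (rule exI[of _ "\<rho> / K"], rule conjI[rotated], rule exI[of _ K], intro conjI allI impI)
    fix u1 :: "real^'n \<Rightarrow> complex"
    assume u1: "integrable lborel u1 \<and> square_integrable u1 \<and> L1norm u1 + L2norm u1 < \<rho> / K"
    define E where "E = L1norm u1 + L2norm u1"
    \<comment> \<open>The radius is proportional to the size of the data, so membership in the ball
      already is the decay estimate with this factor.\<close>
    define R where "R = K * E"
    define F where "F = FT 1 (abs_l2 u1)"
    have f: "integrable lborel u1" "square_integrable u1" using u1 by auto
    have E: "E \<ge> 0" by (simp add: E_def L1norm_nonneg L2norm_nonneg)
    have R: "R \<ge> 0" "R \<le> \<rho>" using E K u1 by (auto simp: R_def E_def[symmetric] pos_less_divide_eq mult.commute)
    have "R powr (p - 1) \<le> \<rho> powr (p - 1)" using R p by (intro powr_mono2) auto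
    also have "\<dots> = 1 / (2 * K1)" using p K1 by (simp add: \<rho>_def powr_powr)
    finally have small: "K1 * R powr (p - 1) \<le> 1 / 2" using K1 by (simp add: pos_le_divide_eq mult_ac)
    have small': "K1 * R powr (p - 1) * x \<le> x / 2" if "x \<ge> 0" for x using mult_right_mono[OF small that] by simp
    have lin: "norm (symbol_mult (rate_symbol t t) F) \<le> R / 2" if t: "t \<ge> 0" for t
    proof -
      have "norm (symbol_mult (rate_symbol t t) F) \<le> Cl * 2 * E"
        unfolding F_def E_def by (rule linear_estimate[OF Cl t f _ _ cmod_rate_symbol_le]) (use t in auto)
      then show ?thesis by (simp add: R_def K_def)
    qed
    have Wb: "bounded_symbol (2 * (1 + t) powr r1) (rate_symbol t (t - \<tau>))"
      "cmod (rate_symbol t (t - \<tau>) \<xi>) \<le> 2 * (1 + t) powr r1 * exp (- (norm \<xi> powr (2 * \<delta>) * ((t - \<tau>) / 2)))"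
      if "0 \<le> \<tau>" "\<tau> \<le> t" for t \<tau> \<xi>
      using that by (intro bounded_symbol_rate_symbol cmod_rate_symbol_le; simp)+
    obtain V where V: "continuous_on {0..} V" "\<And>t. t \<ge> 0 \<Longrightarrow> norm (V t) \<le> R" "\<And>t. t \<ge> 0 \<Longrightarrow> V t = fixed_point_map F V t"
    proof (rule contraction_fixed_point[OF R(1)])
      show "continuous_on {0..} (fixed_point_map F V)" if "continuous_on {0..} V" for V
        by (rule continuous_on_fixed_point_map[OF that])
      show "norm (fixed_point_map F V t) \<le> R"
        if V: "continuous_on {0..} V" "\<And>t. t \<ge> 0 \<Longrightarrow> norm (V t) \<le> R" and t: "t \<ge> 0" for V t
      proof -
        have "norm (integral {0..t} (\<lambda>\<tau>. symbol_mult (rate_symbol t (t - \<tau>)) (source (state \<tau> (V \<tau>))))) \<le> Cd * 2 / (\<kappa> - 1) * R powr (p - 1) * R"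
          by (rule Duhamel_bound[OF Cd t _ Wb continuous_on_rate_symbol_source[OF V(1) t] V(2)]) auto
        then have "norm (integral {0..t} (\<lambda>\<tau>. symbol_mult (rate_symbol t (t - \<tau>)) (source (state \<tau> (V \<tau>))))) \<le> R / 2"
          using small'[OF R(1)] unfolding K1_def by linarith
        then show ?thesis
          unfolding fixed_point_map_def using lin[OF t] norm_triangle_ineq[of "symbol_mult (rate_symbol t t) F"] by (smt (verit) field_sum_of_halves)
      qed
      show "norm (fixed_point_map F V t - fixed_point_map F V' t) \<le> d / 2"
        if V: "continuous_on {0..} V" "\<And>t. t \<ge> 0 \<Longrightarrow> norm (V t) \<le> R"
          and V': "continuous_on {0..} V'" "\<And>t. t \<ge> 0 \<Longrightarrow> norm (V' t) \<le> R"
          and d: "\<And>t. t \<ge> 0 \<Longrightarrow> norm (V t - V' t) \<le> d" and t: "t \<ge> 0" for V V' d t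
      proof -
        have "d \<ge> 0" using d[OF t] norm_ge_zero[of "V t - V' t"] by linarith
        have "norm (integral {0..t} (\<lambda>\<tau>. symbol_mult (rate_symbol t (t - \<tau>)) (source (state \<tau> (V \<tau>))))
            - integral {0..t} (\<lambda>\<tau>. symbol_mult (rate_symbol t (t - \<tau>)) (source (state \<tau> (V' \<tau>))))) \<le> Cd * 2 / (\<kappa> - 1) * R powr (p - 1) * d"
          by (rule Duhamel_difference[OF Cd t _ Wb continuous_on_rate_symbol_source[OF V(1) t] V(2) continuous_on_rate_symbol_source[OF V'(1) t] V'(2) d]) auto
        then show ?thesis
          using small'[OF \<open>d \<ge> 0\<close>] unfolding fixed_point_map_def K1_def by simp
      qed
    qed (use that in blast)
    have "norm (velocity F (\<lambda>\<tau>. state \<tau> (V \<tau>)) t) \<le> (1 + t) powr (- r1) * R" if t: "t \<ge> 0" for t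
    proof -
      let ?B = "2 * (1 + t) powr (- r1)"
      have wb: "cmod (wave_symbol' \<sigma> \<delta> (t - \<tau>) \<xi>) \<le> ?B * (1 + t) powr r1 * exp (- (norm \<xi> powr (2 * \<delta>) * ((t - \<tau>) / 2)))"
        if "0 \<le> \<tau>" "\<tau> \<le> t" for \<tau> and \<xi> :: "real^'n"
        using that by (intro cmod_wave_symbol'_decay) auto
      have "norm (symbol_mult (wave_symbol' \<sigma> \<delta> t) F) \<le> Cl * ?B * E"
        unfolding F_def E_def by (rule linear_estimate[OF Cl t f]) (use t wb[of 0] in auto)
      moreover have "norm (integral {0..t} (\<lambda>\<tau>. symbol_mult (wave_symbol' \<sigma> \<delta> (t - \<tau>)) (source (state \<tau> (V \<tau>)))))
          \<le> Cd * ?B / (\<kappa> - 1) * R powr (p - 1) * R"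
        by (rule Duhamel_bound[OF Cd t _ bounded_symbol_wave_symbol' wb
              continuous_on_Duhamel_integrand(2)[OF continuous_on_source_state[OF V(1)]] V(2)]) auto
      moreover have "Cd * ?B / (\<kappa> - 1) * R powr (p - 1) * R = (1 + t) powr (- r1) * (K1 * R powr (p - 1) * R)"
        by (simp add: K1_def)
      moreover have "Cl * ?B * E = (1 + t) powr (- r1) * (R / 2)" by (simp add: R_def K_def)
      moreover have "(1 + t) powr (- r1) * (K1 * R powr (p - 1) * R) \<le> (1 + t) powr (- r1) * (R / 2)"
        using small'[OF R(1)] by (intro mult_left_mono) auto
      ultimately show ?thesis
        unfolding velocity_def
        using norm_triangle_ineq[of "symbol_mult (wave_symbol' \<sigma> \<delta> t) F" "integral {0..t} (\<lambda>\<tau>. symbol_mult (wave_symbol' \<sigma> \<delta> (t - \<tau>)) (source (state \<tau> (V \<tau>))))"]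
        by linarith
    qed
    then show "\<exists>V. continuous_on {0..} V \<and> (\<forall>t\<ge>0. V t = fixed_point_map (FT 1 (abs_l2 u1)) V t \<and> norm (V t) \<le> K * (L1norm u1 + L2norm u1) \<and>
        norm (velocity (FT 1 (abs_l2 u1)) (\<lambda>\<tau>. state \<tau> (V \<tau>)) t) \<le> (1 + t) powr (- r1) * (K * (L1norm u1 + L2norm u1)))"
      using V unfolding E_def[symmetric] R_def[symmetric] F_def[symmetric] by (intro exI[of _ V]) simp
  qed (use \<rho> K in auto)
qed

text \<open>Existence needs one direction and uniqueness the other. The representation by a
  continuous \<open>Z\<close> makes the source integrable, square-integrable and continuous in time,
  so both time integrals exist and correspond under \<open>inv_FT\<close>.\<close>

lemma mild_solution_iff_Fourier_mild:
  fixes u1 :: "real^'n \<Rightarrow> complex"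
  assumes u1: "integrable lborel u1" "square_integrable u1"
    and Z: "continuous_on {0..} Z" "\<And>t. t \<ge> 0 \<Longrightarrow> FT 1 (u t) = symbol_mult (inv_weight \<sigma> 1 1) (Z t)"
  shows "mild_solution \<sigma> \<delta> p u1 u \<longleftrightarrow> Fourier_mild (FT 1 (abs_l2 u1)) u"
  unfolding mild_solution_def Fourier_mild_def
proof (rule iff_allI, rule imp_cong[OF refl])
  fix t :: real
  let ?G = "\<lambda>\<tau>. symbol_mult (wave_symbol \<sigma> \<delta> (t - \<tau>)) (source (u \<tau>))"
  let ?J = "\<lambda>\<tau>. abs_l2 (Defs.convolution (kernel \<sigma> \<delta> (t - \<tau>)) (abs_power p (rep_l2 (u \<tau>))))"
  let ?a = "abs_l2 (Defs.convolution (kernel \<sigma> \<delta> t) u1)" and ?F = "FT 1 (abs_l2 u1)"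
  assume t: "0 \<le> t"
  have J: "?J \<tau> = inv_FT (?G \<tau>)" if "\<tau> \<in> {0..t}" for \<tau>
  proof -
    have "FT 1 (?J \<tau>) = ?G \<tau>"
      unfolding source_def using that by (intro FT_kernel_convolution[OF \<delta>(1)] abs_power_L1_L2[OF _ _ Z(2)]) auto
    then show ?thesis by (metis inv_FT_FT)
  qed
  have "(?G has_integral integral {0..t} ?G) {0..t}"
    by (intro integrable_integral integrable_continuous_interval continuous_on_Duhamel_integrand(1) continuous_on_source[OF Z])
  from has_integral_linear[OF this bounded_linear_inv_FT]
  have I: "((\<lambda>\<tau>. inv_FT (?G \<tau>)) has_integral inv_FT (integral {0..t} ?G)) {0..t}" by (simp add: o_def)
  have a: "FT 1 ?a = symbol_mult (wave_symbol \<sigma> \<delta> t) ?F" by (rule FT_kernel_convolution[OF \<delta>(1) t u1])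
  have "(?J has_integral u t - ?a) {0..t} \<longleftrightarrow> ((\<lambda>\<tau>. inv_FT (?G \<tau>)) has_integral u t - ?a) {0..t}"
    by (rule has_integral_cong[OF J])
  also have "\<dots> \<longleftrightarrow> u t - ?a = inv_FT (integral {0..t} ?G)"
  proof
    show "((\<lambda>\<tau>. inv_FT (?G \<tau>)) has_integral u t - ?a) {0..t} \<Longrightarrow> u t - ?a = inv_FT (integral {0..t} ?G)"
      by (rule has_integral_unique[OF _ I])
    show "u t - ?a = inv_FT (integral {0..t} ?G) \<Longrightarrow> ((\<lambda>\<tau>. inv_FT (?G \<tau>)) has_integral u t - ?a) {0..t}"
      using I by (simp only:)
  qed
  also have "\<dots> \<longleftrightarrow> FT 1 (u t - ?a) = integral {0..t} ?G"
  proof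
    show "u t - ?a = inv_FT (integral {0..t} ?G) \<Longrightarrow> FT 1 (u t - ?a) = integral {0..t} ?G" by (simp only: FT_inv_FT)
    show "FT 1 (u t - ?a) = integral {0..t} ?G \<Longrightarrow> u t - ?a = inv_FT (integral {0..t} ?G)"
      using inv_FT_FT[of "u t - ?a"] by (simp only:)
  qed
  also have "FT 1 (u t - ?a) = FT 1 (u t) - symbol_mult (wave_symbol \<sigma> \<delta> t) ?F"
    unfolding a[symmetric] by (rule linear_diff[OF bounded_linear.linear[OF bounded_linear_FT]]) simp
  finally show "(?J has_integral u t - ?a) {0..t} \<longleftrightarrow> FT 1 (u t) = symbol_mult (wave_symbol \<sigma> \<delta> t) ?F + integral {0..t} ?G"
    by (simp add: diff_eq_eq add.commute)
qed

section \<open>Regularity, decay and uniqueness of the solution\<close>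

lemma Fourier_mild_state:
  assumes V: "continuous_on {0..} V" and fp: "\<And>t. t \<ge> 0 \<Longrightarrow> V t = fixed_point_map F V t"
  shows "Fourier_mild F (\<lambda>t. state t (V t))"
  unfolding Fourier_mild_def
proof (intro allI impI)
  fix t :: real assume t: "t \<ge> 0"
  have "FT 1 (state t (V t)) = symbol_mult (inv_weight \<sigma> ((1 + t) powr r0) ((1 + t) powr r1)) (fixed_point_map F V t)"
    unfolding FT_state by (subst fp[OF t]) (rule refl)
  also have "\<dots> = symbol_mult (wave_symbol \<sigma> \<delta> t) F + integral {0..t} (\<lambda>\<tau>. symbol_mult (wave_symbol \<sigma> \<delta> (t - \<tau>)) (source (state \<tau> (V \<tau>))))"
    unfolding fixed_point_map_def rate_symbol_def by (rule inv_weight_Duhamel[OF pos_rates[OF t] continuous_on_source_state[OF V]])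
  finally show "FT 1 (state t (V t)) = \<dots>" .
qed

lemma has_vector_derivative_Fourier_mild:
  assumes u: "Fourier_mild F u" and N: "continuous_on {0..} (\<lambda>t. source (u t))" and t: "t \<ge> 0"
  shows "(u has_vector_derivative inv_FT (velocity F u t)) (at t within {0..})"
proof -
  let ?G = "\<lambda>t. symbol_mult (wave_symbol \<sigma> \<delta> t) F + integral {0..t} (\<lambda>\<tau>. symbol_mult (wave_symbol \<sigma> \<delta> (t - \<tau>)) (source (u \<tau>)))"
  have "((\<lambda>t. symbol_mult (wave_symbol \<sigma> \<delta> t) F) has_vector_derivative symbol_mult (wave_symbol' \<sigma> \<delta> t) F) (at t)"
  proof (rule has_vector_derivative_symbol_mult[OF bounded_symbol_wave_symbol bounded_symbol_wave_symbol' has_vector_derivative_wave_symbol])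
    show "cmod (wave_symbol' \<sigma> \<delta> s \<xi>) \<le> 2" for s and \<xi> :: "real^'n"
      by (rule bounded_symbolD(2)[OF bounded_symbol_wave_symbol'])
  qed
  then have "(?G has_vector_derivative velocity F u t) (at t within {0..})"
    unfolding velocity_def
    by (rule has_vector_derivative_add[OF has_vector_derivative_at_within has_vector_derivative_Duhamel[OF N t]])
  from bounded_linear.has_vector_derivative[OF bounded_linear_inv_FT this]
  have "((\<lambda>t. inv_FT (?G t)) has_vector_derivative inv_FT (velocity F u t)) (at t within {0..})" .
  then show ?thesis
  proof (rule has_vector_derivative_transform[rotated 2])
    fix s :: real assume "s \<in> {0..}"
    then have "FT 1 (u s) = ?G s" using u by (simp add: Fourier_mild_def)
    then show "u s = inv_FT (?G s)" by (metis inv_FT_FT)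
  qed (use t in simp)
qed

lemma continuous_on_velocity:
  assumes N: "continuous_on {0..} (\<lambda>t. source (u t))"
  shows "continuous_on {0..} (velocity F u)"
proof (rule continuous_on_atLeast_if_atLeastAtMost)
  fix T :: real assume "T \<ge> 0"
  show "continuous_on {0..T} (velocity F u)"
    unfolding velocity_def[abs_def]
  proof (intro continuous_on_add)
    show "continuous_on {0..T} (\<lambda>t. symbol_mult (wave_symbol' \<sigma> \<delta> t) F)"
      by (rule continuous_on_symbol_mult[OF bounded_symbol_wave_symbol' continuous_wave_symbol']) simp
    show "continuous_on {0..T} (\<lambda>t. integral {0..t} (\<lambda>\<tau>. symbol_mult (wave_symbol' \<sigma> \<delta> (t - \<tau>)) (source (u \<tau>))))"
    proof (rule continuous_on_Volterra_integral)
      show "continuous_on {z. 0 \<le> snd z \<and> snd z \<le> fst z \<and> fst z \<le> T}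
         (\<lambda>z. symbol_mult (wave_symbol' \<sigma> \<delta> (fst z - snd z)) (source (u (snd z))))"
        by (rule continuous_on_wave_integrand[OF N, where m = "\<lambda>t \<tau>. wave_symbol' \<sigma> \<delta> (t - \<tau>)" and B = 2])
          (auto intro!: bounded_symbol_wave_symbol' continuous_on_compose2[OF continuous_wave_symbol'[of UNIV]] continuous_intros)
    qed
  qed
qed

lemma Fourier_mild_C1:
  assumes u: "Fourier_mild F u" and N: "continuous_on {0..} (\<lambda>t. source (u t))"
  shows "C1_L2 u" and "\<And>t. t \<ge> 0 \<Longrightarrow> time_derivative u t = inv_FT (velocity F u t)"
proof -
  note d = has_vector_derivative_Fourier_mild[OF u N]
  show td: "time_derivative u t = inv_FT (velocity F u t)" if t: "t \<ge> 0" for t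
  proof -
    \<comment> \<open>The half-line has no isolated point, so the one-sided derivative at 0 is also
      unique.\<close>
    have "{0::real..} \<noteq> {a}" for a by (auto simp: set_eq_iff intro!: exI[of _ "\<bar>a\<bar> + 1"])
    then have "at t within {0..} \<noteq> bot"
      using t by (subst trivial_limit_within) (auto intro!: connected_imp_perfect)
    then show ?thesis unfolding time_derivative_def by (rule vector_derivative_within[OF _ d[OF t]])
  qed
  have "continuous_on {0..} (\<lambda>t. inv_FT (velocity F u t))"
    by (rule bounded_linear.continuous_on[OF bounded_linear_inv_FT continuous_on_velocity[OF N]])
  then have "continuous_on {0..} (time_derivative u)"
    by (rule continuous_on_cong[OF refl, THEN iffD2, rotated]) (simp add: td)
  then show "C1_L2 u"
    unfolding C1_L2_def using d differentiableI_vector by blast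
qed

text \<open>Only the first summand of the weight is kept, which gives the rate \<open>r0\<close>;
  the next lemma keeps only the second one. The normalising factor of the inverse transform is at
  most 1 and is dropped.\<close>

lemma norm_state_le:
  assumes t: "t \<ge> 0"
  shows "norm (state t V) \<le> (1 + t) powr (- r0) * norm V"
proof -
  have "norm (state t V) \<le> norm (symbol_mult (inv_weight \<sigma> ((1 + t) powr r0) ((1 + t) powr r1)) V)"
    unfolding state_def by (rule norm_inv_FT_le)
  also have "\<dots> \<le> 1 / (1 + t) powr r0 * norm V"
    by (rule norm_symbol_mult_le[OF bounded_symbol_inv_weight[OF pos_rates[OF t]]])
  finally show ?thesis by (simp add: powr_minus_divide)
qed

lemma norm_frac_laplacian_state_le:
  assumes t: "t \<ge> 0"
  shows "norm (frac_laplacian (\<sigma> / 2) (state t V)) \<le> (1 + t) powr (- r1) * norm V"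
proof -
  let ?a = "(1 + t) powr r0" and ?b = "(1 + t) powr r1"
  let ?g = "\<lambda>\<xi>. of_real (norm \<xi> powr (2 * (\<sigma> / 2))) * rep_l2 (FT 1 (state t V)) \<xi>"
  have [measurable]: "rep_l2 f \<in> borel_measurable borel" for f :: "'n l2"
    using square_integrable_rep_l2[of f] by (simp add: square_integrable_def)
  have m: "?g \<in> borel_measurable borel" by measurable
  have le: "AE \<xi> in lborel. cmod (?g \<xi>) \<le> (1 + t) powr (- r1) * cmod (rep_l2 V \<xi>)"
    unfolding FT_state using AE_rep_symbol_mult[OF bounded_symbol_inv_weight[OF pos_rates[OF t], of \<sigma>], of V]
  proof eventually_elim
    case (elim \<xi>)
    let ?r = "norm \<xi> powr \<sigma>"
    note w = weight_pos[OF pos_rates[OF t], of \<xi> \<sigma>]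
    have "?b * ?r \<le> ?a + ?b * ?r" by simp
    then have "?r / (?a + ?b * ?r) \<le> 1 / ?b" using w pos_rates(2)[OF t] by (simp add: divide_simps mult.commute)
    then have "?r / (?a + ?b * ?r) \<le> (1 + t) powr (- r1)" by (simp add: powr_minus_divide)
    from mult_right_mono[OF this, of "cmod (rep_l2 V \<xi>)"]
    moreover have "cmod (inv_weight \<sigma> ?a ?b \<xi>) = 1 / (?a + ?b * ?r)"
      unfolding inv_weight_def norm_of_real using w by simp
    ultimately show ?case unfolding elim norm_mult by simp
  qed
  have "norm (frac_laplacian (\<sigma> / 2) (state t V)) = L2norm ?g / sqrt ((2 * pi) ^ CARD('n))"
    by (rule norm_frac_laplacian[OF square_integrable_bound[OF square_integrable_rep_l2 m le]])
  also have "\<dots> \<le> L2norm ?g"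
  proof -
    have "1 \<le> (2 * pi) ^ CARD('n)" using pi_gt3 by (intro one_le_power) simp
    then have "1 \<le> sqrt ((2 * pi) ^ CARD('n))" by simp
    from divide_left_mono[OF this, of "L2norm ?g"] show ?thesis by (simp add: L2norm_nonneg)
  qed
  also have "\<dots> \<le> (1 + t) powr (- r1) * norm V"
    unfolding norm_l2_eq by (rule L2norm_mono[OF square_integrable_rep_l2 m _ le]) simp
  finally show ?thesis .
qed

text \<open>With the fixed weight, \<open>Z\<close> and \<open>Y\<close> satisfy integral equations
  with the same linear term. On \<open>{0..T}\<close> they stay in a common ball of radius
  \<open>M\<close>, and the symbol is at most \<open>T + 1\<close>, so their distance satisfies the
  hypothesis of \<open>Gronwall_zero\<close> without any smallness.\<close>

lemma Fourier_mild_unique: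
  assumes Z: "continuous_on {0..} Z" "\<And>t. t \<ge> 0 \<Longrightarrow> FT 1 (u t) = symbol_mult (inv_weight \<sigma> 1 1) (Z t)" and u: "Fourier_mild F u"
    and Y: "continuous_on {0..} Y" "\<And>t. t \<ge> 0 \<Longrightarrow> FT 1 (v t) = symbol_mult (inv_weight \<sigma> 1 1) (Y t)" and v: "Fourier_mild F v"
    and T: "T \<ge> 0"
  shows "v T = u T"
proof -
  let ?w = "\<lambda>s. weighted_wave_symbol \<sigma> \<delta> 1 1 s :: real^'n \<Rightarrow> complex"
  have Duhamel: "Z t = symbol_mult (?w t) F + integral {0..t} (\<lambda>\<tau>. symbol_mult (?w (t - \<tau>)) (source (u \<tau>)))"
    if Z: "continuous_on {0..} Z" "\<And>t. t \<ge> 0 \<Longrightarrow> FT 1 (u t) = symbol_mult (inv_weight \<sigma> 1 1) (Z t)" and u: "Fourier_mild F u"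
      and t: "t \<ge> 0" for u Z t
  proof (rule symbol_mult_inv_weight_inj[where \<alpha> = 1 and \<beta> = 1 and \<sigma> = \<sigma>])
    show "symbol_mult (inv_weight \<sigma> 1 1) (Z t) = symbol_mult (inv_weight \<sigma> 1 1)
        (symbol_mult (?w t) F + integral {0..t} (\<lambda>\<tau>. symbol_mult (?w (t - \<tau>)) (source (u \<tau>))))"
      using u t by (subst inv_weight_Duhamel[OF _ _ continuous_on_source[OF Z]]) (auto simp: Z(2)[symmetric] Fourier_mild_def)
  qed auto
  obtain L where L: "Lipschitz_constant L" using source_Lipschitz ..
  then have L0: "L \<ge> 0" by (simp add: Lipschitz_constant_def)
  have ZT: "continuous_on {0..T} Z" "continuous_on {0..T} Y"
    by (rule continuous_on_subset[OF Z(1)], simp, rule continuous_on_subset[OF Y(1)], simp)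
  have "bounded (Z ` {0..T} \<union> Y ` {0..T})"
    by (intro bounded_Un[THEN iffD2] conjI compact_imp_bounded compact_continuous_image ZT) auto
  then obtain M where M: "\<forall>x\<in>Z ` {0..T} \<union> Y ` {0..T}. norm x \<le> M" unfolding bounded_iff ..
  let ?d = "\<lambda>t. norm (Z t - Y t)"
  let ?K = "(T + 1) * (L * M powr (p - 1))"
  have c: "continuous_on {0..T} ?d" by (intro continuous_intros ZT)
  have "\<forall>t\<in>{0..T}. ?d t = 0"
  proof (rule Gronwall_zero[OF T c])
    show "0 \<le> ?K" using T L0 by simp
    fix t assume t: "t \<in> {0..T}"
    then have t0: "t \<ge> 0" by simp
    have i: "(\<lambda>\<tau>. symbol_mult (?w (t - \<tau>)) (source (u \<tau>))) integrable_on {0..t}"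
      "(\<lambda>\<tau>. symbol_mult (?w (t - \<tau>)) (source (v \<tau>))) integrable_on {0..t}"
      by (intro integrable_continuous_interval continuous_on_Duhamel_integrand(3) continuous_on_source[OF Z] continuous_on_source[OF Y]; simp)+
    have "Z t = symbol_mult (?w t) F + integral {0..t} (\<lambda>\<tau>. symbol_mult (?w (t - \<tau>)) (source (u \<tau>)))"
      "Y t = symbol_mult (?w t) F + integral {0..t} (\<lambda>\<tau>. symbol_mult (?w (t - \<tau>)) (source (v \<tau>)))"
      using Duhamel[OF Z u t0] Duhamel[OF Y v t0] by blast+
    then have "?d t = norm (integral {0..t} (\<lambda>\<tau>. symbol_mult (?w (t - \<tau>)) (source (u \<tau>)) - symbol_mult (?w (t - \<tau>)) (source (v \<tau>))))"
      unfolding Henstock_Kurzweil_Integration.integral_diff[OF i] by simp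
    also have "\<dots> \<le> integral {0..t} (\<lambda>\<tau>. ?K * ?d \<tau>)"
    proof (rule integral_norm_bound_integral[OF integrable_diff[OF i]])
      show "(\<lambda>\<tau>. ?K * ?d \<tau>) integrable_on {0..t}"
        using t by (intro integrable_continuous_interval continuous_intros continuous_on_subset[OF c]) auto
      fix \<tau> assume \<tau>: "\<tau> \<in> {0..t}"
      then have \<tau>T: "\<tau> \<in> {0..T}" "\<tau> \<ge> 0" using t by auto
      have b: "bounded_symbol (1 * \<bar>t - \<tau>\<bar> + 1) (?w (t - \<tau>))" by (rule bounded_symbol_weighted_wave_symbol) auto
      have "norm (symbol_mult (?w (t - \<tau>)) (source (u \<tau>) - source (v \<tau>))) \<le> (1 * \<bar>t - \<tau>\<bar> + 1) * norm (source (u \<tau>) - source (v \<tau>))"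
        by (rule norm_symbol_mult_le[OF b])
      also have "\<dots> \<le> (T + 1) * (L * M powr (p - 1) * ?d \<tau>)"
        using \<tau> t by (intro mult_mono Lipschitz_constantD[OF L Z(2)[OF \<tau>T(2)] Y(2)[OF \<tau>T(2)]]) (use M \<tau>T in auto)
      finally show "norm (symbol_mult (?w (t - \<tau>)) (source (u \<tau>)) - symbol_mult (?w (t - \<tau>)) (source (v \<tau>))) \<le> ?K * ?d \<tau>"
        by (simp only: symbol_mult_diff[OF b] mult.assoc)
    qed
    also have "\<dots> = ?K * integral {0..t} ?d" by simp
    finally show "?d t \<le> ?K * integral {0..t} ?d" .
  qed simp
  then have "Z T = Y T" using T by simp
  then show ?thesis by - (rule FT_inj, simp only: Z(2)[OF T] Y(2)[OF T])
qed

theorem well_posedness: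
  "\<exists>\<epsilon>0>0. \<exists>C>0. \<forall>u1 :: real^'n \<Rightarrow> complex.
    integrable lborel u1 \<and> square_integrable u1 \<and> L1norm u1 + L2norm u1 < \<epsilon>0 \<longrightarrow>
    (\<exists>u :: real \<Rightarrow> 'n l2.
       (continuous_sobolev \<sigma> u \<and> C1_L2 u \<and> mild_solution \<sigma> \<delta> p u1 u) \<and>
       (\<forall>v :: real \<Rightarrow> 'n l2. continuous_sobolev \<sigma> v \<and> C1_L2 v \<and> mild_solution \<sigma> \<delta> p u1 v \<longrightarrow> (\<forall>t\<ge>0. v t = u t)) \<and>
       (\<forall>t\<ge>0.
          norm (u t) \<le> C * (1 + t) powr (- r0) * (L1norm u1 + L2norm u1) \<and>
          norm (frac_laplacian (\<sigma> / 2) (u t)) \<le> C * (1 + t) powr (- r1) * (L1norm u1 + L2norm u1) \<and>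
          norm (time_derivative u t) \<le> C * (1 + t) powr (- (r0 + 1)) * (L1norm u1 + L2norm u1)))"
proof -
  have \<sigma>0: "\<sigma> \<ge> 0" using \<sigma> by simp
  obtain \<epsilon>0 K where \<epsilon>0: "\<epsilon>0 > 0" and K: "K > 0" and
    ex: "\<forall>u1 :: real^'n \<Rightarrow> complex. integrable lborel u1 \<and> square_integrable u1 \<and> L1norm u1 + L2norm u1 < \<epsilon>0 \<longrightarrow>
    (\<exists>V. continuous_on {0..} V \<and> (\<forall>t\<ge>0. V t = fixed_point_map (FT 1 (abs_l2 u1)) V t \<and> norm (V t) \<le> K * (L1norm u1 + L2norm u1) \<and>
      norm (velocity (FT 1 (abs_l2 u1)) (\<lambda>\<tau>. state \<tau> (V \<tau>)) t) \<le> (1 + t) powr (- r1) * (K * (L1norm u1 + L2norm u1))))"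
    using small_data_fixed_point by (elim exE conjE)
  show ?thesis
  proof (rule exI[of _ \<epsilon>0], rule conjI[OF \<epsilon>0], rule exI[of _ K], rule conjI[OF K], intro allI impI)
    fix u1 :: "real^'n \<Rightarrow> complex"
    assume u1: "integrable lborel u1 \<and> square_integrable u1 \<and> L1norm u1 + L2norm u1 < \<epsilon>0"
    then have f: "integrable lborel u1" "square_integrable u1" by auto
    let ?E = "L1norm u1 + L2norm u1" and ?F = "FT 1 (abs_l2 u1)"
    have E: "?E \<ge> 0" by (simp add: L1norm_nonneg L2norm_nonneg)
    obtain V where V: "continuous_on {0..} V" and V': "\<forall>t\<ge>0. V t = fixed_point_map ?F V t \<and> norm (V t) \<le> K * ?E \<and>
      norm (velocity ?F (\<lambda>\<tau>. state \<tau> (V \<tau>)) t) \<le> (1 + t) powr (- r1) * (K * ?E)"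
      using ex[rule_format, OF u1] by (elim exE conjE)
    then have fp: "V t = fixed_point_map ?F V t" and VK: "norm (V t) \<le> K * ?E"
      and vel: "norm (velocity ?F (\<lambda>\<tau>. state \<tau> (V \<tau>)) t) \<le> (1 + t) powr (- r1) * (K * ?E)" if "t \<ge> 0" for t
      using that by auto
    define u where "u t = state t (V t)" for t
    have mild: "Fourier_mild ?F u" unfolding u_def[abs_def] by (rule Fourier_mild_state[OF V fp])
    obtain Z where Z: "continuous_on {0..} Z" "\<And>t. t \<ge> 0 \<Longrightarrow> FT 1 (u t) = symbol_mult (inv_weight \<sigma> 1 1) (Z t)"
      by (rule state_continuous[OF V]) (rule that, simp_all add: u_def)
    note src = continuous_on_source[OF Z]
    have 1: "continuous_sobolev \<sigma> u" unfolding continuous_sobolev_iff[OF \<sigma>0] using Z by blast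
    have 2: "C1_L2 u" by (rule Fourier_mild_C1(1)[OF mild src])
    have 3: "mild_solution \<sigma> \<delta> p u1 u" using mild by (simp only: mild_solution_iff_Fourier_mild[OF f Z])
    have 4: "v t = u t" if v: "continuous_sobolev \<sigma> v" "mild_solution \<sigma> \<delta> p u1 v" and t: "t \<ge> 0" for v t
    proof -
      obtain Y where Y: "continuous_on {0..} Y" "\<forall>t\<ge>0. FT 1 (v t) = symbol_mult (inv_weight \<sigma> 1 1) (Y t)"
        using v(1) unfolding continuous_sobolev_iff[OF \<sigma>0] by (elim exE conjE)
      note Y' = Y(1) Y(2)[rule_format]
      have "Fourier_mild ?F v" using v(2) by (simp only: mild_solution_iff_Fourier_mild[OF f Y'])
      from Fourier_mild_unique[OF Z mild Y' this t] show ?thesis by simp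
    qed
    have 5: "norm (u t) \<le> K * (1 + t) powr (- r0) * ?E \<and> norm (frac_laplacian (\<sigma> / 2) (u t)) \<le> K * (1 + t) powr (- r1) * ?E \<and>
          norm (time_derivative u t) \<le> K * (1 + t) powr (- (r0 + 1)) * ?E" if t: "t \<ge> 0" for t
    proof (intro conjI)
      have V0: "c * norm (V t) \<le> K * c * ?E" if "c \<ge> 0" for c
        using mult_left_mono[OF VK[OF t] that] by (simp only: mult_ac)
      show "norm (u t) \<le> K * (1 + t) powr (- r0) * ?E"
        unfolding u_def by (rule order_trans[OF norm_state_le[OF t] V0]) simp
      show "norm (frac_laplacian (\<sigma> / 2) (u t)) \<le> K * (1 + t) powr (- r1) * ?E"
        unfolding u_def by (rule order_trans[OF norm_frac_laplacian_state_le[OF t] V0]) simp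
      have "time_derivative u t = inv_FT (velocity ?F u t)" by (rule Fourier_mild_C1(2)[OF mild src t])
      then have "norm (time_derivative u t) \<le> norm (velocity ?F u t)" by (simp add: norm_inv_FT_le)
      also have "\<dots> \<le> (1 + t) powr (- r1) * (K * ?E)" unfolding u_def[abs_def] by (rule vel[OF t])
      \<comment> \<open>The velocity decays at the rate \<open>r1\<close>, which is at least the
        claimed \<open>r0 + 1\<close>.\<close>
      also have "\<dots> \<le> (1 + t) powr (- (r0 + 1)) * (K * ?E)"
        using t K E rates by (intro mult_right_mono powr_mono mult_nonneg_nonneg) auto
      finally show "norm (time_derivative u t) \<le> K * (1 + t) powr (- (r0 + 1)) * ?E" by (simp only: mult_ac)
    qed
    have 6: "\<forall>v :: real \<Rightarrow> 'n l2. continuous_sobolev \<sigma> v \<and> C1_L2 v \<and> mild_solution \<sigma> \<delta> p u1 v \<longrightarrow> (\<forall>t\<ge>0. v t = u t)"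
      using 4 by simp
    have 7: "\<forall>t\<ge>0. norm (u t) \<le> K * (1 + t) powr (- r0) * ?E \<and> norm (frac_laplacian (\<sigma> / 2) (u t)) \<le> K * (1 + t) powr (- r1) * ?E \<and>
          norm (time_derivative u t) \<le> K * (1 + t) powr (- (r0 + 1)) * ?E"
      by (intro allI impI 5)
    show "\<exists>u :: real \<Rightarrow> 'n l2.
       (continuous_sobolev \<sigma> u \<and> C1_L2 u \<and> mild_solution \<sigma> \<delta> p u1 u) \<and>
       (\<forall>v :: real \<Rightarrow> 'n l2. continuous_sobolev \<sigma> v \<and> C1_L2 v \<and> mild_solution \<sigma> \<delta> p u1 v \<longrightarrow> (\<forall>t\<ge>0. v t = u t)) \<and>
       (\<forall>t\<ge>0.
          norm (u t) \<le> K * (1 + t) powr (- r0) * ?E \<and>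
          norm (frac_laplacian (\<sigma> / 2) (u t)) \<le> K * (1 + t) powr (- r1) * ?E \<and>
          norm (time_derivative u t) \<le> K * (1 + t) powr (- (r0 + 1)) * ?E)"
      by (rule exI[of _ u], rule conjI[OF conjI[OF 1 conjI[OF 2 3]] conjI[OF 6 7]])
  qed
qed

end

theorem theorem2p1:
  fixes \<sigma> \<delta> p n :: real
  assumes n: "n = real CARD('n::finite)"
    and \<sigma>: "\<sigma> \<ge> 1"
    and \<delta>: "\<delta> \<in> {0<..<\<sigma> / 2}"
    and p: "p > 1"
    and cond: "(2 * \<sigma> < n \<and> n \<le> 4 * \<sigma> \<and> 2 \<le> p \<and> p \<le> n / (n - 2 * \<sigma>)) \<or>
               (\<sigma> < n \<and> n \<le> 2 * \<sigma> \<and> 2 \<le> p)"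
    and p_crit: "p > 1 + (\<sigma> + 2 * \<delta>) / (n - \<sigma>)"
  shows "\<exists>\<epsilon>0>0. \<exists>C>0. \<forall>u1 :: real^'n \<Rightarrow> complex.
    integrable lborel u1 \<and> square_integrable u1 \<and> L1norm u1 + L2norm u1 < \<epsilon>0 \<longrightarrow>
    (\<exists>u :: real \<Rightarrow> 'n l2.
       (continuous_sobolev \<sigma> u \<and> C1_L2 u \<and> mild_solution \<sigma> \<delta> p u1 u) \<and>
       (\<forall>v :: real \<Rightarrow> 'n l2.
          continuous_sobolev \<sigma> v \<and> C1_L2 v \<and> mild_solution \<sigma> \<delta> p u1 v
          \<longrightarrow> (\<forall>t\<ge>0. v t = u t)) \<and>
       (\<forall>t\<ge>0.
          norm (u t)
            \<le> C * (1 + t) powr (- (n - 2 * \<sigma>) / (4 * \<delta>)) * (L1norm u1 + L2norm u1) \<and>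
          norm (frac_laplacian (\<sigma> / 2) (u t))
            \<le> C * (1 + t) powr (- n / (4 * \<delta>)) * (L1norm u1 + L2norm u1) \<and>
          norm (time_derivative u t)
            \<le> C * (1 + t) powr (- (n - (2 * \<sigma> - 4 * \<delta>)) / (4 * \<delta>)) * (L1norm u1 + L2norm u1)))"
proof -
  have p2: "p \<ge> 2" and n\<sigma>: "\<sigma> < n" using cond \<sigma> by auto
  \<comment> \<open>In the first case \<open>p * (n - 2 * \<sigma>) <= n\<close> is a rearrangement
    of the claim; in the second the order is below \<open>n / 2\<close>, hence at most
    \<open>\<sigma>\<close>.\<close>
  have sub: "n * (1/2 - 1/(2*p)) \<le> \<sigma>"
    using cond
  proof
    assume c: "2 * \<sigma> < n \<and> n \<le> 4 * \<sigma> \<and> 2 \<le> p \<and> p \<le> n / (n - 2 * \<sigma>)"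
    then have "n - 2 * \<sigma> > 0" "p \<le> n / (n - 2 * \<sigma>)" by auto
    then have "p * (n - 2 * \<sigma>) \<le> n" by (simp only: pos_le_divide_eq)
    then show ?thesis using p2 by (simp add: field_simps)
  next
    assume c: "\<sigma> < n \<and> n \<le> 2 * \<sigma> \<and> 2 \<le> p"
    have "n * (1/2 - 1/(2*p)) \<le> n * (1/2)" using p2 n\<sigma> \<sigma> by (intro mult_left_mono) auto
    then show ?thesis using c by linarith
  qed
  interpret damped_wave \<sigma> \<delta> p n "TYPE('n)"
    by (rule damped_wave.intro[OF n \<sigma> _ _ p2 n\<sigma> sub p_crit]) (use \<delta> in auto)
  have "- (n - 2 * \<sigma>) / (4 * \<delta>) = - r0" "- n / (4 * \<delta>) = - r1" "- (n - (2 * \<sigma> - 4 * \<delta>)) / (4 * \<delta>) = - (r0 + 1)"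
    using \<delta> by (auto simp: r0_def r1_def field_simps)
  then show ?thesis using well_posedness by (simp only:)
qed

end
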